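(* Let $R$ be a commutative unital ring and let $(P,\le,+,0)$ be a preordered set with a compatible abelian group structure. Then $\big(\underline{\mathbf{Mod}}_R^{\mathbf{P}},\otimes_{\mathbf{gr}}, R[U_0]\big)$ is a closed symmetric monoidal category. That is, for all $N \in \underline{\mathbf{Mod}}_R^{\mathbf{P}}$, the functor $-\otimes_{\mathbf{gr}} N$ has right adjoint $\underline{\mathrm{Hom}}(N,-):\underline{\mathbf{Mod}}_R^{\mathbf{P}} \to \underline{\mathbf{Mod}}_R^{\mathbf{P}}$; that is, for any persistence modules $M,N$ and $N'$ there exists an isomorphism, natural in all arguments, $$\underline{\mathrm{Hom}}(M\otimes_{\mathbf{gr}} N,N')\cong \underline{\mathrm{Hom}}(M,\underline{\mathrm{Hom}}(N,N')).$$ Furthermore this isomorphism is a morphism of degree zero, i.e., a natural transformation. In particular, $\big(\mathbf{Mod}_R^{\mathbf{P}},\otimes_{\mathbf{gr}},R[U_0]\big)$ is a closed symmetric monoidal category.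
   Context: Compatible means: $a\le b$ implies $a+c\le b+c$ for all $a,b,c\in P$. Let $\mathbf{P}$ be the category associated to $(P,\le)$ and $\mathbf{Mod}_R^{\mathbf{P}}$ the category of functors $\mathbf{P}\to\mathbf{Mod}_R$ (persistence modules) with natural transformations; $\mathrm{Hom}(M,N)$ is the $R$-module of natural transformations. Let $U_0=\{x\in P:0\le x\}$; $R[U_0]$ is the persistence module equal to $R$ on $U_0$ and $0$ elsewhere, with identity maps within $U_0$ (equivalently the monoid ring of $U_0$ as a $P$-graded module over itself; persistence modules are the same as $P$-graded $R[U_0]$-modules). Tensor product: $(M\otimes_{\mathbf{gr}}N)_r=\operatorname{colim}_{s+t\le r}M_s\otimes_R N_t$, with colimit over pairs $(s,t)\in P\times P$ with $s+t\le r$ under the product preorder (the tensor product of graded $R[U_0]$-modules). For $s\in P$, $N(s)_x=N_{x+s}$. The internal hom is the persistence module $\underline{\mathrm{Hom}}(M,N)$ with $\underline{\mathrm{Hom}}(M,N)_s=\mathrm{Hom}(M,N(s))$ and map for $s\le t$ obtained by composing components $M_x\to N_{x+s}$ with $N_{x+s\le x+t}$. $\underline{\mathbf{Mod}}_R^{\mathbf{P}}$ is the category whose objects are persistence modules and whose morphisms from $M$ to $N$ are the elements of $\bigoplus_{s\in P}\mathrm{Hom}(M,N(s))$, the summand for $s$ being the morphisms of degree $s$; for $\alpha:M\to N(s)$ and $\beta:N\to N'(t)$, the composite $\beta\circ\alpha$ of degree $s+t$ has $x$-component $\beta_{s+x}\circ\alpha_x$, extended bilinearly. On $\underline{\mathbf{Mod}}_R^{\mathbf{P}}$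 the tensor product of homogeneous morphisms is induced by the maps $\varphi_s\otimes_R\psi_t$ and the associator, unitors and braiding are those of $\mathbf{Mod}_R^{\mathbf{P}}$ (induced by those of $\otimes_R$). *)

theory Defs
  imports "HOL-Algebra.Module" "HOL-Algebra.AbelCoset"
begin

text \<open>
  A preordered set \<open>P\<close> with a compatible abelian group structure is a type of the following class.
  Antisymmetry is not required.
\<close>

class preordered_ab_group_add = ab_group_add + preorder +
  assumes add_mono_right: "a \<le> b \<Longrightarrow> a + c \<le> b + c"


section \<open>Modules with explicit carriers\<close>

text \<open>
  The library record of modules extends the record of rings; the fields \<open>mult\<close> and \<open>one\<close> carry
  no information for a module and are left \<open>undefined\<close>.

  Maps are extensional, that is \<open>undefined\<close> outside the carrier of their domain, so that equality
  of functions is equality of morphisms.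
\<close>

definition lin_hom :: "('r, 'm) ring_scheme \<Rightarrow> ('r, 'a) module \<Rightarrow> ('r, 'b) module \<Rightarrow> ('a \<Rightarrow> 'b) set"
  where "lin_hom R M N = {f \<in> carrier M \<rightarrow>\<^sub>E carrier N.
    (\<forall>x\<in>carrier M. \<forall>y\<in>carrier M. f (x \<oplus>\<^bsub>M\<^esub> y) = f x \<oplus>\<^bsub>N\<^esub> f y) \<and>
    (\<forall>a\<in>carrier R. \<forall>x\<in>carrier M. f (a \<odot>\<^bsub>M\<^esub> x) = a \<odot>\<^bsub>N\<^esub> f x)}"

definition regular_mod :: "('r, 'm) ring_scheme \<Rightarrow> ('r, 'r) module"
  where "regular_mod R = \<lparr>carrier = carrier R, mult = undefined, one = undefined,
    zero = \<zero>\<^bsub>R\<^esub>, add = (\<oplus>\<^bsub>R\<^esub>), smult = (\<otimes>\<^bsub>R\<^esub>)\<rparr>"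

definition span_mod :: "('r, 'm) ring_scheme \<Rightarrow> ('r, 'a) module \<Rightarrow> 'a set \<Rightarrow> 'a set"
  where "span_mod R M S = \<Inter>{H. submodule H R M \<and> S \<subseteq> H}"

definition quot_mod :: "('r, 'a) module \<Rightarrow> 'a set \<Rightarrow> ('r, 'a set) module"
  where "quot_mod M H = \<lparr>carrier = a_rcosets\<^bsub>M\<^esub> H, mult = undefined, one = undefined,
    zero = H, add = (<+>\<^bsub>M\<^esub>), smult = (\<lambda>a X. \<Union>x\<in>X. H +>\<^bsub>M\<^esub> (a \<odot>\<^bsub>M\<^esub> x))\<rparr>"

definition dsum :: "'i set \<Rightarrow> ('i \<Rightarrow> ('r, 'a) module) \<Rightarrow> ('r, 'i \<Rightarrow> 'a) module"
  where "dsum I F = \<lparr>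
    carrier = {u \<in> \<Pi>\<^sub>E i\<in>I. carrier (F i). finite {i \<in> I. u i \<noteq> \<zero>\<^bsub>F i\<^esub>}},
    mult = undefined, one = undefined,
    zero = (\<lambda>i\<in>I. \<zero>\<^bsub>F i\<^esub>),
    add = (\<lambda>u v. \<lambda>i\<in>I. u i \<oplus>\<^bsub>F i\<^esub> v i),
    smult = (\<lambda>a u. \<lambda>i\<in>I. a \<odot>\<^bsub>F i\<^esub> u i)\<rparr>"

definition dsum_in :: "'i set \<Rightarrow> ('i \<Rightarrow> ('r, 'a) module) \<Rightarrow> 'i \<Rightarrow> 'a \<Rightarrow> 'i \<Rightarrow> 'a"
  where "dsum_in I F j x = (\<lambda>i\<in>I. if i = j then x else \<zero>\<^bsub>F i\<^esub>)"


subsection \<open>Tensor product over \<open>R\<close>\<close>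

text \<open>The free module on \<open>M \<times> N\<close> modulo the bilinearity relations.\<close>

definition free_mod :: "('r, 'm) ring_scheme \<Rightarrow> 'x set \<Rightarrow> ('r, 'x \<Rightarrow> 'r) module"
  where "free_mod R X = dsum X (\<lambda>_. regular_mod R)"

definition free_gen :: "('r, 'm) ring_scheme \<Rightarrow> 'x set \<Rightarrow> 'x \<Rightarrow> 'x \<Rightarrow> 'r"
  where "free_gen R X x = dsum_in X (\<lambda>_. regular_mod R) x \<one>\<^bsub>R\<^esub>"

definition tensor_relations ::
  "('r, 'm) ring_scheme \<Rightarrow> ('r, 'a) module \<Rightarrow> ('r, 'b) module \<Rightarrow> ('a \<times> 'b \<Rightarrow> 'r) set"
  where "tensor_relations R M N =
    (let F = free_mod R (carrier M \<times> carrier N); e = free_gen R (carrier M \<times> carrier N) in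
      {e (m \<oplus>\<^bsub>M\<^esub> m', n) \<ominus>\<^bsub>F\<^esub> (e (m, n) \<oplus>\<^bsub>F\<^esub> e (m', n)) | m m' n.
          m \<in> carrier M \<and> m' \<in> carrier M \<and> n \<in> carrier N} \<union>
      {e (m, n \<oplus>\<^bsub>N\<^esub> n') \<ominus>\<^bsub>F\<^esub> (e (m, n) \<oplus>\<^bsub>F\<^esub> e (m, n')) | m n n'.
          m \<in> carrier M \<and> n \<in> carrier N \<and> n' \<in> carrier N} \<union>
      {e (a \<odot>\<^bsub>M\<^esub> m, n) \<ominus>\<^bsub>F\<^esub> (a \<odot>\<^bsub>F\<^esub> e (m, n)) | a m n.
          a \<in> carrier R \<and> m \<in> carrier M \<and> n \<in> carrier N} \<union>
      {e (m, a \<odot>\<^bsub>N\<^esub> n) \<ominus>\<^bsub>F\<^esub> (a \<odot>\<^bsub>F\<^esub> e (m, n)) | a m n.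
          a \<in> carrier R \<and> m \<in> carrier M \<and> n \<in> carrier N})"

definition tensor_mod ::
  "('r, 'm) ring_scheme \<Rightarrow> ('r, 'a) module \<Rightarrow> ('r, 'b) module \<Rightarrow> ('r, ('a \<times> 'b \<Rightarrow> 'r) set) module"
  where "tensor_mod R M N =
    (let F = free_mod R (carrier M \<times> carrier N)
     in quot_mod F (span_mod R F (tensor_relations R M N)))"

definition tensor_elt ::
  "('r, 'm) ring_scheme \<Rightarrow> ('r, 'a) module \<Rightarrow> ('r, 'b) module \<Rightarrow> 'a \<Rightarrow> 'b \<Rightarrow> ('a \<times> 'b \<Rightarrow> 'r) set"
  where "tensor_elt R M N m n =
    (let F = free_mod R (carrier M \<times> carrier N)
     in span_mod R F (tensor_relations R M N)
          +>\<^bsub>F\<^esub> free_gen R (carrier M \<times> carrier N) (m, n))"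

text \<open>The linear map out of a tensor product determined by a bilinear map \<open>b\<close>.\<close>

definition tensor_desc ::
  "('r, 'm) ring_scheme \<Rightarrow> ('r, 'a) module \<Rightarrow> ('r, 'b) module \<Rightarrow> ('r, 'c) module
    \<Rightarrow> ('a \<Rightarrow> 'b \<Rightarrow> 'c) \<Rightarrow> ('a \<times> 'b \<Rightarrow> 'r) set \<Rightarrow> 'c"
  where "tensor_desc R M N K b = (THE h. h \<in> lin_hom R (tensor_mod R M N) K \<and>
    (\<forall>m\<in>carrier M. \<forall>n\<in>carrier N. h (tensor_elt R M N m n) = b m n))"

definition tensor_map ::
  "('r, 'm) ring_scheme \<Rightarrow> ('r, 'a) module \<Rightarrow> ('r, 'b) module \<Rightarrow> ('r, 'c) module \<Rightarrow> ('r, 'd) module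
    \<Rightarrow> ('a \<Rightarrow> 'c) \<Rightarrow> ('b \<Rightarrow> 'd) \<Rightarrow> ('a \<times> 'b \<Rightarrow> 'r) set \<Rightarrow> ('c \<times> 'd \<Rightarrow> 'r) set"
  where "tensor_map R M N M' N' f g =
    tensor_desc R M N (tensor_mod R M' N') (\<lambda>m n. tensor_elt R M' N' (f m) (g n))"


subsection \<open>Colimits over preordered index sets\<close>

text \<open>
  \<open>F\<close> is a diagram with transition maps \<open>f i j : F i \<rightarrow> F j\<close> for \<open>leq i j\<close>; the colimit is the direct
  sum of all \<open>F i\<close> modulo the identification of each \<open>x \<in> F i\<close> with \<open>f i j x \<in> F j\<close>.
\<close>

definition colim_relations ::
  "'i set \<Rightarrow> ('i \<Rightarrow> 'i \<Rightarrow> bool) \<Rightarrow> ('i \<Rightarrow> ('r, 'a) module) \<Rightarrow> ('i \<Rightarrow> 'i \<Rightarrow> 'a \<Rightarrow> 'a) \<Rightarrow> ('i \<Rightarrow> 'a) set"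
  where "colim_relations I leq F f =
    {dsum_in I F i x \<ominus>\<^bsub>dsum I F\<^esub> dsum_in I F j (f i j x) | i j x.
       i \<in> I \<and> j \<in> I \<and> leq i j \<and> x \<in> carrier (F i)}"

definition colim_mod ::
  "('r, 'm) ring_scheme \<Rightarrow> 'i set \<Rightarrow> ('i \<Rightarrow> 'i \<Rightarrow> bool) \<Rightarrow> ('i \<Rightarrow> ('r, 'a) module)
    \<Rightarrow> ('i \<Rightarrow> 'i \<Rightarrow> 'a \<Rightarrow> 'a) \<Rightarrow> ('r, ('i \<Rightarrow> 'a) set) module"
  where "colim_mod R I leq F f = quot_mod (dsum I F) (span_mod R (dsum I F) (colim_relations I leq F f))"

definition colim_in ::
  "('r, 'm) ring_scheme \<Rightarrow> 'i set \<Rightarrow> ('i \<Rightarrow> 'i \<Rightarrow> bool) \<Rightarrow> ('i \<Rightarrow> ('r, 'a) module)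
    \<Rightarrow> ('i \<Rightarrow> 'i \<Rightarrow> 'a \<Rightarrow> 'a) \<Rightarrow> 'i \<Rightarrow> 'a \<Rightarrow> ('i \<Rightarrow> 'a) set"
  where "colim_in R I leq F f i x =
    span_mod R (dsum I F) (colim_relations I leq F f) +>\<^bsub>dsum I F\<^esub> dsum_in I F i x"

text \<open>The linear map out of a colimit determined by a cocone \<open>g\<close>.\<close>

definition colim_desc ::
  "('r, 'm) ring_scheme \<Rightarrow> 'i set \<Rightarrow> ('i \<Rightarrow> 'i \<Rightarrow> bool) \<Rightarrow> ('i \<Rightarrow> ('r, 'a) module)
    \<Rightarrow> ('i \<Rightarrow> 'i \<Rightarrow> 'a \<Rightarrow> 'a) \<Rightarrow> ('r, 'c) module \<Rightarrow> ('i \<Rightarrow> 'a \<Rightarrow> 'c) \<Rightarrow> ('i \<Rightarrow> 'a) set \<Rightarrow> 'c"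
  where "colim_desc R I leq F f K g = (THE h. h \<in> lin_hom R (colim_mod R I leq F f) K \<and>
    (\<forall>i\<in>I. \<forall>x\<in>carrier (F i). h (colim_in R I leq F f i x) = g i x))"


section \<open>The category of persistence modules\<close>

text \<open>\<open>pmap M r s\<close> is the structure map for \<open>r \<le> s\<close>; its values for other pairs are irrelevant.\<close>

record ('p, 'r, 'a) pers =
  pobj :: "'p \<Rightarrow> ('r, 'a) module"
  pmap :: "'p \<Rightarrow> 'p \<Rightarrow> 'a \<Rightarrow> 'a"

definition persistence_module ::
  "('r, 'm) ring_scheme \<Rightarrow> ('p::preordered_ab_group_add, 'r, 'a) pers \<Rightarrow> bool"
  where "persistence_module R M \<longleftrightarrow>
    (\<forall>r. module R (pobj M r)) \<and>
    (\<forall>r s. r \<le> s \<longrightarrow> pmap M r s \<in> lin_hom R (pobj M r) (pobj M s)) \<and>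
    (\<forall>r. pmap M r r = (\<lambda>x\<in>carrier (pobj M r). x)) \<and>
    (\<forall>r s t. r \<le> s \<longrightarrow> s \<le> t \<longrightarrow>
      compose (carrier (pobj M r)) (pmap M s t) (pmap M r s) = pmap M r t)"

text \<open>The \<open>R\<close>-module \<open>Hom(M, N)\<close> of natural transformations.\<close>

definition nat_hom ::
  "('r, 'm) ring_scheme \<Rightarrow> ('p::preordered_ab_group_add, 'r, 'a) pers \<Rightarrow> ('p, 'r, 'b) pers
    \<Rightarrow> ('r, 'p \<Rightarrow> 'a \<Rightarrow> 'b) module"
  where "nat_hom R M N = \<lparr>
    carrier = {\<phi>. (\<forall>x. \<phi> x \<in> lin_hom R (pobj M x) (pobj N x)) \<and>
      (\<forall>x y. x \<le> y \<longrightarrow> compose (carrier (pobj M x)) (pmap N x y) (\<phi> x)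
                      = compose (carrier (pobj M x)) (\<phi> y) (pmap M x y))},
    mult = undefined, one = undefined,
    zero = (\<lambda>x. \<lambda>m\<in>carrier (pobj M x). \<zero>\<^bsub>pobj N x\<^esub>),
    add = (\<lambda>\<phi> \<psi> x. \<lambda>m\<in>carrier (pobj M x). \<phi> x m \<oplus>\<^bsub>pobj N x\<^esub> \<psi> x m),
    smult = (\<lambda>a \<phi> x. \<lambda>m\<in>carrier (pobj M x). a \<odot>\<^bsub>pobj N x\<^esub> \<phi> x m)\<rparr>"

abbreviation PHom ::
  "('r, 'm) ring_scheme \<Rightarrow> ('p::preordered_ab_group_add, 'r, 'a) pers \<Rightarrow> ('p, 'r, 'b) pers
    \<Rightarrow> ('p \<Rightarrow> 'a \<Rightarrow> 'b) set"
  where "PHom R M N \<equiv> carrier (nat_hom R M N)"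

definition pm_id :: "('p, 'r, 'a) pers \<Rightarrow> 'p \<Rightarrow> 'a \<Rightarrow> 'a"
  where "pm_id M = (\<lambda>x. \<lambda>m\<in>carrier (pobj M x). m)"

definition pm_comp :: "('p, 'r, 'a) pers \<Rightarrow> ('p \<Rightarrow> 'b \<Rightarrow> 'c) \<Rightarrow> ('p \<Rightarrow> 'a \<Rightarrow> 'b) \<Rightarrow> 'p \<Rightarrow> 'a \<Rightarrow> 'c"
  where "pm_comp M \<psi> \<phi> = (\<lambda>x. compose (carrier (pobj M x)) (\<psi> x) (\<phi> x))"

definition pm_iso ::
  "('r, 'm) ring_scheme \<Rightarrow> ('p::preordered_ab_group_add, 'r, 'a) pers \<Rightarrow> ('p, 'r, 'b) pers
    \<Rightarrow> ('p \<Rightarrow> 'a \<Rightarrow> 'b) \<Rightarrow> bool"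
  where "pm_iso R M N \<phi> \<longleftrightarrow> \<phi> \<in> PHom R M N \<and>
    (\<exists>\<psi>\<in>PHom R N M. pm_comp M \<psi> \<phi> = pm_id M \<and> pm_comp N \<phi> \<psi> = pm_id N)"

definition shift :: "('p::preordered_ab_group_add, 'r, 'a) pers \<Rightarrow> 'p \<Rightarrow> ('p, 'r, 'a) pers"
  where "shift N s = \<lparr>pobj = (\<lambda>x. pobj N (x + s)), pmap = (\<lambda>x y. pmap N (x + s) (y + s))\<rparr>"

text \<open>The persistence module \<open>R[U\<^sub>0]\<close>.\<close>

definition pm_unit :: "('r, 'm) ring_scheme \<Rightarrow> ('p::preordered_ab_group_add, 'r, 'r) pers"
  where "pm_unit R = \<lparr>
    pobj = (\<lambda>r. (regular_mod R)\<lparr>carrier := if 0 \<le> r then carrier R else {\<zero>\<^bsub>R\<^esub>}\<rparr>),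
    pmap = (\<lambda>r s. if 0 \<le> r then (\<lambda>a\<in>carrier R. a) else (\<lambda>a\<in>{\<zero>\<^bsub>R\<^esub>}. \<zero>\<^bsub>R\<^esub>))\<rparr>"


subsection \<open>Graded tensor product\<close>

text \<open>The diagram of all \<open>M\<^sub>s \<otimes> N\<^sub>t\<close>, and the index set and order of its restriction to \<open>s + t \<le> r\<close>.\<close>

definition gr_index :: "'p::preordered_ab_group_add \<Rightarrow> ('p \<times> 'p) set"
  where "gr_index r = {(s, t). s + t \<le> r}"

definition gr_le :: "'p::preordered_ab_group_add \<times> 'p \<Rightarrow> 'p \<times> 'p \<Rightarrow> bool"
  where "gr_le = (\<lambda>(s, t) (s', t'). s \<le> s' \<and> t \<le> t')"

definition gr_diag ::
  "('r, 'm) ring_scheme \<Rightarrow> ('p, 'r, 'a) pers \<Rightarrow> ('p, 'r, 'b) pers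
    \<Rightarrow> 'p \<times> 'p \<Rightarrow> ('r, ('a \<times> 'b \<Rightarrow> 'r) set) module"
  where "gr_diag R M N = (\<lambda>(s, t). tensor_mod R (pobj M s) (pobj N t))"

definition gr_diag_map ::
  "('r, 'm) ring_scheme \<Rightarrow> ('p, 'r, 'a) pers \<Rightarrow> ('p, 'r, 'b) pers
    \<Rightarrow> 'p \<times> 'p \<Rightarrow> 'p \<times> 'p \<Rightarrow> ('a \<times> 'b \<Rightarrow> 'r) set \<Rightarrow> ('a \<times> 'b \<Rightarrow> 'r) set"
  where "gr_diag_map R M N = (\<lambda>(s, t) (s', t').
    tensor_map R (pobj M s) (pobj N t) (pobj M s') (pobj N t') (pmap M s s') (pmap N t t'))"

definition gr_tensor_obj ::
  "('r, 'm) ring_scheme \<Rightarrow> ('p::preordered_ab_group_add, 'r, 'a) pers \<Rightarrow> ('p, 'r, 'b) pers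
    \<Rightarrow> 'p \<Rightarrow> ('r, ('p \<times> 'p \<Rightarrow> ('a \<times> 'b \<Rightarrow> 'r) set) set) module"
  where "gr_tensor_obj R M N r =
    colim_mod R (gr_index r) gr_le (gr_diag R M N) (gr_diag_map R M N)"

text \<open>The class of \<open>m \<otimes> n\<close>, where \<open>m \<in> M\<^sub>s\<close>, \<open>n \<in> N\<^sub>t\<close> and \<open>s + t \<le> r\<close>, in degree \<open>r\<close>.\<close>

definition gr_elt ::
  "('r, 'm) ring_scheme \<Rightarrow> ('p::preordered_ab_group_add, 'r, 'a) pers \<Rightarrow> ('p, 'r, 'b) pers
    \<Rightarrow> 'p \<Rightarrow> 'p \<Rightarrow> 'p \<Rightarrow> 'a \<Rightarrow> 'b \<Rightarrow> ('p \<times> 'p \<Rightarrow> ('a \<times> 'b \<Rightarrow> 'r) set) set"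
  where "gr_elt R M N r s t m n =
    colim_in R (gr_index r) gr_le (gr_diag R M N) (gr_diag_map R M N) (s, t)
      (tensor_elt R (pobj M s) (pobj N t) m n)"

text \<open>The linear map out of degree \<open>r\<close> sending the class of \<open>m \<otimes> n\<close> at \<open>(s, t)\<close> to \<open>b s t m n\<close>.\<close>

definition gr_desc ::
  "('r, 'm) ring_scheme \<Rightarrow> ('p::preordered_ab_group_add, 'r, 'a) pers \<Rightarrow> ('p, 'r, 'b) pers
    \<Rightarrow> 'p \<Rightarrow> ('r, 'c) module \<Rightarrow> ('p \<Rightarrow> 'p \<Rightarrow> 'a \<Rightarrow> 'b \<Rightarrow> 'c)
    \<Rightarrow> ('p \<times> 'p \<Rightarrow> ('a \<times> 'b \<Rightarrow> 'r) set) set \<Rightarrow> 'c"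
  where "gr_desc R M N r K b =
    colim_desc R (gr_index r) gr_le (gr_diag R M N) (gr_diag_map R M N) K
      (\<lambda>(s, t). tensor_desc R (pobj M s) (pobj N t) K (b s t))"

definition gr_tensor ::
  "('r, 'm) ring_scheme \<Rightarrow> ('p::preordered_ab_group_add, 'r, 'a) pers \<Rightarrow> ('p, 'r, 'b) pers
    \<Rightarrow> ('p, 'r, ('p \<times> 'p \<Rightarrow> ('a \<times> 'b \<Rightarrow> 'r) set) set) pers" (infixl \<open>\<boxtimes>\<index>\<close> 70)
  where "gr_tensor R M N = \<lparr>
    pobj = gr_tensor_obj R M N,
    pmap = (\<lambda>r r'. gr_desc R M N r (gr_tensor_obj R M N r') (gr_elt R M N r'))\<rparr>"

text \<open>
  For \<open>\<phi> : M \<rightarrow> M'(a)\<close> and \<open>\<psi> : N \<rightarrow> N'(b)\<close>, the morphism \<open>M \<otimes> N \<rightarrow> (M' \<otimes> N')(a + b)\<close> induced by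
  the maps \<open>\<phi>\<^sub>s \<otimes> \<psi>\<^sub>t : M\<^sub>s \<otimes> N\<^sub>t \<rightarrow> M'\<^bsub>s + a\<^esub> \<otimes> N'\<^bsub>t + b\<^esub>\<close>.
\<close>

definition hom_tensor_map ::
  "('r, 'm) ring_scheme \<Rightarrow> ('p::preordered_ab_group_add, 'r, 'a) pers \<Rightarrow> ('p, 'r, 'b) pers
    \<Rightarrow> ('p, 'r, 'c) pers \<Rightarrow> ('p, 'r, 'd) pers \<Rightarrow> 'p \<Rightarrow> 'p \<Rightarrow> ('p \<Rightarrow> 'a \<Rightarrow> 'c) \<Rightarrow> ('p \<Rightarrow> 'b \<Rightarrow> 'd)
    \<Rightarrow> 'p \<Rightarrow> ('p \<times> 'p \<Rightarrow> ('a \<times> 'b \<Rightarrow> 'r) set) set \<Rightarrow> ('p \<times> 'p \<Rightarrow> ('c \<times> 'd \<Rightarrow> 'r) set) set"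
  where "hom_tensor_map R M N M' N' a b \<phi> \<psi> =
    (\<lambda>r. gr_desc R M N r (pobj (M' \<boxtimes>\<^bsub>R\<^esub> N') (r + (a + b)))
      (\<lambda>s t m n. gr_elt R M' N' (r + (a + b)) (s + a) (t + b) (\<phi> s m) (\<psi> t n)))"

definition pm_tensor_map ::
  "('r, 'm) ring_scheme \<Rightarrow> ('p::preordered_ab_group_add, 'r, 'a) pers \<Rightarrow> ('p, 'r, 'b) pers
    \<Rightarrow> ('p, 'r, 'c) pers \<Rightarrow> ('p, 'r, 'd) pers \<Rightarrow> ('p \<Rightarrow> 'a \<Rightarrow> 'c) \<Rightarrow> ('p \<Rightarrow> 'b \<Rightarrow> 'd)
    \<Rightarrow> 'p \<Rightarrow> ('p \<times> 'p \<Rightarrow> ('a \<times> 'b \<Rightarrow> 'r) set) set \<Rightarrow> ('p \<times> 'p \<Rightarrow> ('c \<times> 'd \<Rightarrow> 'r) set) set"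
  where "pm_tensor_map R M N M' N' \<phi> \<psi> =
    (\<lambda>r. gr_desc R M N r (pobj (M' \<boxtimes>\<^bsub>R\<^esub> N') r)
      (\<lambda>s t m n. gr_elt R M' N' r s t (\<phi> s m) (\<psi> t n)))"

text \<open>\<open>(m \<otimes> n) \<otimes> k \<mapsto> m \<otimes> (n \<otimes> k)\<close>, \<open>a \<otimes> m \<mapsto> a m\<close>, \<open>m \<otimes> a \<mapsto> a m\<close> and \<open>m \<otimes> n \<mapsto> n \<otimes> m\<close>.\<close>

definition pm_assoc ::
  "('r, 'm) ring_scheme \<Rightarrow> ('p::preordered_ab_group_add, 'r, 'a) pers \<Rightarrow> ('p, 'r, 'b) pers
    \<Rightarrow> ('p, 'r, 'c) pers \<Rightarrow> 'p
    \<Rightarrow> ('p \<times> 'p \<Rightarrow> (('p \<times> 'p \<Rightarrow> ('a \<times> 'b \<Rightarrow> 'r) set) set \<times> 'c \<Rightarrow> 'r) set) set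
    \<Rightarrow> ('p \<times> 'p \<Rightarrow> ('a \<times> ('p \<times> 'p \<Rightarrow> ('b \<times> 'c \<Rightarrow> 'r) set) set \<Rightarrow> 'r) set) set"
  where "pm_assoc R M N K =
    (\<lambda>r. gr_desc R (M \<boxtimes>\<^bsub>R\<^esub> N) K r (pobj (M \<boxtimes>\<^bsub>R\<^esub> (N \<boxtimes>\<^bsub>R\<^esub> K)) r)
      (\<lambda>u v x k. gr_desc R M N u (pobj (M \<boxtimes>\<^bsub>R\<^esub> (N \<boxtimes>\<^bsub>R\<^esub> K)) r)
        (\<lambda>s t m n. gr_elt R M (N \<boxtimes>\<^bsub>R\<^esub> K) r s (t + v) m (gr_elt R N K (t + v) t v n k)) x))"

definition pm_lunit ::
  "('r, 'm) ring_scheme \<Rightarrow> ('p::preordered_ab_group_add, 'r, 'a) pers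
    \<Rightarrow> 'p \<Rightarrow> ('p \<times> 'p \<Rightarrow> ('r \<times> 'a \<Rightarrow> 'r) set) set \<Rightarrow> 'a"
  where "pm_lunit R M = (\<lambda>r. gr_desc R (pm_unit R) M r (pobj M r)
    (\<lambda>s t a m. if 0 \<le> s then pmap M t r (a \<odot>\<^bsub>pobj M t\<^esub> m) else \<zero>\<^bsub>pobj M r\<^esub>))"

definition pm_runit ::
  "('r, 'm) ring_scheme \<Rightarrow> ('p::preordered_ab_group_add, 'r, 'a) pers
    \<Rightarrow> 'p \<Rightarrow> ('p \<times> 'p \<Rightarrow> ('a \<times> 'r \<Rightarrow> 'r) set) set \<Rightarrow> 'a"
  where "pm_runit R M = (\<lambda>r. gr_desc R M (pm_unit R) r (pobj M r)
    (\<lambda>s t m a. if 0 \<le> t then pmap M s r (a \<odot>\<^bsub>pobj M s\<^esub> m) else \<zero>\<^bsub>pobj M r\<^esub>))"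

definition pm_braid ::
  "('r, 'm) ring_scheme \<Rightarrow> ('p::preordered_ab_group_add, 'r, 'a) pers \<Rightarrow> ('p, 'r, 'b) pers
    \<Rightarrow> 'p \<Rightarrow> ('p \<times> 'p \<Rightarrow> ('a \<times> 'b \<Rightarrow> 'r) set) set \<Rightarrow> ('p \<times> 'p \<Rightarrow> ('b \<times> 'a \<Rightarrow> 'r) set) set"
  where "pm_braid R M N = (\<lambda>r. gr_desc R M N r (pobj (N \<boxtimes>\<^bsub>R\<^esub> M) r)
    (\<lambda>s t m n. gr_elt R N M r t s n m))"


subsection \<open>Internal hom\<close>

definition ihom ::
  "('r, 'm) ring_scheme \<Rightarrow> ('p::preordered_ab_group_add, 'r, 'a) pers \<Rightarrow> ('p, 'r, 'b) pers
    \<Rightarrow> ('p, 'r, 'p \<Rightarrow> 'a \<Rightarrow> 'b) pers"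
  where "ihom R M N = \<lparr>
    pobj = (\<lambda>s. nat_hom R M (shift N s)),
    pmap = (\<lambda>s t. \<lambda>\<phi>\<in>PHom R M (shift N s).
      \<lambda>x. compose (carrier (pobj M x)) (pmap N (x + s) (x + t)) (\<phi> x))\<rparr>"

text \<open>
  For \<open>\<psi> : N' \<rightarrow> N(e)\<close> and \<open>\<chi> : K \<rightarrow> K'(d)\<close>, the morphism from \<open>ihom R N K\<close> to the shift by \<open>e + d\<close>
  of \<open>ihom R N' K'\<close> given by \<open>\<phi> \<mapsto> \<chi> \<circ> \<phi> \<circ> \<psi>\<close>.
\<close>

definition hom_ihom_map ::
  "('r, 'm) ring_scheme \<Rightarrow> ('p::preordered_ab_group_add, 'r, 'b) pers \<Rightarrow> ('p, 'r, 'b') pers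
    \<Rightarrow> ('p, 'r, 'c) pers \<Rightarrow> 'p \<Rightarrow> ('p \<Rightarrow> 'b' \<Rightarrow> 'b) \<Rightarrow> ('p \<Rightarrow> 'c \<Rightarrow> 'c')
    \<Rightarrow> 'p \<Rightarrow> ('p \<Rightarrow> 'b \<Rightarrow> 'c) \<Rightarrow> 'p \<Rightarrow> 'b' \<Rightarrow> 'c'"
  where "hom_ihom_map R N N' K e \<psi> \<chi> =
    (\<lambda>s. \<lambda>\<phi>\<in>PHom R N (shift K s). \<lambda>x. \<lambda>n\<in>carrier (pobj N' x). \<chi> (x + e + s) (\<phi> (x + e) (\<psi> x n)))"

definition pm_ihom_map ::
  "('r, 'm) ring_scheme \<Rightarrow> ('p::preordered_ab_group_add, 'r, 'b) pers \<Rightarrow> ('p, 'r, 'b') pers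
    \<Rightarrow> ('p, 'r, 'c) pers \<Rightarrow> ('p \<Rightarrow> 'b' \<Rightarrow> 'b) \<Rightarrow> ('p \<Rightarrow> 'c \<Rightarrow> 'c')
    \<Rightarrow> 'p \<Rightarrow> ('p \<Rightarrow> 'b \<Rightarrow> 'c) \<Rightarrow> 'p \<Rightarrow> 'b' \<Rightarrow> 'c'"
  where "pm_ihom_map R N N' K \<psi> \<chi> =
    (\<lambda>s. \<lambda>\<phi>\<in>PHom R N (shift K s). \<lambda>x. \<lambda>n\<in>carrier (pobj N' x). \<chi> (x + s) (\<phi> x (\<psi> x n)))"

text \<open>
  Currying, as a family of maps indexed by the degree \<open>s\<close>: a morphism \<open>\<phi> : M \<otimes> N \<rightarrow> K(s)\<close> is sent to
  the morphism \<open>M \<rightarrow> ihom R N K\<close> shifted by \<open>s\<close> whose value at \<open>m \<in> M\<^sub>x\<close> is \<open>n \<mapsto> \<phi> (m \<otimes> n)\<close>.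
\<close>

definition ihom_curry ::
  "('r, 'm) ring_scheme \<Rightarrow> ('p::preordered_ab_group_add, 'r, 'a) pers \<Rightarrow> ('p, 'r, 'b) pers
    \<Rightarrow> ('p, 'r, 'c) pers
    \<Rightarrow> 'p \<Rightarrow> ('p \<Rightarrow> ('p \<times> 'p \<Rightarrow> ('a \<times> 'b \<Rightarrow> 'r) set) set \<Rightarrow> 'c) \<Rightarrow> 'p \<Rightarrow> 'a \<Rightarrow> 'p \<Rightarrow> 'b \<Rightarrow> 'c"
  where "ihom_curry R M N K = (\<lambda>s. \<lambda>\<phi>\<in>PHom R (M \<boxtimes>\<^bsub>R\<^esub> N) (shift K s).
    \<lambda>x. \<lambda>m\<in>carrier (pobj M x). \<lambda>y. \<lambda>n\<in>carrier (pobj N y).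
      \<phi> (x + y) (gr_elt R M N (x + y) x y m n))"


section \<open>The category with graded morphisms\<close>

text \<open>
  A graded morphism is a finitely supported family \<open>f\<close>, with homogeneous component \<open>f s : M \<rightarrow> N(s)\<close>
  in degree \<open>s\<close>.
\<close>

definition gr_hom ::
  "('r, 'm) ring_scheme \<Rightarrow> ('p::preordered_ab_group_add, 'r, 'a) pers \<Rightarrow> ('p, 'r, 'b) pers
    \<Rightarrow> ('r, 'p \<Rightarrow> 'p \<Rightarrow> 'a \<Rightarrow> 'b) module"
  where "gr_hom R M N = dsum UNIV (\<lambda>s. nat_hom R M (shift N s))"

abbreviation GHom ::
  "('r, 'm) ring_scheme \<Rightarrow> ('p::preordered_ab_group_add, 'r, 'a) pers \<Rightarrow> ('p, 'r, 'b) pers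
    \<Rightarrow> ('p \<Rightarrow> 'p \<Rightarrow> 'a \<Rightarrow> 'b) set"
  where "GHom R M N \<equiv> carrier (gr_hom R M N)"

text \<open>A natural transformation as a morphism of degree zero.\<close>

definition gr_of ::
  "('r, 'm) ring_scheme \<Rightarrow> ('p::preordered_ab_group_add, 'r, 'a) pers \<Rightarrow> ('p, 'r, 'b) pers
    \<Rightarrow> ('p \<Rightarrow> 'a \<Rightarrow> 'b) \<Rightarrow> 'p \<Rightarrow> 'p \<Rightarrow> 'a \<Rightarrow> 'b"
  where "gr_of R M N \<phi> = (\<lambda>s. if s = 0 then \<phi> else \<zero>\<^bsub>nat_hom R M (shift N s)\<^esub>)"

text \<open>
  Extension of operations \<open>op s t : A s \<times> B t \<rightarrow> C (s + t)\<close> on homogeneous elements to elements of the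
  direct sums.  Restricting to the supports of \<open>f\<close> and \<open>g\<close> makes the sum finite.
\<close>

definition bilinear_ext ::
  "('p::preordered_ab_group_add \<Rightarrow> ('r, 'x) module) \<Rightarrow> ('p \<Rightarrow> ('r, 'y) module)
    \<Rightarrow> ('p \<Rightarrow> ('r, 'z) module) \<Rightarrow> ('p \<Rightarrow> 'p \<Rightarrow> 'x \<Rightarrow> 'y \<Rightarrow> 'z)
    \<Rightarrow> ('p \<Rightarrow> 'x) \<Rightarrow> ('p \<Rightarrow> 'y) \<Rightarrow> 'p \<Rightarrow> 'z"
  where "bilinear_ext A B C op f g = (\<lambda>r. finsum (C r) (\<lambda>(s, t). op s t (f s) (g t))
    {(s, t). s + t = r \<and> f s \<noteq> \<zero>\<^bsub>A s\<^esub> \<and> g t \<noteq> \<zero>\<^bsub>B t\<^esub>})"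

definition hom_comp ::
  "('p::preordered_ab_group_add, 'r, 'a) pers \<Rightarrow> 'p \<Rightarrow> ('p \<Rightarrow> 'b \<Rightarrow> 'c) \<Rightarrow> ('p \<Rightarrow> 'a \<Rightarrow> 'b)
    \<Rightarrow> 'p \<Rightarrow> 'a \<Rightarrow> 'c"
  where "hom_comp M s \<beta> \<alpha> = (\<lambda>x. compose (carrier (pobj M x)) (\<beta> (s + x)) (\<alpha> x))"

definition gr_comp ::
  "('r, 'm) ring_scheme \<Rightarrow> ('p::preordered_ab_group_add, 'r, 'a) pers \<Rightarrow> ('p, 'r, 'b) pers
    \<Rightarrow> ('p, 'r, 'c) pers \<Rightarrow> ('p \<Rightarrow> 'p \<Rightarrow> 'b \<Rightarrow> 'c) \<Rightarrow> ('p \<Rightarrow> 'p \<Rightarrow> 'a \<Rightarrow> 'b) \<Rightarrow> 'p \<Rightarrow> 'p \<Rightarrow> 'a \<Rightarrow> 'c"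
  where "gr_comp R M N K g f =
    bilinear_ext (\<lambda>s. nat_hom R M (shift N s)) (\<lambda>t. nat_hom R N (shift K t))
      (\<lambda>r. nat_hom R M (shift K r)) (\<lambda>s t \<alpha> \<beta>. hom_comp M s \<beta> \<alpha>) f g"

definition gr_id ::
  "('r, 'm) ring_scheme \<Rightarrow> ('p::preordered_ab_group_add, 'r, 'a) pers \<Rightarrow> 'p \<Rightarrow> 'p \<Rightarrow> 'a \<Rightarrow> 'a"
  where "gr_id R M = gr_of R M M (pm_id M)"

definition gr_iso ::
  "('r, 'm) ring_scheme \<Rightarrow> ('p::preordered_ab_group_add, 'r, 'a) pers \<Rightarrow> ('p, 'r, 'b) pers
    \<Rightarrow> ('p \<Rightarrow> 'p \<Rightarrow> 'a \<Rightarrow> 'b) \<Rightarrow> bool"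
  where "gr_iso R M N f \<longleftrightarrow> f \<in> GHom R M N \<and>
    (\<exists>g\<in>GHom R N M. gr_comp R M N M g f = gr_id R M \<and> gr_comp R N M N f g = gr_id R N)"

definition gr_tensor_map ::
  "('r, 'm) ring_scheme \<Rightarrow> ('p::preordered_ab_group_add, 'r, 'a) pers \<Rightarrow> ('p, 'r, 'b) pers
    \<Rightarrow> ('p, 'r, 'c) pers \<Rightarrow> ('p, 'r, 'd) pers
    \<Rightarrow> ('p \<Rightarrow> 'p \<Rightarrow> 'a \<Rightarrow> 'c) \<Rightarrow> ('p \<Rightarrow> 'p \<Rightarrow> 'b \<Rightarrow> 'd)
    \<Rightarrow> 'p \<Rightarrow> 'p \<Rightarrow> ('p \<times> 'p \<Rightarrow> ('a \<times> 'b \<Rightarrow> 'r) set) set \<Rightarrow> ('p \<times> 'p \<Rightarrow> ('c \<times> 'd \<Rightarrow> 'r) set) set"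
  where "gr_tensor_map R M N M' N' f g =
    bilinear_ext (\<lambda>s. nat_hom R M (shift M' s)) (\<lambda>t. nat_hom R N (shift N' t))
      (\<lambda>r. nat_hom R (M \<boxtimes>\<^bsub>R\<^esub> N) (shift (M' \<boxtimes>\<^bsub>R\<^esub> N') r)) (hom_tensor_map R M N M' N') f g"

definition gr_ihom_map ::
  "('r, 'm) ring_scheme \<Rightarrow> ('p::preordered_ab_group_add, 'r, 'b) pers \<Rightarrow> ('p, 'r, 'b') pers
    \<Rightarrow> ('p, 'r, 'c) pers \<Rightarrow> ('p, 'r, 'c') pers
    \<Rightarrow> ('p \<Rightarrow> 'p \<Rightarrow> 'b' \<Rightarrow> 'b) \<Rightarrow> ('p \<Rightarrow> 'p \<Rightarrow> 'c \<Rightarrow> 'c')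
    \<Rightarrow> 'p \<Rightarrow> 'p \<Rightarrow> ('p \<Rightarrow> 'b \<Rightarrow> 'c) \<Rightarrow> 'p \<Rightarrow> 'b' \<Rightarrow> 'c'"
  where "gr_ihom_map R N N' K K' g h =
    bilinear_ext (\<lambda>e. nat_hom R N' (shift N e)) (\<lambda>d. nat_hom R K (shift K' d))
      (\<lambda>r. nat_hom R (ihom R N K) (shift (ihom R N' K') r))
      (\<lambda>e d \<psi> \<chi>. hom_ihom_map R N N' K e \<psi> \<chi>) g h"

definition gr_assoc where
  "gr_assoc R M N K = gr_of R ((M \<boxtimes>\<^bsub>R\<^esub> N) \<boxtimes>\<^bsub>R\<^esub> K) (M \<boxtimes>\<^bsub>R\<^esub> (N \<boxtimes>\<^bsub>R\<^esub> K)) (pm_assoc R M N K)"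

definition gr_lunit where
  "gr_lunit R M = gr_of R (pm_unit R \<boxtimes>\<^bsub>R\<^esub> M) M (pm_lunit R M)"

definition gr_runit where
  "gr_runit R M = gr_of R (M \<boxtimes>\<^bsub>R\<^esub> pm_unit R) M (pm_runit R M)"

definition gr_braid where
  "gr_braid R M N = gr_of R (M \<boxtimes>\<^bsub>R\<^esub> N) (N \<boxtimes>\<^bsub>R\<^esub> M) (pm_braid R M N)"

definition gr_ihom_curry where
  "gr_ihom_curry R M N K =
    gr_of R (ihom R (M \<boxtimes>\<^bsub>R\<^esub> N) K) (ihom R M (ihom R N K)) (ihom_curry R M N K)"

text \<open>The bijection of morphism sets: currying in each degree.\<close>

definition gr_adj ::
  "('r, 'm) ring_scheme \<Rightarrow> ('p::preordered_ab_group_add, 'r, 'a) pers \<Rightarrow> ('p, 'r, 'b) pers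
    \<Rightarrow> ('p, 'r, 'c) pers \<Rightarrow> ('p \<Rightarrow> 'p \<Rightarrow> ('p \<times> 'p \<Rightarrow> ('a \<times> 'b \<Rightarrow> 'r) set) set \<Rightarrow> 'c)
    \<Rightarrow> 'p \<Rightarrow> 'p \<Rightarrow> 'a \<Rightarrow> 'p \<Rightarrow> 'b \<Rightarrow> 'c"
  where "gr_adj R M N K f = (\<lambda>s. ihom_curry R M N K s (f s))"

definition pm_adj ::
  "('r, 'm) ring_scheme \<Rightarrow> ('p::preordered_ab_group_add, 'r, 'a) pers \<Rightarrow> ('p, 'r, 'b) pers
    \<Rightarrow> ('p, 'r, 'c) pers \<Rightarrow> ('p \<Rightarrow> ('p \<times> 'p \<Rightarrow> ('a \<times> 'b \<Rightarrow> 'r) set) set \<Rightarrow> 'c)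
    \<Rightarrow> 'p \<Rightarrow> 'a \<Rightarrow> 'p \<Rightarrow> 'b \<Rightarrow> 'c"
  where "pm_adj R M N K \<phi> = ihom_curry R M N K 0 \<phi>"


section \<open>The axioms of a closed symmetric monoidal category\<close>

text \<open>
  The elements of \<open>M\<close>, of \<open>M \<boxtimes> N\<close> and of \<open>ihom R M N\<close> have different types, and no type is closed
  under these constructions.  The types of the elements therefore play the role of the universe: the
  axioms are stated for objects over arbitrary, independent element types.  Each predicate below
  collects the axioms as properties of the given objects, quantified over all morphisms.
\<close>

subsection \<open>Graded morphisms\<close>

definition gr_category where
  "gr_category R M N K L \<longleftrightarrow>
    gr_id R M \<in> GHom R M M \<and>
    (\<forall>f\<in>GHom R M N. \<forall>g\<in>GHom R N K. gr_comp R M N K g f \<in> GHom R M K) \<and>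
    (\<forall>f\<in>GHom R M N. gr_comp R M M N f (gr_id R M) = f \<and> gr_comp R M N N (gr_id R N) f = f) \<and>
    (\<forall>f\<in>GHom R M N. \<forall>g\<in>GHom R N K. \<forall>h\<in>GHom R K L.
      gr_comp R M K L h (gr_comp R M N K g f) = gr_comp R M N L (gr_comp R N K L h g) f)"

definition gr_tensor_functor where
  "gr_tensor_functor R M M' M'' N N' N'' \<longleftrightarrow>
    persistence_module R (M \<boxtimes>\<^bsub>R\<^esub> N) \<and>
    (\<forall>f\<in>GHom R M M'. \<forall>g\<in>GHom R N N'.
      gr_tensor_map R M N M' N' f g \<in> GHom R (M \<boxtimes>\<^bsub>R\<^esub> N) (M' \<boxtimes>\<^bsub>R\<^esub> N')) \<and>
    gr_tensor_map R M N M N (gr_id R M) (gr_id R N) = gr_id R (M \<boxtimes>\<^bsub>R\<^esub> N) \<and>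
    (\<forall>f\<in>GHom R M M'. \<forall>f'\<in>GHom R M' M''. \<forall>g\<in>GHom R N N'. \<forall>g'\<in>GHom R N' N''.
      gr_tensor_map R M N M'' N'' (gr_comp R M M' M'' f' f) (gr_comp R N N' N'' g' g) =
      gr_comp R (M \<boxtimes>\<^bsub>R\<^esub> N) (M' \<boxtimes>\<^bsub>R\<^esub> N') (M'' \<boxtimes>\<^bsub>R\<^esub> N'')
        (gr_tensor_map R M' N' M'' N'' f' g') (gr_tensor_map R M N M' N' f g))"

definition gr_monoidal_isos where
  "gr_monoidal_isos R M M' N N' K K' \<longleftrightarrow>
    gr_iso R ((M \<boxtimes>\<^bsub>R\<^esub> N) \<boxtimes>\<^bsub>R\<^esub> K) (M \<boxtimes>\<^bsub>R\<^esub> (N \<boxtimes>\<^bsub>R\<^esub> K)) (gr_assoc R M N K) \<and>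
    gr_iso R (pm_unit R \<boxtimes>\<^bsub>R\<^esub> M) M (gr_lunit R M) \<and>
    gr_iso R (M \<boxtimes>\<^bsub>R\<^esub> pm_unit R) M (gr_runit R M) \<and>
    (\<forall>f\<in>GHom R M M'. \<forall>g\<in>GHom R N N'. \<forall>h\<in>GHom R K K'.
      gr_comp R ((M \<boxtimes>\<^bsub>R\<^esub> N) \<boxtimes>\<^bsub>R\<^esub> K) ((M' \<boxtimes>\<^bsub>R\<^esub> N') \<boxtimes>\<^bsub>R\<^esub> K') (M' \<boxtimes>\<^bsub>R\<^esub> (N' \<boxtimes>\<^bsub>R\<^esub> K'))
        (gr_assoc R M' N' K')
        (gr_tensor_map R (M \<boxtimes>\<^bsub>R\<^esub> N) K (M' \<boxtimes>\<^bsub>R\<^esub> N') K' (gr_tensor_map R M N M' N' f g) h) =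
      gr_comp R ((M \<boxtimes>\<^bsub>R\<^esub> N) \<boxtimes>\<^bsub>R\<^esub> K) (M \<boxtimes>\<^bsub>R\<^esub> (N \<boxtimes>\<^bsub>R\<^esub> K)) (M' \<boxtimes>\<^bsub>R\<^esub> (N' \<boxtimes>\<^bsub>R\<^esub> K'))
        (gr_tensor_map R M (N \<boxtimes>\<^bsub>R\<^esub> K) M' (N' \<boxtimes>\<^bsub>R\<^esub> K') f (gr_tensor_map R N K N' K' g h))
        (gr_assoc R M N K)) \<and>
    (\<forall>f\<in>GHom R M M'.
      gr_comp R (pm_unit R \<boxtimes>\<^bsub>R\<^esub> M) (pm_unit R \<boxtimes>\<^bsub>R\<^esub> M') M' (gr_lunit R M')
        (gr_tensor_map R (pm_unit R) M (pm_unit R) M' (gr_id R (pm_unit R)) f) =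
      gr_comp R (pm_unit R \<boxtimes>\<^bsub>R\<^esub> M) M M' f (gr_lunit R M)) \<and>
    (\<forall>f\<in>GHom R M M'.
      gr_comp R (M \<boxtimes>\<^bsub>R\<^esub> pm_unit R) (M' \<boxtimes>\<^bsub>R\<^esub> pm_unit R) M' (gr_runit R M')
        (gr_tensor_map R M (pm_unit R) M' (pm_unit R) f (gr_id R (pm_unit R))) =
      gr_comp R (M \<boxtimes>\<^bsub>R\<^esub> pm_unit R) M M' f (gr_runit R M))"

definition gr_pentagon where
  "gr_pentagon R M N K L \<longleftrightarrow>
    gr_comp R (((M \<boxtimes>\<^bsub>R\<^esub> N) \<boxtimes>\<^bsub>R\<^esub> K) \<boxtimes>\<^bsub>R\<^esub> L) ((M \<boxtimes>\<^bsub>R\<^esub> N) \<boxtimes>\<^bsub>R\<^esub> (K \<boxtimes>\<^bsub>R\<^esub> L))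
        (M \<boxtimes>\<^bsub>R\<^esub> (N \<boxtimes>\<^bsub>R\<^esub> (K \<boxtimes>\<^bsub>R\<^esub> L)))
      (gr_assoc R M N (K \<boxtimes>\<^bsub>R\<^esub> L)) (gr_assoc R (M \<boxtimes>\<^bsub>R\<^esub> N) K L) =
    gr_comp R (((M \<boxtimes>\<^bsub>R\<^esub> N) \<boxtimes>\<^bsub>R\<^esub> K) \<boxtimes>\<^bsub>R\<^esub> L) (M \<boxtimes>\<^bsub>R\<^esub> ((N \<boxtimes>\<^bsub>R\<^esub> K) \<boxtimes>\<^bsub>R\<^esub> L))
        (M \<boxtimes>\<^bsub>R\<^esub> (N \<boxtimes>\<^bsub>R\<^esub> (K \<boxtimes>\<^bsub>R\<^esub> L)))
      (gr_tensor_map R M ((N \<boxtimes>\<^bsub>R\<^esub> K) \<boxtimes>\<^bsub>R\<^esub> L) M (N \<boxtimes>\<^bsub>R\<^esub> (K \<boxtimes>\<^bsub>R\<^esub> L)) (gr_id R M) (gr_assoc R N K L))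
      (gr_comp R (((M \<boxtimes>\<^bsub>R\<^esub> N) \<boxtimes>\<^bsub>R\<^esub> K) \<boxtimes>\<^bsub>R\<^esub> L) ((M \<boxtimes>\<^bsub>R\<^esub> (N \<boxtimes>\<^bsub>R\<^esub> K)) \<boxtimes>\<^bsub>R\<^esub> L)
          (M \<boxtimes>\<^bsub>R\<^esub> ((N \<boxtimes>\<^bsub>R\<^esub> K) \<boxtimes>\<^bsub>R\<^esub> L))
        (gr_assoc R M (N \<boxtimes>\<^bsub>R\<^esub> K) L)
        (gr_tensor_map R ((M \<boxtimes>\<^bsub>R\<^esub> N) \<boxtimes>\<^bsub>R\<^esub> K) L (M \<boxtimes>\<^bsub>R\<^esub> (N \<boxtimes>\<^bsub>R\<^esub> K)) L
          (gr_assoc R M N K) (gr_id R L)))"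

definition gr_triangle where
  "gr_triangle R M N \<longleftrightarrow>
    gr_comp R ((M \<boxtimes>\<^bsub>R\<^esub> pm_unit R) \<boxtimes>\<^bsub>R\<^esub> N) (M \<boxtimes>\<^bsub>R\<^esub> (pm_unit R \<boxtimes>\<^bsub>R\<^esub> N)) (M \<boxtimes>\<^bsub>R\<^esub> N)
      (gr_tensor_map R M (pm_unit R \<boxtimes>\<^bsub>R\<^esub> N) M N (gr_id R M) (gr_lunit R N))
      (gr_assoc R M (pm_unit R) N) =
    gr_tensor_map R (M \<boxtimes>\<^bsub>R\<^esub> pm_unit R) N M N (gr_runit R M) (gr_id R N)"

definition gr_symmetry where
  "gr_symmetry R M M' N N' K \<longleftrightarrow>
    gr_iso R (M \<boxtimes>\<^bsub>R\<^esub> N) (N \<boxtimes>\<^bsub>R\<^esub> M) (gr_braid R M N) \<and>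
    (\<forall>f\<in>GHom R M M'. \<forall>g\<in>GHom R N N'.
      gr_comp R (M \<boxtimes>\<^bsub>R\<^esub> N) (M' \<boxtimes>\<^bsub>R\<^esub> N') (N' \<boxtimes>\<^bsub>R\<^esub> M')
        (gr_braid R M' N') (gr_tensor_map R M N M' N' f g) =
      gr_comp R (M \<boxtimes>\<^bsub>R\<^esub> N) (N \<boxtimes>\<^bsub>R\<^esub> M) (N' \<boxtimes>\<^bsub>R\<^esub> M')
        (gr_tensor_map R N M N' M' g f) (gr_braid R M N)) \<and>
    gr_comp R (M \<boxtimes>\<^bsub>R\<^esub> N) (N \<boxtimes>\<^bsub>R\<^esub> M) (M \<boxtimes>\<^bsub>R\<^esub> N) (gr_braid R N M) (gr_braid R M N)
      = gr_id R (M \<boxtimes>\<^bsub>R\<^esub> N) \<and>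
    gr_comp R ((M \<boxtimes>\<^bsub>R\<^esub> N) \<boxtimes>\<^bsub>R\<^esub> K) ((N \<boxtimes>\<^bsub>R\<^esub> K) \<boxtimes>\<^bsub>R\<^esub> M) (N \<boxtimes>\<^bsub>R\<^esub> (K \<boxtimes>\<^bsub>R\<^esub> M))
      (gr_assoc R N K M)
      (gr_comp R ((M \<boxtimes>\<^bsub>R\<^esub> N) \<boxtimes>\<^bsub>R\<^esub> K) (M \<boxtimes>\<^bsub>R\<^esub> (N \<boxtimes>\<^bsub>R\<^esub> K)) ((N \<boxtimes>\<^bsub>R\<^esub> K) \<boxtimes>\<^bsub>R\<^esub> M)
        (gr_braid R M (N \<boxtimes>\<^bsub>R\<^esub> K)) (gr_assoc R M N K)) =
    gr_comp R ((M \<boxtimes>\<^bsub>R\<^esub> N) \<boxtimes>\<^bsub>R\<^esub> K) (N \<boxtimes>\<^bsub>R\<^esub> (M \<boxtimes>\<^bsub>R\<^esub> K)) (N \<boxtimes>\<^bsub>R\<^esub> (K \<boxtimes>\<^bsub>R\<^esub> M))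
      (gr_tensor_map R N (M \<boxtimes>\<^bsub>R\<^esub> K) N (K \<boxtimes>\<^bsub>R\<^esub> M) (gr_id R N) (gr_braid R M K))
      (gr_comp R ((M \<boxtimes>\<^bsub>R\<^esub> N) \<boxtimes>\<^bsub>R\<^esub> K) ((N \<boxtimes>\<^bsub>R\<^esub> M) \<boxtimes>\<^bsub>R\<^esub> K) (N \<boxtimes>\<^bsub>R\<^esub> (M \<boxtimes>\<^bsub>R\<^esub> K))
        (gr_assoc R N M K)
        (gr_tensor_map R (M \<boxtimes>\<^bsub>R\<^esub> N) K (N \<boxtimes>\<^bsub>R\<^esub> M) K (gr_braid R M N) (gr_id R K)))"

definition gr_ihom_functor where
  "gr_ihom_functor R N N' N'' K K' K'' \<longleftrightarrow>
    persistence_module R (ihom R N K) \<and>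
    (\<forall>g\<in>GHom R N' N. \<forall>h\<in>GHom R K K'.
      gr_ihom_map R N N' K K' g h \<in> GHom R (ihom R N K) (ihom R N' K')) \<and>
    gr_ihom_map R N N K K (gr_id R N) (gr_id R K) = gr_id R (ihom R N K) \<and>
    (\<forall>g\<in>GHom R N' N. \<forall>g'\<in>GHom R N'' N'. \<forall>h\<in>GHom R K K'. \<forall>h'\<in>GHom R K' K''.
      gr_ihom_map R N N'' K K'' (gr_comp R N'' N' N g g') (gr_comp R K K' K'' h' h) =
      gr_comp R (ihom R N K) (ihom R N' K') (ihom R N'' K'')
        (gr_ihom_map R N' N'' K' K'' g' h') (gr_ihom_map R N N' K K' g h))"

definition gr_adjunction where
  "gr_adjunction R M M' N N' K K' \<longleftrightarrow>
    bij_betw (gr_adj R M N K) (GHom R (M \<boxtimes>\<^bsub>R\<^esub> N) K) (GHom R M (ihom R N K)) \<and>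
    (\<forall>\<phi>\<in>GHom R (M \<boxtimes>\<^bsub>R\<^esub> N) K. \<forall>f\<in>GHom R M' M. \<forall>g\<in>GHom R N' N. \<forall>h\<in>GHom R K K'.
      gr_adj R M' N' K'
        (gr_comp R (M' \<boxtimes>\<^bsub>R\<^esub> N') K K' h
          (gr_comp R (M' \<boxtimes>\<^bsub>R\<^esub> N') (M \<boxtimes>\<^bsub>R\<^esub> N) K \<phi> (gr_tensor_map R M' N' M N f g))) =
      gr_comp R M' (ihom R N K) (ihom R N' K') (gr_ihom_map R N N' K K' g h)
        (gr_comp R M' M (ihom R N K) (gr_adj R M N K \<phi>) f))"

definition gr_closed_symmetric_monoidal where
  "gr_closed_symmetric_monoidal R M M' M'' N N' N'' K K' K'' L \<longleftrightarrow>
    gr_category R M N K L \<and>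
    gr_tensor_functor R M M' M'' N N' N'' \<and>
    gr_monoidal_isos R M M' N N' K K' \<and>
    gr_pentagon R M N K L \<and>
    gr_triangle R M N \<and>
    gr_symmetry R M M' N N' K \<and>
    gr_ihom_functor R N N' N'' K K' K'' \<and>
    gr_adjunction R M M' N N' K K'"

definition gr_ihom_natural_iso where
  "gr_ihom_natural_iso R M M' N N' K K' \<longleftrightarrow>
    gr_iso R (ihom R (M \<boxtimes>\<^bsub>R\<^esub> N) K) (ihom R M (ihom R N K)) (gr_ihom_curry R M N K) \<and>
    (\<forall>f\<in>GHom R M' M. \<forall>g\<in>GHom R N' N. \<forall>h\<in>GHom R K K'.
      gr_comp R (ihom R (M \<boxtimes>\<^bsub>R\<^esub> N) K) (ihom R M (ihom R N K)) (ihom R M' (ihom R N' K'))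
        (gr_ihom_map R M M' (ihom R N K) (ihom R N' K') f (gr_ihom_map R N N' K K' g h))
        (gr_ihom_curry R M N K) =
      gr_comp R (ihom R (M \<boxtimes>\<^bsub>R\<^esub> N) K) (ihom R (M' \<boxtimes>\<^bsub>R\<^esub> N') K') (ihom R M' (ihom R N' K'))
        (gr_ihom_curry R M' N' K')
        (gr_ihom_map R (M \<boxtimes>\<^bsub>R\<^esub> N) (M' \<boxtimes>\<^bsub>R\<^esub> N') K K' (gr_tensor_map R M' N' M N f g) h))"

subsection \<open>Natural transformations\<close>

definition pm_category where
  "pm_category R M N K L \<longleftrightarrow>
    pm_id M \<in> PHom R M M \<and>
    (\<forall>f\<in>PHom R M N. \<forall>g\<in>PHom R N K. pm_comp M g f \<in> PHom R M K) \<and>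
    (\<forall>f\<in>PHom R M N. pm_comp M f (pm_id M) = f \<and> pm_comp M (pm_id N) f = f) \<and>
    (\<forall>f\<in>PHom R M N. \<forall>g\<in>PHom R N K. \<forall>h\<in>PHom R K L.
      pm_comp M h (pm_comp M g f) = pm_comp M (pm_comp N h g) f)"

definition pm_tensor_functor where
  "pm_tensor_functor R M M' M'' N N' N'' \<longleftrightarrow>
    persistence_module R (M \<boxtimes>\<^bsub>R\<^esub> N) \<and>
    (\<forall>f\<in>PHom R M M'. \<forall>g\<in>PHom R N N'.
      pm_tensor_map R M N M' N' f g \<in> PHom R (M \<boxtimes>\<^bsub>R\<^esub> N) (M' \<boxtimes>\<^bsub>R\<^esub> N')) \<and>
    pm_tensor_map R M N M N (pm_id M) (pm_id N) = pm_id (M \<boxtimes>\<^bsub>R\<^esub> N) \<and>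
    (\<forall>f\<in>PHom R M M'. \<forall>f'\<in>PHom R M' M''. \<forall>g\<in>PHom R N N'. \<forall>g'\<in>PHom R N' N''.
      pm_tensor_map R M N M'' N'' (pm_comp M f' f) (pm_comp N g' g) =
      pm_comp (M \<boxtimes>\<^bsub>R\<^esub> N)
        (pm_tensor_map R M' N' M'' N'' f' g') (pm_tensor_map R M N M' N' f g))"

definition pm_monoidal_isos where
  "pm_monoidal_isos R M M' N N' K K' \<longleftrightarrow>
    pm_iso R ((M \<boxtimes>\<^bsub>R\<^esub> N) \<boxtimes>\<^bsub>R\<^esub> K) (M \<boxtimes>\<^bsub>R\<^esub> (N \<boxtimes>\<^bsub>R\<^esub> K)) (pm_assoc R M N K) \<and>
    pm_iso R (pm_unit R \<boxtimes>\<^bsub>R\<^esub> M) M (pm_lunit R M) \<and>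
    pm_iso R (M \<boxtimes>\<^bsub>R\<^esub> pm_unit R) M (pm_runit R M) \<and>
    (\<forall>f\<in>PHom R M M'. \<forall>g\<in>PHom R N N'. \<forall>h\<in>PHom R K K'.
      pm_comp ((M \<boxtimes>\<^bsub>R\<^esub> N) \<boxtimes>\<^bsub>R\<^esub> K)
        (pm_assoc R M' N' K')
        (pm_tensor_map R (M \<boxtimes>\<^bsub>R\<^esub> N) K (M' \<boxtimes>\<^bsub>R\<^esub> N') K' (pm_tensor_map R M N M' N' f g) h) =
      pm_comp ((M \<boxtimes>\<^bsub>R\<^esub> N) \<boxtimes>\<^bsub>R\<^esub> K)
        (pm_tensor_map R M (N \<boxtimes>\<^bsub>R\<^esub> K) M' (N' \<boxtimes>\<^bsub>R\<^esub> K') f (pm_tensor_map R N K N' K' g h))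
        (pm_assoc R M N K)) \<and>
    (\<forall>f\<in>PHom R M M'.
      pm_comp (pm_unit R \<boxtimes>\<^bsub>R\<^esub> M) (pm_lunit R M')
        (pm_tensor_map R (pm_unit R) M (pm_unit R) M' (pm_id (pm_unit R)) f) =
      pm_comp (pm_unit R \<boxtimes>\<^bsub>R\<^esub> M) f (pm_lunit R M)) \<and>
    (\<forall>f\<in>PHom R M M'.
      pm_comp (M \<boxtimes>\<^bsub>R\<^esub> pm_unit R) (pm_runit R M')
        (pm_tensor_map R M (pm_unit R) M' (pm_unit R) f (pm_id (pm_unit R))) =
      pm_comp (M \<boxtimes>\<^bsub>R\<^esub> pm_unit R) f (pm_runit R M))"

definition pm_pentagon where
  "pm_pentagon R M N K L \<longleftrightarrow>
    pm_comp (((M \<boxtimes>\<^bsub>R\<^esub> N) \<boxtimes>\<^bsub>R\<^esub> K) \<boxtimes>\<^bsub>R\<^esub> L)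
      (pm_assoc R M N (K \<boxtimes>\<^bsub>R\<^esub> L)) (pm_assoc R (M \<boxtimes>\<^bsub>R\<^esub> N) K L) =
    pm_comp (((M \<boxtimes>\<^bsub>R\<^esub> N) \<boxtimes>\<^bsub>R\<^esub> K) \<boxtimes>\<^bsub>R\<^esub> L)
      (pm_tensor_map R M ((N \<boxtimes>\<^bsub>R\<^esub> K) \<boxtimes>\<^bsub>R\<^esub> L) M (N \<boxtimes>\<^bsub>R\<^esub> (K \<boxtimes>\<^bsub>R\<^esub> L)) (pm_id M) (pm_assoc R N K L))
      (pm_comp (((M \<boxtimes>\<^bsub>R\<^esub> N) \<boxtimes>\<^bsub>R\<^esub> K) \<boxtimes>\<^bsub>R\<^esub> L)
        (pm_assoc R M (N \<boxtimes>\<^bsub>R\<^esub> K) L)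
        (pm_tensor_map R ((M \<boxtimes>\<^bsub>R\<^esub> N) \<boxtimes>\<^bsub>R\<^esub> K) L (M \<boxtimes>\<^bsub>R\<^esub> (N \<boxtimes>\<^bsub>R\<^esub> K)) L
          (pm_assoc R M N K) (pm_id L)))"

definition pm_triangle where
  "pm_triangle R M N \<longleftrightarrow>
    pm_comp ((M \<boxtimes>\<^bsub>R\<^esub> pm_unit R) \<boxtimes>\<^bsub>R\<^esub> N)
      (pm_tensor_map R M (pm_unit R \<boxtimes>\<^bsub>R\<^esub> N) M N (pm_id M) (pm_lunit R N))
      (pm_assoc R M (pm_unit R) N) =
    pm_tensor_map R (M \<boxtimes>\<^bsub>R\<^esub> pm_unit R) N M N (pm_runit R M) (pm_id N)"

definition pm_symmetry where
  "pm_symmetry R M M' N N' K \<longleftrightarrow>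
    pm_iso R (M \<boxtimes>\<^bsub>R\<^esub> N) (N \<boxtimes>\<^bsub>R\<^esub> M) (pm_braid R M N) \<and>
    (\<forall>f\<in>PHom R M M'. \<forall>g\<in>PHom R N N'.
      pm_comp (M \<boxtimes>\<^bsub>R\<^esub> N)
        (pm_braid R M' N') (pm_tensor_map R M N M' N' f g) =
      pm_comp (M \<boxtimes>\<^bsub>R\<^esub> N)
        (pm_tensor_map R N M N' M' g f) (pm_braid R M N)) \<and>
    pm_comp (M \<boxtimes>\<^bsub>R\<^esub> N) (pm_braid R N M) (pm_braid R M N)
      = pm_id (M \<boxtimes>\<^bsub>R\<^esub> N) \<and>
    pm_comp ((M \<boxtimes>\<^bsub>R\<^esub> N) \<boxtimes>\<^bsub>R\<^esub> K)
      (pm_assoc R N K M)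
      (pm_comp ((M \<boxtimes>\<^bsub>R\<^esub> N) \<boxtimes>\<^bsub>R\<^esub> K)
        (pm_braid R M (N \<boxtimes>\<^bsub>R\<^esub> K)) (pm_assoc R M N K)) =
    pm_comp ((M \<boxtimes>\<^bsub>R\<^esub> N) \<boxtimes>\<^bsub>R\<^esub> K)
      (pm_tensor_map R N (M \<boxtimes>\<^bsub>R\<^esub> K) N (K \<boxtimes>\<^bsub>R\<^esub> M) (pm_id N) (pm_braid R M K))
      (pm_comp ((M \<boxtimes>\<^bsub>R\<^esub> N) \<boxtimes>\<^bsub>R\<^esub> K)
        (pm_assoc R N M K)
        (pm_tensor_map R (M \<boxtimes>\<^bsub>R\<^esub> N) K (N \<boxtimes>\<^bsub>R\<^esub> M) K (pm_braid R M N) (pm_id K)))"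

definition pm_ihom_functor where
  "pm_ihom_functor R N N' N'' K K' K'' \<longleftrightarrow>
    persistence_module R (ihom R N K) \<and>
    (\<forall>g\<in>PHom R N' N. \<forall>h\<in>PHom R K K'.
      pm_ihom_map R N N' K g h \<in> PHom R (ihom R N K) (ihom R N' K')) \<and>
    pm_ihom_map R N N K (pm_id N) (pm_id K) = pm_id (ihom R N K) \<and>
    (\<forall>g\<in>PHom R N' N. \<forall>g'\<in>PHom R N'' N'. \<forall>h\<in>PHom R K K'. \<forall>h'\<in>PHom R K' K''.
      pm_ihom_map R N N'' K (pm_comp N'' g g') (pm_comp K h' h) =
      pm_comp (ihom R N K)
        (pm_ihom_map R N' N'' K' g' h') (pm_ihom_map R N N' K g h))"

definition pm_adjunction where
  "pm_adjunction R M M' N N' K K' \<longleftrightarrow>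
    bij_betw (pm_adj R M N K) (PHom R (M \<boxtimes>\<^bsub>R\<^esub> N) K) (PHom R M (ihom R N K)) \<and>
    (\<forall>\<phi>\<in>PHom R (M \<boxtimes>\<^bsub>R\<^esub> N) K. \<forall>f\<in>PHom R M' M. \<forall>g\<in>PHom R N' N. \<forall>h\<in>PHom R K K'.
      pm_adj R M' N' K'
        (pm_comp (M' \<boxtimes>\<^bsub>R\<^esub> N') h
          (pm_comp (M' \<boxtimes>\<^bsub>R\<^esub> N') \<phi> (pm_tensor_map R M' N' M N f g))) =
      pm_comp M' (pm_ihom_map R N N' K g h)
        (pm_comp M' (pm_adj R M N K \<phi>) f))"

definition pm_closed_symmetric_monoidal where
  "pm_closed_symmetric_monoidal R M M' M'' N N' N'' K K' K'' L \<longleftrightarrow>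
    pm_category R M N K L \<and>
    pm_tensor_functor R M M' M'' N N' N'' \<and>
    pm_monoidal_isos R M M' N N' K K' \<and>
    pm_pentagon R M N K L \<and>
    pm_triangle R M N \<and>
    pm_symmetry R M M' N N' K \<and>
    pm_ihom_functor R N N' N'' K K' K'' \<and>
    pm_adjunction R M M' N N' K K'"

end

theory Submission
  imports Defs
begin

text \<open>
  A linear map out of \<open>(M \<otimes> N)\<^sub>r\<close> is the same as a balanced family: bilinear maps on \<open>M\<^sub>s \<times> N\<^sub>t\<close> for
  \<open>s + t \<le> r\<close> that are compatible with the structure maps.  A morphism out of an iterated tensor product
  is therefore determined by its values on pure tensors, and every naturality and coherence axiom becomes
  an equality between pure tensors.  The values of a morphism \<open>M \<otimes> N \<rightarrow> K(s)\<close> on pure tensors \<open>m \<otimes> n\<close>,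
  as functions of \<open>n\<close>, form a morphism from \<open>M\<close> to the internal hom shifted by \<open>s\<close>; conversely the values
  of such a morphism are a balanced family, whence the currying bijection in each degree.

  Graded morphisms are finite sums of homogeneous ones and all operations on them are biadditive, so each
  axiom needs to be checked for homogeneous morphisms only.  The axioms for natural transformations are
  the special case of degree zero.
\<close>


section \<open>Linear maps\<close>

text \<open>Tensor products and colimits are concrete quotients of direct sums, and the maps out of
  them are definite descriptions. Nothing is known about such a map until existence and uniqueness
  have been proved, so each construction comes with one principle for equality of maps and one for
  their existence. The associator is the hard case: it is a description inside a description, and
  the inner map must be shown to depend bilinearly on an argument in which its definition is not
  visibly linear. Degrees are terms of the index group, so shifts create no coherence isomorphisms:
  the components at \<open>x + (y + s)\<close> and \<open>x + y + s\<close> are equal modules. The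
  price is rewriting of degrees. Several closure rules therefore leave the degree free and ask for
  an equation such as \<open>u = s + t\<close>, which the simplifier discharges by associativity and
  commutativity. A graded morphism has finite support but its support is not additive: sums may
  cancel. Sums over supports are therefore always replaced by sums over larger finite sets before
  two of them are compared.\<close>

lemma lin_homI:
  assumes "f \<in> carrier M \<rightarrow>\<^sub>E carrier N"
    and "\<And>x y. x \<in> carrier M \<Longrightarrow> y \<in> carrier M \<Longrightarrow> f (x \<oplus>\<^bsub>M\<^esub> y) = f x \<oplus>\<^bsub>N\<^esub> f y"
    and "\<And>a x. a \<in> carrier R \<Longrightarrow> x \<in> carrier M \<Longrightarrow> f (a \<odot>\<^bsub>M\<^esub> x) = a \<odot>\<^bsub>N\<^esub> f x"
  shows "f \<in> lin_hom R M N"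
  using assms by (simp add: lin_hom_def)

lemma lin_hom_closed: "f \<in> lin_hom R M N \<Longrightarrow> x \<in> carrier M \<Longrightarrow> f x \<in> carrier N"
  by (auto simp: lin_hom_def)

lemma lin_hom_add:
  "f \<in> lin_hom R M N \<Longrightarrow> x \<in> carrier M \<Longrightarrow> y \<in> carrier M \<Longrightarrow> f (x \<oplus>\<^bsub>M\<^esub> y) = f x \<oplus>\<^bsub>N\<^esub> f y"
  by (auto simp: lin_hom_def)

lemma lin_hom_smult:
  "f \<in> lin_hom R M N \<Longrightarrow> a \<in> carrier R \<Longrightarrow> x \<in> carrier M \<Longrightarrow> f (a \<odot>\<^bsub>M\<^esub> x) = a \<odot>\<^bsub>N\<^esub> f x"
  by (auto simp: lin_hom_def)

text \<open>Outside the carrier both maps are \<open>undefined\<close>, so agreement on the carrier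
  is equality of functions.\<close>

lemma lin_hom_eqI:
  assumes "f \<in> lin_hom R M N" "g \<in> lin_hom R M N" "\<And>x. x \<in> carrier M \<Longrightarrow> f x = g x"
  shows "f = g"
  using assms by (auto simp: lin_hom_def intro: PiE_ext)

lemma lin_hom_id: "(\<lambda>x\<in>carrier M. x) \<in> lin_hom R M M" if "module R M"
proof -
  interpret module R M by fact
  show ?thesis by (rule lin_homI) auto
qed

lemma lin_hom_compose:
  assumes "module R M" "f \<in> lin_hom R M N" "g \<in> lin_hom R N K"
  shows "compose (carrier M) g f \<in> lin_hom R M K"
proof -
  interpret module R M by fact
  show ?thesis
    using assms(2,3)
    by (intro lin_homI) (auto simp: compose_def lin_hom_closed lin_hom_add lin_hom_smult)
qed

text \<open>Zero is its own multiple by the scalar zero, so compatibility with scalars settles the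
  claim.\<close>

lemma lin_hom_zero:
  assumes "module R M" "module R N" "f \<in> lin_hom R M N"
  shows "f \<zero>\<^bsub>M\<^esub> = \<zero>\<^bsub>N\<^esub>"
proof -
  interpret M: module R M by fact
  interpret N: module R N by fact
  have "f (\<zero>\<^bsub>R\<^esub> \<odot>\<^bsub>M\<^esub> \<zero>\<^bsub>M\<^esub>) = \<zero>\<^bsub>R\<^esub> \<odot>\<^bsub>N\<^esub> f \<zero>\<^bsub>M\<^esub>"
    by (rule lin_hom_smult[OF assms(3)]) auto
  then show ?thesis using lin_hom_closed[OF assms(3)] by simp
qed

lemma lin_hom_a_inv:
  assumes "module R M" "module R N" "f \<in> lin_hom R M N" "x \<in> carrier M"
  shows "f (\<ominus>\<^bsub>M\<^esub> x) = \<ominus>\<^bsub>N\<^esub> f x"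
proof -
  interpret M: module R M by fact
  interpret N: module R N by fact
  have "f (\<ominus>\<^bsub>M\<^esub> x) \<oplus>\<^bsub>N\<^esub> f x = \<zero>\<^bsub>N\<^esub>"
    using assms lin_hom_add[OF assms(3), of "\<ominus>\<^bsub>M\<^esub> x" x] lin_hom_zero[OF assms(1-3)]
    by (simp add: M.l_neg)
  then show ?thesis
    using assms lin_hom_closed[OF assms(3)] by (metis N.minus_equality M.a_inv_closed)
qed

lemma lin_hom_minus:
  assumes "module R M" "module R N" "f \<in> lin_hom R M N" "x \<in> carrier M" "y \<in> carrier M"
  shows "f (x \<ominus>\<^bsub>M\<^esub> y) = f x \<ominus>\<^bsub>N\<^esub> f y"
proof -
  interpret M: module R M by fact
  show ?thesis
    using assms by (simp add: a_minus_def lin_hom_add lin_hom_a_inv)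
qed

lemma kernel_submodule:
  assumes "module R M" "module R N" "f \<in> lin_hom R M N"
  shows "submodule {x \<in> carrier M. f x = \<zero>\<^bsub>N\<^esub>} R M"
proof -
  interpret M: module R M by fact
  interpret N: module R N by fact
  show ?thesis
    using assms
    by (intro M.submoduleI) (auto simp: lin_hom_zero lin_hom_a_inv lin_hom_add lin_hom_smult)
qed

section \<open>Submodules generated by a set\<close>

lemma span_mod_submodule:
  assumes "module R M" "S \<subseteq> carrier M"
  shows "submodule (span_mod R M S) R M"
proof -
  interpret module R M by fact
  \<comment> \<open>The carrier takes part in the intersection, which therefore stays inside
    it.\<close>
  have "carrier M \<in> {H. submodule H R M \<and> S \<subseteq> H}"
    using assms(2) carrier_is_submodule by auto
  then have "span_mod R M S \<subseteq> carrier M" unfolding span_mod_def by (rule Inter_lower)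
  moreover have "\<zero>\<^bsub>M\<^esub> \<in> H" if "submodule H R M" for H
    using subgroup.one_closed[OF submodule.axioms(1)[OF that]] by simp
  ultimately show ?thesis
    by (intro submoduleI) (auto simp: span_mod_def submoduleE(3-5))
qed

lemma span_mod_superset: "S \<subseteq> span_mod R M S"
  by (auto simp: span_mod_def)

text \<open>The kernel of \<open>f\<close> is one of the submodules being intersected, so it
  suffices that the generators are killed. Descent to a tensor product or to a colimit is checked
  through this fact.\<close>

lemma span_mod_kernel:
  assumes "module R M" "module R N" "f \<in> lin_hom R M N" "S \<subseteq> carrier M"
    and "\<And>x. x \<in> S \<Longrightarrow> f x = \<zero>\<^bsub>N\<^esub>" "x \<in> span_mod R M S"
  shows "f x = \<zero>\<^bsub>N\<^esub>"
proof -
  have "span_mod R M S \<subseteq> {x \<in> carrier M. f x = \<zero>\<^bsub>N\<^esub>}"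
    unfolding span_mod_def using kernel_submodule[OF assms(1-3)] assms(4,5)
    by (intro Inter_lower) auto
  then show ?thesis using assms(6) by auto
qed


section \<open>Quotient modules\<close>

text \<open>The library theory of cosets of an additive subgroup supplies the addition of cosets;
  the scalar action is built by hand.\<close>

locale quotient_module = M: module R M for R (structure) and M :: "('r, 'a) module" +
  fixes H :: "'a set"
  assumes submod: "submodule H R M"
begin

lemma subgroup: "subgroup H (add_monoid M)"
  using submod by (rule submodule.axioms)

lemma abelian_subgroup: "abelian_subgroup H M"
  using subgroup M.abelian_group_axioms
  by (intro abelian_subgroupI3) (auto simp: additive_subgroup_def M.abelian_group_axioms)

sublocale H: abelian_subgroup H M
  by (rule abelian_subgroup)

lemma quot_carrier: "carrier (quot_mod M H) = (\<lambda>x. H +>\<^bsub>M\<^esub> x) ` carrier M"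
  by (auto simp: quot_mod_def A_RCOSETS_def')

text \<open>The zero is expressed through a representative, the form to which
  \<open>quot_add\<close> applies.\<close>

lemma quot_zero: "\<zero>\<^bsub>quot_mod M H\<^esub> = H +>\<^bsub>M\<^esub> \<zero>\<^bsub>M\<^esub>"
  using H.a_subset by (simp add: quot_mod_def)

lemma quot_add:
  "x \<in> carrier M \<Longrightarrow> y \<in> carrier M \<Longrightarrow>
    (H +>\<^bsub>M\<^esub> x) \<oplus>\<^bsub>quot_mod M H\<^esub> (H +>\<^bsub>M\<^esub> y) = H +>\<^bsub>M\<^esub> (x \<oplus>\<^bsub>M\<^esub> y)"
  by (simp add: quot_mod_def H.a_rcos_sum)

text \<open>The relations imposed on a tensor product or a colimit are used in this form: a
  difference lies in \<open>H\<close>, hence the two cosets agree.\<close>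

lemma coset_eq_iff:
  assumes "x \<in> carrier M" "y \<in> carrier M"
  shows "H +>\<^bsub>M\<^esub> x = H +>\<^bsub>M\<^esub> y \<longleftrightarrow> x \<ominus>\<^bsub>M\<^esub> y \<in> H"
proof -
  have "x \<in> H +>\<^bsub>M\<^esub> y \<longleftrightarrow> x \<ominus>\<^bsub>M\<^esub> y \<in> H"
    using H.a_rcos_module[OF assms(2,1)] by (simp add: a_minus_def)
  then show ?thesis
    using assms H.a_rcos_self H.a_repr_independence' by blast
qed

text \<open>The scalar action is defined as a union over all representatives of a coset, so that no
  choice is involved. Since \<open>H\<close> absorbs scalars, all cosets in this union
  coincide.\<close>

lemma quot_smult:
  assumes "a \<in> carrier R" "x \<in> carrier M"
  shows "a \<odot>\<^bsub>quot_mod M H\<^esub> (H +>\<^bsub>M\<^esub> x) = H +>\<^bsub>M\<^esub> (a \<odot>\<^bsub>M\<^esub> x)"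
proof -
  have "H +>\<^bsub>M\<^esub> (a \<odot>\<^bsub>M\<^esub> y) = H +>\<^bsub>M\<^esub> (a \<odot>\<^bsub>M\<^esub> x)" if "y \<in> H +>\<^bsub>M\<^esub> x" for y
  proof -
    have y: "y \<in> carrier M" using that assms H.a_elemrcos_carrier by blast
    have "H +>\<^bsub>M\<^esub> y = H +>\<^bsub>M\<^esub> x"
      using H.a_repr_independence'[OF that assms(2)] by simp
    then have "y \<ominus>\<^bsub>M\<^esub> x \<in> H" using coset_eq_iff y assms by simp
    then have "a \<odot>\<^bsub>M\<^esub> (y \<ominus>\<^bsub>M\<^esub> x) \<in> H"
      using assms submodule.smult_closed[OF submod] by blast
    then have "a \<odot>\<^bsub>M\<^esub> y \<ominus>\<^bsub>M\<^esub> a \<odot>\<^bsub>M\<^esub> x \<in> H"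
      using assms y by (simp add: a_minus_def M.smult_r_distr M.smult_r_minus)
    then show ?thesis using coset_eq_iff y assms by simp
  qed
  then have "(\<Union>y\<in>H +>\<^bsub>M\<^esub> x. H +>\<^bsub>M\<^esub> (a \<odot>\<^bsub>M\<^esub> y)) = (\<Union>y\<in>H +>\<^bsub>M\<^esub> x. H +>\<^bsub>M\<^esub> (a \<odot>\<^bsub>M\<^esub> x))"
    by (intro SUP_cong refl)
  \<comment> \<open>A union of equal sets is that set provided there is at least one of
    them.\<close>
  moreover have "H +>\<^bsub>M\<^esub> x \<noteq> {}" using H.a_rcos_self[OF assms(2)] by blast
  ultimately show ?thesis
    by (simp add: quot_mod_def)
qed

lemma quot_module: "module R (quot_mod M H)"
proof (rule moduleI)
  show "cring R" ..
  show "abelian_group (quot_mod M H)"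
  proof (rule abelian_groupI)
    fix X assume "X \<in> carrier (quot_mod M H)"
    then obtain x where x: "x \<in> carrier M" "X = H +>\<^bsub>M\<^esub> x" by (auto simp: quot_carrier)
    have "(H +>\<^bsub>M\<^esub> \<ominus>\<^bsub>M\<^esub> x) \<oplus>\<^bsub>quot_mod M H\<^esub> X = \<zero>\<^bsub>quot_mod M H\<^esub>"
      using x by (simp add: quot_add quot_zero M.l_neg)
    then show "\<exists>Y\<in>carrier (quot_mod M H). Y \<oplus>\<^bsub>quot_mod M H\<^esub> X = \<zero>\<^bsub>quot_mod M H\<^esub>"
      using x by (auto simp: quot_carrier)
  \<comment> \<open>Collapsing \<open>H +> 0\<close> to \<open>H\<close> is switched off, because
    the rule for sums expects a representative of each summand.\<close>
  qed (auto simp: quot_carrier quot_add quot_zero M.a_ac simp del: M.a_coset_add_zero)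
qed (auto simp: quot_carrier quot_add quot_smult M.smult_l_distr M.smult_r_distr M.smult_assoc1)

lemma proj_lin_hom: "(\<lambda>x\<in>carrier M. H +>\<^bsub>M\<^esub> x) \<in> lin_hom R M (quot_mod M H)"
  by (rule lin_homI) (auto simp: quot_carrier quot_add quot_smult)

lemma quot_hom_ext:
  assumes "f \<in> lin_hom R (quot_mod M H) K" "g \<in> lin_hom R (quot_mod M H) K"
    and "\<And>x. x \<in> carrier M \<Longrightarrow> f (H +>\<^bsub>M\<^esub> x) = g (H +>\<^bsub>M\<^esub> x)"
  shows "f = g"
  using assms(3) by (intro lin_hom_eqI[OF assms(1,2)]) (auto simp: quot_carrier)

text \<open>The value on a coset is \<open>f\<close> at a chosen representative. Two representatives
  differ by an element of \<open>H\<close>, which \<open>f\<close> kills, so the choice is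
  immaterial.\<close>

lemma quot_hom_exists:
  assumes K: "module R K" and f: "f \<in> lin_hom R M K" and ker: "\<And>x. x \<in> H \<Longrightarrow> f x = \<zero>\<^bsub>K\<^esub>"
  shows "\<exists>g\<in>lin_hom R (quot_mod M H) K. \<forall>x\<in>carrier M. g (H +>\<^bsub>M\<^esub> x) = f x"
proof (intro bexI ballI)
  interpret K: module R K by fact
  let ?g = "\<lambda>X\<in>carrier (quot_mod M H). f (SOME x. x \<in> carrier M \<and> X = H +>\<^bsub>M\<^esub> x)"
  show g: "?g (H +>\<^bsub>M\<^esub> x) = f x" if x: "x \<in> carrier M" for x
  proof -
    define y where "y = (SOME y. y \<in> carrier M \<and> H +>\<^bsub>M\<^esub> x = H +>\<^bsub>M\<^esub> y)"
    have y: "y \<in> carrier M \<and> H +>\<^bsub>M\<^esub> x = H +>\<^bsub>M\<^esub> y"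
      unfolding y_def by (rule someI[of _ x]) (simp add: x)
    then have "f (x \<ominus>\<^bsub>M\<^esub> y) = \<zero>\<^bsub>K\<^esub>" using coset_eq_iff x ker by blast
    then have "f x \<ominus>\<^bsub>K\<^esub> f y = \<zero>\<^bsub>K\<^esub>"
      using lin_hom_minus[OF M.module_axioms K f] x y by simp
    then have "f x = f y"
      using x y lin_hom_closed[OF f] by (metis K.add.inv_closed K.minus_equality K.minus_minus a_minus_def)
    then show ?thesis using x by (simp add: quot_carrier y_def)
  qed
  show "?g \<in> lin_hom R (quot_mod M H) K"
  proof (rule lin_homI)
    show "?g \<in> carrier (quot_mod M H) \<rightarrow>\<^sub>E carrier K"
      using g lin_hom_closed[OF f] by (intro PiE_I) (auto simp: quot_carrier)
  next
    fix X Y assume "X \<in> carrier (quot_mod M H)" "Y \<in> carrier (quot_mod M H)"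
    then obtain x y where "X = H +>\<^bsub>M\<^esub> x" "Y = H +>\<^bsub>M\<^esub> y" "x \<in> carrier M" "y \<in> carrier M"
      by (auto simp: quot_carrier)
    then show "?g (X \<oplus>\<^bsub>quot_mod M H\<^esub> Y) = ?g X \<oplus>\<^bsub>K\<^esub> ?g Y"
      using g lin_hom_add[OF f] by (simp add: quot_add del: restrict_apply)
  next
    fix a X assume "a \<in> carrier R" "X \<in> carrier (quot_mod M H)"
    then obtain x where "X = H +>\<^bsub>M\<^esub> x" "x \<in> carrier M"
      by (auto simp: quot_carrier)
    then show "?g (a \<odot>\<^bsub>quot_mod M H\<^esub> X) = a \<odot>\<^bsub>K\<^esub> ?g X"
      using \<open>a \<in> carrier R\<close> g lin_hom_smult[OF f] by (simp add: quot_smult del: restrict_apply)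
  qed
qed

end


section \<open>Direct sums\<close>

text \<open>The ring axiom is stated separately because an empty index set provides no module from
  which to derive it.\<close>

locale module_family =
  fixes R :: "('r, 'm) ring_scheme" (structure) and I :: "'i set" and F :: "'i \<Rightarrow> ('r, 'a) module"
  assumes ring: "cring R" and mod: "\<And>i. i \<in> I \<Longrightarrow> module R (F i)"
begin

lemma F_group: "i \<in> I \<Longrightarrow> abelian_group (F i)"
  using mod by (rule module.axioms)

lemmas F_simps =
  abelian_monoid.a_closed[OF abelian_group.axioms(1)[OF F_group]] abelian_monoid.zero_closed[OF abelian_group.axioms(1)[OF F_group]]
  abelian_group.a_inv_closed[OF F_group]
  module.smult_closed[OF mod]
  abelian_monoid.l_zero[OF abelian_group.axioms(1)[OF F_group]]
  abelian_monoid.r_zero[OF abelian_group.axioms(1)[OF F_group]]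
  abelian_group.l_neg[OF F_group] abelian_group.r_neg[OF F_group] 
  module.smult_r_null[OF mod] module.smult_one[OF mod]

lemma dsum_mem:
  "u \<in> carrier (dsum I F) \<longleftrightarrow>
    u \<in> extensional I \<and> (\<forall>i\<in>I. u i \<in> carrier (F i)) \<and> finite {i \<in> I. u i \<noteq> \<zero>\<^bsub>F i\<^esub>}"
  by (auto simp: dsum_def PiE_def)

lemma dsum_add: "u \<oplus>\<^bsub>dsum I F\<^esub> v = (\<lambda>i\<in>I. u i \<oplus>\<^bsub>F i\<^esub> v i)"
  and dsum_smult: "a \<odot>\<^bsub>dsum I F\<^esub> u = (\<lambda>i\<in>I. a \<odot>\<^bsub>F i\<^esub> u i)"
  and dsum_zero: "\<zero>\<^bsub>dsum I F\<^esub> = (\<lambda>i\<in>I. \<zero>\<^bsub>F i\<^esub>)"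
  by (simp_all add: dsum_def)

lemma dsum_add_closed:
  assumes "u \<in> carrier (dsum I F)" "v \<in> carrier (dsum I F)"
  shows "u \<oplus>\<^bsub>dsum I F\<^esub> v \<in> carrier (dsum I F)"
proof -
  have "finite ({i \<in> I. u i \<noteq> \<zero>\<^bsub>F i\<^esub>} \<union> {i \<in> I. v i \<noteq> \<zero>\<^bsub>F i\<^esub>})"
    using assms by (simp add: dsum_mem)
  then have "finite {i \<in> I. u i \<oplus>\<^bsub>F i\<^esub> v i \<noteq> \<zero>\<^bsub>F i\<^esub>}"
    by (rule rev_finite_subset) (auto simp: F_simps)
  then show ?thesis
    using assms by (auto simp: dsum_mem dsum_add F_simps cong: conj_cong)
qed

lemma dsum_smult_closed:
  assumes "a \<in> carrier R" "u \<in> carrier (dsum I F)"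
  shows "a \<odot>\<^bsub>dsum I F\<^esub> u \<in> carrier (dsum I F)"
proof -
  have "finite {i \<in> I. u i \<noteq> \<zero>\<^bsub>F i\<^esub>}"
    using assms by (simp add: dsum_mem)
  then have "finite {i \<in> I. a \<odot>\<^bsub>F i\<^esub> u i \<noteq> \<zero>\<^bsub>F i\<^esub>}"
    by (rule rev_finite_subset) (use assms in \<open>auto simp: F_simps\<close>)
  then show ?thesis
    using assms by (auto simp: dsum_mem dsum_smult F_simps cong: conj_cong)
qed

lemma dsum_zero_closed: "\<zero>\<^bsub>dsum I F\<^esub> \<in> carrier (dsum I F)"
  by (auto simp: dsum_mem dsum_zero F_simps cong: conj_cong)

lemma dsum_eqI:
  "u \<in> extensional I \<Longrightarrow> v \<in> extensional I \<Longrightarrow> (\<And>i. i \<in> I \<Longrightarrow> u i = v i) \<Longrightarrow> u = v"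
  by (rule extensionalityI)

lemma dsum_module: "module R (dsum I F)"
proof (rule moduleI)
  show "cring R" by (rule ring)
  show "abelian_group (dsum I F)"
  proof (rule abelian_groupI)
    fix u assume u: "u \<in> carrier (dsum I F)"
    \<comment> \<open>The negative is taken as the multiple by -1; closure under scalars already
      contains the finiteness of its support.\<close>
    let ?v = "(\<ominus>\<^bsub>R\<^esub> \<one>\<^bsub>R\<^esub>) \<odot>\<^bsub>dsum I F\<^esub> u"
    interpret cring R by (rule ring)
    have "?v \<oplus>\<^bsub>dsum I F\<^esub> u = \<zero>\<^bsub>dsum I F\<^esub>"
      using u by (auto simp: dsum_add dsum_smult dsum_zero dsum_mem module.smult_l_minus[OF mod] F_simps
          intro!: restrict_ext)
    moreover have "?v \<in> carrier (dsum I F)" using u by (intro dsum_smult_closed) auto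
    ultimately show "\<exists>v\<in>carrier (dsum I F). v \<oplus>\<^bsub>dsum I F\<^esub> u = \<zero>\<^bsub>dsum I F\<^esub>" by blast
  next
    fix u v w
    assume "u \<in> carrier (dsum I F)" "v \<in> carrier (dsum I F)" "w \<in> carrier (dsum I F)"
    then show "u \<oplus>\<^bsub>dsum I F\<^esub> v \<oplus>\<^bsub>dsum I F\<^esub> w = u \<oplus>\<^bsub>dsum I F\<^esub> (v \<oplus>\<^bsub>dsum I F\<^esub> w)"
      by (auto simp: dsum_add dsum_mem abelian_monoid.a_assoc[OF abelian_group.axioms(1)[OF F_group]]
          intro!: restrict_ext)
  next
    fix u v assume "u \<in> carrier (dsum I F)" "v \<in> carrier (dsum I F)"
    then show "u \<oplus>\<^bsub>dsum I F\<^esub> v = v \<oplus>\<^bsub>dsum I F\<^esub> u"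
      by (auto simp: dsum_add dsum_mem abelian_monoid.a_comm[OF abelian_group.axioms(1)[OF F_group]]
          intro!: restrict_ext)
  next
    fix u assume "u \<in> carrier (dsum I F)"
    then show "\<zero>\<^bsub>dsum I F\<^esub> \<oplus>\<^bsub>dsum I F\<^esub> u = u"
      by (intro dsum_eqI) (auto simp: dsum_add dsum_mem dsum_zero F_simps)
  qed (auto intro: dsum_add_closed dsum_zero_closed)
  fix u assume "u \<in> carrier (dsum I F)"
  then show "\<one>\<^bsub>R\<^esub> \<odot>\<^bsub>dsum I F\<^esub> u = u"
    by (intro dsum_eqI) (auto simp: dsum_smult dsum_mem F_simps)
qed (fact dsum_smult_closed, auto simp: dsum_add dsum_smult dsum_mem module.smult_l_distr[OF mod]
    module.smult_r_distr[OF mod] module.smult_assoc1[OF mod] intro!: restrict_ext)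

lemma dsum_in_closed: "j \<in> I \<Longrightarrow> x \<in> carrier (F j) \<Longrightarrow> dsum_in I F j x \<in> carrier (dsum I F)"
  by (auto simp: dsum_in_def dsum_mem F_simps intro: finite_subset[of _ "{j}"])

lemma dsum_in_lin_hom:
  assumes "j \<in> I"
  shows "restrict (dsum_in I F j) (carrier (F j)) \<in> lin_hom R (F j) (dsum I F)"
proof (rule lin_homI)
  show "restrict (dsum_in I F j) (carrier (F j)) \<in> carrier (F j) \<rightarrow>\<^sub>E carrier (dsum I F)"
    using assms by (auto simp: dsum_in_closed)
qed (use assms in \<open>auto simp: dsum_in_def dsum_add dsum_smult F_simps intro!: restrict_ext\<close>)

lemma dsum_in_zero: "j \<in> I \<Longrightarrow> dsum_in I F j \<zero>\<^bsub>F j\<^esub> = \<zero>\<^bsub>dsum I F\<^esub>"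
  by (auto simp: dsum_in_def dsum_zero intro!: restrict_ext)

text \<open>Induction on the size of the support, splitting off one coordinate at a time.\<close>

lemma dsum_induct [consumes 1, case_names zero incl add]:
  assumes "u \<in> carrier (dsum I F)"
    and zero: "P \<zero>\<^bsub>dsum I F\<^esub>"
    and incl: "\<And>i x. i \<in> I \<Longrightarrow> x \<in> carrier (F i) \<Longrightarrow> P (dsum_in I F i x)"
    and add: "\<And>v w. v \<in> carrier (dsum I F) \<Longrightarrow> w \<in> carrier (dsum I F) \<Longrightarrow> P v \<Longrightarrow> P w \<Longrightarrow>
      P (v \<oplus>\<^bsub>dsum I F\<^esub> w)"
  shows "P u"
proof -
  have "P u" if "finite S" "u \<in> carrier (dsum I F)" "{i \<in> I. u i \<noteq> \<zero>\<^bsub>F i\<^esub>} = S" for S u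
    using that
  proof (induction S arbitrary: u rule: finite_induct)
    case empty
    then have "u = \<zero>\<^bsub>dsum I F\<^esub>"
      by (intro dsum_eqI) (auto simp: dsum_mem dsum_zero)
    then show ?case using zero by simp
  next
    case (insert j S)
    have j: "j \<in> I" and uj: "u j \<in> carrier (F j)" using insert.prems by (auto simp: dsum_mem)
    \<comment> \<open>Annulling the coordinate \<open>j\<close> leaves an element with support
      \<open>S\<close>, covered by the induction hypothesis; what was removed is the inclusion of
      \<open>u j\<close>.\<close>
    let ?v = "u(j := \<zero>\<^bsub>F j\<^esub>)"
    have supp: "{i \<in> I. ?v i \<noteq> \<zero>\<^bsub>F i\<^esub>} = S"
      using insert.prems(2) insert.hyps(2) by (auto split: if_splits)
    have v: "?v \<in> carrier (dsum I F)"
      unfolding dsum_mem supp using insert.prems(1) insert.hyps(1) j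
      by (auto simp: dsum_mem extensional_def F_simps)
    have "u = ?v \<oplus>\<^bsub>dsum I F\<^esub> dsum_in I F j (u j)"
      using insert.prems(1) j by (intro dsum_eqI) (auto simp: dsum_mem dsum_add dsum_in_def F_simps)
    then show ?case
      using add[OF v dsum_in_closed[OF j uj] insert.IH[OF v supp] incl[OF j uj]] by metis
  qed
  moreover have "finite {i \<in> I. u i \<noteq> \<zero>\<^bsub>F i\<^esub>}" using assms(1) by (simp add: dsum_mem)
  ultimately show ?thesis using assms(1) by blast
qed

lemma dsum_hom_ext:
  assumes "module R K" "f \<in> lin_hom R (dsum I F) K" "g \<in> lin_hom R (dsum I F) K"
    and "\<And>i x. i \<in> I \<Longrightarrow> x \<in> carrier (F i) \<Longrightarrow> f (dsum_in I F i x) = g (dsum_in I F i x)"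
  shows "f = g"
proof (rule lin_hom_eqI[OF assms(2,3)])
  fix u assume "u \<in> carrier (dsum I F)"
  then show "f u = g u"
    by (induction rule: dsum_induct)
      (use assms in \<open>simp_all add: lin_hom_add[OF assms(2)] lin_hom_add[OF assms(3)]
        lin_hom_zero[OF dsum_module]\<close>)
qed

text \<open>The map adds up the values \<open>g i (u i)\<close> over the support of
  \<open>u\<close>, which is finite for each \<open>u\<close> but not the same for all.\<close>

lemma dsum_hom_exists:
  assumes K: "module R K" and g: "\<And>i. i \<in> I \<Longrightarrow> g i \<in> lin_hom R (F i) K"
  shows "\<exists>f\<in>lin_hom R (dsum I F) K. \<forall>i\<in>I. \<forall>x\<in>carrier (F i). f (dsum_in I F i x) = g i x"
proof (intro bexI ballI)
  interpret K: module R K by fact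
  let ?supp = "\<lambda>u. {i \<in> I. u i \<noteq> \<zero>\<^bsub>F i\<^esub>}"
  let ?f = "\<lambda>u\<in>carrier (dsum I F). \<Oplus>\<^bsub>K\<^esub>i\<in>?supp u. g i (u i)"
  have gz: "g i \<zero>\<^bsub>F i\<^esub> = \<zero>\<^bsub>K\<^esub>" if "i \<in> I" for i
    using lin_hom_zero[OF mod K g] that by simp
  have gc: "g i x \<in> carrier K" if "i \<in> I" "x \<in> carrier (F i)" for i x
    using lin_hom_closed[OF g] that by simp
  \<comment> \<open>Any larger finite set of indices gives the same sum, so \<open>u\<close>,
    \<open>v\<close> and \<open>u + v\<close> can be compared over one common set.\<close>
  have f: "?f u = (\<Oplus>\<^bsub>K\<^esub>i\<in>S. g i (u i))"
    if "u \<in> carrier (dsum I F)" "finite S" "?supp u \<subseteq> S" "S \<subseteq> I" for u S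
    using that by (auto simp: dsum_mem gz gc intro!: K.add.finprod_mono_neutral_cong_left)
  show "?f (dsum_in I F j x) = g j x" if "j \<in> I" "x \<in> carrier (F j)" for j x
  proof -
    have j: "?supp (dsum_in I F j x) \<subseteq> {j}" "{j} \<subseteq> I"
      using that by (auto simp: dsum_in_def)
    have "?f (dsum_in I F j x) = (\<Oplus>\<^bsub>K\<^esub>i\<in>{j}. g i (dsum_in I F j x i))"
      by (rule f[OF dsum_in_closed[OF that] _ j]) simp
    also have "\<dots> = g j x"
      using that gc by (simp add: dsum_in_def)
    finally show ?thesis .
  qed
  show "?f \<in> lin_hom R (dsum I F) K"
  proof (rule lin_homI)
    show "?f \<in> carrier (dsum I F) \<rightarrow>\<^sub>E carrier K"
      by (auto simp: dsum_mem gc intro!: K.finsum_closed)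
  next
    fix u v assume u: "u \<in> carrier (dsum I F)" and v: "v \<in> carrier (dsum I F)"
    let ?S = "?supp u \<union> ?supp v"
    have S: "finite ?S" "?S \<subseteq> I" using u v by (auto simp: dsum_mem)
    have uv: "?supp (u \<oplus>\<^bsub>dsum I F\<^esub> v) \<subseteq> ?S" by (auto simp: dsum_add F_simps)
    have "?f (u \<oplus>\<^bsub>dsum I F\<^esub> v) = (\<Oplus>\<^bsub>K\<^esub>i\<in>?S. g i ((u \<oplus>\<^bsub>dsum I F\<^esub> v) i))"
      by (rule f[OF dsum_add_closed[OF u v] S(1) uv S(2)])
    also have "\<dots> = (\<Oplus>\<^bsub>K\<^esub>i\<in>?S. g i (u i) \<oplus>\<^bsub>K\<^esub> g i (v i))"
      using u v by (intro K.finsum_cong') (auto simp: dsum_mem dsum_add lin_hom_add[OF g] gc)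
    also have "\<dots> = (\<Oplus>\<^bsub>K\<^esub>i\<in>?S. g i (u i)) \<oplus>\<^bsub>K\<^esub> (\<Oplus>\<^bsub>K\<^esub>i\<in>?S. g i (v i))"
      using u v by (intro K.finsum_addf) (auto simp: dsum_mem gc)
    also have "\<dots> = ?f u \<oplus>\<^bsub>K\<^esub> ?f v"
      using f[OF u S(1) _ S(2)] f[OF v S(1) _ S(2)] by (simp del: restrict_apply)
    finally show "?f (u \<oplus>\<^bsub>dsum I F\<^esub> v) = ?f u \<oplus>\<^bsub>K\<^esub> ?f v" .
  next
    fix a u assume a: "a \<in> carrier R" and u: "u \<in> carrier (dsum I F)"
    have S: "finite (?supp u)" "?supp u \<subseteq> I" using u by (auto simp: dsum_mem)
    have au: "?supp (a \<odot>\<^bsub>dsum I F\<^esub> u) \<subseteq> ?supp u" using a by (auto simp: dsum_smult F_simps)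
    have "?f (a \<odot>\<^bsub>dsum I F\<^esub> u) = (\<Oplus>\<^bsub>K\<^esub>i\<in>?supp u. g i ((a \<odot>\<^bsub>dsum I F\<^esub> u) i))"
      by (rule f[OF dsum_smult_closed[OF a u] S(1) au S(2)])
    also have "\<dots> = (\<Oplus>\<^bsub>K\<^esub>i\<in>?supp u. a \<odot>\<^bsub>K\<^esub> g i (u i))"
      using a u by (intro K.finsum_cong') (auto simp: dsum_mem dsum_smult lin_hom_smult[OF g] gc)
    also have "\<dots> = a \<odot>\<^bsub>K\<^esub> ?f u"
      using a u S by (simp add: K.finsum_smult_ldistr gc dsum_mem Pi_def)
    finally show "?f (a \<odot>\<^bsub>dsum I F\<^esub> u) = a \<odot>\<^bsub>K\<^esub> ?f u" .
  qed
qed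

end


section \<open>Tensor products\<close>

lemma regular_mod_simps:
  "carrier (regular_mod R) = carrier R" "\<zero>\<^bsub>regular_mod R\<^esub> = \<zero>\<^bsub>R\<^esub>"
  "a \<oplus>\<^bsub>regular_mod R\<^esub> b = a \<oplus>\<^bsub>R\<^esub> b" "a \<odot>\<^bsub>regular_mod R\<^esub> b = a \<otimes>\<^bsub>R\<^esub> b"
  by (simp_all add: regular_mod_def)

lemma regular_mod_module:
  assumes "cring R"
  shows "module R (regular_mod R)"
proof -
  interpret cring R by fact
  show ?thesis
  proof (rule moduleI)
    show "abelian_group (regular_mod R)"
    proof (rule abelian_groupI)
      fix x assume "x \<in> carrier (regular_mod R)"
      then show "\<exists>y\<in>carrier (regular_mod R). y \<oplus>\<^bsub>regular_mod R\<^esub> x = \<zero>\<^bsub>regular_mod R\<^esub>"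
        by (intro bexI[of _ "\<ominus>\<^bsub>R\<^esub> x"]) (auto simp: regular_mod_simps l_neg)
    qed (auto simp: regular_mod_simps a_ac)
  qed (auto simp: regular_mod_simps l_distr r_distr m_assoc is_cring)
qed

section \<open>Free modules\<close>

locale free_module = cring R for R :: "('r, 'm) ring_scheme" (structure) +
  fixes X :: "'x set"
begin

sublocale gens: module_family R X "\<lambda>_. regular_mod R"
  by (intro module_family.intro is_cring regular_mod_module)

lemma free_module: "module R (free_mod R X)"
  unfolding free_mod_def by (rule gens.dsum_module)

lemma free_gen_closed: "x \<in> X \<Longrightarrow> free_gen R X x \<in> carrier (free_mod R X)"
  unfolding free_mod_def free_gen_def by (rule gens.dsum_in_closed) (auto simp: regular_mod_simps)

text \<open>Each summand is spanned by its generator. This is why linear maps out of the free module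
  need to be compared on generators only.\<close>

lemma dsum_in_free_gen:
  "x \<in> X \<Longrightarrow> a \<in> carrier R \<Longrightarrow>
    dsum_in X (\<lambda>_. regular_mod R) x a = a \<odot>\<^bsub>free_mod R X\<^esub> free_gen R X x"
  by (auto simp: free_mod_def free_gen_def gens.dsum_smult dsum_in_def regular_mod_simps
      intro!: restrict_ext)

lemma free_hom_ext:
  assumes "module R K" "f \<in> lin_hom R (free_mod R X) K" "g \<in> lin_hom R (free_mod R X) K"
    and "\<And>x. x \<in> X \<Longrightarrow> f (free_gen R X x) = g (free_gen R X x)"
  shows "f = g"
proof (rule gens.dsum_hom_ext[OF assms(1)])
  show "f \<in> lin_hom R (dsum X (\<lambda>_. regular_mod R)) K" "g \<in> lin_hom R (dsum X (\<lambda>_. regular_mod R)) K"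
    using assms(2,3) by (simp_all add: free_mod_def)
  fix x a assume "x \<in> X" "a \<in> carrier (regular_mod R)"
  then show "f (dsum_in X (\<lambda>_. regular_mod R) x a) = g (dsum_in X (\<lambda>_. regular_mod R) x a)"
    using assms(4) lin_hom_smult[OF assms(2)] lin_hom_smult[OF assms(3)]
    by (simp add: dsum_in_free_gen regular_mod_simps free_gen_closed)
qed

lemma free_hom_exists:
  assumes K: "module R K" and g: "\<And>x. x \<in> X \<Longrightarrow> g x \<in> carrier K"
  shows "\<exists>f\<in>lin_hom R (free_mod R X) K. \<forall>x\<in>X. f (free_gen R X x) = g x"
proof -
  interpret K: module R K by fact
  let ?g = "\<lambda>x. \<lambda>a\<in>carrier R. a \<odot>\<^bsub>K\<^esub> g x"
  have "?g x \<in> lin_hom R (regular_mod R) K" if "x \<in> X" for x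
    using g[OF that]
    by (intro lin_homI) (auto simp: regular_mod_simps K.smult_l_distr K.smult_assoc1)
  then have "\<exists>f\<in>lin_hom R (dsum X (\<lambda>_. regular_mod R)) K. \<forall>x\<in>X. \<forall>a\<in>carrier (regular_mod R).
      f (dsum_in X (\<lambda>_. regular_mod R) x a) = ?g x a"
    by (rule gens.dsum_hom_exists[OF K])
  then obtain f where f: "f \<in> lin_hom R (dsum X (\<lambda>_. regular_mod R)) K"
      "\<forall>x\<in>X. \<forall>a\<in>carrier (regular_mod R).
        f (dsum_in X (\<lambda>_. regular_mod R) x a) = ?g x a"
    by blast
  then have "f (free_gen R X x) = g x" if "x \<in> X" for x
    using g that by (simp add: free_gen_def regular_mod_simps)
  then show ?thesis using f(1) by (auto simp: free_mod_def)
qed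

end

definition bilinear_map ::
  "('r, 'm) ring_scheme \<Rightarrow> ('r, 'a) module \<Rightarrow> ('r, 'b) module \<Rightarrow> ('r, 'c) module
    \<Rightarrow> ('a \<Rightarrow> 'b \<Rightarrow> 'c) \<Rightarrow> bool"
  where "bilinear_map R M N K b \<longleftrightarrow>
    (\<forall>m\<in>carrier M. \<forall>n\<in>carrier N. b m n \<in> carrier K) \<and>
    (\<forall>m\<in>carrier M. \<forall>m'\<in>carrier M. \<forall>n\<in>carrier N. b (m \<oplus>\<^bsub>M\<^esub> m') n = b m n \<oplus>\<^bsub>K\<^esub> b m' n) \<and>
    (\<forall>m\<in>carrier M. \<forall>n\<in>carrier N. \<forall>n'\<in>carrier N. b m (n \<oplus>\<^bsub>N\<^esub> n') = b m n \<oplus>\<^bsub>K\<^esub> b m n') \<and>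
    (\<forall>a\<in>carrier R. \<forall>m\<in>carrier M. \<forall>n\<in>carrier N. b (a \<odot>\<^bsub>M\<^esub> m) n = a \<odot>\<^bsub>K\<^esub> b m n) \<and>
    (\<forall>a\<in>carrier R. \<forall>m\<in>carrier M. \<forall>n\<in>carrier N. b m (a \<odot>\<^bsub>N\<^esub> n) = a \<odot>\<^bsub>K\<^esub> b m n)"

lemma bilinear_mapD:
  assumes "bilinear_map R M N K b" "m \<in> carrier M" "n \<in> carrier N"
  shows "b m n \<in> carrier K"
    and "m' \<in> carrier M \<Longrightarrow> b (m \<oplus>\<^bsub>M\<^esub> m') n = b m n \<oplus>\<^bsub>K\<^esub> b m' n"
    and "n' \<in> carrier N \<Longrightarrow> b m (n \<oplus>\<^bsub>N\<^esub> n') = b m n \<oplus>\<^bsub>K\<^esub> b m n'"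
    and "a \<in> carrier R \<Longrightarrow> b (a \<odot>\<^bsub>M\<^esub> m) n = a \<odot>\<^bsub>K\<^esub> b m n"
    and "a \<in> carrier R \<Longrightarrow> b m (a \<odot>\<^bsub>N\<^esub> n) = a \<odot>\<^bsub>K\<^esub> b m n"
  using assms by (simp_all add: bilinear_map_def)

lemma bilinear_mapI:
  assumes "\<And>m n. m \<in> carrier M \<Longrightarrow> n \<in> carrier N \<Longrightarrow> b m n \<in> carrier K"
    and "\<And>m m' n. m \<in> carrier M \<Longrightarrow> m' \<in> carrier M \<Longrightarrow> n \<in> carrier N \<Longrightarrow>
      b (m \<oplus>\<^bsub>M\<^esub> m') n = b m n \<oplus>\<^bsub>K\<^esub> b m' n"
    and "\<And>m n n'. m \<in> carrier M \<Longrightarrow> n \<in> carrier N \<Longrightarrow> n' \<in> carrier N \<Longrightarrow>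
      b m (n \<oplus>\<^bsub>N\<^esub> n') = b m n \<oplus>\<^bsub>K\<^esub> b m n'"
    and "\<And>a m n. a \<in> carrier R \<Longrightarrow> m \<in> carrier M \<Longrightarrow> n \<in> carrier N \<Longrightarrow> b (a \<odot>\<^bsub>M\<^esub> m) n = a \<odot>\<^bsub>K\<^esub> b m n"
    and "\<And>a m n. a \<in> carrier R \<Longrightarrow> m \<in> carrier M \<Longrightarrow> n \<in> carrier N \<Longrightarrow> b m (a \<odot>\<^bsub>N\<^esub> n) = a \<odot>\<^bsub>K\<^esub> b m n"
  shows "bilinear_map R M N K b"
  using assms by (simp add: bilinear_map_def)

lemma bilinear_map_swap: "bilinear_map R M N K b \<Longrightarrow> bilinear_map R N M K (\<lambda>n m. b m n)"
  by (auto simp: bilinear_map_def)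

lemma bilinear_map_lin_hom:
  "bilinear_map R M N K b \<Longrightarrow> h \<in> lin_hom R K L \<Longrightarrow> bilinear_map R M N L (\<lambda>m n. h (b m n))"
  by (rule bilinear_mapI) (simp_all add: lin_hom_closed lin_hom_add lin_hom_smult bilinear_mapD)

lemma bilinear_map_precompose:
  assumes "bilinear_map R M N K b" "f \<in> lin_hom R M' M" "g \<in> lin_hom R N' N"
  shows "bilinear_map R M' N' K (\<lambda>m n. b (f m) (g n))"
  by (rule bilinear_mapI)
    (simp_all add: bilinear_mapD[OF assms(1)] lin_hom_closed[OF assms(2)] lin_hom_closed[OF assms(3)]
      lin_hom_add[OF assms(2)] lin_hom_add[OF assms(3)] lin_hom_smult[OF assms(2)]
      lin_hom_smult[OF assms(3)])

section \<open>Universal property of the tensor product over \<open>R\<close>\<close>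

locale tensor_product = M: module R M + N: module R N
  for R :: "('r, 'm) ring_scheme" (structure) and M :: "('r, 'a) module" and N :: "('r, 'b) module"
begin

abbreviation "F \<equiv> free_mod R (carrier M \<times> carrier N)"
abbreviation "e \<equiv> free_gen R (carrier M \<times> carrier N)"
abbreviation "S \<equiv> tensor_relations R M N"
abbreviation "H \<equiv> span_mod R F S"

sublocale F: free_module R "carrier M \<times> carrier N" ..

sublocale F: module R F by (rule F.free_module)

lemma e_closed: "m \<in> carrier M \<Longrightarrow> n \<in> carrier N \<Longrightarrow> e (m, n) \<in> carrier F"
  by (rule F.free_gen_closed) simp

lemma tensor_relations_closed: "S \<subseteq> carrier F"
  by (auto simp: tensor_relations_def Let_def e_closed)

lemma quotient: "quotient_module R F H"
  by (intro quotient_module.intro quotient_module_axioms.intro F.module_axioms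
      span_mod_submodule[OF F.module_axioms tensor_relations_closed])

lemmas quot_carrier = quotient_module.quot_carrier[OF quotient]
  and quot_add = quotient_module.quot_add[OF quotient]
  and quot_smult = quotient_module.quot_smult[OF quotient]
  and coset_eq_iff = quotient_module.coset_eq_iff[OF quotient]
  and quot_module = quotient_module.quot_module[OF quotient]
  and proj_lin_hom = quotient_module.proj_lin_hom[OF quotient]
  and quot_hom_ext = quotient_module.quot_hom_ext[OF quotient]
  and quot_hom_exists = quotient_module.quot_hom_exists[OF quotient]

lemma tensor_mod_eq: "tensor_mod R M N = quot_mod F H"
  by (simp add: tensor_mod_def Let_def)

lemma tensor_elt_eq: "tensor_elt R M N m n = H +>\<^bsub>F\<^esub> e (m, n)"
  by (simp add: tensor_elt_def Let_def)

lemma tensor_module: "module R (tensor_mod R M N)"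
  unfolding tensor_mod_eq by (rule quot_module)

text \<open>Each of the four clauses beyond closure says that one of the four families of relations
  lies in the submodule divided out.\<close>

lemma tensor_elt_bilinear: "bilinear_map R M N (tensor_mod R M N) (tensor_elt R M N)"
proof -
  note S = subsetD[OF span_mod_superset, of _ S R F]
  have 1: "e (m \<oplus>\<^bsub>M\<^esub> m', n) \<ominus>\<^bsub>F\<^esub> (e (m, n) \<oplus>\<^bsub>F\<^esub> e (m', n)) \<in> H"
    if "m \<in> carrier M" "m' \<in> carrier M" "n \<in> carrier N" for m m' n
    by (rule S) (use that in \<open>unfold tensor_relations_def Let_def, blast\<close>)
  have 2: "e (m, n \<oplus>\<^bsub>N\<^esub> n') \<ominus>\<^bsub>F\<^esub> (e (m, n) \<oplus>\<^bsub>F\<^esub> e (m, n')) \<in> H"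
    if "m \<in> carrier M" "n \<in> carrier N" "n' \<in> carrier N" for m n n'
    by (rule S) (use that in \<open>unfold tensor_relations_def Let_def, blast\<close>)
  have 3: "e (a \<odot>\<^bsub>M\<^esub> m, n) \<ominus>\<^bsub>F\<^esub> (a \<odot>\<^bsub>F\<^esub> e (m, n)) \<in> H"
    if "a \<in> carrier R" "m \<in> carrier M" "n \<in> carrier N" for a m n
    by (rule S) (use that in \<open>unfold tensor_relations_def Let_def, blast\<close>)
  have 4: "e (m, a \<odot>\<^bsub>N\<^esub> n) \<ominus>\<^bsub>F\<^esub> (a \<odot>\<^bsub>F\<^esub> e (m, n)) \<in> H"
    if "a \<in> carrier R" "m \<in> carrier M" "n \<in> carrier N" for a m n
    by (rule S) (use that in \<open>unfold tensor_relations_def Let_def, blast\<close>)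
  show ?thesis
    unfolding tensor_mod_eq tensor_elt_eq
    by (rule bilinear_mapI)
      (auto simp: quot_add quot_smult coset_eq_iff e_closed 1 2 3 4 quot_carrier)
qed

text \<open>Composed with the projection, both maps live on the free module, where agreement on the
  generators \<open>(m, n)\<close> is enough.\<close>

lemma tensor_hom_ext:
  assumes K: "module R K"
    and f: "f \<in> lin_hom R (tensor_mod R M N) K" and g: "g \<in> lin_hom R (tensor_mod R M N) K"
    and eq: "\<And>m n. m \<in> carrier M \<Longrightarrow> n \<in> carrier N \<Longrightarrow>
      f (tensor_elt R M N m n) = g (tensor_elt R M N m n)"
  shows "f = g"
proof (rule quot_hom_ext)
  let ?p = "\<lambda>x\<in>carrier F. H +>\<^bsub>F\<^esub> x"
  show f': "f \<in> lin_hom R (quot_mod F H) K" and g': "g \<in> lin_hom R (quot_mod F H) K"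
    using f g by (simp_all add: tensor_mod_eq)
  have "compose (carrier F) f ?p = compose (carrier F) g ?p"
    by (rule F.free_hom_ext[OF K lin_hom_compose[OF F.module_axioms proj_lin_hom f']
          lin_hom_compose[OF F.module_axioms proj_lin_hom g']])
      (use eq in \<open>auto simp: compose_def tensor_elt_eq e_closed\<close>)
  then show "f (H +>\<^bsub>F\<^esub> x) = g (H +>\<^bsub>F\<^esub> x)" if "x \<in> carrier F" for x
    using that by (auto simp: compose_def dest: fun_cong[of _ _ x])
qed

text \<open>\<open>b\<close> extends linearly to the free module. The extension kills the relations
  because \<open>b\<close> is bilinear, and so factors through the quotient.\<close>

lemma tensor_hom_exists:
  assumes K: "module R K" and b: "bilinear_map R M N K b"
  shows "\<exists>h\<in>lin_hom R (tensor_mod R M N) K.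
    \<forall>m\<in>carrier M. \<forall>n\<in>carrier N. h (tensor_elt R M N m n) = b m n"
proof -
  interpret K: module R K by fact
  have "(\<lambda>(m, n). b m n) x \<in> carrier K" if "x \<in> carrier M \<times> carrier N" for x
    using that bilinear_mapD(1)[OF b] by (cases x) simp
  then obtain f where f: "f \<in> lin_hom R F K"
    and f_gen: "\<forall>x\<in>carrier M \<times> carrier N. f (e x) = (\<lambda>(m, n). b m n) x"
    using F.free_hom_exists[OF K, of "\<lambda>(m, n). b m n"] by blast
  have fe: "f (e (m, n)) = b m n" if "m \<in> carrier M" "n \<in> carrier N" for m n
    using f_gen that by simp
  have "f x = \<zero>\<^bsub>K\<^esub>" if "x \<in> S" for x
    using that unfolding tensor_relations_def Let_def
    by (elim UnE CollectE exE conjE)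
      (simp_all add: lin_hom_a_inv[OF F.module_axioms K f] lin_hom_add[OF f] lin_hom_smult[OF f]
        e_closed fe bilinear_mapD[OF b] a_minus_def K.r_neg)
  then have "f x = \<zero>\<^bsub>K\<^esub>" if "x \<in> H" for x
    using span_mod_kernel[OF F.module_axioms K f tensor_relations_closed] that by blast
  then obtain g where "g \<in> lin_hom R (quot_mod F H) K" "\<forall>x\<in>carrier F. g (H +>\<^bsub>F\<^esub> x) = f x"
    using quot_hom_exists[OF K f] by blast
  then show ?thesis
    using fe by (intro bexI[of _ g]) (simp_all add: tensor_mod_eq tensor_elt_eq e_closed)
qed

text \<open>Existence and uniqueness together give the definite description
  \<open>tensor_desc\<close> its meaning.\<close>

lemma
  assumes K: "module R K" and b: "bilinear_map R M N K b"
  shows tensor_desc_lin_hom: "tensor_desc R M N K b \<in> lin_hom R (tensor_mod R M N) K"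
    and tensor_desc_elt: "m \<in> carrier M \<Longrightarrow> n \<in> carrier N \<Longrightarrow>
      tensor_desc R M N K b (tensor_elt R M N m n) = b m n"
proof -
  let ?P = "\<lambda>h. h \<in> lin_hom R (tensor_mod R M N) K \<and>
    (\<forall>m\<in>carrier M. \<forall>n\<in>carrier N. h (tensor_elt R M N m n) = b m n)"
  have "\<exists>h. ?P h" using tensor_hom_exists[OF K b] by (simp add: Bex_def)
  then obtain h where "?P h" by (rule exE)
  moreover have "h' = h" if "?P h'" for h'
    by (rule tensor_hom_ext[OF K]) (use that \<open>?P h\<close> in simp_all)
  ultimately have "tensor_desc R M N K b = h"
    unfolding tensor_desc_def by (rule the_equality)
  with \<open>?P h\<close> show "tensor_desc R M N K b \<in> lin_hom R (tensor_mod R M N) K"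
    and "m \<in> carrier M \<Longrightarrow> n \<in> carrier N \<Longrightarrow>
      tensor_desc R M N K b (tensor_elt R M N m n) = b m n"
    by auto
qed

end


section \<open>Colimits\<close>

locale module_diagram = module_family R I F
  for R :: "('r, 'm) ring_scheme" (structure) and I :: "'i set" and F :: "'i \<Rightarrow> ('r, 'a) module" +
  fixes leq :: "'i \<Rightarrow> 'i \<Rightarrow> bool" and f :: "'i \<Rightarrow> 'i \<Rightarrow> 'a \<Rightarrow> 'a"
  assumes trans_lin_hom: "\<And>i j. i \<in> I \<Longrightarrow> j \<in> I \<Longrightarrow> leq i j \<Longrightarrow> f i j \<in> lin_hom R (F i) (F j)"
begin

abbreviation "D \<equiv> dsum I F"
abbreviation "S \<equiv> colim_relations I leq F f"
abbreviation "H \<equiv> span_mod R D S"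

sublocale D: module R D by (rule dsum_module)

lemma colim_relations_closed: "S \<subseteq> carrier D"
  by (auto simp: colim_relations_def intro!: D.minus_closed dsum_in_closed lin_hom_closed[OF trans_lin_hom])

lemma quotient: "quotient_module R D H"
  by (intro quotient_module.intro quotient_module_axioms.intro D.module_axioms
      span_mod_submodule[OF D.module_axioms colim_relations_closed])

lemmas coset_eq_iff = quotient_module.coset_eq_iff[OF quotient]
  and quot_module = quotient_module.quot_module[OF quotient]
  and proj_lin_hom = quotient_module.proj_lin_hom[OF quotient]
  and quot_hom_ext = quotient_module.quot_hom_ext[OF quotient]
  and quot_hom_exists = quotient_module.quot_hom_exists[OF quotient]

lemma colim_module: "module R (colim_mod R I leq F f)"
  unfolding colim_mod_def by (rule quot_module)

lemma colim_in_lin_hom: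
  assumes "i \<in> I"
  shows "restrict (colim_in R I leq F f i) (carrier (F i)) \<in> lin_hom R (F i) (colim_mod R I leq F f)"
proof -
  have "compose (carrier (F i)) (\<lambda>x\<in>carrier D. H +>\<^bsub>D\<^esub> x) (restrict (dsum_in I F i) (carrier (F i)))
      \<in> lin_hom R (F i) (quot_mod D H)"
    by (rule lin_hom_compose[OF mod[OF assms] dsum_in_lin_hom[OF assms] proj_lin_hom])
  moreover have "compose (carrier (F i)) (\<lambda>x\<in>carrier D. H +>\<^bsub>D\<^esub> x) (restrict (dsum_in I F i) (carrier (F i))) =
      restrict (colim_in R I leq F f i) (carrier (F i))"
    using assms by (auto simp: compose_def colim_in_def dsum_in_closed intro!: restrict_ext)
  ultimately show ?thesis by (simp add: colim_mod_def)
qed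

lemma colim_in_trans:
  assumes "i \<in> I" "j \<in> I" "leq i j" "x \<in> carrier (F i)"
  shows "colim_in R I leq F f j (f i j x) = colim_in R I leq F f i x"
proof -
  have "dsum_in I F i x \<ominus>\<^bsub>D\<^esub> dsum_in I F j (f i j x) \<in> H"
    using assms by (intro subsetD[OF span_mod_superset]) (auto simp: colim_relations_def)
  then have "H +>\<^bsub>D\<^esub> dsum_in I F i x = H +>\<^bsub>D\<^esub> dsum_in I F j (f i j x)"
    using assms coset_eq_iff dsum_in_closed lin_hom_closed[OF trans_lin_hom] by simp
  then show ?thesis by (simp add: colim_in_def)
qed

lemma colim_hom_ext:
  assumes K: "module R K" and g: "g \<in> lin_hom R (colim_mod R I leq F f) K"
    and h: "h \<in> lin_hom R (colim_mod R I leq F f) K"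
    and eq: "\<And>i x. i \<in> I \<Longrightarrow> x \<in> carrier (F i) \<Longrightarrow>
      g (colim_in R I leq F f i x) = h (colim_in R I leq F f i x)"
  shows "g = h"
proof (rule quot_hom_ext)
  let ?p = "\<lambda>x\<in>carrier D. H +>\<^bsub>D\<^esub> x"
  show g': "g \<in> lin_hom R (quot_mod D H) K" and h': "h \<in> lin_hom R (quot_mod D H) K"
    using g h by (simp_all add: colim_mod_def)
  have "compose (carrier D) g ?p = compose (carrier D) h ?p"
    by (rule dsum_hom_ext[OF K lin_hom_compose[OF D.module_axioms proj_lin_hom g']
          lin_hom_compose[OF D.module_axioms proj_lin_hom h']])
      (use eq in \<open>auto simp: compose_def colim_in_def dsum_in_closed\<close>)
  then show "g (H +>\<^bsub>D\<^esub> x) = h (H +>\<^bsub>D\<^esub> x)" if "x \<in> carrier D" for x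
    using that by (auto simp: compose_def dest: fun_cong[of _ _ x])
qed

text \<open>The family \<open>g\<close> extends to the direct sum in any case; compatibility with
  the transition maps is exactly what makes the extension kill the relations.\<close>

lemma
  assumes K: "module R K" and g: "\<And>i. i \<in> I \<Longrightarrow> g i \<in> lin_hom R (F i) K"
    and cocone: "\<And>i j x. i \<in> I \<Longrightarrow> j \<in> I \<Longrightarrow> leq i j \<Longrightarrow> x \<in> carrier (F i) \<Longrightarrow> g j (f i j x) = g i x"
  shows colim_desc_lin_hom: "colim_desc R I leq F f K g \<in> lin_hom R (colim_mod R I leq F f) K"
    and colim_desc_in: "i \<in> I \<Longrightarrow> x \<in> carrier (F i) \<Longrightarrow>
      colim_desc R I leq F f K g (colim_in R I leq F f i x) = g i x"
proof -
  interpret K: module R K by fact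
  let ?P = "\<lambda>h. h \<in> lin_hom R (colim_mod R I leq F f) K \<and>
    (\<forall>i\<in>I. \<forall>x\<in>carrier (F i). h (colim_in R I leq F f i x) = g i x)"
  obtain d where d: "d \<in> lin_hom R D K"
    and din: "\<forall>i\<in>I. \<forall>x\<in>carrier (F i). d (dsum_in I F i x) = g i x"
    using dsum_hom_exists[where g = g, OF K g] by blast
  have "d x = \<zero>\<^bsub>K\<^esub>" if x: "x \<in> S" for x
  proof -
    obtain i j y where "i \<in> I" "j \<in> I" "leq i j" "y \<in> carrier (F i)"
        and "x = dsum_in I F i y \<ominus>\<^bsub>D\<^esub> dsum_in I F j (f i j y)"
      using x unfolding colim_relations_def by blast
    then show ?thesis
      by (simp add: lin_hom_add[OF d] lin_hom_a_inv[OF D.module_axioms K d] dsum_in_closed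
          lin_hom_closed[OF trans_lin_hom] din cocone lin_hom_closed[OF g] a_minus_def K.r_neg)
  qed
  then have "d x = \<zero>\<^bsub>K\<^esub>" if "x \<in> H" for x
    using span_mod_kernel[OF D.module_axioms K d colim_relations_closed] that by blast
  then obtain h where "h \<in> lin_hom R (quot_mod D H) K" "\<forall>x\<in>carrier D. h (H +>\<^bsub>D\<^esub> x) = d x"
    using quot_hom_exists[OF K d] by blast
  then have "?P h"
    using din by (simp add: colim_mod_def colim_in_def dsum_in_closed)
  moreover have "h' = h" if "?P h'" for h'
    by (rule colim_hom_ext[OF K]) (use that \<open>?P h\<close> in simp_all)
  ultimately have "colim_desc R I leq F f K g = h"
    unfolding colim_desc_def by (rule the_equality)
  with \<open>?P h\<close> show "colim_desc R I leq F f K g \<in> lin_hom R (colim_mod R I leq F f) K"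
    and "i \<in> I \<Longrightarrow> x \<in> carrier (F i) \<Longrightarrow>
      colim_desc R I leq F f K g (colim_in R I leq F f i x) = g i x"
    by auto
qed

end


section \<open>Persistence modules and their graded tensor product\<close>

text \<open>Two one-sided steps through \<open>b + c\<close>.\<close>

lemma preordered_add_mono:
  fixes a b c d :: "'p::preordered_ab_group_add"
  assumes "a \<le> b" "c \<le> d"
  shows "a + c \<le> b + d"
  using add_mono_right[OF assms(1), of c] add_mono_right[OF assms(2), of b]
  by (metis add.commute order_trans)

lemma pers_module: "persistence_module R M \<Longrightarrow> module R (pobj M r)"
  by (simp add: persistence_module_def)

lemma pers_cring: "persistence_module R M \<Longrightarrow> cring R"
  by (rule module.axioms(1)[OF pers_module])

lemma pmap_lin_hom: "persistence_module R M \<Longrightarrow> r \<le> s \<Longrightarrow> pmap M r s \<in> lin_hom R (pobj M r) (pobj M s)"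
  by (simp add: persistence_module_def)

lemma pmap_closed:
  "persistence_module R M \<Longrightarrow> r \<le> s \<Longrightarrow> m \<in> carrier (pobj M r) \<Longrightarrow> pmap M r s m \<in> carrier (pobj M s)"
  by (rule lin_hom_closed[OF pmap_lin_hom])

lemma pmap_refl: "persistence_module R M \<Longrightarrow> m \<in> carrier (pobj M r) \<Longrightarrow> pmap M r r m = m"
  by (simp add: persistence_module_def)

lemma pmap_trans:
  assumes "persistence_module R M" "r \<le> s" "s \<le> t" "m \<in> carrier (pobj M r)"
  shows "pmap M s t (pmap M r s m) = pmap M r t m"
proof -
  have "compose (carrier (pobj M r)) (pmap M s t) (pmap M r s) = pmap M r t"
    using assms(1-3) by (simp add: persistence_module_def)
  from fun_cong[OF this, of m] show ?thesis using assms(4) by (simp add: compose_def)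
qed

lemma persistence_moduleI:
  assumes "\<And>r. module R (pobj M r)"
    and "\<And>r s. r \<le> s \<Longrightarrow> pmap M r s \<in> lin_hom R (pobj M r) (pobj M s)"
    and "\<And>r m. m \<in> carrier (pobj M r) \<Longrightarrow> pmap M r r m = m"
    and "\<And>r s t m. r \<le> s \<Longrightarrow> s \<le> t \<Longrightarrow> m \<in> carrier (pobj M r) \<Longrightarrow> pmap M s t (pmap M r s m) = pmap M r t m"
  shows "persistence_module R M"
  unfolding persistence_module_def
proof (intro conjI allI impI)
  fix r
  show "pmap M r r = (\<lambda>x\<in>carrier (pobj M r). x)"
    using assms(3) by (intro lin_hom_eqI[OF assms(2) lin_hom_id[OF assms(1)]]) auto
next
  fix r s t :: 'a assume "r \<le> s" "s \<le> t"
  then show "compose (carrier (pobj M r)) (pmap M s t) (pmap M r s) = pmap M r t"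
    using assms order_trans[of r s t]
    by (intro lin_hom_eqI[OF lin_hom_compose]) (auto simp: compose_def)
qed (use assms in auto)

text \<open>A cocone under the diagram of the \<open>M\<^sub>s \<otimes> N\<^sub>t\<close> with the
  tensor products unfolded into bilinear maps, so that two universal properties are merged into one.
  The family is total in \<open>s\<close> and \<open>t\<close>, but constrained only at indices with
  \<open>s + t \<le> r\<close>.\<close>

definition balanced ::
  "('r, 'm) ring_scheme \<Rightarrow> ('p::preordered_ab_group_add, 'r, 'a) pers \<Rightarrow> ('p, 'r, 'b) pers
    \<Rightarrow> 'p \<Rightarrow> ('r, 'c) module \<Rightarrow> ('p \<Rightarrow> 'p \<Rightarrow> 'a \<Rightarrow> 'b \<Rightarrow> 'c) \<Rightarrow> bool"
  where "balanced R M N r K b \<longleftrightarrow>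
    (\<forall>s t. s + t \<le> r \<longrightarrow> bilinear_map R (pobj M s) (pobj N t) K (b s t)) \<and>
    (\<forall>s s' t t'. s \<le> s' \<longrightarrow> t \<le> t' \<longrightarrow> s' + t' \<le> r \<longrightarrow>
      (\<forall>m\<in>carrier (pobj M s). \<forall>n\<in>carrier (pobj N t).
        b s' t' (pmap M s s' m) (pmap N t t' n) = b s t m n))"

text \<open>In the second premise \<open>s + t \<le> r\<close> follows from the other three
  inequalities; supplying it here spares each application the argument.\<close>

lemma balancedI:
  assumes "\<And>s t. s + t \<le> r \<Longrightarrow> bilinear_map R (pobj M s) (pobj N t) K (b s t)"
    and "\<And>s s' t t' m n. s \<le> s' \<Longrightarrow> t \<le> t' \<Longrightarrow> s' + t' \<le> r \<Longrightarrow> s + t \<le> r \<Longrightarrow>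
      m \<in> carrier (pobj M s) \<Longrightarrow> n \<in> carrier (pobj N t) \<Longrightarrow>
      b s' t' (pmap M s s' m) (pmap N t t' n) = b s t m n"
  shows "balanced R M N r K b"
  using assms preordered_add_mono order_trans unfolding balanced_def by blast

lemma balanced_bilinear: "balanced R M N r K b \<Longrightarrow> s + t \<le> r \<Longrightarrow> bilinear_map R (pobj M s) (pobj N t) K (b s t)"
  by (simp add: balanced_def)

lemma balanced_trans:
  "balanced R M N r K b \<Longrightarrow> s \<le> s' \<Longrightarrow> t \<le> t' \<Longrightarrow> s' + t' \<le> r \<Longrightarrow>
    m \<in> carrier (pobj M s) \<Longrightarrow> n \<in> carrier (pobj N t) \<Longrightarrow>
    b s' t' (pmap M s s' m) (pmap N t t' n) = b s t m n"
  by (simp add: balanced_def)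

text \<open>Source of the braiding, and of the right unitor from the left one.\<close>

lemma balanced_swap: "balanced R M N r K b \<Longrightarrow> balanced R N M r K (\<lambda>t s n m. b s t m n)"
  by (rule balancedI, rule bilinear_map_swap, rule balanced_bilinear)
    (simp_all add: balanced_trans add.commute)

text \<open>A smaller bound imposes fewer conditions. Structure maps of the tensor product come from
  this: pure tensors of degree \<open>r'\<close> form a balanced family in every degree below
  \<open>r'\<close>.\<close>

lemma balanced_mono: "balanced R M N r K b \<Longrightarrow> r' \<le> r \<Longrightarrow> balanced R M N r' K b"
  by (rule balancedI) (auto intro: balanced_bilinear balanced_trans order_trans)

locale pers_pair =
  fixes R :: "('r, 'm) ring_scheme" (structure)
    and M :: "('p::preordered_ab_group_add, 'r, 'a) pers" and N :: "('p, 'r, 'b) pers"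
  assumes M: "persistence_module R M" and N: "persistence_module R N"
begin

lemma tensor_product: "tensor_product R (pobj M s) (pobj N t)"
  by (intro tensor_product.intro pers_module M N)

lemma tensor_map_bilinear:
  assumes "s \<le> s'" "t \<le> t'"
  shows "bilinear_map R (pobj M s) (pobj N t) (tensor_mod R (pobj M s') (pobj N t'))
    (\<lambda>m n. tensor_elt R (pobj M s') (pobj N t') (pmap M s s' m) (pmap N t t' n))"
  by (rule bilinear_map_precompose[OF tensor_product.tensor_elt_bilinear[OF tensor_product]])
    (simp_all add: pmap_lin_hom M N assms)

lemma gr_diag_map_elt:
  assumes "s \<le> s'" "t \<le> t'" "m \<in> carrier (pobj M s)" "n \<in> carrier (pobj N t)"
  shows "gr_diag_map R M N (s, t) (s', t') (tensor_elt R (pobj M s) (pobj N t) m n) =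
    tensor_elt R (pobj M s') (pobj N t') (pmap M s s' m) (pmap N t t' n)"
  unfolding gr_diag_map_def tensor_map_def prod.case
  by (rule tensor_product.tensor_desc_elt[OF tensor_product
      tensor_product.tensor_module[OF tensor_product] tensor_map_bilinear]) fact+

lemma gr_diag_map_lin_hom:
  assumes "s \<le> s'" "t \<le> t'"
  shows "gr_diag_map R M N (s, t) (s', t') \<in> lin_hom R (gr_diag R M N (s, t)) (gr_diag R M N (s', t'))"
  unfolding gr_diag_map_def tensor_map_def gr_diag_def prod.case
  by (rule tensor_product.tensor_desc_lin_hom[OF tensor_product
      tensor_product.tensor_module[OF tensor_product] tensor_map_bilinear]) fact+

lemma diagram: "module_diagram R (gr_index r) (gr_diag R M N) gr_le (gr_diag_map R M N)"
proof (intro module_diagram.intro module_family.intro module_diagram_axioms.intro)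
  show "cring R" using M by (rule pers_cring)
  show "module R (gr_diag R M N i)" if "i \<in> gr_index r" for i
    by (cases i) (simp add: gr_diag_def tensor_product.tensor_module[OF tensor_product])
  show "gr_diag_map R M N i j \<in> lin_hom R (gr_diag R M N i) (gr_diag R M N j)"
    if "i \<in> gr_index r" "j \<in> gr_index r" "gr_le i j" for i j
    using that by (cases i; cases j) (simp add: gr_le_def gr_diag_map_lin_hom)
qed

lemma pobj_gr_tensor:
  "pobj (M \<boxtimes>\<^bsub>R\<^esub> N) r = colim_mod R (gr_index r) gr_le (gr_diag R M N) (gr_diag_map R M N)"
  by (simp add: gr_tensor_def gr_tensor_obj_def)

lemma gr_tensor_module: "module R (pobj (M \<boxtimes>\<^bsub>R\<^esub> N) r)"
  unfolding pobj_gr_tensor by (rule module_diagram.colim_module[OF diagram])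

text \<open>Bilinearity is inherited from the tensor product over \<open>R\<close>, compatibility
  with structure maps from the relations of the colimit.\<close>

lemma gr_elt_balanced: "balanced R M N r (pobj (M \<boxtimes>\<^bsub>R\<^esub> N) r) (gr_elt R M N r)"
proof (rule balancedI)
  let ?c = "colim_in R (gr_index r) gr_le (gr_diag R M N) (gr_diag_map R M N)"
  fix s t :: 'p assume st: "s + t \<le> r"
  then have "restrict (?c (s, t)) (carrier (gr_diag R M N (s, t))) \<in> lin_hom R (gr_diag R M N (s, t))
      (pobj (M \<boxtimes>\<^bsub>R\<^esub> N) r)"
    unfolding pobj_gr_tensor by (intro module_diagram.colim_in_lin_hom[OF diagram]) (simp add: gr_index_def)
  from bilinear_map_lin_hom[OF tensor_product.tensor_elt_bilinear[OF tensor_product]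
      this[unfolded gr_diag_def prod.case]]
  \<comment> \<open>The inclusion into the colimit was restricted to its carrier to make it a linear
    map; closure of the carriers under the operations removes the restriction again.\<close>
  show "bilinear_map R (pobj M s) (pobj N t) (pobj (M \<boxtimes>\<^bsub>R\<^esub> N) r) (gr_elt R M N r s t)"
    using bilinear_mapD(1)[OF tensor_product.tensor_elt_bilinear[OF tensor_product]]
    by (simp add: bilinear_map_def gr_elt_def gr_diag_def module.smult_closed[OF pers_module[OF M]]
        module.smult_closed[OF pers_module[OF N]] 
        abelian_monoid.a_closed[OF abelian_group.axioms(1)[OF module.axioms(2)[OF pers_module[OF M]]]]
        abelian_monoid.a_closed[OF abelian_group.axioms(1)[OF module.axioms(2)[OF pers_module[OF N]]]])
next
  fix s s' t t' :: 'p and m n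
  assume st: "s \<le> s'" "t \<le> t'" "s' + t' \<le> r" "s + t \<le> r"
    and m: "m \<in> carrier (pobj M s)" "n \<in> carrier (pobj N t)"
  have "colim_in R (gr_index r) gr_le (gr_diag R M N) (gr_diag_map R M N) (s', t')
      (gr_diag_map R M N (s, t) (s', t') (tensor_elt R (pobj M s) (pobj N t) m n)) =
    colim_in R (gr_index r) gr_le (gr_diag R M N) (gr_diag_map R M N) (s, t)
      (tensor_elt R (pobj M s) (pobj N t) m n)"
    using st m bilinear_mapD(1)[OF tensor_product.tensor_elt_bilinear[OF tensor_product]]
    by (intro module_diagram.colim_in_trans[OF diagram]) (simp_all add: gr_index_def gr_le_def gr_diag_def)
  then show "gr_elt R M N r s' t' (pmap M s s' m) (pmap N t t' n) = gr_elt R M N r s t m n"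
    using st m by (simp add: gr_elt_def gr_diag_map_elt)
qed

text \<open>Maps out of a colimit agree if they agree on each term of the diagram, and on a term,
  being a tensor product, if they agree on pure tensors.\<close>

lemma gr_tensor_hom_ext:
  assumes K: "module R K" and f: "f \<in> lin_hom R (pobj (M \<boxtimes>\<^bsub>R\<^esub> N) r) K"
    and g: "g \<in> lin_hom R (pobj (M \<boxtimes>\<^bsub>R\<^esub> N) r) K"
    and eq: "\<And>s t m n. s + t \<le> r \<Longrightarrow> m \<in> carrier (pobj M s) \<Longrightarrow> n \<in> carrier (pobj N t) \<Longrightarrow>
      f (gr_elt R M N r s t m n) = g (gr_elt R M N r s t m n)"
  shows "f = g"
proof (rule module_diagram.colim_hom_ext[OF diagram K f[unfolded pobj_gr_tensor] g[unfolded pobj_gr_tensor]])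
  let ?c = "colim_in R (gr_index r) gr_le (gr_diag R M N) (gr_diag_map R M N)"
  fix i x assume i: "i \<in> gr_index r" and x: "x \<in> carrier (gr_diag R M N i)"
  obtain s t where st: "i = (s, t)" by (cases i)
  let ?T = "tensor_mod R (pobj M s) (pobj N t)"
  let ?c' = "restrict (?c (s, t)) (carrier ?T)"
  have c: "?c' \<in> lin_hom R ?T (pobj (M \<boxtimes>\<^bsub>R\<^esub> N) r)"
    using module_diagram.colim_in_lin_hom[OF diagram i] by (simp add: st pobj_gr_tensor gr_diag_def)
  note T = tensor_product.tensor_module[OF tensor_product]
  have "compose (carrier ?T) f ?c' = compose (carrier ?T) g ?c'"
    using i st eq bilinear_mapD(1)[OF tensor_product.tensor_elt_bilinear[OF tensor_product]]
    by (intro tensor_product.tensor_hom_ext[OF tensor_product K lin_hom_compose[OF T c f]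
        lin_hom_compose[OF T c g]]) (auto simp: compose_def gr_elt_def gr_index_def)
  from fun_cong[OF this, of x] show "f (?c i x) = g (?c i x)"
    using x by (simp add: st gr_diag_def compose_def)
qed

lemma
  assumes K: "module R K" and b: "balanced R M N r K b"
  shows gr_desc_lin_hom: "gr_desc R M N r K b \<in> lin_hom R (pobj (M \<boxtimes>\<^bsub>R\<^esub> N) r) K"
    and gr_desc_elt: "s + t \<le> r \<Longrightarrow> m \<in> carrier (pobj M s) \<Longrightarrow> n \<in> carrier (pobj N t) \<Longrightarrow>
      gr_desc R M N r K b (gr_elt R M N r s t m n) = b s t m n"
proof -
  let ?g = "\<lambda>(s, t). tensor_desc R (pobj M s) (pobj N t) K (b s t)"
  have g: "tensor_desc R (pobj M s) (pobj N t) K (b s t) \<in> lin_hom R (tensor_mod R (pobj M s) (pobj N t)) K"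
    if "s + t \<le> r" for s t
    by (rule tensor_product.tensor_desc_lin_hom[OF tensor_product K balanced_bilinear[OF b that]])
  have g_elt: "tensor_desc R (pobj M s) (pobj N t) K (b s t) (tensor_elt R (pobj M s) (pobj N t) m n) = b s t m n"
    if "s + t \<le> r" "m \<in> carrier (pobj M s)" "n \<in> carrier (pobj N t)" for s t m n
    by (rule tensor_product.tensor_desc_elt[OF tensor_product K balanced_bilinear[OF b that(1)] that(2,3)])
  have lin: "?g i \<in> lin_hom R (gr_diag R M N i) K" if "i \<in> gr_index r" for i
    using that g by (cases i) (simp add: gr_index_def gr_diag_def)
  have cocone: "?g j (gr_diag_map R M N i j x) = ?g i x"
    if ij: "i \<in> gr_index r" "j \<in> gr_index r" "gr_le i j" and x: "x \<in> carrier (gr_diag R M N i)" for i j x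
  proof -
    obtain s t s' t' where st: "i = (s, t)" "j = (s', t')" by (cases i; cases j)
    have le: "s \<le> s'" "t \<le> t'" "s' + t' \<le> r" "s + t \<le> r"
      using ij by (simp_all add: st gr_index_def gr_le_def)
    let ?T = "tensor_mod R (pobj M s) (pobj N t)"
    note T = tensor_product.tensor_module[OF tensor_product]
    \<comment> \<open>The cocone condition at a fixed arrow of the diagram is an equality of linear
      maps out of a tensor product. On pure tensors it is the second clause of balancedness.\<close>
    have "compose (carrier ?T) (?g (s', t')) (gr_diag_map R M N (s, t) (s', t')) = ?g (s, t)"
    proof (rule tensor_product.tensor_hom_ext[OF tensor_product K])
      show "compose (carrier ?T) (?g (s', t')) (gr_diag_map R M N (s, t) (s', t')) \<in> lin_hom R ?T K"
        using gr_diag_map_lin_hom[OF le(1,2)] g[OF le(3)]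
        by (intro lin_hom_compose[OF T]) (auto simp: gr_diag_def)
      show "?g (s, t) \<in> lin_hom R ?T K" using g[OF le(4)] by simp
      show "compose (carrier ?T) (?g (s', t')) (gr_diag_map R M N (s, t) (s', t'))
          (tensor_elt R (pobj M s) (pobj N t) m n) = ?g (s, t) (tensor_elt R (pobj M s) (pobj N t) m n)"
        if "m \<in> carrier (pobj M s)" "n \<in> carrier (pobj N t)" for m n
        using that le bilinear_mapD(1)[OF tensor_product.tensor_elt_bilinear[OF tensor_product]]
        by (simp add: compose_def gr_diag_map_elt g_elt pmap_closed[OF M] pmap_closed[OF N] balanced_trans[OF b])
    qed
    from fun_cong[OF this, of x] show ?thesis using x by (simp add: st compose_def gr_diag_def)
  qed
  show "gr_desc R M N r K b \<in> lin_hom R (pobj (M \<boxtimes>\<^bsub>R\<^esub> N) r) K"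
    unfolding gr_desc_def pobj_gr_tensor
    by (rule module_diagram.colim_desc_lin_hom[OF diagram K lin cocone])
  show "gr_desc R M N r K b (gr_elt R M N r s t m n) = b s t m n"
    if "s + t \<le> r" "m \<in> carrier (pobj M s)" "n \<in> carrier (pobj N t)"
  proof -
    have "gr_desc R M N r K b (gr_elt R M N r s t m n) = ?g (s, t) (tensor_elt R (pobj M s) (pobj N t) m n)"
      unfolding gr_desc_def gr_elt_def
      using that bilinear_mapD(1)[OF tensor_product.tensor_elt_bilinear[OF tensor_product]]
      by (intro module_diagram.colim_desc_in[OF diagram K lin cocone]) (auto simp: gr_index_def gr_diag_def)
    then show ?thesis using that by (simp add: g_elt)
  qed
qed

end


lemmas gr_tensor_module = pers_pair.gr_tensor_module[OF pers_pair.intro]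
  and gr_elt_balanced = pers_pair.gr_elt_balanced[OF pers_pair.intro]
  and gr_tensor_hom_ext = pers_pair.gr_tensor_hom_ext[OF pers_pair.intro]
  and gr_desc_lin_hom = pers_pair.gr_desc_lin_hom[OF pers_pair.intro]
  and gr_desc_elt = pers_pair.gr_desc_elt[OF pers_pair.intro]


section \<open>Natural transformations and shifts\<close>

lemma lin_hom_pointwise_add:
  assumes "module R M" "module R N" "f \<in> lin_hom R M N" "g \<in> lin_hom R M N"
  shows "(\<lambda>m\<in>carrier M. f m \<oplus>\<^bsub>N\<^esub> g m) \<in> lin_hom R M N"
proof -
  interpret M: module R M by fact
  interpret N: module R N by fact
  note fg = assms(3,4)
  show ?thesis
    using fg[THEN lin_hom_closed]
    by (intro lin_homI)
      (auto simp: lin_hom_add[OF fg(1)] lin_hom_add[OF fg(2)] lin_hom_smult[OF fg(1)]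
        lin_hom_smult[OF fg(2)] N.smult_r_distr N.a_ac)
qed

text \<open>A scalar multiple of a linear map commutes with scalars because the ring is
  commutative.\<close>

lemma lin_hom_pointwise_smult:
  assumes "module R M" "module R N" "f \<in> lin_hom R M N" "a \<in> carrier R"
  shows "(\<lambda>m\<in>carrier M. a \<odot>\<^bsub>N\<^esub> f m) \<in> lin_hom R M N"
proof -
  interpret M: module R M by fact
  interpret N: module R N by fact
  note f = assms(3)
  show ?thesis
    using f[THEN lin_hom_closed] assms(4)
    by (intro lin_homI)
      (auto simp: lin_hom_add[OF f] lin_hom_smult[OF f] N.smult_r_distr N.smult_assoc1[symmetric]
        M.m_comm)
qed

lemma lin_hom_pointwise_zero:
  assumes "module R M" "module R N"
  shows "(\<lambda>m\<in>carrier M. \<zero>\<^bsub>N\<^esub>) \<in> lin_hom R M N"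
proof -
  interpret M: module R M by fact
  interpret N: module R N by fact
  show ?thesis by (intro lin_homI) auto
qed

lemma PHomI:
  assumes "\<And>x. \<phi> x \<in> lin_hom R (pobj M x) (pobj N x)"
    and "\<And>x y m. x \<le> y \<Longrightarrow> m \<in> carrier (pobj M x) \<Longrightarrow> pmap N x y (\<phi> x m) = \<phi> y (pmap M x y m)"
  shows "\<phi> \<in> PHom R M N"
  using assms by (auto simp: nat_hom_def compose_def intro!: restrict_ext)

lemma PHom_lin_hom: "\<phi> \<in> PHom R M N \<Longrightarrow> \<phi> x \<in> lin_hom R (pobj M x) (pobj N x)"
  by (simp add: nat_hom_def)

lemma PHom_closed: "\<phi> \<in> PHom R M N \<Longrightarrow> m \<in> carrier (pobj M x) \<Longrightarrow> \<phi> x m \<in> carrier (pobj N x)"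
  by (rule lin_hom_closed[OF PHom_lin_hom])

lemma PHom_pmap:
  assumes "\<phi> \<in> PHom R M N" "x \<le> y" "m \<in> carrier (pobj M x)"
  shows "\<phi> y (pmap M x y m) = pmap N x y (\<phi> x m)"
proof -
  have "compose (carrier (pobj M x)) (pmap N x y) (\<phi> x) = compose (carrier (pobj M x)) (\<phi> y) (pmap M x y)"
    using assms(1,2) by (simp add: nat_hom_def)
  from fun_cong[OF this, of m] show ?thesis using assms(3) by (simp add: compose_def)
qed

lemma PHom_eqI:
  assumes "\<phi> \<in> PHom R M N" "\<psi> \<in> PHom R M N"
    and "\<And>x m. m \<in> carrier (pobj M x) \<Longrightarrow> \<phi> x m = \<psi> x m"
  shows "\<phi> = \<psi>"
  using lin_hom_eqI[OF PHom_lin_hom[OF assms(1)] PHom_lin_hom[OF assms(2)] assms(3)]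
  by (rule ext)

lemma shift_simps [simp]:
  "pobj (shift N s) x = pobj N (x + s)" "pmap (shift N s) x y = pmap N (x + s) (y + s)"
  by (simp_all add: shift_def)

lemma shift_0 [simp]: "shift N 0 = N"
  by (simp add: shift_def)

lemma shift_pers [simp]: "persistence_module R N \<Longrightarrow> persistence_module R (shift N s)"
  by (rule persistence_moduleI)
    (simp_all add: pers_module pmap_lin_hom add_mono_right pmap_refl pmap_trans)

text \<open>The target degree is a variable with an equation, so the rule applies however the goal
  happens to associate or order the summands.\<close>

lemma PHom_shift_closed:
  "\<phi> \<in> PHom R M (shift N s) \<Longrightarrow> m \<in> carrier (pobj M x) \<Longrightarrow> y = x + s \<Longrightarrow> \<phi> x m \<in> carrier (pobj N y)"
  using PHom_closed[of \<phi> R M "shift N s"] by simp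

lemma PHom_shift_lin_hom: "\<phi> \<in> PHom R M (shift N s) \<Longrightarrow> \<phi> x \<in> lin_hom R (pobj M x) (pobj N (x + s))"
  using PHom_lin_hom[of \<phi> R M "shift N s"] by simp

lemma PHom_shift_pmap:
  "\<phi> \<in> PHom R M (shift N s) \<Longrightarrow> x \<le> y \<Longrightarrow> m \<in> carrier (pobj M x) \<Longrightarrow>
    \<phi> y (pmap M x y m) = pmap N (x + s) (y + s) (\<phi> x m)"
  using PHom_pmap[of \<phi> R M "shift N s"] by simp

lemma nat_hom_add_apply [simp]:
  "m \<in> carrier (pobj M x) \<Longrightarrow> (\<phi> \<oplus>\<^bsub>nat_hom R M N\<^esub> \<psi>) x m = \<phi> x m \<oplus>\<^bsub>pobj N x\<^esub> \<psi> x m"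
  and nat_hom_smult_apply [simp]:
  "m \<in> carrier (pobj M x) \<Longrightarrow> (a \<odot>\<^bsub>nat_hom R M N\<^esub> \<phi>) x m = a \<odot>\<^bsub>pobj N x\<^esub> \<phi> x m"
  and nat_hom_zero_apply [simp]:
  "m \<in> carrier (pobj M x) \<Longrightarrow> \<zero>\<^bsub>nat_hom R M N\<^esub> x m = \<zero>\<^bsub>pobj N x\<^esub>"
  by (simp_all add: nat_hom_def)

lemma nat_hom_module [simp]:
  assumes M: "persistence_module R M" and N: "persistence_module R N"
  shows "module R (nat_hom R M N)"
proof -
  interpret R: cring R by (rule pers_cring[OF M])
  note NM = pers_module[OF N]
  note [simp] = module.smult_closed[OF NM] abelian_monoid.a_closed[OF abelian_group.axioms(1)[OF module.axioms(2)[OF NM]]]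
    abelian_monoid.zero_closed[OF abelian_group.axioms(1)[OF module.axioms(2)[OF NM]]]
  have add: "\<phi> \<oplus>\<^bsub>nat_hom R M N\<^esub> \<psi> \<in> PHom R M N" if "\<phi> \<in> PHom R M N" "\<psi> \<in> PHom R M N" for \<phi> \<psi>
  proof (rule PHomI)
    fix x
    show "(\<phi> \<oplus>\<^bsub>nat_hom R M N\<^esub> \<psi>) x \<in> lin_hom R (pobj M x) (pobj N x)"
      using lin_hom_pointwise_add[OF pers_module[OF M] NM PHom_lin_hom[OF that(1)] PHom_lin_hom[OF that(2)]]
      by (simp add: nat_hom_def)
    fix y m assume "x \<le> y" "m \<in> carrier (pobj M x)"
    then show "pmap N x y ((\<phi> \<oplus>\<^bsub>nat_hom R M N\<^esub> \<psi>) x m) = (\<phi> \<oplus>\<^bsub>nat_hom R M N\<^esub> \<psi>) y (pmap M x y m)"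
      using that by (simp add: PHom_pmap lin_hom_add[OF pmap_lin_hom[OF N]] PHom_closed pmap_closed[OF M])
  qed
  have smult: "a \<odot>\<^bsub>nat_hom R M N\<^esub> \<phi> \<in> PHom R M N" if "a \<in> carrier R" "\<phi> \<in> PHom R M N" for a \<phi>
  proof (rule PHomI)
    fix x
    show "(a \<odot>\<^bsub>nat_hom R M N\<^esub> \<phi>) x \<in> lin_hom R (pobj M x) (pobj N x)"
      using lin_hom_pointwise_smult[OF pers_module[OF M] NM PHom_lin_hom[OF that(2)] that(1)]
      by (simp add: nat_hom_def)
    fix y m assume "x \<le> y" "m \<in> carrier (pobj M x)"
    then show "pmap N x y ((a \<odot>\<^bsub>nat_hom R M N\<^esub> \<phi>) x m) = (a \<odot>\<^bsub>nat_hom R M N\<^esub> \<phi>) y (pmap M x y m)"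
      using that by (simp add: PHom_pmap lin_hom_smult[OF pmap_lin_hom[OF N]] PHom_closed pmap_closed[OF M])
  qed
  have zero: "\<zero>\<^bsub>nat_hom R M N\<^esub> \<in> PHom R M N"
  proof (rule PHomI)
    fix x
    show "\<zero>\<^bsub>nat_hom R M N\<^esub> x \<in> lin_hom R (pobj M x) (pobj N x)"
      using lin_hom_pointwise_zero[OF pers_module[OF M] NM] by (simp add: nat_hom_def)
    fix y m assume "x \<le> y" "m \<in> carrier (pobj M x)"
    then show "pmap N x y (\<zero>\<^bsub>nat_hom R M N\<^esub> x m) = \<zero>\<^bsub>nat_hom R M N\<^esub> y (pmap M x y m)"
      by (simp add: lin_hom_zero[OF NM NM pmap_lin_hom[OF N]] pmap_closed[OF M])
  qed
  show ?thesis
  proof (rule moduleI)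
    show "abelian_group (nat_hom R M N)"
    proof (rule abelian_groupI)
      fix \<phi> assume \<phi>: "\<phi> \<in> PHom R M N"
      \<comment> \<open>As for direct sums, the negative is the multiple by -1, whose naturality is
        part of \<open>smult\<close>.\<close>
      let ?\<psi> = "(\<ominus>\<^bsub>R\<^esub> \<one>\<^bsub>R\<^esub>) \<odot>\<^bsub>nat_hom R M N\<^esub> \<phi>"
      have \<psi>: "?\<psi> \<in> PHom R M N" using \<phi> by (intro smult) auto
      have "?\<psi> \<oplus>\<^bsub>nat_hom R M N\<^esub> \<phi> = \<zero>\<^bsub>nat_hom R M N\<^esub>"
        using \<phi> by (intro PHom_eqI[OF add[OF \<psi> \<phi>] zero])
          (simp add: PHom_closed module.smult_l_minus[OF NM] module.smult_one[OF NM]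
            abelian_group.l_neg[OF module.axioms(2)[OF NM]])
      with \<psi> show "\<exists>\<psi>\<in>PHom R M N. \<psi> \<oplus>\<^bsub>nat_hom R M N\<^esub> \<phi> = \<zero>\<^bsub>nat_hom R M N\<^esub>" by blast
    next
      fix \<phi> \<psi> \<chi> assume *: "\<phi> \<in> PHom R M N" "\<psi> \<in> PHom R M N" "\<chi> \<in> PHom R M N"
      then show "\<phi> \<oplus>\<^bsub>nat_hom R M N\<^esub> \<psi> \<oplus>\<^bsub>nat_hom R M N\<^esub> \<chi> = \<phi> \<oplus>\<^bsub>nat_hom R M N\<^esub> (\<psi> \<oplus>\<^bsub>nat_hom R M N\<^esub> \<chi>)"
        by (intro PHom_eqI[of _ R M N]) (auto simp: PHom_closed
            abelian_monoid.a_assoc[OF abelian_group.axioms(1)[OF module.axioms(2)[OF NM]]] intro: add)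
    next
      fix \<phi> \<psi> assume *: "\<phi> \<in> PHom R M N" "\<psi> \<in> PHom R M N"
      then show "\<phi> \<oplus>\<^bsub>nat_hom R M N\<^esub> \<psi> = \<psi> \<oplus>\<^bsub>nat_hom R M N\<^esub> \<phi>"
        by (intro PHom_eqI[of _ R M N]) (auto simp: PHom_closed
            abelian_monoid.a_comm[OF abelian_group.axioms(1)[OF module.axioms(2)[OF NM]]] intro: add)
    next
      fix \<phi> assume \<phi>: "\<phi> \<in> PHom R M N"
      then show "\<zero>\<^bsub>nat_hom R M N\<^esub> \<oplus>\<^bsub>nat_hom R M N\<^esub> \<phi> = \<phi>"
        by (intro PHom_eqI[of _ R M N]) (auto simp: PHom_closed
            abelian_monoid.l_zero[OF abelian_group.axioms(1)[OF module.axioms(2)[OF NM]]] intro: add zero)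
    qed (fact add zero)+
    show "cring R" by (rule R.is_cring)
    fix a \<phi> assume "a \<in> carrier R" "\<phi> \<in> PHom R M N"
    then show "a \<odot>\<^bsub>nat_hom R M N\<^esub> \<phi> \<in> PHom R M N" by (rule smult)
  qed (rule PHom_eqI[of _ R M N]; auto simp: PHom_closed module.smult_l_distr[OF NM]
        module.smult_r_distr[OF NM] module.smult_assoc1[OF NM] module.smult_one[OF NM] intro: add smult)+
qed

lemma PHom_add_closed [simp]:
  "persistence_module R M \<Longrightarrow> persistence_module R N \<Longrightarrow> \<phi> \<in> PHom R M N \<Longrightarrow> \<psi> \<in> PHom R M N \<Longrightarrow>
    \<phi> \<oplus>\<^bsub>nat_hom R M N\<^esub> \<psi> \<in> PHom R M N"
  by (meson nat_hom_module abelian_monoid.a_closed abelian_group.axioms(1) module.axioms(2))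

lemma PHom_zero_closed [simp]:
  "persistence_module R M \<Longrightarrow> persistence_module R N \<Longrightarrow> \<zero>\<^bsub>nat_hom R M N\<^esub> \<in> PHom R M N"
  by (meson nat_hom_module abelian_monoid.zero_closed abelian_group.axioms(1) module.axioms(2))

lemma pm_id_PHom [simp]: "persistence_module R M \<Longrightarrow> pm_id M \<in> PHom R M M"
  by (rule PHomI) (simp_all add: pm_id_def lin_hom_id pers_module pmap_closed)

lemma pm_id_apply [simp]: "m \<in> carrier (pobj M x) \<Longrightarrow> pm_id M x m = m"
  by (simp add: pm_id_def)


section \<open>The persistence modules occurring in the closed structure\<close>

lemma pm_unit_simps:
  "carrier (pobj (pm_unit R) x) = (if 0 \<le> x then carrier R else {\<zero>\<^bsub>R\<^esub>})"
  "\<zero>\<^bsub>pobj (pm_unit R) x\<^esub> = \<zero>\<^bsub>R\<^esub>"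
  "a \<oplus>\<^bsub>pobj (pm_unit R) x\<^esub> b = a \<oplus>\<^bsub>R\<^esub> b"
  "a \<odot>\<^bsub>pobj (pm_unit R) x\<^esub> b = a \<otimes>\<^bsub>R\<^esub> b"
  by (simp_all add: pm_unit_def regular_mod_def)

text \<open>Both branches of the structure map act as the identity on their domain: off
  \<open>U\<^sub>0\<close> the only element is zero.\<close>

lemma pm_unit_pmap:
  "cring R \<Longrightarrow> a \<in> carrier (pobj (pm_unit R) x) \<Longrightarrow> pmap (pm_unit R) x y a = a"
  by (auto simp: pm_unit_def regular_mod_def split: if_splits)

lemma pm_unit_pers [simp]:
  assumes "cring R"
  shows "persistence_module R (pm_unit R :: ('p::preordered_ab_group_add, 'r, 'r) pers)"
proof -
  interpret cring R by fact
  \<comment> \<open>\<open>U\<^sub>0\<close> is closed upwards by transitivity, so the components of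
    the unit only grow and the structure maps are inclusions.\<close>
  have sub: "carrier (pobj (pm_unit R) x) \<subseteq> carrier (pobj (pm_unit R) y)" if "x \<le> y" for x y :: 'p
    using that order_trans[of 0 x y] by (auto simp: pm_unit_simps)
  show ?thesis
  proof (rule persistence_moduleI)
    fix x :: 'p
    show "module R (pobj (pm_unit R) x)"
    proof (rule moduleI[OF is_cring])
      show "abelian_group (pobj (pm_unit R) x)"
      proof (rule abelian_groupI)
        fix a assume "a \<in> carrier (pobj (pm_unit R) x)"
        then show "\<exists>b\<in>carrier (pobj (pm_unit R) x). b \<oplus>\<^bsub>pobj (pm_unit R) x\<^esub> a = \<zero>\<^bsub>pobj (pm_unit R) x\<^esub>"
          by (intro bexI[of _ "\<ominus>\<^bsub>R\<^esub> a"]) (auto simp: pm_unit_simps l_neg split: if_splits)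
      qed (auto simp: pm_unit_simps a_ac split: if_splits)
    qed (auto simp: pm_unit_simps l_distr r_distr m_assoc split: if_splits)
  next
    fix x y :: 'p assume "x \<le> y"
    have "pmap (pm_unit R) x y = (\<lambda>a\<in>carrier (pobj (pm_unit R) x). a)"
      by (auto simp: pm_unit_def regular_mod_def)
    then show "pmap (pm_unit R) x y \<in> lin_hom R (pobj (pm_unit R) x) (pobj (pm_unit R) y)"
      using sub[OF \<open>x \<le> y\<close>] by (intro lin_homI) (auto simp: pm_unit_simps split: if_splits)
  next
    fix x y z :: 'p and a assume "x \<le> y" "y \<le> z" "a \<in> carrier (pobj (pm_unit R) x)"
    then show "pmap (pm_unit R) y z (pmap (pm_unit R) x y a) = pmap (pm_unit R) x z a"
      using sub[OF \<open>x \<le> y\<close>] by (simp add: pm_unit_pmap[OF is_cring] subset_iff)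
  qed (simp add: pm_unit_pmap[OF is_cring])
qed

lemma gr_elt_closed [simp]:
  "persistence_module R M \<Longrightarrow> persistence_module R N \<Longrightarrow> s + t \<le> r \<Longrightarrow>
    m \<in> carrier (pobj M s) \<Longrightarrow> n \<in> carrier (pobj N t) \<Longrightarrow>
    gr_elt R M N r s t m n \<in> carrier (pobj (M \<boxtimes>\<^bsub>R\<^esub> N) r)"
  by (rule bilinear_mapD(1)[OF balanced_bilinear[OF gr_elt_balanced]])

lemma gr_elt_trans:
  "persistence_module R M \<Longrightarrow> persistence_module R N \<Longrightarrow> s \<le> s' \<Longrightarrow> t \<le> t' \<Longrightarrow> s' + t' \<le> r \<Longrightarrow>
    m \<in> carrier (pobj M s) \<Longrightarrow> n \<in> carrier (pobj N t) \<Longrightarrow>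
    gr_elt R M N r s' t' (pmap M s s' m) (pmap N t t' n) = gr_elt R M N r s t m n"
  by (rule balanced_trans[OF gr_elt_balanced])

lemma gr_elt_balanced_le:
  "persistence_module R M \<Longrightarrow> persistence_module R N \<Longrightarrow> r \<le> r' \<Longrightarrow>
    balanced R M N r (pobj (M \<boxtimes>\<^bsub>R\<^esub> N) r') (gr_elt R M N r')"
  by (rule balanced_mono[OF gr_elt_balanced])

lemma pmap_gr_tensor:
  "pmap (M \<boxtimes>\<^bsub>R\<^esub> N) r r' = gr_desc R M N r (pobj (M \<boxtimes>\<^bsub>R\<^esub> N) r') (gr_elt R M N r')"
  by (simp add: gr_tensor_def)

text \<open>A structure map only relaxes the bound on \<open>s + t\<close>; the representative and
  its two indices stay.\<close>

lemma pmap_gr_elt [simp]: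
  "persistence_module R M \<Longrightarrow> persistence_module R N \<Longrightarrow> r \<le> r' \<Longrightarrow> s + t \<le> r \<Longrightarrow>
    m \<in> carrier (pobj M s) \<Longrightarrow> n \<in> carrier (pobj N t) \<Longrightarrow>
    pmap (M \<boxtimes>\<^bsub>R\<^esub> N) r r' (gr_elt R M N r s t m n) = gr_elt R M N r' s t m n"
  unfolding pmap_gr_tensor
  by (rule gr_desc_elt) (simp_all add: gr_tensor_module gr_elt_balanced_le)

text \<open>The functor laws are equalities of maps out of a tensor product, and on pure tensors
  they are immediate since structure maps do not touch the indices.\<close>

lemma gr_tensor_pers [simp]:
  assumes [simp]: "persistence_module R M" "persistence_module R N"
  shows "persistence_module R (M \<boxtimes>\<^bsub>R\<^esub> N)"
proof (rule persistence_moduleI)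
  let ?T = "\<lambda>r. pobj (M \<boxtimes>\<^bsub>R\<^esub> N) r" and ?p = "pmap (M \<boxtimes>\<^bsub>R\<^esub> N)"
  show T: "module R (?T r)" for r
    by (simp add: gr_tensor_module)
  show p: "?p r s \<in> lin_hom R (?T r) (?T s)" if "r \<le> s" for r s
    unfolding pmap_gr_tensor using that
    by (intro gr_desc_lin_hom) (simp_all add: gr_tensor_module gr_elt_balanced_le)
  have "?p r r = (\<lambda>x\<in>carrier (?T r). x)" for r
    by (rule gr_tensor_hom_ext[OF _ _ T p lin_hom_id[OF T]]) simp_all
  then show "?p r r x = x" if "x \<in> carrier (?T r)" for r x using that by simp
  show "?p s t (?p r s x) = ?p r t x" if "r \<le> s" "s \<le> t" "x \<in> carrier (?T r)" for r s t x
  proof -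
    have "r \<le> t" using that by (metis order_trans)
    have "compose (carrier (?T r)) (?p s t) (?p r s) = ?p r t"
      using that \<open>r \<le> t\<close> order_trans[of _ r s]
      by (intro gr_tensor_hom_ext[OF _ _ T lin_hom_compose[OF T p p] p]) (simp_all add: compose_def)
    from fun_cong[OF this, of x] show ?thesis using that by (simp add: compose_def)
  qed
qed

section \<open>The internal hom as a persistence module\<close>

lemma pobj_ihom [simp]: "pobj (ihom R M N) s = nat_hom R M (shift N s)"
  by (simp add: ihom_def)

lemma ihom_pmap_apply [simp]:
  "\<phi> \<in> PHom R M (shift N s) \<Longrightarrow> m \<in> carrier (pobj M x) \<Longrightarrow>
    pmap (ihom R M N) s t \<phi> x m = pmap N (x + s) (x + t) (\<phi> x m)"
  by (simp add: ihom_def compose_def)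

lemma add_mono_left: "a \<le> b \<Longrightarrow> c + a \<le> c + b" for a b c :: "'p::preordered_ab_group_add"
  using add_mono_right[of a b c] by (simp add: add.commute)

lemma ihom_pers [simp]:
  fixes M :: "('p::preordered_ab_group_add, 'r, 'a) pers" and N :: "('p, 'r, 'b) pers"
  assumes M [simp]: "persistence_module R M" and N [simp]: "persistence_module R N"
  shows "persistence_module R (ihom R M N)"
proof -
  let ?p = "pmap (ihom R M N)"
  have closed: "?p s t \<phi> \<in> PHom R M (shift N t)" if "s \<le> t" "\<phi> \<in> PHom R M (shift N s)" for s t \<phi>
  proof (rule PHomI)
    fix x
    have "?p s t \<phi> x = compose (carrier (pobj M x)) (pmap N (x + s) (x + t)) (\<phi> x)"
      using that by (simp add: ihom_def)
    then show "?p s t \<phi> x \<in> lin_hom R (pobj M x) (pobj (shift N t) x)"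
      using that lin_hom_compose[OF pers_module[OF M] PHom_shift_lin_hom pmap_lin_hom[OF N]]
      by (simp add: add_mono_left)
    fix y m assume "x \<le> y" "m \<in> carrier (pobj M x)"
    \<comment> \<open>Both sides are the image of \<open>\<phi> x m\<close> in degree
      \<open>y + t\<close>, reached once through \<open>x + t\<close> and once through
      \<open>y + s\<close>.\<close>
    then show "pmap (shift N t) x y (?p s t \<phi> x m) = ?p s t \<phi> y (pmap M x y m)"
      using that by (simp add: pmap_closed[OF M] PHom_shift_pmap[OF that(2)] pmap_trans[OF N]
          add_mono_left add_mono_right PHom_shift_closed[OF that(2)])
  qed
  show ?thesis
  proof (rule persistence_moduleI)
    fix s show "module R (pobj (ihom R M N) s)" by simp
  next
    fix s t :: 'p assume st: "s \<le> t"
    interpret T: module R "nat_hom R M (shift N t)" by simp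
    interpret S: module R "nat_hom R M (shift N s)" by simp
    show "?p s t \<in> lin_hom R (pobj (ihom R M N) s) (pobj (ihom R M N) t)"
    proof (rule lin_homI)
      show "?p s t \<in> carrier (pobj (ihom R M N) s) \<rightarrow>\<^sub>E carrier (pobj (ihom R M N) t)"
        using closed[OF st] by (intro PiE_I) (simp_all add: ihom_def)
    next
      fix \<phi> \<psi> assume *: "\<phi> \<in> carrier (pobj (ihom R M N) s)" "\<psi> \<in> carrier (pobj (ihom R M N) s)"
      then show "?p s t (\<phi> \<oplus>\<^bsub>pobj (ihom R M N) s\<^esub> \<psi>) = ?p s t \<phi> \<oplus>\<^bsub>pobj (ihom R M N) t\<^esub> ?p s t \<psi>"
        using st by (intro PHom_eqI[of _ R M "shift N t"])
          (simp_all add: closed lin_hom_add[OF pmap_lin_hom[OF N]] add_mono_left PHom_shift_closed)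
    next
      fix a \<phi> assume *: "a \<in> carrier R" "\<phi> \<in> carrier (pobj (ihom R M N) s)"
      then show "?p s t (a \<odot>\<^bsub>pobj (ihom R M N) s\<^esub> \<phi>) = a \<odot>\<^bsub>pobj (ihom R M N) t\<^esub> ?p s t \<phi>"
        using st by (intro PHom_eqI[of _ R M "shift N t"])
          (simp_all add: closed lin_hom_smult[OF pmap_lin_hom[OF N]] add_mono_left PHom_shift_closed)
    qed
  next
    fix s \<phi> assume "\<phi> \<in> carrier (pobj (ihom R M N) s)"
    then show "?p s s \<phi> = \<phi>"
      by (intro PHom_eqI[of _ R M "shift N s"]) (simp_all add: closed pmap_refl[OF N] PHom_shift_closed)
  next
    fix r s t \<phi> assume "r \<le> s" "s \<le> t" "\<phi> \<in> carrier (pobj (ihom R M N) r)"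
    then show "?p s t (?p r s \<phi>) = ?p r t \<phi>"
      using order_trans[of r s t]
      by (intro PHom_eqI[of _ R M "shift N t"])
        (simp_all add: closed pmap_trans[OF N] PHom_shift_closed add_mono_left)
  qed
qed


section \<open>Homogeneous morphisms\<close>

text \<open>Composition is defined with \<open>s + x\<close>, whereas \<open>shift\<close> uses
  \<open>x + s\<close>; the rule changes to the second convention once and for all.\<close>

lemma hom_comp_apply [simp]:
  "m \<in> carrier (pobj M x) \<Longrightarrow> hom_comp M s \<beta> \<alpha> x m = \<beta> (x + s) (\<alpha> x m)"
  by (simp add: hom_comp_def compose_def add.commute)

lemma hom_comp_PHom:
  assumes M: "persistence_module R M" and \<alpha>: "\<alpha> \<in> PHom R M (shift N s)"
    and \<beta>: "\<beta> \<in> PHom R N (shift K t)" and u: "u = s + t"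
  shows "hom_comp M s \<beta> \<alpha> \<in> PHom R M (shift K u)"
proof (rule PHomI)
  fix x
  have "hom_comp M s \<beta> \<alpha> x = compose (carrier (pobj M x)) (\<beta> (x + s)) (\<alpha> x)"
    by (simp add: hom_comp_def add.commute)
  then show "hom_comp M s \<beta> \<alpha> x \<in> lin_hom R (pobj M x) (pobj (shift K u) x)"
    using lin_hom_compose[OF pers_module[OF M] PHom_shift_lin_hom[OF \<alpha>] PHom_shift_lin_hom[OF \<beta>]]
    by (simp add: u add.assoc)
  fix y m assume "x \<le> y" "m \<in> carrier (pobj M x)"
  then show "pmap (shift K u) x y (hom_comp M s \<beta> \<alpha> x m) = hom_comp M s \<beta> \<alpha> y (pmap M x y m)"
    using PHom_shift_pmap[OF \<beta>, of "x + s" "y + s" "\<alpha> x m"]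
    by (simp add: pmap_closed[OF M] PHom_shift_pmap[OF \<alpha>] PHom_shift_closed[OF \<alpha>]
        add_mono_right u add.assoc)
qed

text \<open>By naturality it suffices to compare the values in the least degree in which a pure tensor lives.\<close>

lemma gr_tensor_PHom_eqI:
  assumes M: "persistence_module R M" and N: "persistence_module R N" and K: "persistence_module R K"
    and \<Phi>: "\<Phi> \<in> PHom R (M \<boxtimes>\<^bsub>R\<^esub> N) K" and \<Psi>: "\<Psi> \<in> PHom R (M \<boxtimes>\<^bsub>R\<^esub> N) K"
    and eq: "\<And>s t m n. m \<in> carrier (pobj M s) \<Longrightarrow> n \<in> carrier (pobj N t) \<Longrightarrow>
      \<Phi> (s + t) (gr_elt R M N (s + t) s t m n) = \<Psi> (s + t) (gr_elt R M N (s + t) s t m n)"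
  shows "\<Phi> = \<Psi>"
proof
  fix r
  show "\<Phi> r = \<Psi> r"
  proof (rule gr_tensor_hom_ext[OF M N pers_module[OF K] PHom_lin_hom[OF \<Phi>] PHom_lin_hom[OF \<Psi>]])
    fix s t m n assume *: "s + t \<le> r" "m \<in> carrier (pobj M s)" "n \<in> carrier (pobj N t)"
    let ?x = "gr_elt R M N (s + t) s t m n"
    have x: "?x \<in> carrier (pobj (M \<boxtimes>\<^bsub>R\<^esub> N) (s + t))" "pmap (M \<boxtimes>\<^bsub>R\<^esub> N) (s + t) r ?x = gr_elt R M N r s t m n"
      using * M N by simp_all
    show "\<Phi> r (gr_elt R M N r s t m n) = \<Psi> r (gr_elt R M N r s t m n)"
      using PHom_pmap[OF \<Phi> *(1) x(1)] PHom_pmap[OF \<Psi> *(1) x(1)] eq[OF *(2,3)] by (simp add: x(2))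
  qed
qed

text \<open>Balancedness gives a linear map in each degree separately. The premise
  \<open>nat\<close> links the degrees: raising \<open>r\<close> amounts to applying a structure map
  of \<open>K\<close>, and on pure tensors this is naturality.\<close>

lemma gr_desc_PHom:
  assumes M: "persistence_module R M" and N: "persistence_module R N" and K: "persistence_module R K"
    and b: "\<And>r. balanced R M N r (pobj K r) (b r)"
    and nat: "\<And>r r' s t m n. r \<le> r' \<Longrightarrow> s + t \<le> r \<Longrightarrow> m \<in> carrier (pobj M s) \<Longrightarrow> n \<in> carrier (pobj N t) \<Longrightarrow>
      pmap K r r' (b r s t m n) = b r' s t m n"
  shows "(\<lambda>r. gr_desc R M N r (pobj K r) (b r)) \<in> PHom R (M \<boxtimes>\<^bsub>R\<^esub> N) K"
proof (rule PHomI)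
  let ?T = "M \<boxtimes>\<^bsub>R\<^esub> N"
  have T: "persistence_module R ?T" using M N by simp
  show d: "gr_desc R M N r (pobj K r) (b r) \<in> lin_hom R (pobj ?T r) (pobj K r)" for r
    by (rule gr_desc_lin_hom[OF M N pers_module[OF K] b])
  fix r r' x assume r: "r \<le> r'" and x: "x \<in> carrier (pobj ?T r)"
  have "compose (carrier (pobj ?T r)) (pmap K r r') (gr_desc R M N r (pobj K r) (b r)) =
    compose (carrier (pobj ?T r)) (gr_desc R M N r' (pobj K r') (b r')) (pmap ?T r r')"
  proof (rule gr_tensor_hom_ext[OF M N pers_module[OF K]
      lin_hom_compose[OF pers_module[OF T] d pmap_lin_hom[OF K r]]
      lin_hom_compose[OF pers_module[OF T] pmap_lin_hom[OF T r] d]])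
    fix s t m n assume *: "s + t \<le> r" "m \<in> carrier (pobj M s)" "n \<in> carrier (pobj N t)"
    then have "s + t \<le> r'" using r by (metis order_trans)
    then show "compose (carrier (pobj ?T r)) (pmap K r r') (gr_desc R M N r (pobj K r) (b r)) (gr_elt R M N r s t m n) =
      compose (carrier (pobj ?T r)) (gr_desc R M N r' (pobj K r') (b r')) (pmap ?T r r') (gr_elt R M N r s t m n)"
      using * r M N nat by (simp add: compose_def gr_desc_elt[OF M N pers_module[OF K] b])
  qed
  from fun_cong[OF this, of x]
  show "pmap K r r' (gr_desc R M N r (pobj K r) (b r) x) = gr_desc R M N r' (pobj K r') (b r') (pmap ?T r r' x)"
    using x by (simp add: compose_def)
qed

lemma gr_elt_bilinear:
  "persistence_module R M \<Longrightarrow> persistence_module R N \<Longrightarrow> s + t \<le> r \<Longrightarrow>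
    bilinear_map R (pobj M s) (pobj N t) (pobj (M \<boxtimes>\<^bsub>R\<^esub> N) r) (gr_elt R M N r s t)"
  by (rule balanced_bilinear[OF gr_elt_balanced])

text \<open>Composites with restricted functions agree with the intended bilinear map on the
  carriers only; this rule bridges the difference.\<close>

lemma bilinear_map_cong:
  assumes "module R M" "module R N" "bilinear_map R M N K b"
    and "\<And>m n. m \<in> carrier M \<Longrightarrow> n \<in> carrier N \<Longrightarrow> b m n = b' m n"
  shows "bilinear_map R M N K b'"
proof -
  interpret M: module R M by fact
  interpret N: module R N by fact
  show ?thesis
    using assms(3) by (auto simp: bilinear_map_def assms(4)[symmetric])
qed

lemma bilinear_map_zero:
  assumes "module R M" "module R N" "module R K" "bilinear_map R M N K b"
  shows "n \<in> carrier N \<Longrightarrow> b \<zero>\<^bsub>M\<^esub> n = \<zero>\<^bsub>K\<^esub>" "m \<in> carrier M \<Longrightarrow> b m \<zero>\<^bsub>N\<^esub> = \<zero>\<^bsub>K\<^esub>"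
proof -
  interpret M: module R M by fact
  interpret N: module R N by fact
  interpret K: module R K by fact
  note b = bilinear_mapD[OF assms(4)]
  show "n \<in> carrier N \<Longrightarrow> b \<zero>\<^bsub>M\<^esub> n = \<zero>\<^bsub>K\<^esub>"
    using b(4)[of "\<zero>\<^bsub>M\<^esub>" n "\<zero>\<^bsub>R\<^esub>"] b(1)[of "\<zero>\<^bsub>M\<^esub>" n] by simp
  show "m \<in> carrier M \<Longrightarrow> b m \<zero>\<^bsub>N\<^esub> = \<zero>\<^bsub>K\<^esub>"
    using b(5)[of m "\<zero>\<^bsub>N\<^esub>" "\<zero>\<^bsub>R\<^esub>"] b(1)[of m "\<zero>\<^bsub>N\<^esub>"] by simp
qed

text \<open>
  Tensoring with a fixed element is homogeneous.  Composing with these morphisms reduces equalities of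
  morphisms out of iterated tensor products to equalities on pure tensors.
\<close>

definition tensor_right ::
  "('r, 'm) ring_scheme \<Rightarrow> ('p::preordered_ab_group_add, 'r, 'a) pers \<Rightarrow> ('p, 'r, 'b) pers
    \<Rightarrow> 'p \<Rightarrow> 'b \<Rightarrow> 'p \<Rightarrow> 'a \<Rightarrow> ('p \<times> 'p \<Rightarrow> ('a \<times> 'b \<Rightarrow> 'r) set) set"
  where "tensor_right R M N t n = (\<lambda>s. \<lambda>m\<in>carrier (pobj M s). gr_elt R M N (s + t) s t m n)"

definition tensor_left ::
  "('r, 'm) ring_scheme \<Rightarrow> ('p::preordered_ab_group_add, 'r, 'a) pers \<Rightarrow> ('p, 'r, 'b) pers
    \<Rightarrow> 'p \<Rightarrow> 'a \<Rightarrow> 'p \<Rightarrow> 'b \<Rightarrow> ('p \<times> 'p \<Rightarrow> ('a \<times> 'b \<Rightarrow> 'r) set) set"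
  where "tensor_left R M N s m = (\<lambda>t. \<lambda>n\<in>carrier (pobj N t). gr_elt R M N (s + t) s t m n)"

text \<open>Naturality is the colimit relation in which the first index moves while \<open>n\<close>
  keeps its place.\<close>

lemma tensor_right_PHom:
  assumes M: "persistence_module R M" and N: "persistence_module R N" and n: "n \<in> carrier (pobj N t)"
  shows "tensor_right R M N t n \<in> PHom R M (shift (M \<boxtimes>\<^bsub>R\<^esub> N) t)"
proof (rule PHomI)
  fix x
  interpret module R "pobj M x" by (rule pers_module[OF M])
  note b = bilinear_mapD[OF gr_elt_bilinear[OF M N order_refl] _ n]
  show "tensor_right R M N t n x \<in> lin_hom R (pobj M x) (pobj (shift (M \<boxtimes>\<^bsub>R\<^esub> N) t) x)"
    by (rule lin_homI) (auto simp: tensor_right_def b)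
  fix y m assume *: "x \<le> y" "m \<in> carrier (pobj M x)"
  have "gr_elt R M N (y + t) y t (pmap M x y m) n = gr_elt R M N (y + t) x t m n"
    using gr_elt_trans[OF M N *(1) order_refl order_refl *(2) n] by (simp add: pmap_refl[OF N n])
  then show "pmap (shift (M \<boxtimes>\<^bsub>R\<^esub> N) t) x y (tensor_right R M N t n x m) =
      tensor_right R M N t n y (pmap M x y m)"
    using * M N n by (simp add: tensor_right_def pmap_closed[OF M] add_mono_right)
qed

lemma tensor_left_PHom:
  assumes M: "persistence_module R M" and N: "persistence_module R N" and m: "m \<in> carrier (pobj M s)"
  shows "tensor_left R M N s m \<in> PHom R N (shift (M \<boxtimes>\<^bsub>R\<^esub> N) s)"
proof (rule PHomI)
  fix x
  interpret module R "pobj N x" by (rule pers_module[OF N])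
  note b = bilinear_mapD[OF gr_elt_bilinear[OF M N order_refl] m]
  show "tensor_left R M N s m x \<in> lin_hom R (pobj N x) (pobj (shift (M \<boxtimes>\<^bsub>R\<^esub> N) s) x)"
    by (rule lin_homI) (auto simp: tensor_left_def b add.commute[of x])
  fix y n assume *: "x \<le> y" "n \<in> carrier (pobj N x)"
  have "gr_elt R M N (s + y) s y m (pmap N x y n) = gr_elt R M N (s + y) s x m n"
    using gr_elt_trans[OF M N order_refl *(1) order_refl m *(2)] by (simp add: pmap_refl[OF M m])
  then show "pmap (shift (M \<boxtimes>\<^bsub>R\<^esub> N) s) x y (tensor_left R M N s m x n) =
      tensor_left R M N s m y (pmap N x y n)"
    using * M N m by (simp add: tensor_left_def pmap_closed[OF N] add_mono_left add.commute[of _ s])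
qed

text \<open>Fixing the right factor leaves a morphism out of \<open>M\<close> alone. If
  \<open>M\<close> is itself a tensor product, its own principle of equality takes over, which
  treats products nested on the left.\<close>

lemma gr_tensor_PHom_eqI_right:
  assumes M: "persistence_module R M" and N: "persistence_module R N" and K: "persistence_module R K"
    and \<Phi>: "\<Phi> \<in> PHom R (M \<boxtimes>\<^bsub>R\<^esub> N) K" and \<Psi>: "\<Psi> \<in> PHom R (M \<boxtimes>\<^bsub>R\<^esub> N) K"
    and eq: "\<And>t n \<Phi>' \<Psi>'. n \<in> carrier (pobj N t) \<Longrightarrow>
      \<Phi>' = hom_comp M t \<Phi> (tensor_right R M N t n) \<Longrightarrow>
      \<Psi>' = hom_comp M t \<Psi> (tensor_right R M N t n) \<Longrightarrow>
      \<Phi>' \<in> PHom R M (shift K t) \<Longrightarrow> \<Psi>' \<in> PHom R M (shift K t) \<Longrightarrow> \<Phi>' = \<Psi>'"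
  shows "\<Phi> = \<Psi>"
proof (rule gr_tensor_PHom_eqI[OF M N K \<Phi> \<Psi>])
  fix s t m n assume m: "m \<in> carrier (pobj M s)" and n: "n \<in> carrier (pobj N t)"
  have "hom_comp M t \<Phi> (tensor_right R M N t n) \<in> PHom R M (shift K t)"
    "hom_comp M t \<Psi> (tensor_right R M N t n) \<in> PHom R M (shift K t)"
    using \<Phi> \<Psi> by (auto intro!: hom_comp_PHom[OF M tensor_right_PHom[OF M N n], where t = 0])
  from eq[OF n refl refl this]
  show "\<Phi> (s + t) (gr_elt R M N (s + t) s t m n) = \<Psi> (s + t) (gr_elt R M N (s + t) s t m n)"
    using m by (auto simp: tensor_right_def dest!: fun_cong[of _ _ s] fun_cong[of _ _ m])
qed

text \<open>Mirror image, for products nested on the right.\<close>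

lemma gr_tensor_PHom_eqI_left:
  assumes M: "persistence_module R M" and N: "persistence_module R N" and K: "persistence_module R K"
    and \<Phi>: "\<Phi> \<in> PHom R (M \<boxtimes>\<^bsub>R\<^esub> N) K" and \<Psi>: "\<Psi> \<in> PHom R (M \<boxtimes>\<^bsub>R\<^esub> N) K"
    and eq: "\<And>s m \<Phi>' \<Psi>'. m \<in> carrier (pobj M s) \<Longrightarrow>
      \<Phi>' = hom_comp N s \<Phi> (tensor_left R M N s m) \<Longrightarrow>
      \<Psi>' = hom_comp N s \<Psi> (tensor_left R M N s m) \<Longrightarrow>
      \<Phi>' \<in> PHom R N (shift K s) \<Longrightarrow> \<Psi>' \<in> PHom R N (shift K s) \<Longrightarrow> \<Phi>' = \<Psi>'"
  shows "\<Phi> = \<Psi>"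
proof (rule gr_tensor_PHom_eqI[OF M N K \<Phi> \<Psi>])
  fix s t m n assume m: "m \<in> carrier (pobj M s)" and n: "n \<in> carrier (pobj N t)"
  have "hom_comp N s \<Phi> (tensor_left R M N s m) \<in> PHom R N (shift K s)"
    "hom_comp N s \<Psi> (tensor_left R M N s m) \<in> PHom R N (shift K s)"
    using \<Phi> \<Psi> by (auto intro!: hom_comp_PHom[OF N tensor_left_PHom[OF M N m], where t = 0])
  from eq[OF m refl refl this]
  show "\<Phi> (s + t) (gr_elt R M N (s + t) s t m n) = \<Psi> (s + t) (gr_elt R M N (s + t) s t m n)"
    using n by (auto simp: tensor_left_def add.commute[of t] dest!: fun_cong[of _ _ t] fun_cong[of _ _ n])
qed

text \<open>Fixing an element of \<open>K\<close> in degree \<open>v\<close> leaves morphisms from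
  the tensor product of \<open>M\<close> and \<open>N\<close> to \<open>shift L v\<close>.\<close>

lemma gr_tensor3_PHom_eqI:
  assumes M: "persistence_module R M" and N: "persistence_module R N" and K: "persistence_module R K"
    and L: "persistence_module R L"
    and \<Phi>: "\<Phi> \<in> PHom R ((M \<boxtimes>\<^bsub>R\<^esub> N) \<boxtimes>\<^bsub>R\<^esub> K) L" and \<Psi>: "\<Psi> \<in> PHom R ((M \<boxtimes>\<^bsub>R\<^esub> N) \<boxtimes>\<^bsub>R\<^esub> K) L"
    and eq: "\<And>s t v m n k. m \<in> carrier (pobj M s) \<Longrightarrow> n \<in> carrier (pobj N t) \<Longrightarrow> k \<in> carrier (pobj K v) \<Longrightarrow>
      \<Phi> (s + t + v) (gr_elt R (M \<boxtimes>\<^bsub>R\<^esub> N) K (s + t + v) (s + t) v (gr_elt R M N (s + t) s t m n) k) =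
      \<Psi> (s + t + v) (gr_elt R (M \<boxtimes>\<^bsub>R\<^esub> N) K (s + t + v) (s + t) v (gr_elt R M N (s + t) s t m n) k)"
  shows "\<Phi> = \<Psi>"
proof (rule gr_tensor_PHom_eqI_right[OF gr_tensor_pers[OF M N] K L \<Phi> \<Psi>])
  fix v k \<Phi>' \<Psi>'
  assume k: "k \<in> carrier (pobj K v)"
    and "\<Phi>' = hom_comp (M \<boxtimes>\<^bsub>R\<^esub> N) v \<Phi> (tensor_right R (M \<boxtimes>\<^bsub>R\<^esub> N) K v k)"
    and "\<Psi>' = hom_comp (M \<boxtimes>\<^bsub>R\<^esub> N) v \<Psi> (tensor_right R (M \<boxtimes>\<^bsub>R\<^esub> N) K v k)"
    and "\<Phi>' \<in> PHom R (M \<boxtimes>\<^bsub>R\<^esub> N) (shift L v)" "\<Psi>' \<in> PHom R (M \<boxtimes>\<^bsub>R\<^esub> N) (shift L v)"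
  then show "\<Phi>' = \<Psi>'"
    by (intro gr_tensor_PHom_eqI[OF M N shift_pers[OF L]]) (simp_all add: tensor_right_def M N eq)
qed

text \<open>The bracketing that occurs as the source of the inverse associator.\<close>

lemma gr_tensor3_PHom_eqI':
  assumes M: "persistence_module R M" and N: "persistence_module R N" and K: "persistence_module R K"
    and L: "persistence_module R L"
    and \<Phi>: "\<Phi> \<in> PHom R (M \<boxtimes>\<^bsub>R\<^esub> (N \<boxtimes>\<^bsub>R\<^esub> K)) L" and \<Psi>: "\<Psi> \<in> PHom R (M \<boxtimes>\<^bsub>R\<^esub> (N \<boxtimes>\<^bsub>R\<^esub> K)) L"
    and eq: "\<And>s t v m n k. m \<in> carrier (pobj M s) \<Longrightarrow> n \<in> carrier (pobj N t) \<Longrightarrow> k \<in> carrier (pobj K v) \<Longrightarrow>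
      \<Phi> (s + (t + v)) (gr_elt R M (N \<boxtimes>\<^bsub>R\<^esub> K) (s + (t + v)) s (t + v) m (gr_elt R N K (t + v) t v n k)) =
      \<Psi> (s + (t + v)) (gr_elt R M (N \<boxtimes>\<^bsub>R\<^esub> K) (s + (t + v)) s (t + v) m (gr_elt R N K (t + v) t v n k))"
  shows "\<Phi> = \<Psi>"
proof (rule gr_tensor_PHom_eqI_left[OF M gr_tensor_pers[OF N K] L \<Phi> \<Psi>])
  fix s m \<Phi>' \<Psi>'
  assume m: "m \<in> carrier (pobj M s)"
    and "\<Phi>' = hom_comp (N \<boxtimes>\<^bsub>R\<^esub> K) s \<Phi> (tensor_left R M (N \<boxtimes>\<^bsub>R\<^esub> K) s m)"
    and "\<Psi>' = hom_comp (N \<boxtimes>\<^bsub>R\<^esub> K) s \<Psi> (tensor_left R M (N \<boxtimes>\<^bsub>R\<^esub> K) s m)"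
    and "\<Phi>' \<in> PHom R (N \<boxtimes>\<^bsub>R\<^esub> K) (shift L s)" "\<Psi>' \<in> PHom R (N \<boxtimes>\<^bsub>R\<^esub> K) (shift L s)"
  then show "\<Phi>' = \<Psi>'"
    by (intro gr_tensor_PHom_eqI[OF N K shift_pers[OF L]])
      (simp_all add: tensor_left_def N K eq add.commute[of _ s])
qed

lemma gr_tensor4_PHom_eqI:
  assumes M: "persistence_module R M" and N: "persistence_module R N" and K: "persistence_module R K"
    and L: "persistence_module R L" and X: "persistence_module R X"
    and \<Phi>: "\<Phi> \<in> PHom R (((M \<boxtimes>\<^bsub>R\<^esub> N) \<boxtimes>\<^bsub>R\<^esub> K) \<boxtimes>\<^bsub>R\<^esub> L) X"
    and \<Psi>: "\<Psi> \<in> PHom R (((M \<boxtimes>\<^bsub>R\<^esub> N) \<boxtimes>\<^bsub>R\<^esub> K) \<boxtimes>\<^bsub>R\<^esub> L) X"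
    and eq: "\<And>s t v w m n k l x. m \<in> carrier (pobj M s) \<Longrightarrow> n \<in> carrier (pobj N t) \<Longrightarrow>
      k \<in> carrier (pobj K v) \<Longrightarrow> l \<in> carrier (pobj L w) \<Longrightarrow>
      x = gr_elt R ((M \<boxtimes>\<^bsub>R\<^esub> N) \<boxtimes>\<^bsub>R\<^esub> K) L (s + t + v + w) (s + t + v) w
        (gr_elt R (M \<boxtimes>\<^bsub>R\<^esub> N) K (s + t + v) (s + t) v (gr_elt R M N (s + t) s t m n) k) l \<Longrightarrow>
      \<Phi> (s + t + v + w) x = \<Psi> (s + t + v + w) x"
  shows "\<Phi> = \<Psi>"
proof (rule gr_tensor_PHom_eqI_right[OF gr_tensor_pers[OF gr_tensor_pers[OF M N] K] L X \<Phi> \<Psi>])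
  let ?T = "(M \<boxtimes>\<^bsub>R\<^esub> N) \<boxtimes>\<^bsub>R\<^esub> K"
  fix w l \<Phi>' \<Psi>'
  assume k: "l \<in> carrier (pobj L w)"
    and "\<Phi>' = hom_comp ?T w \<Phi> (tensor_right R ?T L w l)"
    and "\<Psi>' = hom_comp ?T w \<Psi> (tensor_right R ?T L w l)"
    and "\<Phi>' \<in> PHom R ?T (shift X w)" "\<Psi>' \<in> PHom R ?T (shift X w)"
  then show "\<Phi>' = \<Psi>'"
    by (intro gr_tensor3_PHom_eqI[OF M N K shift_pers[OF X]]) (simp_all add: tensor_right_def M N K eq)
qed

subsection \<open>Tensor product of homogeneous morphisms\<close>

lemma balanced_precompose:
  fixes M :: "('p::preordered_ab_group_add, 'r, 'a) pers" and a b :: 'p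
  assumes B: "balanced R M' N' (r + (a + b)) K B"
    and \<phi>: "\<phi> \<in> PHom R M (shift M' a)" and \<psi>: "\<psi> \<in> PHom R N (shift N' b)"
  shows "balanced R M N r K (\<lambda>s t m n. B (s + a) (t + b) (\<phi> s m) (\<psi> t n))"
proof -
  \<comment> \<open>Shifting the two factors separately keeps the pair of indices below the shifted
    degree; the rearrangement rests on commutativity of the index group.\<close>
  have le: "s + a + (t + b) \<le> r + (a + b)" if "s + t \<le> r" for s t
    using add_mono_right[OF that, of "a + b"] by (simp add: ac_simps)
  show ?thesis
  proof (rule balancedI)
    fix s t :: 'p assume "s + t \<le> r"
    from bilinear_map_precompose[OF balanced_bilinear[OF B le[OF this]] PHom_shift_lin_hom[OF \<phi>]
        PHom_shift_lin_hom[OF \<psi>]]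
    show "bilinear_map R (pobj M s) (pobj N t) K (\<lambda>m n. B (s + a) (t + b) (\<phi> s m) (\<psi> t n))" .
  next
    fix s s' t t' m n
    assume "s \<le> s'" "t \<le> t'" "s' + t' \<le> r" "m \<in> carrier (pobj M s)" "n \<in> carrier (pobj N t)"
    then show "B (s' + a) (t' + b) (\<phi> s' (pmap M s s' m)) (\<psi> t' (pmap N t t' n)) =
        B (s + a) (t + b) (\<phi> s m) (\<psi> t n)"
      by (simp add: PHom_shift_pmap[OF \<phi>] PHom_shift_pmap[OF \<psi>] balanced_trans[OF B] add_mono_right le
          PHom_shift_closed[OF \<phi>] PHom_shift_closed[OF \<psi>])
  qed
qed

lemma
  fixes M :: "('p::preordered_ab_group_add, 'r, 'a) pers" and a b :: 'p
  assumes [simp]: "persistence_module R M" "persistence_module R N" "persistence_module R M'" "persistence_module R N'"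
    and \<phi>: "\<phi> \<in> PHom R M (shift M' a)" and \<psi>: "\<psi> \<in> PHom R N (shift N' b)"
  shows hom_tensor_map_PHom: "u = a + b \<Longrightarrow> hom_tensor_map R M N M' N' a b \<phi> \<psi> \<in> PHom R (M \<boxtimes>\<^bsub>R\<^esub> N) (shift (M' \<boxtimes>\<^bsub>R\<^esub> N') u)"
    and hom_tensor_map_elt: "s + t \<le> r \<Longrightarrow> m \<in> carrier (pobj M s) \<Longrightarrow> n \<in> carrier (pobj N t) \<Longrightarrow>
      hom_tensor_map R M N M' N' a b \<phi> \<psi> r (gr_elt R M N r s t m n) =
      gr_elt R M' N' (r + (a + b)) (s + a) (t + b) (\<phi> s m) (\<psi> t n)"
proof -
  have le: "s + a + (t + b) \<le> r + (a + b)" if "s + t \<le> r" for s t r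
    using add_mono_right[OF that, of "a + b"] by (simp add: ac_simps)
  let ?b = "\<lambda>r s t m n. gr_elt R M' N' (r + (a + b)) (s + a) (t + b) (\<phi> s m) (\<psi> t n)"
  have b: "balanced R M N r (pobj (M' \<boxtimes>\<^bsub>R\<^esub> N') (r + (a + b))) (?b r)" for r
    by (rule balanced_precompose[OF gr_elt_balanced \<phi> \<psi>]) simp_all
  have "(\<lambda>r. gr_desc R M N r (pobj (shift (M' \<boxtimes>\<^bsub>R\<^esub> N') (a + b)) r) (?b r)) \<in>
      PHom R (M \<boxtimes>\<^bsub>R\<^esub> N) (shift (M' \<boxtimes>\<^bsub>R\<^esub> N') (a + b))"
    using b by (intro gr_desc_PHom)
      (simp_all add: add_mono_right le PHom_shift_closed[OF \<phi>] PHom_shift_closed[OF \<psi>])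
  then show "hom_tensor_map R M N M' N' a b \<phi> \<psi> \<in> PHom R (M \<boxtimes>\<^bsub>R\<^esub> N) (shift (M' \<boxtimes>\<^bsub>R\<^esub> N') u)" if "u = a + b"
    using that by (simp add: hom_tensor_map_def)
  show "hom_tensor_map R M N M' N' a b \<phi> \<psi> r (gr_elt R M N r s t m n) = ?b r s t m n"
    if "s + t \<le> r" "m \<in> carrier (pobj M s)" "n \<in> carrier (pobj N t)" for s t r m n
    unfolding hom_tensor_map_def by (rule gr_desc_elt[OF _ _ _ b that]) (simp_all add: pers_module)
qed

lemma hom_tensor_map_id:
  assumes [simp]: "persistence_module R M" "persistence_module R N"
  shows "hom_tensor_map R M N M N 0 0 (pm_id M) (pm_id N) = pm_id (M \<boxtimes>\<^bsub>R\<^esub> N)"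
  by (rule gr_tensor_PHom_eqI[OF assms gr_tensor_pers[OF assms]])
    (use hom_tensor_map_PHom[of R M N M N "pm_id M" 0 "pm_id N" 0 0] in \<open>simp_all add: hom_tensor_map_elt\<close>)

text \<open>On a pure tensor both sides are \<open>f' (f m)\<close> tensored with
  \<open>g' (g n)\<close>. What has to be reconciled is the total degree,
  \<open>(a + c) + (b + d)\<close> against \<open>(a + b) + (c + d)\<close>.\<close>

lemma hom_tensor_map_comp:
  assumes [simp]: "persistence_module R M" "persistence_module R M'" "persistence_module R M''"
      "persistence_module R N" "persistence_module R N'" "persistence_module R N''"
    and f: "f \<in> PHom R M (shift M' a)" and f': "f' \<in> PHom R M' (shift M'' c)"
    and g: "g \<in> PHom R N (shift N' b)" and g': "g' \<in> PHom R N' (shift N'' d)"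
  shows "hom_tensor_map R M N M'' N'' (a + c) (b + d) (hom_comp M a f' f) (hom_comp N b g' g) =
    hom_comp (M \<boxtimes>\<^bsub>R\<^esub> N) (a + b) (hom_tensor_map R M' N' M'' N'' c d f' g')
      (hom_tensor_map R M N M' N' a b f g)"
proof -
  have cl: "hom_comp M a f' f \<in> PHom R M (shift M'' (a + c))" "hom_comp N b g' g \<in> PHom R N (shift N'' (b + d))"
    by (rule hom_comp_PHom; (fact | simp))+
  show ?thesis
  proof (rule gr_tensor_PHom_eqI)
    show "hom_tensor_map R M N M'' N'' (a + c) (b + d) (hom_comp M a f' f) (hom_comp N b g' g)
        \<in> PHom R (M \<boxtimes>\<^bsub>R\<^esub> N) (shift (M'' \<boxtimes>\<^bsub>R\<^esub> N'') (a + b + (c + d)))"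
      by (rule hom_tensor_map_PHom[OF _ _ _ _ cl]) (simp_all add: ac_simps)
    show "hom_comp (M \<boxtimes>\<^bsub>R\<^esub> N) (a + b) (hom_tensor_map R M' N' M'' N'' c d f' g')
        (hom_tensor_map R M N M' N' a b f g) \<in> PHom R (M \<boxtimes>\<^bsub>R\<^esub> N) (shift (M'' \<boxtimes>\<^bsub>R\<^esub> N'') (a + b + (c + d)))"
      by (rule hom_comp_PHom[OF _ hom_tensor_map_PHom[OF _ _ _ _ f g] hom_tensor_map_PHom[OF _ _ _ _ f' g']])
        simp_all
    fix s t m n assume [simp]: "m \<in> carrier (pobj M s)" "n \<in> carrier (pobj N t)"
    note [simp] = PHom_shift_closed[OF f] PHom_shift_closed[OF g]
    show "hom_tensor_map R M N M'' N'' (a + c) (b + d) (hom_comp M a f' f) (hom_comp N b g' g) (s + t)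
          (gr_elt R M N (s + t) s t m n) =
        hom_comp (M \<boxtimes>\<^bsub>R\<^esub> N) (a + b) (hom_tensor_map R M' N' M'' N'' c d f' g')
          (hom_tensor_map R M N M' N' a b f g) (s + t) (gr_elt R M N (s + t) s t m n)"
      by (simp add: hom_tensor_map_elt[OF _ _ _ _ f g] hom_tensor_map_elt[OF _ _ _ _ f' g']
          hom_tensor_map_elt[OF _ _ _ _ cl] ac_simps)
  qed simp_all
qed

text \<open>Bilinearity of pure tensors, applied to the values of the two morphisms. Biadditivity is
  what lets the operation extend to graded morphisms.\<close>

lemma hom_tensor_map_add:
  assumes [simp]: "persistence_module R M" "persistence_module R M'"
      "persistence_module R N" "persistence_module R N'"
    and f: "f \<in> PHom R M (shift M' a)" and f': "f' \<in> PHom R M (shift M' a)"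
    and g: "g \<in> PHom R N (shift N' b)" and g': "g' \<in> PHom R N (shift N' b)"
  shows "hom_tensor_map R M N M' N' a b (f \<oplus>\<^bsub>nat_hom R M (shift M' a)\<^esub> f') g =
      hom_tensor_map R M N M' N' a b f g \<oplus>\<^bsub>nat_hom R (M \<boxtimes>\<^bsub>R\<^esub> N) (shift (M' \<boxtimes>\<^bsub>R\<^esub> N') (a + b))\<^esub>
      hom_tensor_map R M N M' N' a b f' g"
    and "hom_tensor_map R M N M' N' a b f (g \<oplus>\<^bsub>nat_hom R N (shift N' b)\<^esub> g') =
      hom_tensor_map R M N M' N' a b f g \<oplus>\<^bsub>nat_hom R (M \<boxtimes>\<^bsub>R\<^esub> N) (shift (M' \<boxtimes>\<^bsub>R\<^esub> N') (a + b))\<^esub>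
      hom_tensor_map R M N M' N' a b f g'"
proof -
  have cl: "f \<oplus>\<^bsub>nat_hom R M (shift M' a)\<^esub> f' \<in> PHom R M (shift M' a)"
    "g \<oplus>\<^bsub>nat_hom R N (shift N' b)\<^esub> g' \<in> PHom R N (shift N' b)"
    using f f' g g' by simp_all
  have le: "s + a + (t + b) \<le> s + t + (a + b)" for s t by (simp add: ac_simps)
  note bil = bilinear_mapD[OF gr_elt_bilinear[OF _ _ le]]
  note P = hom_tensor_map_PHom[OF _ _ _ _ _ _ refl]
  show "hom_tensor_map R M N M' N' a b (f \<oplus>\<^bsub>nat_hom R M (shift M' a)\<^esub> f') g =
      hom_tensor_map R M N M' N' a b f g \<oplus>\<^bsub>nat_hom R (M \<boxtimes>\<^bsub>R\<^esub> N) (shift (M' \<boxtimes>\<^bsub>R\<^esub> N') (a + b))\<^esub>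
      hom_tensor_map R M N M' N' a b f' g"
    by (rule gr_tensor_PHom_eqI[of R M N "shift (M' \<boxtimes>\<^bsub>R\<^esub> N') (a + b)"])
      (simp_all add: P f f' g cl hom_tensor_map_elt[OF _ _ _ _ f g] hom_tensor_map_elt[OF _ _ _ _ f' g]
        hom_tensor_map_elt[OF _ _ _ _ cl(1) g] bil(2) PHom_shift_closed[OF f] PHom_shift_closed[OF f'] PHom_shift_closed[OF g])
  show "hom_tensor_map R M N M' N' a b f (g \<oplus>\<^bsub>nat_hom R N (shift N' b)\<^esub> g') =
      hom_tensor_map R M N M' N' a b f g \<oplus>\<^bsub>nat_hom R (M \<boxtimes>\<^bsub>R\<^esub> N) (shift (M' \<boxtimes>\<^bsub>R\<^esub> N') (a + b))\<^esub>
      hom_tensor_map R M N M' N' a b f g'"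
    by (rule gr_tensor_PHom_eqI[of R M N "shift (M' \<boxtimes>\<^bsub>R\<^esub> N') (a + b)"])
      (simp_all add: P f g g' cl hom_tensor_map_elt[OF _ _ _ _ f g] hom_tensor_map_elt[OF _ _ _ _ f g']
        hom_tensor_map_elt[OF _ _ _ _ f cl(2)] bil(3) PHom_shift_closed[OF f] PHom_shift_closed[OF g] PHom_shift_closed[OF g'])
qed


section \<open>Associator, braiding and unitors\<close>

text \<open>All three indices of a nested pure tensor are raised at once: the inner raise becomes a
  structure map of the inner product, and the outer colimit relation absorbs it.\<close>

lemma gr_elt_nested_trans:
  assumes [simp]: "persistence_module R M" "persistence_module R N" "persistence_module R K"
    and "s \<le> s'" "t \<le> t'" "v \<le> v'" "s' + (t' + v') \<le> r"
    and "m \<in> carrier (pobj M s)" "n \<in> carrier (pobj N t)" "k \<in> carrier (pobj K v)"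
  shows "gr_elt R M (N \<boxtimes>\<^bsub>R\<^esub> K) r s' (t' + v') (pmap M s s' m)
      (gr_elt R N K (t' + v') t' v' (pmap N t t' n) (pmap K v v' k)) =
    gr_elt R M (N \<boxtimes>\<^bsub>R\<^esub> K) r s (t + v) m (gr_elt R N K (t + v) t v n k)"
proof -
  have tv: "t + v \<le> t' + v'" by (rule preordered_add_mono) fact+
  have "gr_elt R N K (t' + v') t' v' (pmap N t t' n) (pmap K v v' k) =
      pmap (N \<boxtimes>\<^bsub>R\<^esub> K) (t + v) (t' + v') (gr_elt R N K (t + v) t v n k)"
    using assms tv by (simp add: gr_elt_trans)
  \<comment> \<open>\<open>pmap_gr_elt\<close> would evaluate the structure map and destroy the form
    that \<open>gr_elt_trans\<close> matches.\<close>
  then show ?thesis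
    using assms tv by (simp add: gr_elt_trans del: pmap_gr_elt)
qed

section \<open>Associator\<close>

context
  fixes R :: "('r, 'm) ring_scheme"
    and M :: "('p::preordered_ab_group_add, 'r, 'a) pers" and N :: "('p, 'r, 'b) pers"
    and K :: "('p, 'r, 'c) pers"
  assumes M [simp]: "persistence_module R M" and N [simp]: "persistence_module R N"
    and K [simp]: "persistence_module R K"
begin

private abbreviation "T \<equiv> M \<boxtimes>\<^bsub>R\<^esub> (N \<boxtimes>\<^bsub>R\<^esub> K)"

text \<open>For fixed \<open>k\<close> in degree \<open>v\<close>, the family
  \<open>(m, n) \<mapsto> m \<otimes> (n \<otimes> k)\<close>. The inner factor sits in its least
  degree \<open>t + v\<close>, the outer one in the target degree \<open>r\<close>.\<close>

private abbreviation "b r v k \<equiv>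
  (\<lambda>s t m n. gr_elt R M (N \<boxtimes>\<^bsub>R\<^esub> K) r s (t + v) m (gr_elt R N K (t + v) t v n k))"

private abbreviation "d r u v k \<equiv> gr_desc R M N u (pobj T r) (b r v k)"

private lemma le_assoc: "s + t \<le> u \<Longrightarrow> u + v \<le> r \<Longrightarrow> s + (t + v) \<le> r" for s t u v r :: 'p
  using add_mono_right[of "s + t" u v] order_trans by (metis add.assoc)

text \<open>Bilinearity holds because the family is the pure tensor precomposed with
  \<open>n \<mapsto> n \<otimes> k\<close>, which is linear. Compatibility is
  \<open>gr_elt_nested_trans\<close> with \<open>k\<close> at rest.\<close>

private lemma balanced_inner:
  assumes uv: "u + v \<le> r" and k: "k \<in> carrier (pobj K v)"
  shows "balanced R M N u (pobj T r) (b r v k)"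
proof (rule balancedI)
  fix s t :: 'p assume "s + t \<le> u"
  note le = le_assoc[OF this uv]
  show "bilinear_map R (pobj M s) (pobj N t) (pobj T r) (b r v k s t)"
    by (rule bilinear_map_cong[OF pers_module[OF M] pers_module[OF N]
          bilinear_map_precompose[OF gr_elt_bilinear[OF M gr_tensor_pers[OF N K] le]
            lin_hom_id[OF pers_module[OF M]] PHom_shift_lin_hom[OF tensor_right_PHom[OF N K k]]]])
      (simp add: tensor_right_def)
next
  fix s s' t t' :: 'p and m n
  assume st: "s \<le> s'" "t \<le> t'" "s' + t' \<le> u" and mn: "m \<in> carrier (pobj M s)" "n \<in> carrier (pobj N t)"
  show "b r v k s' t' (pmap M s s' m) (pmap N t t' n) = b r v k s t m n"
    using gr_elt_nested_trans[OF M N K st(1,2) order_refl le_assoc[OF st(3) uv] mn k]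
    by (simp add: pmap_refl[OF K k])
qed

private lemma d_lin_hom:
  "u + v \<le> r \<Longrightarrow> k \<in> carrier (pobj K v) \<Longrightarrow> d r u v k \<in> lin_hom R (pobj (M \<boxtimes>\<^bsub>R\<^esub> N) u) (pobj T r)"
  by (rule gr_desc_lin_hom[OF M N _ balanced_inner]) (simp_all add: pers_module)

private lemma d_elt:
  "u + v \<le> r \<Longrightarrow> k \<in> carrier (pobj K v) \<Longrightarrow> s + t \<le> u \<Longrightarrow> m \<in> carrier (pobj M s) \<Longrightarrow> n \<in> carrier (pobj N t) \<Longrightarrow>
    d r u v k (gr_elt R M N u s t m n) = b r v k s t m n"
  by (rule gr_desc_elt[OF M N _ balanced_inner]) (simp_all add: pers_module)

private lemma d_ext:
  assumes "f \<in> lin_hom R (pobj (M \<boxtimes>\<^bsub>R\<^esub> N) u) (pobj T r)" "g \<in> lin_hom R (pobj (M \<boxtimes>\<^bsub>R\<^esub> N) u) (pobj T r)"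
    and "\<And>s t m n. s + t \<le> u \<Longrightarrow> m \<in> carrier (pobj M s) \<Longrightarrow> n \<in> carrier (pobj N t) \<Longrightarrow>
      f (gr_elt R M N u s t m n) = g (gr_elt R M N u s t m n)"
    and "x \<in> carrier (pobj (M \<boxtimes>\<^bsub>R\<^esub> N) u)"
  shows "f x = g x"
  using gr_tensor_hom_ext[OF M N _ assms(1-3)] by (simp add: pers_module)

text \<open>In \<open>x\<close> the description is linear by construction. Its dependence on
  \<open>k\<close> is hidden inside the description, so additivity and homogeneity in
  \<open>k\<close> are read as equalities of linear maps in \<open>x\<close> and tested on pure
  tensors.\<close>

private lemma balanced_outer:
  "balanced R (M \<boxtimes>\<^bsub>R\<^esub> N) K r (pobj T r) (\<lambda>u v x k. d r u v k x)"
proof (rule balancedI)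
  fix u v :: 'p assume uv: "u + v \<le> r"
  interpret T: module R "pobj T r" by (simp add: pers_module)
  interpret K: module R "pobj K v" by (simp add: pers_module)
  note Tuv = pers_module[OF gr_tensor_pers[OF M N], of u]
  note le = le_assoc[OF _ uv]
  note b1 = bilinear_mapD[OF gr_elt_bilinear[OF M gr_tensor_pers[OF N K] le]]
  note b2 = bilinear_mapD[OF gr_elt_bilinear[OF N K order_refl]]
  note d = d_lin_hom[OF uv]
  show "bilinear_map R (pobj (M \<boxtimes>\<^bsub>R\<^esub> N) u) (pobj K v) (pobj T r) (\<lambda>x k. d r u v k x)"
  proof (rule bilinear_mapI)
    fix x k k' assume x: "x \<in> carrier (pobj (M \<boxtimes>\<^bsub>R\<^esub> N) u)"
      and k: "k \<in> carrier (pobj K v)" "k' \<in> carrier (pobj K v)"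
    \<comment> \<open>The sum is packaged as one restricted function of \<open>x\<close>, so that it
      is a linear map to which \<open>d_ext\<close> applies.\<close>
    have "d r u v (k \<oplus>\<^bsub>pobj K v\<^esub> k') x =
        (\<lambda>x\<in>carrier (pobj (M \<boxtimes>\<^bsub>R\<^esub> N) u). d r u v k x \<oplus>\<^bsub>pobj T r\<^esub> d r u v k' x) x"
      by (rule d_ext[OF d lin_hom_pointwise_add[OF Tuv T.module_axioms d d] _ x])
        (simp_all add: k d_elt uv b1 b2)
    then show "d r u v (k \<oplus>\<^bsub>pobj K v\<^esub> k') x = d r u v k x \<oplus>\<^bsub>pobj T r\<^esub> d r u v k' x"
      using x by simp
  next
    fix a x k assume x: "x \<in> carrier (pobj (M \<boxtimes>\<^bsub>R\<^esub> N) u)" and k: "a \<in> carrier R" "k \<in> carrier (pobj K v)"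
    have "d r u v (a \<odot>\<^bsub>pobj K v\<^esub> k) x =
        (\<lambda>x\<in>carrier (pobj (M \<boxtimes>\<^bsub>R\<^esub> N) u). a \<odot>\<^bsub>pobj T r\<^esub> d r u v k x) x"
      by (rule d_ext[OF d lin_hom_pointwise_smult[OF Tuv T.module_axioms d] _ x])
        (simp_all add: k d_elt uv b1 b2)
    then show "d r u v (a \<odot>\<^bsub>pobj K v\<^esub> k) x = a \<odot>\<^bsub>pobj T r\<^esub> d r u v k x"
      using x by simp
  qed (simp_all add: lin_hom_closed[OF d] lin_hom_add[OF d] lin_hom_smult[OF d])
next
  fix u u' v v' :: 'p and x k
  assume uv: "u \<le> u'" "v \<le> v'" "u' + v' \<le> r" "u + v \<le> r"
    and x: "x \<in> carrier (pobj (M \<boxtimes>\<^bsub>R\<^esub> N) u)" and k: "k \<in> carrier (pobj K v)"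
  let ?T = "M \<boxtimes>\<^bsub>R\<^esub> N"
  have k': "pmap K v v' k \<in> carrier (pobj K v')" using k uv by (simp add: pmap_closed[OF K])
  \<comment> \<open>On a pure tensor \<open>x = m \<otimes> n\<close> the indices of
    \<open>m\<close> and \<open>n\<close> stay put while the bound \<open>u\<close> is relaxed, so
    only \<open>k\<close> moves.\<close>
  have "compose (carrier (pobj ?T u)) (d r u' v' (pmap K v v' k)) (pmap ?T u u') x = d r u v k x"
  proof (rule d_ext[OF lin_hom_compose[OF pers_module[OF gr_tensor_pers[OF M N]]
        pmap_lin_hom[OF gr_tensor_pers[OF M N] uv(1)] d_lin_hom[OF uv(3) k']] d_lin_hom[OF uv(4) k] _ x])
    fix s t m n assume st: "s + t \<le> u" and mn: "m \<in> carrier (pobj M s)" "n \<in> carrier (pobj N t)"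
    then have st': "s + t \<le> u'" using uv(1) by (metis order_trans)
    show "compose (carrier (pobj ?T u)) (d r u' v' (pmap K v v' k)) (pmap ?T u u') (gr_elt R M N u s t m n) =
        d r u v k (gr_elt R M N u s t m n)"
      using gr_elt_nested_trans[OF M N K order_refl order_refl uv(2) le_assoc[OF st' uv(3)] mn k]
        st st' mn uv k k'
      by (simp add: compose_def d_elt pmap_refl[OF M mn(1)] pmap_refl[OF N mn(2)])
  qed
  then show "d r u' v' (pmap K v v' k) (pmap ?T u u' x) = d r u v k x"
    using x by (simp add: compose_def)
qed

lemma pm_assoc_PHom: "pm_assoc R M N K \<in> PHom R ((M \<boxtimes>\<^bsub>R\<^esub> N) \<boxtimes>\<^bsub>R\<^esub> K) T"
  unfolding pm_assoc_def
proof (rule gr_desc_PHom)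
  fix r r' u v x k
  assume r: "r \<le> r'" and uv: "u + v \<le> r"
    and x: "x \<in> carrier (pobj (M \<boxtimes>\<^bsub>R\<^esub> N) u)" and k: "k \<in> carrier (pobj K v)"
  have uv': "u + v \<le> r'" using r uv by (metis order_trans)
  have "compose (carrier (pobj (M \<boxtimes>\<^bsub>R\<^esub> N) u)) (pmap T r r') (d r u v k) x = d r' u v k x"
    by (rule d_ext[OF lin_hom_compose[OF pers_module[OF gr_tensor_pers[OF M N]] d_lin_hom[OF uv k] pmap_lin_hom]
        d_lin_hom[OF uv' k] _ x])
      (use r uv uv' k in \<open>simp_all add: compose_def d_elt le_assoc\<close>)
  then show "pmap T r r' (d r u v k x) = d r' u v k x" using x by (simp add: compose_def)
qed (simp_all add: balanced_outer)

lemma pm_assoc_elt: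
  assumes "s + t \<le> u" "u + v \<le> r"
    and "m \<in> carrier (pobj M s)" "n \<in> carrier (pobj N t)" "k \<in> carrier (pobj K v)"
  shows "pm_assoc R M N K r (gr_elt R (M \<boxtimes>\<^bsub>R\<^esub> N) K r u v (gr_elt R M N u s t m n) k) =
    gr_elt R M (N \<boxtimes>\<^bsub>R\<^esub> K) r s (t + v) m (gr_elt R N K (t + v) t v n k)"
proof -
  have "pm_assoc R M N K r (gr_elt R (M \<boxtimes>\<^bsub>R\<^esub> N) K r u v (gr_elt R M N u s t m n) k) =
      d r u v k (gr_elt R M N u s t m n)"
    unfolding pm_assoc_def
    by (rule gr_desc_elt[OF _ _ _ balanced_outer]) (simp_all add: pers_module assms)
  then show ?thesis using assms by (simp add: d_elt)
qed

end

section \<open>Braiding and unitors\<close>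

lemma
  assumes M [simp]: "persistence_module R M" and N [simp]: "persistence_module R N"
  shows pm_braid_PHom: "pm_braid R M N \<in> PHom R (M \<boxtimes>\<^bsub>R\<^esub> N) (N \<boxtimes>\<^bsub>R\<^esub> M)"
    and pm_braid_elt: "s + t \<le> r \<Longrightarrow> m \<in> carrier (pobj M s) \<Longrightarrow> n \<in> carrier (pobj N t) \<Longrightarrow>
      pm_braid R M N r (gr_elt R M N r s t m n) = gr_elt R N M r t s n m"
proof -
  have b: "balanced R M N r (pobj (N \<boxtimes>\<^bsub>R\<^esub> M) r) (\<lambda>s t m n. gr_elt R N M r t s n m)" for r
    by (rule balanced_swap[OF gr_elt_balanced[OF N M]])
  show "pm_braid R M N \<in> PHom R (M \<boxtimes>\<^bsub>R\<^esub> N) (N \<boxtimes>\<^bsub>R\<^esub> M)"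
    unfolding pm_braid_def using b by (intro gr_desc_PHom) (simp_all add: add.commute)
  show "pm_braid R M N r (gr_elt R M N r s t m n) = gr_elt R N M r t s n m"
    if "s + t \<le> r" "m \<in> carrier (pobj M s)" "n \<in> carrier (pobj N t)" for r s t m n
    unfolding pm_braid_def by (rule gr_desc_elt[OF M N _ b that]) (simp add: pers_module)
qed

text \<open>For an index \<open>s\<close> in \<open>U\<^sub>0\<close> this provides the structure
  map from degree \<open>t\<close> to degree \<open>r\<close> that occurs in the unitors.\<close>

lemma add_nonneg_le:
  fixes s t r :: "'p::preordered_ab_group_add"
  assumes "0 \<le> s" "s + t \<le> r"
  shows "t \<le> r"
  using add_mono_right[OF assms(1), of t] order_trans[OF _ assms(2)] by simp

text \<open>The delicate case is a step \<open>s \<le> s'\<close> that enters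
  \<open>U\<^sub>0\<close>: the scalar at \<open>s\<close> is then zero, so the branch taken at
  \<open>s'\<close> also yields zero. A step that leaves \<open>U\<^sub>0\<close> is excluded by
  transitivity.\<close>

lemma pm_lunit_balanced:
  fixes M :: "('p::preordered_ab_group_add, 'r, 'a) pers"
  assumes M: "persistence_module R M"
  shows "balanced R (pm_unit R) M r (pobj M r)
    (\<lambda>s t a m. if 0 \<le> s then pmap M t r (a \<odot>\<^bsub>pobj M t\<^esub> m) else \<zero>\<^bsub>pobj M r\<^esub>)"
proof -
  interpret R: cring R by (rule pers_cring[OF M])
  interpret Mr: module R "pobj M r" by (rule pers_module[OF M])
  show ?thesis
  proof (rule balancedI)
    fix s t :: 'p assume st: "s + t \<le> r"
    interpret Mt: module R "pobj M t" by (rule pers_module[OF M])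
    show "bilinear_map R (pobj (pm_unit R) s) (pobj M t) (pobj M r)
      (\<lambda>a m. if 0 \<le> s then pmap M t r (a \<odot>\<^bsub>pobj M t\<^esub> m) else \<zero>\<^bsub>pobj M r\<^esub>)"
    proof (cases "0 \<le> s")
      case True
      note p = pmap_lin_hom[OF M add_nonneg_le[OF True st]]
      show ?thesis
        using True by (intro bilinear_mapI)
          (simp_all add: pm_unit_simps lin_hom_closed[OF p] lin_hom_add[OF p] lin_hom_smult[OF p, symmetric]
            Mt.smult_l_distr Mt.smult_r_distr Mt.smult_assoc1[symmetric] R.m_comm)
    next
      case False
      then show ?thesis by (intro bilinear_mapI) (simp_all add: pm_unit_simps)
    qed
  next
    fix s s' t t' :: 'p and a m
    assume *: "s \<le> s'" "t \<le> t'" "s' + t' \<le> r" and a: "a \<in> carrier (pobj (pm_unit R) s)" and m: "m \<in> carrier (pobj M t)"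
    interpret Mt: module R "pobj M t'" by (rule pers_module[OF M])
    show "(if 0 \<le> s' then pmap M t' r (pmap (pm_unit R) s s' a \<odot>\<^bsub>pobj M t'\<^esub> pmap M t t' m) else \<zero>\<^bsub>pobj M r\<^esub>) =
      (if 0 \<le> s then pmap M t r (a \<odot>\<^bsub>pobj M t\<^esub> m) else \<zero>\<^bsub>pobj M r\<^esub>)"
    proof (cases "0 \<le> s'")
      case True
      note r = add_nonneg_le[OF True *(3)]
      note p = pmap_lin_hom[OF M r]
      have "t \<le> r" using r *(2) by (metis order_trans)
      note p' = pmap_lin_hom[OF M this]
      show ?thesis
        using a True m * r
        by (auto simp: pm_unit_pmap[OF R.is_cring a] pm_unit_simps lin_hom_smult[OF p] lin_hom_smult[OF p']
            pmap_closed[OF M] pmap_trans[OF M] lin_hom_zero[OF pers_module[OF M] pers_module[OF M] p] split: if_splits)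
    next
      case False
      then have "\<not> 0 \<le> s" using * by (metis order_trans)
      with False show ?thesis by simp
    qed
  qed
qed

lemma
  fixes M :: "('p::preordered_ab_group_add, 'r, 'a) pers"
  assumes M [simp]: "persistence_module R M"
  shows pm_lunit_PHom: "pm_lunit R M \<in> PHom R (pm_unit R \<boxtimes>\<^bsub>R\<^esub> M) M"
    and pm_lunit_elt: "s + t \<le> r \<Longrightarrow> a \<in> carrier (pobj (pm_unit R) s) \<Longrightarrow> m \<in> carrier (pobj M t) \<Longrightarrow>
      pm_lunit R M r (gr_elt R (pm_unit R) M r s t a m) =
      (if 0 \<le> s then pmap M t r (a \<odot>\<^bsub>pobj M t\<^esub> m) else \<zero>\<^bsub>pobj M r\<^esub>)"
proof -
  have [simp]: "cring R" by (rule pers_cring[OF M])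
  show "pm_lunit R M \<in> PHom R (pm_unit R \<boxtimes>\<^bsub>R\<^esub> M) M"
    unfolding pm_lunit_def
  proof (rule gr_desc_PHom[OF _ M M pm_lunit_balanced[OF M]])
    fix r r' s t :: 'p and a m
    assume *: "r \<le> r'" "s + t \<le> r" "a \<in> carrier (pobj (pm_unit R) s)" "m \<in> carrier (pobj M t)"
    interpret Mt: module R "pobj M t" by (rule pers_module[OF M])
    show "pmap M r r' (if 0 \<le> s then pmap M t r (a \<odot>\<^bsub>pobj M t\<^esub> m) else \<zero>\<^bsub>pobj M r\<^esub>) =
        (if 0 \<le> s then pmap M t r' (a \<odot>\<^bsub>pobj M t\<^esub> m) else \<zero>\<^bsub>pobj M r'\<^esub>)"
      using * add_nonneg_le[of s t r]
      by (auto simp: pmap_trans[OF M] pm_unit_simps lin_hom_zero[OF pers_module[OF M] pers_module[OF M] pmap_lin_hom[OF M]])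
  qed simp
  show "pm_lunit R M r (gr_elt R (pm_unit R) M r s t a m) =
      (if 0 \<le> s then pmap M t r (a \<odot>\<^bsub>pobj M t\<^esub> m) else \<zero>\<^bsub>pobj M r\<^esub>)"
    if "s + t \<le> r" "a \<in> carrier (pobj (pm_unit R) s)" "m \<in> carrier (pobj M t)" for r s t a m
    unfolding pm_lunit_def by (rule gr_desc_elt[OF _ M _ pm_lunit_balanced[OF M] that]) (simp_all add: pers_module)
qed

text \<open>The right unitor is the left unitor after the braiding. The equation
  \<open>pm_runit_eq\<close> gives its naturality here and its invertibility later.\<close>

lemma
  assumes M [simp]: "persistence_module R M"
  shows pm_runit_PHom: "pm_runit R M \<in> PHom R (M \<boxtimes>\<^bsub>R\<^esub> pm_unit R) M"
    and pm_runit_elt: "s + t \<le> r \<Longrightarrow> m \<in> carrier (pobj M s) \<Longrightarrow> a \<in> carrier (pobj (pm_unit R) t) \<Longrightarrow>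
      pm_runit R M r (gr_elt R M (pm_unit R) r s t m a) =
      (if 0 \<le> t then pmap M s r (a \<odot>\<^bsub>pobj M s\<^esub> m) else \<zero>\<^bsub>pobj M r\<^esub>)"
    and pm_runit_eq: "pm_runit R M = hom_comp (M \<boxtimes>\<^bsub>R\<^esub> pm_unit R) 0 (pm_lunit R M) (pm_braid R M (pm_unit R))"
proof -
  have [simp]: "cring R" by (rule pers_cring[OF M])
  let ?b = "\<lambda>r s t m a. if 0 \<le> t then pmap M s r (a \<odot>\<^bsub>pobj M s\<^esub> m) else \<zero>\<^bsub>pobj M r\<^esub>"
  have b: "balanced R M (pm_unit R) r (pobj M r) (?b r)" for r
    by (rule balanced_swap[OF pm_lunit_balanced[OF M]])
  have elt: "pm_runit R M r (gr_elt R M (pm_unit R) r s t m a) = ?b r s t m a"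
    if "s + t \<le> r" "m \<in> carrier (pobj M s)" "a \<in> carrier (pobj (pm_unit R) t)" for r s t m a
    unfolding pm_runit_def by (rule gr_desc_elt[OF M _ _ b that]) (simp_all add: pers_module)
  let ?\<rho> = "hom_comp (M \<boxtimes>\<^bsub>R\<^esub> pm_unit R) 0 (pm_lunit R M) (pm_braid R M (pm_unit R))"
  have \<rho>: "?\<rho> \<in> PHom R (M \<boxtimes>\<^bsub>R\<^esub> pm_unit R) M"
    using hom_comp_PHom[of R "M \<boxtimes>\<^bsub>R\<^esub> pm_unit R" "pm_braid R M (pm_unit R)" "pm_unit R \<boxtimes>\<^bsub>R\<^esub> M" 0 "pm_lunit R M" M 0 0]
    by (simp add: pm_braid_PHom pm_lunit_PHom)
  have "pm_runit R M r = ?\<rho> r" for r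
  proof (rule gr_tensor_hom_ext[OF M _ pers_module[OF M] _ PHom_lin_hom[OF \<rho>]])
    show "pm_runit R M r \<in> lin_hom R (pobj (M \<boxtimes>\<^bsub>R\<^esub> pm_unit R) r) (pobj M r)"
      unfolding pm_runit_def by (rule gr_desc_lin_hom[OF M _ _ b]) (simp_all add: pers_module)
  qed (simp_all add: elt pm_braid_elt pm_lunit_elt add.commute)
  then show eq: "pm_runit R M = ?\<rho>" by (rule ext)
  show "pm_runit R M \<in> PHom R (M \<boxtimes>\<^bsub>R\<^esub> pm_unit R) M" unfolding eq by (rule \<rho>)
  show "s + t \<le> r \<Longrightarrow> m \<in> carrier (pobj M s) \<Longrightarrow> a \<in> carrier (pobj (pm_unit R) t) \<Longrightarrow>
      pm_runit R M r (gr_elt R M (pm_unit R) r s t m a) = ?b r s t m a" for r s t m a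
    by (rule elt)
qed


section \<open>Natural transformations as homogeneous morphisms of degree zero\<close>

lemma pm_comp_apply [simp]:
  "m \<in> carrier (pobj M x) \<Longrightarrow> pm_comp M \<psi> \<phi> x m = \<psi> x (\<phi> x m)"
  by (simp add: pm_comp_def compose_def)

lemma pm_comp_eq: "pm_comp M \<psi> \<phi> = hom_comp M 0 \<psi> \<phi>"
  by (simp add: pm_comp_def hom_comp_def)

lemma pm_comp_PHom:
  "persistence_module R M \<Longrightarrow> \<phi> \<in> PHom R M N \<Longrightarrow> \<psi> \<in> PHom R N K \<Longrightarrow> pm_comp M \<psi> \<phi> \<in> PHom R M K"
  using hom_comp_PHom[of R M \<phi> N 0 \<psi> K 0 0] by (simp add: pm_comp_eq)

lemma pm_tensor_map_eq: "pm_tensor_map R M N M' N' \<phi> \<psi> = hom_tensor_map R M N M' N' 0 0 \<phi> \<psi>"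
  by (simp add: pm_tensor_map_def hom_tensor_map_def)

lemma
  assumes "persistence_module R M" "persistence_module R N" "persistence_module R M'" "persistence_module R N'"
    and \<phi>: "\<phi> \<in> PHom R M M'" and \<psi>: "\<psi> \<in> PHom R N N'"
  shows pm_tensor_map_PHom: "pm_tensor_map R M N M' N' \<phi> \<psi> \<in> PHom R (M \<boxtimes>\<^bsub>R\<^esub> N) (M' \<boxtimes>\<^bsub>R\<^esub> N')"
    and pm_tensor_map_elt: "s + t \<le> r \<Longrightarrow> m \<in> carrier (pobj M s) \<Longrightarrow> n \<in> carrier (pobj N t) \<Longrightarrow>
      pm_tensor_map R M N M' N' \<phi> \<psi> r (gr_elt R M N r s t m n) = gr_elt R M' N' r s t (\<phi> s m) (\<psi> t n)"
  using hom_tensor_map_PHom[of R M N M' N' \<phi> 0 \<psi> 0 0] hom_tensor_map_elt[of R M N M' N' \<phi> 0 \<psi> 0 s t r m n] assms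
  by (simp_all add: pm_tensor_map_eq)

subsection \<open>Isomorphisms\<close>

lemma pm_isoI:
  assumes M: "persistence_module R M" and N: "persistence_module R N"
    and \<phi>: "\<phi> \<in> PHom R M N" and \<psi>: "\<psi> \<in> PHom R N M"
    and inv: "\<And>x m. m \<in> carrier (pobj M x) \<Longrightarrow> \<psi> x (\<phi> x m) = m"
      "\<And>x n. n \<in> carrier (pobj N x) \<Longrightarrow> \<phi> x (\<psi> x n) = n"
  shows "pm_iso R M N \<phi>"
proof -
  have "pm_comp M \<psi> \<phi> = pm_id M"
    by (rule PHom_eqI[OF pm_comp_PHom[OF M \<phi> \<psi>] pm_id_PHom[OF M]]) (simp add: inv)
  moreover have "pm_comp N \<phi> \<psi> = pm_id N"
    by (rule PHom_eqI[OF pm_comp_PHom[OF N \<psi> \<phi>] pm_id_PHom[OF N]]) (simp add: inv)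
  ultimately show ?thesis using \<phi> \<psi> by (auto simp: pm_iso_def)
qed

text \<open>Linearity and naturality of the inverse are equations that may be tested after applying
  \<open>\<phi>\<close>, since \<open>\<phi>\<close> is injective in each degree.\<close>

lemma pm_iso_bij:
  assumes M: "persistence_module R M" and N: "persistence_module R N"
    and \<phi>: "\<phi> \<in> PHom R M N" and bij: "\<And>x. bij_betw (\<phi> x) (carrier (pobj M x)) (carrier (pobj N x))"
  shows "pm_iso R M N \<phi>"
proof -
  let ?\<psi> = "\<lambda>x. \<lambda>n\<in>carrier (pobj N x). inv_into (carrier (pobj M x)) (\<phi> x) n"
  have inv: "?\<psi> x n \<in> carrier (pobj M x)" "\<phi> x (?\<psi> x n) = n" if "n \<in> carrier (pobj N x)" for x n
    using that bij[of x] by (auto simp: bij_betw_inv_into_right bij_betw_def inv_into_into)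
  have inv': "?\<psi> x (\<phi> x m) = m" if "m \<in> carrier (pobj M x)" for x m
    using that bij[of x] PHom_closed[OF \<phi>] by (simp add: bij_betw_inv_into_left)
  have inj: "m = m'" if "\<phi> x m = \<phi> x m'" "m \<in> carrier (pobj M x)" "m' \<in> carrier (pobj M x)" for x m m'
    using that bij[of x] by (auto simp: bij_betw_def inj_on_def)
  have "?\<psi> \<in> PHom R N M"
  proof (rule PHomI)
    fix x
    interpret Mx: module R "pobj M x" by (rule pers_module[OF M])
    interpret Nx: module R "pobj N x" by (rule pers_module[OF N])
    note l = PHom_lin_hom[OF \<phi>]
    show "?\<psi> x \<in> lin_hom R (pobj N x) (pobj M x)"
    proof (rule lin_homI)
      show "?\<psi> x \<in> carrier (pobj N x) \<rightarrow>\<^sub>E carrier (pobj M x)"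
        using inv(1) by (auto simp del: restrict_apply simp: restrict_def)
      fix n n' assume n: "n \<in> carrier (pobj N x)" "n' \<in> carrier (pobj N x)"
      show "?\<psi> x (n \<oplus>\<^bsub>pobj N x\<^esub> n') = ?\<psi> x n \<oplus>\<^bsub>pobj M x\<^esub> ?\<psi> x n'"
        by (rule inj[of x]) (use n inv in \<open>simp_all add: lin_hom_add[OF l] del: restrict_apply\<close>)
    next
      fix a n assume n: "a \<in> carrier R" "n \<in> carrier (pobj N x)"
      show "?\<psi> x (a \<odot>\<^bsub>pobj N x\<^esub> n) = a \<odot>\<^bsub>pobj M x\<^esub> ?\<psi> x n"
        by (rule inj[of x]) (use n inv in \<open>simp_all add: lin_hom_smult[OF l] del: restrict_apply\<close>)
    qed
    fix y n assume x: "x \<le> y" and n: "n \<in> carrier (pobj N x)"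
    show "pmap M x y (?\<psi> x n) = ?\<psi> y (pmap N x y n)"
      by (rule inj[of y])
        (use x n inv in \<open>simp_all add: PHom_pmap[OF \<phi>] pmap_closed[OF M] pmap_closed[OF N] del: restrict_apply\<close>)
  qed
  from pm_isoI[OF M N \<phi> this inv' inv(2)] show ?thesis .
qed

lemma pm_iso_comp:
  assumes M: "persistence_module R M" and N: "persistence_module R N" and K: "persistence_module R K"
    and "pm_iso R M N \<phi>" "pm_iso R N K \<psi>"
  shows "pm_iso R M K (pm_comp M \<psi> \<phi>)"
proof -
  obtain \<phi>' where \<phi>: "\<phi> \<in> PHom R M N" "\<phi>' \<in> PHom R N M" "pm_comp M \<phi>' \<phi> = pm_id M" "pm_comp N \<phi> \<phi>' = pm_id N"
    using assms(4) by (auto simp: pm_iso_def)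
  obtain \<psi>' where \<psi>: "\<psi> \<in> PHom R N K" "\<psi>' \<in> PHom R K N" "pm_comp N \<psi>' \<psi> = pm_id N" "pm_comp K \<psi> \<psi>' = pm_id K"
    using assms(5) by (auto simp: pm_iso_def)
  have "\<phi>' x (\<phi> x m) = m" if "m \<in> carrier (pobj M x)" for x m
    using fun_cong[OF fun_cong[OF \<phi>(3)], of x m] that by simp
  moreover have "\<phi> x (\<phi>' x n) = n" "\<psi>' x (\<psi> x n) = n" if "n \<in> carrier (pobj N x)" for x n
    using fun_cong[OF fun_cong[OF \<phi>(4)], of x n] fun_cong[OF fun_cong[OF \<psi>(3)], of x n] that by simp_all
  moreover have "\<psi> x (\<psi>' x k) = k" if "k \<in> carrier (pobj K x)" for x k
    using fun_cong[OF fun_cong[OF \<psi>(4)], of x k] that by simp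
  ultimately show ?thesis
    using PHom_closed[OF \<phi>(1)] PHom_closed[OF \<phi>(2)] PHom_closed[OF \<psi>(1)] PHom_closed[OF \<psi>(2)]
    by (intro pm_isoI[OF M K pm_comp_PHom[OF M \<phi>(1) \<psi>(1)] pm_comp_PHom[OF K \<psi>(2) \<phi>(2)]]) simp_all
qed

lemma pm_braid_braid:
  assumes [simp]: "persistence_module R M" "persistence_module R N"
  shows "pm_comp (M \<boxtimes>\<^bsub>R\<^esub> N) (pm_braid R N M) (pm_braid R M N) = pm_id (M \<boxtimes>\<^bsub>R\<^esub> N)"
  by (rule gr_tensor_PHom_eqI[OF assms gr_tensor_pers[OF assms]])
    (simp_all add: pm_comp_PHom[OF _ pm_braid_PHom pm_braid_PHom] pm_braid_elt add.commute)

lemma pm_braid_iso: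
  assumes "persistence_module R M" "persistence_module R N"
  shows "pm_iso R (M \<boxtimes>\<^bsub>R\<^esub> N) (N \<boxtimes>\<^bsub>R\<^esub> M) (pm_braid R M N)"
  unfolding pm_iso_def using assms by (blast intro: pm_braid_PHom pm_braid_braid)

text \<open>The inverse associator is the associator of the reversed product, conjugated by braidings.\<close>

lemma pm_assoc_iso:
  assumes [simp]: "persistence_module R M" "persistence_module R N" "persistence_module R K"
  shows "pm_iso R ((M \<boxtimes>\<^bsub>R\<^esub> N) \<boxtimes>\<^bsub>R\<^esub> K) (M \<boxtimes>\<^bsub>R\<^esub> (N \<boxtimes>\<^bsub>R\<^esub> K)) (pm_assoc R M N K)"
proof -
  let ?l = "(M \<boxtimes>\<^bsub>R\<^esub> N) \<boxtimes>\<^bsub>R\<^esub> K" and ?r = "M \<boxtimes>\<^bsub>R\<^esub> (N \<boxtimes>\<^bsub>R\<^esub> K)"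
  let ?\<beta>1 = "pm_tensor_map R (N \<boxtimes>\<^bsub>R\<^esub> K) M (K \<boxtimes>\<^bsub>R\<^esub> N) M (pm_braid R N K) (pm_id M)"
  let ?\<beta>2 = "pm_tensor_map R (N \<boxtimes>\<^bsub>R\<^esub> M) K (M \<boxtimes>\<^bsub>R\<^esub> N) K (pm_braid R N M) (pm_id K)"
  \<comment> \<open>On pure tensors the path is \<open>m \<otimes> (n \<otimes> k)\<close>,
    \<open>(n \<otimes> k) \<otimes> m\<close>, \<open>(k \<otimes> n) \<otimes> m\<close>,
    \<open>k \<otimes> (n \<otimes> m)\<close>, \<open>(n \<otimes> m) \<otimes> k\<close>,
    \<open>(m \<otimes> n) \<otimes> k\<close>.\<close>
  let ?\<psi> = "pm_comp ?r ?\<beta>2 (pm_comp ?r (pm_braid R K (N \<boxtimes>\<^bsub>R\<^esub> M)) (pm_comp ?r (pm_assoc R K N M)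
      (pm_comp ?r ?\<beta>1 (pm_braid R M (N \<boxtimes>\<^bsub>R\<^esub> K)))))"
  note [simp] = pm_braid_PHom pm_assoc_PHom pm_tensor_map_PHom
  have \<psi>: "?\<psi> \<in> PHom R ?r ?l"
    by (rule pm_comp_PHom pm_tensor_map_PHom pm_braid_PHom pm_assoc_PHom pm_id_PHom gr_tensor_pers | fact)+
  have \<phi>: "pm_assoc R M N K \<in> PHom R ?l ?r" by simp
  have elt: "?\<psi> (s + (t + v)) (gr_elt R M (N \<boxtimes>\<^bsub>R\<^esub> K) (s + (t + v)) s (t + v) m (gr_elt R N K (t + v) t v n k)) =
      gr_elt R (M \<boxtimes>\<^bsub>R\<^esub> N) K (s + (t + v)) (s + t) v (gr_elt R M N (s + t) s t m n) k"
    if "m \<in> carrier (pobj M s)" "n \<in> carrier (pobj N t)" "k \<in> carrier (pobj K v)" for s t v m n k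
    using that by (simp add: pm_braid_elt pm_assoc_elt pm_tensor_map_elt ac_simps)
  \<comment> \<open>Only the outermost composite is unfolded, so that \<open>elt\<close> meets
    \<open>?\<psi>\<close> as a whole.\<close>
  have "pm_comp ?l ?\<psi> (pm_assoc R M N K) = pm_id ?l"
    by (rule gr_tensor3_PHom_eqI[of R M N K ?l])
      (simp_all add: pm_comp_PHom[OF _ \<phi> \<psi>] pm_assoc_elt elt add.assoc del: pm_comp_apply,
       subst pm_comp_apply, simp_all add: pm_assoc_elt elt add.assoc del: pm_comp_apply)
  moreover have "pm_comp ?r (pm_assoc R M N K) ?\<psi> = pm_id ?r"
    by (rule gr_tensor3_PHom_eqI'[of R M N K ?r])
      (simp_all add: pm_comp_PHom[OF _ \<psi> \<phi>] del: pm_comp_apply,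
       subst pm_comp_apply, simp_all add: pm_assoc_elt elt add.assoc del: pm_comp_apply)
  ultimately show ?thesis using \<phi> \<psi> by (auto simp: pm_iso_def)
qed

text \<open>The inverse is \<open>m \<mapsto> 1 \<otimes> m\<close>. On \<open>a \<otimes> m\<close>
  with \<open>a\<close> at an index \<open>s\<close> in \<open>U\<^sub>0\<close>, the composite
  returns \<open>1 \<otimes> a m\<close>; the scalar crosses the tensor sign and the index 0 is
  raised to \<open>s\<close>. Off \<open>U\<^sub>0\<close> everything is zero.\<close>

lemma pm_lunit_iso:
  fixes M :: "('p::preordered_ab_group_add, 'r, 'a) pers"
  assumes M [simp]: "persistence_module R M"
  shows "pm_iso R (pm_unit R \<boxtimes>\<^bsub>R\<^esub> M) M (pm_lunit R M)"
proof -
  interpret R: cring R by (rule pers_cring[OF M])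
  let ?U = "pm_unit R :: ('p, 'r, 'r) pers"
  let ?T = "?U \<boxtimes>\<^bsub>R\<^esub> M"
  have one: "\<one>\<^bsub>R\<^esub> \<in> carrier (pobj ?U 0)" by (simp add: pm_unit_simps)
  have U [simp]: "persistence_module R ?U" by (rule pm_unit_pers) (rule R.is_cring)
  \<comment> \<open>The unit element is placed in degree 0, so tensoring with it is homogeneous of
    degree 0, that is, a natural transformation.\<close>
  let ?\<psi> = "tensor_left R ?U M 0 \<one>\<^bsub>R\<^esub>"
  have \<psi>: "?\<psi> \<in> PHom R M ?T"
    using tensor_left_PHom[OF U M one] by simp
  have \<psi>_apply: "?\<psi> x m = gr_elt R ?U M x 0 x \<one>\<^bsub>R\<^esub> m" if "m \<in> carrier (pobj M x)" for x m
    using that by (simp add: tensor_left_def)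
  have "pm_comp ?T ?\<psi> (pm_lunit R M) = pm_id ?T"
  proof (rule gr_tensor_PHom_eqI[OF U M gr_tensor_pers[OF U M] pm_comp_PHom[OF _ pm_lunit_PHom \<psi>]])
    fix s t a m assume a: "a \<in> carrier (pobj ?U s)" and m: "m \<in> carrier (pobj M t)"
    interpret Mt: module R "pobj M t" by (rule pers_module[OF M])
    have aR: "a \<in> carrier R" using a by (simp add: pm_unit_simps split: if_splits)
    show "pm_comp ?T ?\<psi> (pm_lunit R M) (s + t) (gr_elt R ?U M (s + t) s t a m) =
        pm_id ?T (s + t) (gr_elt R ?U M (s + t) s t a m)"
    proof (cases "0 \<le> s")
      case True
      then have t: "t \<le> s + t" by (rule add_nonneg_le) simp
      then have le0: "0 + t \<le> s + t" by simp
      have "gr_elt R ?U M (s + t) 0 (s + t) \<one>\<^bsub>R\<^esub> (pmap M t (s + t) (a \<odot>\<^bsub>pobj M t\<^esub> m)) =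
          gr_elt R ?U M (s + t) 0 t \<one>\<^bsub>R\<^esub> (a \<odot>\<^bsub>pobj M t\<^esub> m)"
        using gr_elt_trans[OF U M order_refl t _ one, of "s + t"] m aR
        by (simp add: pm_unit_pmap[OF R.is_cring one])
      also have "\<dots> = gr_elt R ?U M (s + t) 0 t (a \<odot>\<^bsub>pobj ?U 0\<^esub> \<one>\<^bsub>R\<^esub>) m"
        using bilinear_mapD(4,5)[OF gr_elt_bilinear[OF U M le0] one m aR] by simp
      \<comment> \<open>The structure map of the unit from 0 to \<open>s\<close> is the identity on
        scalars, so \<open>a\<close> moves from index 0 to index \<open>s\<close> unchanged.\<close>
      also have "\<dots> = gr_elt R ?U M (s + t) s t a m"
        using gr_elt_trans[OF U M True order_refl order_refl, of a m] aR m
        by (simp add: pm_unit_simps pm_unit_pmap[OF R.is_cring] pmap_refl[OF M])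
      finally show ?thesis
        using True a m aR t by (simp add: pm_lunit_elt \<psi>_apply pmap_closed[OF M])
    next
      case False
      have T: "module R (pobj ?T (s + t))" by (rule pers_module) simp
      have z: "\<zero>\<^bsub>pobj M (s + t)\<^esub> \<in> carrier (pobj M (s + t))"
        by (rule abelian_monoid.zero_closed[OF abelian_group.axioms(1)[OF module.axioms(2)[OF pers_module[OF M]]]])
      have "a = \<zero>\<^bsub>pobj ?U s\<^esub>" using a False by (simp add: pm_unit_simps)
      then have "gr_elt R ?U M (s + t) s t a m = \<zero>\<^bsub>pobj ?T (s + t)\<^esub>"
        using bilinear_map_zero(1)[OF pers_module[OF U] pers_module[OF M] T gr_elt_bilinear[OF U M order_refl] m] by simp
      moreover have "gr_elt R ?U M (s + t) 0 (s + t) \<one>\<^bsub>R\<^esub> \<zero>\<^bsub>pobj M (s + t)\<^esub> = \<zero>\<^bsub>pobj ?T (s + t)\<^esub>"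
        using bilinear_map_zero(2)[OF pers_module[OF U] pers_module[OF M] T gr_elt_bilinear[OF U M] one] by simp
      ultimately have "gr_elt R ?U M (s + t) 0 (s + t) \<one>\<^bsub>R\<^esub> \<zero>\<^bsub>pobj M (s + t)\<^esub> = gr_elt R ?U M (s + t) s t a m"
        by simp
      then show ?thesis
        using False a m z by (simp add: pm_lunit_elt \<psi>_apply)
    qed
  qed simp_all
  moreover have "pm_comp M (pm_lunit R M) ?\<psi> = pm_id M"
  proof (rule PHom_eqI[OF pm_comp_PHom[OF M \<psi> pm_lunit_PHom[OF M]] pm_id_PHom[OF M]])
    fix x m assume m: "m \<in> carrier (pobj M x)"
    then show "pm_comp M (pm_lunit R M) ?\<psi> x m = pm_id M x m"
      using one by (simp add: \<psi>_apply pm_lunit_elt pmap_refl[OF M] module.smult_one[OF pers_module[OF M]])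
  qed
  ultimately show ?thesis using \<psi> pm_lunit_PHom[OF M] by (auto simp: pm_iso_def)
qed

lemma pm_runit_iso:
  assumes M: "persistence_module R M"
  shows "pm_iso R (M \<boxtimes>\<^bsub>R\<^esub> pm_unit R) M (pm_runit R M)"
  unfolding pm_runit_eq[OF M] pm_comp_eq[symmetric]
  by (rule pm_iso_comp[OF _ _ _ pm_braid_iso pm_lunit_iso]) (simp_all add: M pers_cring[OF M])

subsection \<open>Naturality\<close>

text \<open>On pure tensors both sides tensor \<open>f m\<close>, \<open>g n\<close> and
  \<open>h k\<close>, bracketed to the right. The associator has degree zero, so the total degrees
  are \<open>a + b + c\<close> and \<open>a + (b + c)\<close>; both sides are compared in the shift
  by the former.\<close>

lemma pm_assoc_natural:
  assumes [simp]: "persistence_module R M" "persistence_module R N" "persistence_module R K"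
      "persistence_module R M'" "persistence_module R N'" "persistence_module R K'"
    and f: "f \<in> PHom R M (shift M' a)" and g: "g \<in> PHom R N (shift N' b)" and h: "h \<in> PHom R K (shift K' c)"
  shows "hom_comp ((M \<boxtimes>\<^bsub>R\<^esub> N) \<boxtimes>\<^bsub>R\<^esub> K) (a + b + c) (pm_assoc R M' N' K')
      (hom_tensor_map R (M \<boxtimes>\<^bsub>R\<^esub> N) K (M' \<boxtimes>\<^bsub>R\<^esub> N') K' (a + b) c (hom_tensor_map R M N M' N' a b f g) h) =
    hom_comp ((M \<boxtimes>\<^bsub>R\<^esub> N) \<boxtimes>\<^bsub>R\<^esub> K) 0
      (hom_tensor_map R M (N \<boxtimes>\<^bsub>R\<^esub> K) M' (N' \<boxtimes>\<^bsub>R\<^esub> K') a (b + c) f (hom_tensor_map R N K N' K' b c g h))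
      (pm_assoc R M N K)" (is "?L = ?R")
proof -
  note [simp] = PHom_shift_closed[OF f] PHom_shift_closed[OF g] PHom_shift_closed[OF h]
  have fg: "hom_tensor_map R M N M' N' a b f g \<in> PHom R (M \<boxtimes>\<^bsub>R\<^esub> N) (shift (M' \<boxtimes>\<^bsub>R\<^esub> N') (a + b))"
    by (rule hom_tensor_map_PHom[OF _ _ _ _ f g]) simp_all
  have gh: "hom_tensor_map R N K N' K' b c g h \<in> PHom R (N \<boxtimes>\<^bsub>R\<^esub> K) (shift (N' \<boxtimes>\<^bsub>R\<^esub> K') (b + c))"
    by (rule hom_tensor_map_PHom[OF _ _ _ _ g h]) simp_all
  note elts = hom_tensor_map_elt[OF _ _ _ _ f g] hom_tensor_map_elt[OF _ _ _ _ g h]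
    hom_tensor_map_elt[OF _ _ _ _ fg h] hom_tensor_map_elt[OF _ _ _ _ f gh]
  show ?thesis
  proof (rule gr_tensor3_PHom_eqI[of R M N K "shift (M' \<boxtimes>\<^bsub>R\<^esub> (N' \<boxtimes>\<^bsub>R\<^esub> K')) (a + b + c)"])
    show "?L \<in> PHom R ((M \<boxtimes>\<^bsub>R\<^esub> N) \<boxtimes>\<^bsub>R\<^esub> K) (shift (M' \<boxtimes>\<^bsub>R\<^esub> (N' \<boxtimes>\<^bsub>R\<^esub> K')) (a + b + c))"
      by (rule hom_comp_PHom[OF _ hom_tensor_map_PHom[OF _ _ _ _ fg h refl], where t = 0])
        (simp_all add: pm_assoc_PHom)
    show "?R \<in> PHom R ((M \<boxtimes>\<^bsub>R\<^esub> N) \<boxtimes>\<^bsub>R\<^esub> K) (shift (M' \<boxtimes>\<^bsub>R\<^esub> (N' \<boxtimes>\<^bsub>R\<^esub> K')) (a + b + c))"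
      by (rule hom_comp_PHom[OF _ _ hom_tensor_map_PHom[OF _ _ _ _ f gh refl]])
        (simp_all add: pm_assoc_PHom add.assoc)
  qed (simp_all add: elts pm_assoc_elt ac_simps)
qed

lemma pm_braid_natural:
  assumes [simp]: "persistence_module R M" "persistence_module R N"
      "persistence_module R M'" "persistence_module R N'"
    and f: "f \<in> PHom R M (shift M' a)" and g: "g \<in> PHom R N (shift N' b)"
  shows "hom_comp (M \<boxtimes>\<^bsub>R\<^esub> N) (a + b) (pm_braid R M' N') (hom_tensor_map R M N M' N' a b f g) =
    hom_comp (M \<boxtimes>\<^bsub>R\<^esub> N) 0 (hom_tensor_map R N M N' M' b a g f) (pm_braid R M N)" (is "?L = ?R")
proof -
  note [simp] = PHom_shift_closed[OF f] PHom_shift_closed[OF g]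
  note elts = hom_tensor_map_elt[OF _ _ _ _ f g] hom_tensor_map_elt[OF _ _ _ _ g f]
  show ?thesis
  proof (rule gr_tensor_PHom_eqI[of R M N "shift (N' \<boxtimes>\<^bsub>R\<^esub> M') (a + b)"])
    show "?L \<in> PHom R (M \<boxtimes>\<^bsub>R\<^esub> N) (shift (N' \<boxtimes>\<^bsub>R\<^esub> M') (a + b))"
      by (rule hom_comp_PHom[OF _ hom_tensor_map_PHom[OF _ _ _ _ f g refl], where t = 0])
        (simp_all add: pm_braid_PHom)
    show "?R \<in> PHom R (M \<boxtimes>\<^bsub>R\<^esub> N) (shift (N' \<boxtimes>\<^bsub>R\<^esub> M') (a + b))"
      by (rule hom_comp_PHom[OF _ _ hom_tensor_map_PHom[OF _ _ _ _ g f refl]])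
        (simp_all add: pm_braid_PHom add.commute)
  qed (simp_all add: elts pm_braid_elt ac_simps)
qed

text \<open>If the scalar sits at an index in \<open>U\<^sub>0\<close>, the claim is linearity of
  \<open>f\<close> together with its naturality along a structure map; otherwise both unitors give
  zero, which \<open>f\<close> preserves.\<close>

lemma
  fixes M :: "('p::preordered_ab_group_add, 'r, 'a) pers"
  assumes [simp]: "persistence_module R M" "persistence_module R M'"
    and f: "f \<in> PHom R M (shift M' a)"
  shows pm_lunit_natural:
    "hom_comp (pm_unit R \<boxtimes>\<^bsub>R\<^esub> M) a (pm_lunit R M')
      (hom_tensor_map R (pm_unit R) M (pm_unit R) M' 0 a (pm_id (pm_unit R)) f) =
    hom_comp (pm_unit R \<boxtimes>\<^bsub>R\<^esub> M) 0 f (pm_lunit R M)" (is "?L = ?R")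
    and pm_runit_natural:
    "hom_comp (M \<boxtimes>\<^bsub>R\<^esub> pm_unit R) a (pm_runit R M')
      (hom_tensor_map R M (pm_unit R) M' (pm_unit R) a 0 f (pm_id (pm_unit R))) =
    hom_comp (M \<boxtimes>\<^bsub>R\<^esub> pm_unit R) 0 f (pm_runit R M)" (is "?L' = ?R'")
proof -
  let ?U = "pm_unit R :: ('p, 'r, 'r) pers"
  have [simp]: "cring R" by (rule pers_cring) fact
  note [simp] = PHom_shift_closed[OF f]
  have id: "pm_id ?U \<in> PHom R ?U (shift ?U 0)" by simp
  note elts = hom_tensor_map_elt[OF _ _ _ _ id f] hom_tensor_map_elt[OF _ _ _ _ f id]
  have t: "t \<le> s + t" if "0 \<le> s" for s t :: 'p using add_mono_right[OF that, of t] by simp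
  have sm: "x \<odot>\<^bsub>pobj M t\<^esub> m \<in> carrier (pobj M t)" "f t (x \<odot>\<^bsub>pobj M t\<^esub> m) = x \<odot>\<^bsub>pobj M' (t + a)\<^esub> f t m"
    if "x \<in> carrier (pobj ?U s)" "m \<in> carrier (pobj M t)" for x m s t
  proof -
    interpret cring R by simp
    have "x \<in> carrier R" using that by (auto simp: pm_unit_simps split: if_splits)
    with that show "x \<odot>\<^bsub>pobj M t\<^esub> m \<in> carrier (pobj M t)" "f t (x \<odot>\<^bsub>pobj M t\<^esub> m) = x \<odot>\<^bsub>pobj M' (t + a)\<^esub> f t m"
      by (simp_all add: module.smult_closed[OF pers_module[OF assms(1)]] lin_hom_smult[OF PHom_shift_lin_hom[OF f]])
  qed
  have z: "f x \<zero>\<^bsub>pobj M x\<^esub> = \<zero>\<^bsub>pobj M' (x + a)\<^esub>" for x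
    by (rule lin_hom_zero[OF pers_module pers_module PHom_shift_lin_hom[OF f]]) simp_all
  show "?L = ?R"
  proof (rule gr_tensor_PHom_eqI[of R ?U M "shift M' a"])
    show "?L \<in> PHom R (?U \<boxtimes>\<^bsub>R\<^esub> M) (shift M' a)"
      by (rule hom_comp_PHom[OF _ hom_tensor_map_PHom[OF _ _ _ _ id f], where t = 0])
        (simp_all add: pm_lunit_PHom)
    show "?R \<in> PHom R (?U \<boxtimes>\<^bsub>R\<^esub> M) (shift M' a)"
      by (rule hom_comp_PHom[OF _ _ f]) (simp_all add: pm_lunit_PHom)
    fix s t x m assume xm: "x \<in> carrier (pobj ?U s)" "m \<in> carrier (pobj M t)"
    then show "?L (s + t) (gr_elt R ?U M (s + t) s t x m) = ?R (s + t) (gr_elt R ?U M (s + t) s t x m)"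
      by (simp add: elts pm_lunit_elt add.assoc t sm[OF xm] z PHom_shift_pmap[OF f])
  qed simp_all
  show "?L' = ?R'"
  proof (rule gr_tensor_PHom_eqI[of R M ?U "shift M' a"])
    show "?L' \<in> PHom R (M \<boxtimes>\<^bsub>R\<^esub> ?U) (shift M' a)"
      by (rule hom_comp_PHom[OF _ hom_tensor_map_PHom[OF _ _ _ _ f id], where t = 0])
        (simp_all add: pm_runit_PHom)
    show "?R' \<in> PHom R (M \<boxtimes>\<^bsub>R\<^esub> ?U) (shift M' a)"
      by (rule hom_comp_PHom[OF _ _ f]) (simp_all add: pm_runit_PHom)
    fix s t m x assume xm: "m \<in> carrier (pobj M s)" "x \<in> carrier (pobj ?U t)"
    \<comment> \<open>The first index has become \<open>s + a\<close>; evaluating the unitor asks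
      for its bound with the summands in this order.\<close>
    have le: "s + a + t \<le> s + t + a" by (simp add: ac_simps)
    show "?L' (s + t) (gr_elt R M ?U (s + t) s t m x) = ?R' (s + t) (gr_elt R M ?U (s + t) s t m x)"
      using xm le t[of t s]
      by (simp add: elts pm_runit_elt sm[OF xm(2,1)] z PHom_shift_pmap[OF f] add.commute[of s t])
  qed simp_all
qed

subsection \<open>Coherence\<close>

text \<open>Both paths send \<open>((m \<otimes> n) \<otimes> k) \<otimes> l\<close> to
  \<open>m \<otimes> (n \<otimes> (k \<otimes> l))\<close>.\<close>

lemma pm_pentagon:
  assumes [simp]: "persistence_module R M" "persistence_module R N" "persistence_module R K" "persistence_module R L"
  shows "pm_pentagon R M N K L"
  unfolding pm_pentagon_def
proof (rule gr_tensor4_PHom_eqI[of R M N K L "M \<boxtimes>\<^bsub>R\<^esub> (N \<boxtimes>\<^bsub>R\<^esub> (K \<boxtimes>\<^bsub>R\<^esub> L))"], goal_cases)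
  case (6)
  show ?case by (rule pm_comp_PHom pm_tensor_map_PHom pm_assoc_PHom pm_id_PHom gr_tensor_pers | fact)+
next
  case (7)
  show ?case by (rule pm_comp_PHom pm_tensor_map_PHom pm_assoc_PHom pm_id_PHom gr_tensor_pers | fact)+
next
  case (8 s t v w m n k l x)
  then show ?case
    by (simp add: pm_assoc_elt pm_tensor_map_elt pm_assoc_PHom ac_simps)
qed simp_all

text \<open>With the middle scalar \<open>a\<close> at an index \<open>t\<close> in
  \<open>U\<^sub>0\<close>, one side is \<open>m \<otimes> a n\<close> and the other
  \<open>a m \<otimes> n\<close>, at different indices. Otherwise both are zero.\<close>

lemma pm_triangle:
  fixes M :: "('p::preordered_ab_group_add, 'r, 'a) pers"
  assumes M [simp]: "persistence_module R M" and N [simp]: "persistence_module R N"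
  shows "pm_triangle R M N"
proof -
  have [simp]: "cring R" by (rule pers_cring[OF M])
  let ?U = "pm_unit R :: ('p, 'r, 'r) pers"
  show ?thesis
    unfolding pm_triangle_def
  proof (rule gr_tensor3_PHom_eqI[of R M ?U N "M \<boxtimes>\<^bsub>R\<^esub> N"], goal_cases)
    case 5
    show ?case by (rule pm_comp_PHom pm_tensor_map_PHom pm_assoc_PHom pm_id_PHom pm_lunit_PHom gr_tensor_pers pm_unit_pers pers_cring[OF M] | fact)+
  next
    case 6
    show ?case by (rule pm_comp_PHom pm_tensor_map_PHom pm_id_PHom pm_runit_PHom gr_tensor_pers pm_unit_pers pers_cring[OF M] | fact)+
  next
    case (7 s t v m a n)
    let ?r = "s + t + v"
    have a: "a \<in> carrier R" using 7(2) cring.cring_simprules(2)[OF pers_cring[OF M]] by (auto simp: pm_unit_simps split: if_splits)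
    have "gr_elt R M N ?r s (t + v) m (if 0 \<le> t then pmap N v (t + v) (a \<odot>\<^bsub>pobj N v\<^esub> n) else \<zero>\<^bsub>pobj N (t + v)\<^esub>) =
      gr_elt R M N ?r (s + t) v (if 0 \<le> t then pmap M s (s + t) (a \<odot>\<^bsub>pobj M s\<^esub> m) else \<zero>\<^bsub>pobj M (s + t)\<^esub>) n"
    proof (cases "0 \<le> t")
      case True
      have sv: "s \<le> s + t" "v \<le> t + v" using add_mono_right[OF True, of s] add_mono_right[OF True, of v] by (simp_all add: add.commute)
      \<comment> \<open>The index pair \<open>(s, v)\<close> lies below both
        \<open>(s, t + v)\<close> and \<open>(s + t, v)\<close>. The two tensors are brought down to
        it, where the scalar can cross.\<close>
      have le: "s + v \<le> ?r" using add_mono_right[OF sv(1), of v] .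
      have an: "a \<odot>\<^bsub>pobj N v\<^esub> n \<in> carrier (pobj N v)" and am: "a \<odot>\<^bsub>pobj M s\<^esub> m \<in> carrier (pobj M s)"
        using a 7 by (simp_all add: module.smult_closed[OF pers_module[OF M]] module.smult_closed[OF pers_module[OF N]])
      have "gr_elt R M N ?r s (t + v) m (pmap N v (t + v) (a \<odot>\<^bsub>pobj N v\<^esub> n)) = gr_elt R M N ?r s v m (a \<odot>\<^bsub>pobj N v\<^esub> n)"
        using gr_elt_trans[OF M N order_refl sv(2) _ 7(1) an, of ?r] by (simp add: pmap_refl[OF M 7(1)] add.assoc)
      also have "\<dots> = gr_elt R M N ?r s v (a \<odot>\<^bsub>pobj M s\<^esub> m) n"
        using bilinear_mapD(4,5)[OF gr_elt_bilinear[OF M N le] 7(1,3) a] by simp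
      also have "\<dots> = gr_elt R M N ?r (s + t) v (pmap M s (s + t) (a \<odot>\<^bsub>pobj M s\<^esub> m)) n"
        using gr_elt_trans[OF M N sv(1) order_refl order_refl am 7(3)] by (simp add: pmap_refl[OF N 7(3)])
      finally show ?thesis using True by simp
    next
      case False
      have T: "module R (pobj (M \<boxtimes>\<^bsub>R\<^esub> N) ?r)" by (rule pers_module) simp
      have "s + (t + v) \<le> ?r" by (simp add: add.assoc)
      then show ?thesis
        using False bilinear_map_zero(2)[OF pers_module[OF M] pers_module[OF N] T gr_elt_bilinear[OF M N] 7(1)]
          bilinear_map_zero(1)[OF pers_module[OF M] pers_module[OF N] T gr_elt_bilinear[OF M N order_refl] 7(3)]
        by simp
    qed
    then show ?case
      using 7 by (simp add: pm_assoc_elt pm_tensor_map_elt pm_lunit_PHom pm_runit_PHom pm_lunit_elt pm_runit_elt add.assoc)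
  qed simp_all
qed

text \<open>Both paths send \<open>(m \<otimes> n) \<otimes> k\<close> to
  \<open>n \<otimes> (k \<otimes> m)\<close>. The mirrored hexagon follows from this one because the
  braiding is an involution.\<close>

lemma pm_hexagon:
  assumes [simp]: "persistence_module R M" "persistence_module R N" "persistence_module R K"
  shows "pm_comp ((M \<boxtimes>\<^bsub>R\<^esub> N) \<boxtimes>\<^bsub>R\<^esub> K)
      (pm_assoc R N K M)
      (pm_comp ((M \<boxtimes>\<^bsub>R\<^esub> N) \<boxtimes>\<^bsub>R\<^esub> K)
        (pm_braid R M (N \<boxtimes>\<^bsub>R\<^esub> K)) (pm_assoc R M N K)) =
    pm_comp ((M \<boxtimes>\<^bsub>R\<^esub> N) \<boxtimes>\<^bsub>R\<^esub> K)
      (pm_tensor_map R N (M \<boxtimes>\<^bsub>R\<^esub> K) N (K \<boxtimes>\<^bsub>R\<^esub> M) (pm_id N) (pm_braid R M K))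
      (pm_comp ((M \<boxtimes>\<^bsub>R\<^esub> N) \<boxtimes>\<^bsub>R\<^esub> K)
        (pm_assoc R N M K)
        (pm_tensor_map R (M \<boxtimes>\<^bsub>R\<^esub> N) K (N \<boxtimes>\<^bsub>R\<^esub> M) K (pm_braid R M N) (pm_id K)))"
proof (rule gr_tensor3_PHom_eqI[of R M N K "N \<boxtimes>\<^bsub>R\<^esub> (K \<boxtimes>\<^bsub>R\<^esub> M)"], goal_cases)
  case 5
  show ?case by (rule pm_comp_PHom pm_tensor_map_PHom pm_assoc_PHom pm_braid_PHom pm_id_PHom gr_tensor_pers | fact)+
next
  case 6
  show ?case by (rule pm_comp_PHom pm_tensor_map_PHom pm_assoc_PHom pm_braid_PHom pm_id_PHom gr_tensor_pers | fact)+
next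
  case (7 s t v m n k)
  then show ?case
    by (simp add: pm_assoc_elt pm_tensor_map_elt pm_braid_PHom pm_braid_elt ac_simps)
qed simp_all


section \<open>Internal hom and currying\<close>

text \<open>Additivity in the inner morphism uses linearity of \<open>\<beta>\<close>; in the outer
  one it is pointwise.\<close>

lemma hom_comp_add:
  assumes [simp]: "persistence_module R M" "persistence_module R N" "persistence_module R K"
    and \<alpha>: "\<alpha> \<in> PHom R M (shift N s)" "\<alpha>' \<in> PHom R M (shift N s)"
    and \<beta>: "\<beta> \<in> PHom R N (shift K t)" "\<beta>' \<in> PHom R N (shift K t)"
  shows "hom_comp M s \<beta> (\<alpha> \<oplus>\<^bsub>nat_hom R M (shift N s)\<^esub> \<alpha>') =
      hom_comp M s \<beta> \<alpha> \<oplus>\<^bsub>nat_hom R M (shift K (s + t))\<^esub> hom_comp M s \<beta> \<alpha>'"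
    and "hom_comp M s (\<beta> \<oplus>\<^bsub>nat_hom R N (shift K t)\<^esub> \<beta>') \<alpha> =
      hom_comp M s \<beta> \<alpha> \<oplus>\<^bsub>nat_hom R M (shift K (s + t))\<^esub> hom_comp M s \<beta>' \<alpha>"
proof -
  note [simp] = hom_comp_PHom[OF assms(1) \<alpha>(1) _ refl] hom_comp_PHom[OF assms(1) \<alpha>(2) _ refl]
  have a: "\<alpha> \<oplus>\<^bsub>nat_hom R M (shift N s)\<^esub> \<alpha>' \<in> PHom R M (shift N s)"
    and b: "\<beta> \<oplus>\<^bsub>nat_hom R N (shift K t)\<^esub> \<beta>' \<in> PHom R N (shift K t)"
    using \<alpha> \<beta> by simp_all
  show "hom_comp M s \<beta> (\<alpha> \<oplus>\<^bsub>nat_hom R M (shift N s)\<^esub> \<alpha>') =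
      hom_comp M s \<beta> \<alpha> \<oplus>\<^bsub>nat_hom R M (shift K (s + t))\<^esub> hom_comp M s \<beta> \<alpha>'"
    by (rule PHom_eqI[of _ R M "shift K (s + t)"])
      (simp_all add: \<beta> hom_comp_PHom[OF assms(1) a \<beta>(1)] lin_hom_add[OF PHom_shift_lin_hom[OF \<beta>(1)]]
        PHom_shift_closed[OF \<alpha>(1)] PHom_shift_closed[OF \<alpha>(2)] add.assoc)
  show "hom_comp M s (\<beta> \<oplus>\<^bsub>nat_hom R N (shift K t)\<^esub> \<beta>') \<alpha> =
      hom_comp M s \<beta> \<alpha> \<oplus>\<^bsub>nat_hom R M (shift K (s + t))\<^esub> hom_comp M s \<beta>' \<alpha>"
    by (rule PHom_eqI[of _ R M "shift K (s + t)"])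
      (simp_all add: \<beta> hom_comp_PHom[OF assms(1) \<alpha>(1) b] PHom_shift_closed[OF \<alpha>(1)] add.assoc)
qed

lemma hom_comp_assoc:
  assumes "persistence_module R M" "persistence_module R N" "persistence_module R K" "persistence_module R L"
    and f: "f \<in> PHom R M (shift N s)" and g: "g \<in> PHom R N (shift K t)" and h: "h \<in> PHom R K (shift L v)"
  shows "hom_comp M (s + t) h (hom_comp M s g f) = hom_comp M s (hom_comp N t h g) f"
  by (rule PHom_eqI[OF hom_comp_PHom[OF assms(1) hom_comp_PHom[OF assms(1) f g refl] h refl]
        hom_comp_PHom[OF assms(1) f hom_comp_PHom[OF assms(2) g h refl]]])
    (simp_all add: PHom_shift_closed[OF f] add.assoc)

lemma hom_comp_id:
  assumes "persistence_module R M" "persistence_module R N" and f: "f \<in> PHom R M (shift N s)"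
  shows "hom_comp M 0 f (pm_id M) = f" "hom_comp M s (pm_id N) f = f"
proof -
  show "hom_comp M 0 f (pm_id M) = f"
    by (rule PHom_eqI[OF hom_comp_PHom[of R M _ M 0, OF assms(1) _ f] f]) (simp_all add: assms)
  show "hom_comp M s (pm_id N) f = f"
    by (rule PHom_eqI[OF hom_comp_PHom[OF assms(1) f, where t = 0] f])
      (simp_all add: assms PHom_shift_closed[OF f])
qed

section \<open>Functoriality of the internal hom\<close>

lemma ihom_PHom_eqI:
  assumes \<Phi>: "\<Phi> \<in> PHom R M (shift (ihom R N K) d)" and \<Psi>: "\<Psi> \<in> PHom R M (shift (ihom R N K) d)"
    and eq: "\<And>x m y n. m \<in> carrier (pobj M x) \<Longrightarrow> n \<in> carrier (pobj N y) \<Longrightarrow> \<Phi> x m y n = \<Psi> x m y n"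
  shows "\<Phi> = \<Psi>"
proof (rule PHom_eqI[OF \<Phi> \<Psi>])
  fix x m assume m: "m \<in> carrier (pobj M x)"
  have "\<Phi> x m \<in> PHom R N (shift K (x + d))" "\<Psi> x m \<in> PHom R N (shift K (x + d))"
    using PHom_shift_closed[OF \<Phi> m refl] PHom_shift_closed[OF \<Psi> m refl] by simp_all
  then show "\<Phi> x m = \<Psi> x m"
    by (rule PHom_eqI) (rule eq[OF m])
qed

lemma ihom_PHom_closed:
  assumes "\<Phi> \<in> PHom R M (shift (ihom R N K) d)" "m \<in> carrier (pobj M x)"
  shows "u = x + d \<Longrightarrow> \<Phi> x m \<in> PHom R N (shift K u)"
    and "n \<in> carrier (pobj N y) \<Longrightarrow> z = y + (x + d) \<Longrightarrow> \<Phi> x m y n \<in> carrier (pobj K z)"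
proof -
  have *: "\<Phi> x m \<in> PHom R N (shift K (x + d))" using PHom_shift_closed[OF assms refl] by simp
  then show "u = x + d \<Longrightarrow> \<Phi> x m \<in> PHom R N (shift K u)" by simp
  show "n \<in> carrier (pobj N y) \<Longrightarrow> z = y + (x + d) \<Longrightarrow> \<Phi> x m y n \<in> carrier (pobj K z)"
    by (rule PHom_shift_closed[OF *])
qed

lemma hom_ihom_map_apply [simp]:
  "\<phi> \<in> PHom R N (shift K s) \<Longrightarrow> n \<in> carrier (pobj N' x) \<Longrightarrow>
    hom_ihom_map R N N' K e \<psi> \<chi> s \<phi> x n = \<chi> (x + e + s) (\<phi> (x + e) (\<psi> x n))"
  by (simp add: hom_ihom_map_def)

text \<open>The value is a composite of homogeneous morphisms of degrees \<open>e\<close>,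
  \<open>s\<close> and \<open>d\<close>, which settles naturality and the total degree at
  once.\<close>

lemma hom_ihom_map_closed:
  assumes "persistence_module R N'"
    and \<psi>: "\<psi> \<in> PHom R N' (shift N e)" and \<chi>: "\<chi> \<in> PHom R K (shift K' d)"
    and \<phi>: "\<phi> \<in> PHom R N (shift K s)" and u: "u = s + (e + d)"
  shows "hom_ihom_map R N N' K e \<psi> \<chi> s \<phi> \<in> PHom R N' (shift K' u)"
proof -
  have "hom_comp N' (e + s) \<chi> (hom_comp N' e \<phi> \<psi>) \<in> PHom R N' (shift K' u)"
    by (rule hom_comp_PHom[OF assms(1) hom_comp_PHom[OF assms(1) \<psi> \<phi> refl] \<chi>]) (simp add: u ac_simps)
  moreover have "hom_ihom_map R N N' K e \<psi> \<chi> s \<phi> = hom_comp N' (e + s) \<chi> (hom_comp N' e \<phi> \<psi>)"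
    using \<phi> by (auto simp: hom_ihom_map_def hom_comp_def compose_def ac_simps fun_eq_iff)
  ultimately show ?thesis by simp
qed

text \<open>Linear in \<open>\<phi>\<close> because \<open>\<chi>\<close> is linear; natural in the
  degree \<open>s\<close> because \<open>\<chi>\<close> commutes with structure maps.\<close>

lemma hom_ihom_map_PHom:
  assumes [simp]: "persistence_module R N" "persistence_module R N'" "persistence_module R K" "persistence_module R K'"
    and \<psi>: "\<psi> \<in> PHom R N' (shift N e)" and \<chi>: "\<chi> \<in> PHom R K (shift K' d)" and u: "u = e + d"
  shows "hom_ihom_map R N N' K e \<psi> \<chi> \<in> PHom R (ihom R N K) (shift (ihom R N' K') u)"
proof (rule PHomI)
  let ?H = "hom_ihom_map R N N' K e \<psi> \<chi>"
  note cl = hom_ihom_map_closed[OF assms(2) \<psi> \<chi>]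
  note \<psi>cl = PHom_shift_closed[OF \<psi>]
  note \<chi>l = PHom_shift_lin_hom[OF \<chi>]
  fix s
  interpret S: module R "nat_hom R N (shift K s)" by simp
  have su: "s + (e + d) = s + u" by (simp add: u)
  show "?H s \<in> lin_hom R (pobj (ihom R N K) s) (pobj (shift (ihom R N' K') u) s)"
  proof (rule lin_homI)
    show "?H s \<in> carrier (pobj (ihom R N K) s) \<rightarrow>\<^sub>E carrier (pobj (shift (ihom R N' K') u) s)"
      using cl[of _ s "s + u"] by (intro PiE_I) (simp_all add: u hom_ihom_map_def)
  next
    fix \<phi> \<phi>' assume *: "\<phi> \<in> carrier (pobj (ihom R N K) s)" "\<phi>' \<in> carrier (pobj (ihom R N K) s)"
    then have [simp]: "\<phi> \<in> PHom R N (shift K s)" "\<phi>' \<in> PHom R N (shift K s)" by simp_all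
    show "?H s (\<phi> \<oplus>\<^bsub>pobj (ihom R N K) s\<^esub> \<phi>') = ?H s \<phi> \<oplus>\<^bsub>pobj (shift (ihom R N' K') u) s\<^esub> ?H s \<phi>'"
      by (rule PHom_eqI[of _ R N' "shift K' (s + u)"])
        (simp_all add: cl su \<psi>cl PHom_shift_closed[of \<phi>] PHom_shift_closed[of \<phi>']
          lin_hom_add[OF \<chi>l] PHom_shift_closed[OF \<open>\<phi> \<in> PHom R N (shift K s)\<close>]
          PHom_shift_closed[OF \<open>\<phi>' \<in> PHom R N (shift K s)\<close>] u ac_simps)
  next
    fix a \<phi> assume *: "a \<in> carrier R" "\<phi> \<in> carrier (pobj (ihom R N K) s)"
    then have [simp]: "\<phi> \<in> PHom R N (shift K s)" by simp
    have "a \<odot>\<^bsub>nat_hom R N (shift K s)\<^esub> \<phi> \<in> PHom R N (shift K s)" using * by simp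
    with * show "?H s (a \<odot>\<^bsub>pobj (ihom R N K) s\<^esub> \<phi>) = a \<odot>\<^bsub>pobj (shift (ihom R N' K') u) s\<^esub> ?H s \<phi>"
      by (intro PHom_eqI[of _ R N' "shift K' (s + u)"] )
        (simp_all add: cl su \<psi>cl module.smult_closed[OF nat_hom_module]
          lin_hom_smult[OF \<chi>l] PHom_shift_closed[OF \<open>\<phi> \<in> PHom R N (shift K s)\<close>] u ac_simps)
  qed
  fix t \<phi> assume st: "s \<le> t" and *: "\<phi> \<in> carrier (pobj (ihom R N K) s)"
  then have \<phi>: "\<phi> \<in> PHom R N (shift K s)" by simp
  have pc: "pmap (ihom R N K) s t \<phi> \<in> PHom R N (shift K t)"
    using pmap_closed[OF ihom_pers[OF assms(1,3)] st *] by simp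
  have su': "s + u \<le> t + u" by (rule add_mono_right[OF st])
  have Hc: "?H s \<phi> \<in> PHom R N' (shift K' (s + u))" by (rule cl[OF \<phi>]) (simp add: u)
  have pHc: "pmap (ihom R N' K') (s + u) (t + u) (?H s \<phi>) \<in> PHom R N' (shift K' (t + u))"
    using pmap_closed[OF ihom_pers[OF assms(2,4)] su'] Hc by simp
  have "pmap (ihom R N' K') (s + u) (t + u) (?H s \<phi>) = ?H t (pmap (ihom R N K) s t \<phi>)"
  proof (rule PHom_eqI[OF pHc cl[OF pc]])
    fix x n assume n: "n \<in> carrier (pobj N' x)"
    have le: "x + e + s \<le> x + e + t" by (rule add_mono_left[OF st])
    show "pmap (ihom R N' K') (s + u) (t + u) (?H s \<phi>) x n = ?H t (pmap (ihom R N K) s t \<phi>) x n"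
      using n \<phi> pc Hc PHom_shift_pmap[OF \<chi> le] PHom_shift_closed[OF \<phi> \<psi>cl[OF n refl] refl]
      by (simp add: \<psi>cl u ac_simps)
  qed (simp add: u)
  then show "pmap (shift (ihom R N' K') u) s t (?H s \<phi>) = ?H t (pmap (ihom R N K) s t \<phi>)"
    by simp
qed

lemma hom_ihom_map_id:
  assumes [simp]: "persistence_module R N" "persistence_module R K"
  shows "hom_ihom_map R N N K 0 (pm_id N) (pm_id K) = pm_id (ihom R N K)"
  by (rule ihom_PHom_eqI[of _ R "ihom R N K" N K 0])
    (use hom_ihom_map_PHom[of R N N K K "pm_id N" 0 "pm_id K" 0 0] in \<open>simp_all add: PHom_shift_closed\<close>)

text \<open>The first argument is contravariant: the composite of \<open>g'\<close> and
  \<open>g\<close> runs from \<open>N''\<close> to \<open>N\<close>, while the induced maps are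
  applied in the order \<open>g\<close>, \<open>g'\<close>.\<close>

lemma hom_ihom_map_comp:
  assumes [simp]: "persistence_module R N" "persistence_module R N'" "persistence_module R N''"
      "persistence_module R K" "persistence_module R K'" "persistence_module R K''"
    and g: "g \<in> PHom R N' (shift N e)" and g': "g' \<in> PHom R N'' (shift N' e')"
    and h: "h \<in> PHom R K (shift K' d)" and h': "h' \<in> PHom R K' (shift K'' d')"
  shows "hom_ihom_map R N N'' K (e' + e) (hom_comp N'' e' g g') (hom_comp K d h' h) =
    hom_comp (ihom R N K) (e + d) (hom_ihom_map R N' N'' K' e' g' h') (hom_ihom_map R N N' K e g h)"
proof (rule ihom_PHom_eqI)
  have c: "hom_comp N'' e' g g' \<in> PHom R N'' (shift N (e' + e))" "hom_comp K d h' h \<in> PHom R K (shift K'' (d + d'))"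
    by (rule hom_comp_PHom[OF _ g' g refl] hom_comp_PHom[OF _ h h' refl], simp)+
  show "hom_ihom_map R N N'' K (e' + e) (hom_comp N'' e' g g') (hom_comp K d h' h)
      \<in> PHom R (ihom R N K) (shift (ihom R N'' K'') (e + d + (e' + d')))"
    by (rule hom_ihom_map_PHom[OF _ _ _ _ c]) (simp_all add: ac_simps)
  note H = hom_ihom_map_PHom[OF _ _ _ _ g h refl]
  show "hom_comp (ihom R N K) (e + d) (hom_ihom_map R N' N'' K' e' g' h') (hom_ihom_map R N N' K e g h)
      \<in> PHom R (ihom R N K) (shift (ihom R N'' K'') (e + d + (e' + d')))"
    by (rule hom_comp_PHom[OF _ H hom_ihom_map_PHom[OF _ _ _ _ g' h' refl] refl]) simp_all
  fix s \<phi> x n assume "\<phi> \<in> carrier (pobj (ihom R N K) s)" and n: "n \<in> carrier (pobj N'' x)"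
  then have \<phi>: "\<phi> \<in> PHom R N (shift K s)" by simp
  have H\<phi>: "hom_ihom_map R N N' K e g h s \<phi> \<in> PHom R N' (shift K' (s + (e + d)))"
    by (rule hom_ihom_map_closed[OF _ g h \<phi> refl]) simp
  show "hom_ihom_map R N N'' K (e' + e) (hom_comp N'' e' g g') (hom_comp K d h' h) s \<phi> x n =
      hom_comp (ihom R N K) (e + d) (hom_ihom_map R N' N'' K' e' g' h') (hom_ihom_map R N N' K e g h) s \<phi> x n"
    using n \<phi> H\<phi> by (simp add: PHom_shift_closed[OF g'] PHom_shift_closed[OF g] PHom_shift_closed[OF \<phi>] ac_simps)
qed

lemma hom_ihom_map_add:
  assumes [simp]: "persistence_module R N" "persistence_module R N'" "persistence_module R K" "persistence_module R K'"
    and g: "g \<in> PHom R N' (shift N e)" "g' \<in> PHom R N' (shift N e)"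
    and h: "h \<in> PHom R K (shift K' d)" "h' \<in> PHom R K (shift K' d)"
  shows "hom_ihom_map R N N' K e (g \<oplus>\<^bsub>nat_hom R N' (shift N e)\<^esub> g') h =
      hom_ihom_map R N N' K e g h \<oplus>\<^bsub>nat_hom R (ihom R N K) (shift (ihom R N' K') (e + d))\<^esub>
      hom_ihom_map R N N' K e g' h" (is "?l = ?r")
    and "hom_ihom_map R N N' K e g (h \<oplus>\<^bsub>nat_hom R K (shift K' d)\<^esub> h') =
      hom_ihom_map R N N' K e g h \<oplus>\<^bsub>nat_hom R (ihom R N K) (shift (ihom R N' K') (e + d))\<^esub>
      hom_ihom_map R N N' K e g h'" (is "?l' = ?r'")
proof -
  have gg: "g \<oplus>\<^bsub>nat_hom R N' (shift N e)\<^esub> g' \<in> PHom R N' (shift N e)"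
    and hh: "h \<oplus>\<^bsub>nat_hom R K (shift K' d)\<^esub> h' \<in> PHom R K (shift K' d)" using g h by simp_all
  note P = hom_ihom_map_PHom[OF assms(1-4) _ _ refl]
  note [simp] = P[OF g(1) h(1)] P[OF g(2) h(1)] P[OF g(1) h(2)] P[OF gg h(1)] P[OF g(1) hh]
  show "?l = ?r"
  proof (rule ihom_PHom_eqI[of _ R _ N' K' "e + d"])
    fix s \<phi> x n assume \<phi>: "\<phi> \<in> carrier (pobj (ihom R N K) s)" and n: "n \<in> carrier (pobj N' x)"
    then have \<phi>': "\<phi> \<in> PHom R N (shift K s)" by simp
    show "?l s \<phi> x n = ?r s \<phi> x n"
      using \<phi> \<phi>' n by (simp add: PHom_shift_closed[OF g(1)] PHom_shift_closed[OF g(2)] PHom_shift_closed[OF \<phi>']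
          lin_hom_add[OF PHom_shift_lin_hom[OF \<phi>']] lin_hom_add[OF PHom_shift_lin_hom[OF h(1)]] ac_simps)
  qed simp_all
  show "?l' = ?r'"
  proof (rule ihom_PHom_eqI[of _ R _ N' K' "e + d"])
    fix s \<phi> x n assume \<phi>: "\<phi> \<in> carrier (pobj (ihom R N K) s)" and n: "n \<in> carrier (pobj N' x)"
    then have \<phi>': "\<phi> \<in> PHom R N (shift K s)" by simp
    show "?l' s \<phi> x n = ?r' s \<phi> x n"
      using \<phi> \<phi>' n by (simp add: PHom_shift_closed[OF g(1)] PHom_shift_closed[OF \<phi>'] ac_simps)
  qed simp_all
qed

subsection \<open>Currying\<close>

context
  fixes R :: "('r, 'm) ring_scheme"
    and M :: "('p::preordered_ab_group_add, 'r, 'a) pers" and N :: "('p, 'r, 'b) pers"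
    and K :: "('p, 'r, 'c) pers"
  assumes M [simp]: "persistence_module R M" and N [simp]: "persistence_module R N"
    and K [simp]: "persistence_module R K"
begin

lemma ihom_curry_apply [simp]:
  "\<phi> \<in> PHom R (M \<boxtimes>\<^bsub>R\<^esub> N) (shift K s) \<Longrightarrow> m \<in> carrier (pobj M x) \<Longrightarrow> n \<in> carrier (pobj N y) \<Longrightarrow>
    ihom_curry R M N K s \<phi> x m y n = \<phi> (x + y) (gr_elt R M N (x + y) x y m n)"
  by (simp add: ihom_curry_def)

text \<open>For fixed \<open>m\<close> the value is \<open>\<phi>\<close> composed with
  \<open>n \<mapsto> m \<otimes> n\<close>, hence homogeneous as a composite.\<close>

lemma ihom_curry_inner_closed:
  assumes \<phi>: "\<phi> \<in> PHom R (M \<boxtimes>\<^bsub>R\<^esub> N) (shift K s)" and m: "m \<in> carrier (pobj M x)"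
  shows "ihom_curry R M N K s \<phi> x m \<in> PHom R N (shift K (x + s))"
proof -
  have "ihom_curry R M N K s \<phi> x m = hom_comp N x \<phi> (tensor_left R M N x m)"
    using assms by (auto simp: ihom_curry_def hom_comp_def tensor_left_def compose_def fun_eq_iff)
  then show ?thesis
    using hom_comp_PHom[OF N tensor_left_PHom[OF M N m] \<phi> refl] by simp
qed

lemma ihom_curry_closed:
  assumes \<phi>: "\<phi> \<in> PHom R (M \<boxtimes>\<^bsub>R\<^esub> N) (shift K s)"
  shows "ihom_curry R M N K s \<phi> \<in> PHom R M (shift (ihom R N K) s)"
proof (rule PHomI)
  let ?C = "ihom_curry R M N K s \<phi>"
  note cl = ihom_curry_inner_closed[OF \<phi>]
  note l = PHom_shift_lin_hom[OF \<phi>]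
  fix x
  interpret Mx: module R "pobj M x" by (rule pers_module[OF M])
  note b = bilinear_mapD[OF gr_elt_bilinear[OF M N order_refl]]
  have e: "y + (x + s) = x + y + s" for y by (simp add: ac_simps)
  show "?C x \<in> lin_hom R (pobj M x) (pobj (shift (ihom R N K) s) x)"
  proof (rule lin_homI)
    show "?C x \<in> carrier (pobj M x) \<rightarrow>\<^sub>E carrier (pobj (shift (ihom R N K) s) x)"
      using cl \<phi> by (intro PiE_I) (simp_all add: ihom_curry_def)
  next
    fix m m' assume m: "m \<in> carrier (pobj M x)" "m' \<in> carrier (pobj M x)"
    show "?C x (m \<oplus>\<^bsub>pobj M x\<^esub> m') = ?C x m \<oplus>\<^bsub>pobj (shift (ihom R N K) s) x\<^esub> ?C x m'"
      by (rule PHom_eqI[of _ R N "shift K (x + s)"])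
        (simp_all add: m cl \<phi> b(2) lin_hom_add[OF l] e)
  next
    fix a m assume m: "a \<in> carrier R" "m \<in> carrier (pobj M x)"
    show "?C x (a \<odot>\<^bsub>pobj M x\<^esub> m) = a \<odot>\<^bsub>pobj (shift (ihom R N K) s) x\<^esub> ?C x m"
      by (rule PHom_eqI[of _ R N "shift K (x + s)"])
        (simp_all add: m cl \<phi> b(4) lin_hom_smult[OF l] module.smult_closed[OF nat_hom_module] e)
  qed
  fix x' m assume x: "x \<le> x'" and m: "m \<in> carrier (pobj M x)"
  have m': "pmap M x x' m \<in> carrier (pobj M x')" using x m by (simp add: pmap_closed[OF M])
  have xs: "x + s \<le> x' + s" by (rule add_mono_right[OF x])
  have "pmap (ihom R N K) (x + s) (x' + s) (?C x m) = ?C x' (pmap M x x' m)"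
  proof (rule PHom_eqI[OF _ cl[OF m']])
    show "pmap (ihom R N K) (x + s) (x' + s) (?C x m) \<in> PHom R N (shift K (x' + s))"
      using pmap_closed[OF ihom_pers[OF N K] xs] cl[OF m] by simp
    fix y n assume n: "n \<in> carrier (pobj N y)"
    have le: "x + y \<le> x' + y" by (rule add_mono_right[OF x])
    \<comment> \<open>Raising \<open>m\<close> to \<open>x'\<close> does not change its pure tensor
      in degree \<open>x' + y\<close>, and this tensor is also the structure-map image of the one in
      degree \<open>x + y\<close>. Naturality of \<open>\<phi>\<close> then applies.\<close>
    have "gr_elt R M N (x' + y) x' y (pmap M x x' m) n = gr_elt R M N (x' + y) x y m n"
      using gr_elt_trans[OF M N x order_refl order_refl m n] by (simp add: pmap_refl[OF N n])
    also have "\<dots> = pmap (M \<boxtimes>\<^bsub>R\<^esub> N) (x + y) (x' + y) (gr_elt R M N (x + y) x y m n)"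
      using le m n by simp
    finally have "?C x' (pmap M x x' m) y n =
        pmap K (x + y + s) (x' + y + s) (\<phi> (x + y) (gr_elt R M N (x + y) x y m n))"
      using \<phi> m' n m le PHom_shift_pmap[OF \<phi> le] by (simp del: pmap_gr_elt)
    then show "pmap (ihom R N K) (x + s) (x' + s) (?C x m) y n = ?C x' (pmap M x x' m) y n"
      using cl[OF m] \<phi> m n by (simp add: ac_simps)
  qed
  then show "pmap (shift (ihom R N K) s) x x' (?C x m) = ?C x' (pmap M x x' m)" by simp
qed

lemma ihom_curry_inj: "inj_on (ihom_curry R M N K s) (PHom R (M \<boxtimes>\<^bsub>R\<^esub> N) (shift K s))"
proof (rule inj_onI)
  fix \<phi> \<psi> assume \<phi>: "\<phi> \<in> PHom R (M \<boxtimes>\<^bsub>R\<^esub> N) (shift K s)" and \<psi>: "\<psi> \<in> PHom R (M \<boxtimes>\<^bsub>R\<^esub> N) (shift K s)"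
    and eq: "ihom_curry R M N K s \<phi> = ihom_curry R M N K s \<psi>"
  show "\<phi> = \<psi>"
  proof (rule gr_tensor_PHom_eqI[OF M N _ \<phi> \<psi>])
    fix x y m n assume "m \<in> carrier (pobj M x)" "n \<in> carrier (pobj N y)"
    then show "\<phi> (x + y) (gr_elt R M N (x + y) x y m n) = \<psi> (x + y) (gr_elt R M N (x + y) x y m n)"
      using ihom_curry_apply[OF \<phi>] ihom_curry_apply[OF \<psi>] eq by metis
  qed simp
qed

text \<open>The preimage sends \<open>m \<otimes> n\<close> at indices \<open>(x, y)\<close>, seen
  in degree \<open>r\<close>, to \<open>\<psi> x m y n\<close> pushed forward from degree
  \<open>x + y + s\<close> to degree \<open>r + s\<close>.\<close>

lemma ihom_curry_surj:
  assumes \<psi>: "\<psi> \<in> PHom R M (shift (ihom R N K) s)"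
  obtains \<phi> where "\<phi> \<in> PHom R (M \<boxtimes>\<^bsub>R\<^esub> N) (shift K s)" "ihom_curry R M N K s \<phi> = \<psi>"
proof -
  let ?b = "\<lambda>r x y m n. pmap K (x + y + s) (r + s) (\<psi> x m y n)"
  have \<psi>in: "\<psi> x m \<in> PHom R N (shift K (x + s))" if "m \<in> carrier (pobj M x)" for x m
    by (rule ihom_PHom_closed(1)[OF \<psi> that refl])
  have \<psi>cl: "\<psi> x m y n \<in> carrier (pobj K (x + y + s))"
    if "m \<in> carrier (pobj M x)" "n \<in> carrier (pobj N y)" for x m y n
    by (rule ihom_PHom_closed(2)[OF \<psi> that]) (simp add: ac_simps)
  have bal: "balanced R M N r (pobj K (r + s)) (?b r)" for r
  proof (rule balancedI)
    fix x y :: 'p assume xy: "x + y \<le> r"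
    note p = pmap_lin_hom[OF K add_mono_right[OF xy, of s]]
    have e: "y + (x + s) = x + y + s" by (simp add: ac_simps)
    note l = PHom_shift_lin_hom[OF \<psi>in, of _ x y, unfolded e]
    note l' = PHom_shift_lin_hom[OF \<psi>, of x]
    show "bilinear_map R (pobj M x) (pobj N y) (pobj K (r + s)) (?b r x y)"
      by (rule bilinear_mapI)
        (simp_all add: lin_hom_closed[OF p] lin_hom_add[OF p] lin_hom_smult[OF p] \<psi>cl
          lin_hom_add[OF l] lin_hom_smult[OF l] lin_hom_add[OF l'] lin_hom_smult[OF l'] e)
  next
    fix x x' y y' :: 'p and m n
    assume xy: "x \<le> x'" "y \<le> y'" "x' + y' \<le> r" and m: "m \<in> carrier (pobj M x)" and n: "n \<in> carrier (pobj N y)"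
    have n': "pmap N y y' n \<in> carrier (pobj N y')" using n xy by (simp add: pmap_closed[OF N])
    have le: "x + y + s \<le> x + y' + s" "x + y' + s \<le> x' + y' + s" "x' + y' + s \<le> r + s"
      using xy by (auto intro: add_mono_left add_mono_right)
    \<comment> \<open>Two naturalities are combined: that of \<open>\<psi>\<close> moves
      \<open>x\<close> to \<open>x'\<close>, that of the single transformation
      \<open>\<psi> x m\<close> moves \<open>y\<close> to \<open>y'\<close>.\<close>
    have "\<psi> x' (pmap M x x' m) = pmap (ihom R N K) (x + s) (x' + s) (\<psi> x m)"
      by (rule PHom_shift_pmap[OF \<psi> xy(1) m])
    then have "\<psi> x' (pmap M x x' m) y' (pmap N y y' n) =
        pmap K (x + y' + s) (x' + y' + s) (\<psi> x m y' (pmap N y y' n))"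
      using \<psi>in[OF m] n' by (simp add: ac_simps)
    also have "\<psi> x m y' (pmap N y y' n) = pmap K (x + y + s) (x + y' + s) (\<psi> x m y n)"
      using PHom_shift_pmap[OF \<psi>in[OF m] xy(2) n] by (simp add: ac_simps)
    finally have "\<psi> x' (pmap M x x' m) y' (pmap N y y' n) = pmap K (x + y + s) (x' + y' + s) (\<psi> x m y n)"
      using pmap_trans[OF K le(1,2) \<psi>cl[OF m n]] by simp
    then show "?b r x' y' (pmap M x x' m) (pmap N y y' n) = ?b r x y m n"
      using pmap_trans[OF K order_trans[OF le(1,2)] le(3) \<psi>cl[OF m n]] by simp
  qed
  let ?\<phi> = "\<lambda>r. gr_desc R M N r (pobj K (r + s)) (?b r)"
  have "(\<lambda>r. gr_desc R M N r (pobj (shift K s) r) (?b r)) \<in> PHom R (M \<boxtimes>\<^bsub>R\<^esub> N) (shift K s)"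
    using bal by (intro gr_desc_PHom) (simp_all add: pmap_trans[OF K] add_mono_right \<psi>cl)
  then have \<phi>: "?\<phi> \<in> PHom R (M \<boxtimes>\<^bsub>R\<^esub> N) (shift K s)" by simp
  \<comment> \<open>In the least degree \<open>r = x + y\<close> the push-forward inside
    \<open>?b\<close> is the identity.\<close>
  have elt: "?\<phi> (x + y) (gr_elt R M N (x + y) x y m n) = \<psi> x m y n"
    if "m \<in> carrier (pobj M x)" "n \<in> carrier (pobj N y)" for x y m n
    using that by (simp add: gr_desc_elt[OF M N pers_module[OF K] bal] pmap_refl[OF K] \<psi>cl)
  have "ihom_curry R M N K s ?\<phi> = \<psi>"
    by (rule ihom_PHom_eqI[OF ihom_curry_closed[OF \<phi>] \<psi>]) (simp add: \<phi> elt)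
  with \<phi> show thesis by (rule that)
qed

lemma ihom_curry_bij:
  "bij_betw (ihom_curry R M N K s) (PHom R (M \<boxtimes>\<^bsub>R\<^esub> N) (shift K s)) (PHom R M (shift (ihom R N K) s))"
proof (intro bij_betw_imageI ihom_curry_inj equalityI subsetI)
  fix \<psi> assume "\<psi> \<in> PHom R M (shift (ihom R N K) s)"
  then obtain \<phi> where "\<phi> \<in> PHom R (M \<boxtimes>\<^bsub>R\<^esub> N) (shift K s)" "ihom_curry R M N K s \<phi> = \<psi>"
    by (rule ihom_curry_surj)
  then show "\<psi> \<in> ihom_curry R M N K s ` PHom R (M \<boxtimes>\<^bsub>R\<^esub> N) (shift K s)" by auto
qed (auto simp: ihom_curry_closed)

lemma ihom_curry_add:
  assumes "\<phi> \<in> PHom R (M \<boxtimes>\<^bsub>R\<^esub> N) (shift K s)" "\<phi>' \<in> PHom R (M \<boxtimes>\<^bsub>R\<^esub> N) (shift K s)"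
  shows "ihom_curry R M N K s (\<phi> \<oplus>\<^bsub>nat_hom R (M \<boxtimes>\<^bsub>R\<^esub> N) (shift K s)\<^esub> \<phi>') =
    ihom_curry R M N K s \<phi> \<oplus>\<^bsub>nat_hom R M (shift (ihom R N K) s)\<^esub> ihom_curry R M N K s \<phi>'"
proof (rule ihom_PHom_eqI)
  have s: "\<phi> \<oplus>\<^bsub>nat_hom R (M \<boxtimes>\<^bsub>R\<^esub> N) (shift K s)\<^esub> \<phi>' \<in> PHom R (M \<boxtimes>\<^bsub>R\<^esub> N) (shift K s)"
    using assms by simp
  then show "ihom_curry R M N K s (\<phi> \<oplus>\<^bsub>nat_hom R (M \<boxtimes>\<^bsub>R\<^esub> N) (shift K s)\<^esub> \<phi>') \<in> PHom R M (shift (ihom R N K) s)"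
    by (rule ihom_curry_closed)
  show "ihom_curry R M N K s \<phi> \<oplus>\<^bsub>nat_hom R M (shift (ihom R N K) s)\<^esub> ihom_curry R M N K s \<phi>' \<in> PHom R M (shift (ihom R N K) s)"
    using assms by (simp add: ihom_curry_closed)
  fix x m y n assume "m \<in> carrier (pobj M x)" "n \<in> carrier (pobj N y)"
  then show "ihom_curry R M N K s (\<phi> \<oplus>\<^bsub>nat_hom R (M \<boxtimes>\<^bsub>R\<^esub> N) (shift K s)\<^esub> \<phi>') x m y n =
    (ihom_curry R M N K s \<phi> \<oplus>\<^bsub>nat_hom R M (shift (ihom R N K) s)\<^esub> ihom_curry R M N K s \<phi>') x m y n"
    using s assms by (simp add: ac_simps)
qed

lemma ihom_curry_PHom: "ihom_curry R M N K \<in> PHom R (ihom R (M \<boxtimes>\<^bsub>R\<^esub> N) K) (ihom R M (ihom R N K))"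
proof (rule PHomI)
  let ?A = "ihom R (M \<boxtimes>\<^bsub>R\<^esub> N) K" and ?B = "ihom R M (ihom R N K)" and ?C = "ihom_curry R M N K"
  fix s
  interpret A: module R "nat_hom R (M \<boxtimes>\<^bsub>R\<^esub> N) (shift K s)" by simp
  interpret B: module R "nat_hom R M (shift (ihom R N K) s)" by simp
  show "?C s \<in> lin_hom R (pobj ?A s) (pobj ?B s)"
  proof (rule lin_homI)
    show "?C s \<in> carrier (pobj ?A s) \<rightarrow>\<^sub>E carrier (pobj ?B s)"
      using ihom_curry_closed by (intro PiE_I) (simp_all add: ihom_curry_def)
  next
    fix a \<phi> assume *: "a \<in> carrier R" "\<phi> \<in> carrier (pobj ?A s)"
    then have c: "\<phi> \<in> PHom R (M \<boxtimes>\<^bsub>R\<^esub> N) (shift K s)"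
      "a \<odot>\<^bsub>nat_hom R (M \<boxtimes>\<^bsub>R\<^esub> N) (shift K s)\<^esub> \<phi> \<in> PHom R (M \<boxtimes>\<^bsub>R\<^esub> N) (shift K s)" by simp_all
    show "?C s (a \<odot>\<^bsub>pobj ?A s\<^esub> \<phi>) = a \<odot>\<^bsub>pobj ?B s\<^esub> ?C s \<phi>"
    proof (rule ihom_PHom_eqI[of _ R M N K s])
      show "?C s (a \<odot>\<^bsub>pobj ?A s\<^esub> \<phi>) \<in> PHom R M (shift (ihom R N K) s)"
        using ihom_curry_closed[OF c(2)] by simp
      show "a \<odot>\<^bsub>pobj ?B s\<^esub> ?C s \<phi> \<in> PHom R M (shift (ihom R N K) s)"
        using ihom_curry_closed[OF c(1)] *(1) by simp
    qed (use c in \<open>simp add: ac_simps\<close>)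
  qed (simp add: ihom_curry_add)
  fix t \<phi> assume st: "s \<le> t" and \<phi>A: "\<phi> \<in> carrier (pobj ?A s)"
  then have \<phi>: "\<phi> \<in> PHom R (M \<boxtimes>\<^bsub>R\<^esub> N) (shift K s)" by simp
  have p\<phi>: "pmap ?A s t \<phi> \<in> PHom R (M \<boxtimes>\<^bsub>R\<^esub> N) (shift K t)"
    using pmap_closed[OF ihom_pers[OF gr_tensor_pers[OF M N] K] st \<phi>A] by simp
  have C\<phi>: "?C s \<phi> \<in> PHom R M (shift (ihom R N K) s)" by (rule ihom_curry_closed[OF \<phi>])
  show "pmap ?B s t (?C s \<phi>) = ?C t (pmap ?A s t \<phi>)"
  proof (rule ihom_PHom_eqI[OF _ ihom_curry_closed[OF p\<phi>]])
    show "pmap ?B s t (?C s \<phi>) \<in> PHom R M (shift (ihom R N K) t)"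
      using pmap_closed[OF ihom_pers[OF M ihom_pers[OF N K]] st] C\<phi> by simp
    fix x m y n assume m: "m \<in> carrier (pobj M x)" and n: "n \<in> carrier (pobj N y)"
    then show "pmap ?B s t (?C s \<phi>) x m y n = ?C t (pmap ?A s t \<phi>) x m y n"
      using \<phi> p\<phi> C\<phi> ihom_curry_inner_closed[OF \<phi> m] by (simp add: ac_simps)
  qed
qed

text \<open>The inverse of currying need not be described: bijectivity in each degree makes it
  linear and natural.\<close>

lemma ihom_curry_iso: "pm_iso R (ihom R (M \<boxtimes>\<^bsub>R\<^esub> N) K) (ihom R M (ihom R N K)) (ihom_curry R M N K)"
  using ihom_curry_bij by (intro pm_iso_bij ihom_curry_PHom) simp_all

end

text \<open>The one computation behind both naturality statements that follow: the two sides are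
  \<open>h\<close> applied to the value of \<open>\<phi>\<close> at
  \<open>f m \<otimes> g n\<close>, written with differently arranged degrees.\<close>

lemma ihom_curry_natural:
  assumes [simp]: "persistence_module R M" "persistence_module R N" "persistence_module R K"
      "persistence_module R M'" "persistence_module R N'" "persistence_module R K'"
    and f: "f \<in> PHom R M' (shift M a)" and g: "g \<in> PHom R N' (shift N b)" and h: "h \<in> PHom R K (shift K' d)"
    and \<phi>: "\<phi> \<in> PHom R (M \<boxtimes>\<^bsub>R\<^esub> N) (shift K s)"
    and m: "m \<in> carrier (pobj M' x)" and n: "n \<in> carrier (pobj N' y)"
  shows "h (x + y + (a + b) + s) (\<phi> (x + y + (a + b)) (hom_tensor_map R M' N' M N a b f g (x + y) (gr_elt R M' N' (x + y) x y m n))) =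
    h (y + b + (x + a + s)) (ihom_curry R M N K s \<phi> (x + a) (f x m) (y + b) (g y n))"
  using m n \<phi> by (simp add: hom_tensor_map_elt[OF _ _ _ _ f g] PHom_shift_closed[OF f] PHom_shift_closed[OF g] ac_simps)

text \<open>Three layers of evaluation are peeled off, at \<open>\<phi>\<close>, at \<open>m\<close>
  and at \<open>n\<close>; closure of each intermediate value has to be known before the next layer
  can be evaluated.\<close>

lemma ihom_curry_ihom_natural:
  assumes [simp]: "persistence_module R M" "persistence_module R N" "persistence_module R K"
      "persistence_module R M'" "persistence_module R N'" "persistence_module R K'"
    and f: "f \<in> PHom R M' (shift M a)" and g: "g \<in> PHom R N' (shift N b)" and h: "h \<in> PHom R K (shift K' d)"
  shows "hom_comp (ihom R (M \<boxtimes>\<^bsub>R\<^esub> N) K) 0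
      (hom_ihom_map R M M' (ihom R N K) a f (hom_ihom_map R N N' K b g h)) (ihom_curry R M N K) =
    hom_comp (ihom R (M \<boxtimes>\<^bsub>R\<^esub> N) K) (a + b + d) (ihom_curry R M' N' K')
      (hom_ihom_map R (M \<boxtimes>\<^bsub>R\<^esub> N) (M' \<boxtimes>\<^bsub>R\<^esub> N') K (a + b) (hom_tensor_map R M' N' M N a b f g) h)" (is "?L = ?R")
proof -
  let ?A = "ihom R (M \<boxtimes>\<^bsub>R\<^esub> N) K" and ?B = "ihom R M' (ihom R N' K')"
  note fg = hom_tensor_map_PHom[OF _ _ _ _ f g refl]
  note gh = hom_ihom_map_PHom[OF _ _ _ _ g h refl]
  have L: "?L \<in> PHom R ?A (shift ?B (a + b + d))"
  proof (rule hom_comp_PHom)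
    show "ihom_curry R M N K \<in> PHom R ?A (shift (ihom R M (ihom R N K)) 0)" by (simp add: ihom_curry_PHom)
    show "hom_ihom_map R M M' (ihom R N K) a f (hom_ihom_map R N N' K b g h) \<in>
        PHom R (ihom R M (ihom R N K)) (shift ?B (a + (b + d)))"
      by (rule hom_ihom_map_PHom[OF _ _ _ _ f gh refl]) simp_all
  qed (simp_all add: add.assoc)
  have R: "?R \<in> PHom R ?A (shift ?B (a + b + d))"
    by (rule hom_comp_PHom[OF _ hom_ihom_map_PHom[OF _ _ _ _ fg h refl], where t = 0])
      (simp_all add: ihom_curry_PHom)
  show ?thesis
  proof (rule PHom_eqI[OF L R])
    fix s \<phi> assume \<phi>A: "\<phi> \<in> carrier (pobj ?A s)"
    then have \<phi>: "\<phi> \<in> PHom R (M \<boxtimes>\<^bsub>R\<^esub> N) (shift K s)" by simp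
    have L\<phi>: "?L s \<phi> \<in> PHom R M' (shift (ihom R N' K') (s + (a + b + d)))"
      and R\<phi>: "?R s \<phi> \<in> PHom R M' (shift (ihom R N' K') (s + (a + b + d)))"
      using PHom_shift_closed[OF L \<phi>A refl] PHom_shift_closed[OF R \<phi>A refl] by simp_all
    show "?L s \<phi> = ?R s \<phi>"
    proof (rule ihom_PHom_eqI[OF L\<phi> R\<phi>])
      fix x m y n assume m: "m \<in> carrier (pobj M' x)" and n: "n \<in> carrier (pobj N' y)"
      have C: "ihom_curry R M N K s \<phi> \<in> PHom R M (shift (ihom R N K) s)"
        by (rule ihom_curry_closed[OF _ _ _ \<phi>]) simp_all
      have fm: "f x m \<in> carrier (pobj M (x + a))" by (rule PHom_shift_closed[OF f m refl])
      have C': "ihom_curry R M N K s \<phi> (x + a) (f x m) \<in> PHom R N (shift K (x + a + s))"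
        by (rule ihom_PHom_closed(1)[OF C fm refl])
      have H: "hom_ihom_map R (M \<boxtimes>\<^bsub>R\<^esub> N) (M' \<boxtimes>\<^bsub>R\<^esub> N') K (a + b) (hom_tensor_map R M' N' M N a b f g) h s \<phi>
          \<in> PHom R (M' \<boxtimes>\<^bsub>R\<^esub> N') (shift K' (s + (a + b + d)))"
        by (rule hom_ihom_map_closed[OF _ fg h \<phi> refl]) simp_all
      \<comment> \<open>Currying stays folded, as in the right-hand side of
        \<open>ihom_curry_natural\<close>.\<close>
      have "?L s \<phi> x m y n = h (y + b + (x + a + s)) (ihom_curry R M N K s \<phi> (x + a) (f x m) (y + b) (g y n))"
        using \<phi>A C C' m n by (simp del: ihom_curry_apply)
      moreover have "?R s \<phi> x m y n = h (x + y + (a + b) + s) (\<phi> (x + y + (a + b)) (hom_tensor_map R M' N' M N a b f g (x + y) (gr_elt R M' N' (x + y) x y m n)))"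
        using \<phi>A \<phi> H m n by simp
      ultimately show "?L s \<phi> x m y n = ?R s \<phi> x m y n"
        using ihom_curry_natural[OF assms(1-9) \<phi> m n] by simp
    qed
  qed
qed

text \<open>The same evaluation for a single \<open>\<phi>\<close> of degree \<open>s\<close>, whose
  degree now enters the total: \<open>a + b + s + d\<close> on one side,
  \<open>a + s + (b + d)\<close> on the other.\<close>

lemma ihom_curry_adj_natural:
  assumes [simp]: "persistence_module R M" "persistence_module R N" "persistence_module R K"
      "persistence_module R M'" "persistence_module R N'" "persistence_module R K'"
    and f: "f \<in> PHom R M' (shift M a)" and g: "g \<in> PHom R N' (shift N b)" and h: "h \<in> PHom R K (shift K' d)"
    and \<phi>: "\<phi> \<in> PHom R (M \<boxtimes>\<^bsub>R\<^esub> N) (shift K s)"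
  shows "ihom_curry R M' N' K' (a + b + s + d)
      (hom_comp (M' \<boxtimes>\<^bsub>R\<^esub> N') (a + b + s) h (hom_comp (M' \<boxtimes>\<^bsub>R\<^esub> N') (a + b) \<phi> (hom_tensor_map R M' N' M N a b f g))) =
    hom_comp M' (a + s) (hom_ihom_map R N N' K b g h) (hom_comp M' a (ihom_curry R M N K s \<phi>) f)" (is "?L = ?R")
proof -
  note fg = hom_tensor_map_PHom[OF _ _ _ _ f g refl]
  let ?T = "hom_comp (M' \<boxtimes>\<^bsub>R\<^esub> N') (a + b + s) h (hom_comp (M' \<boxtimes>\<^bsub>R\<^esub> N') (a + b) \<phi> (hom_tensor_map R M' N' M N a b f g))"
  have T: "?T \<in> PHom R (M' \<boxtimes>\<^bsub>R\<^esub> N') (shift K' (a + b + s + d))"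
    by (rule hom_comp_PHom[OF _ hom_comp_PHom[OF _ fg \<phi> refl] h refl]) simp_all
  have C: "ihom_curry R M N K s \<phi> \<in> PHom R M (shift (ihom R N K) s)"
    by (rule ihom_curry_closed[OF _ _ _ \<phi>]) simp_all
  have L: "?L \<in> PHom R M' (shift (ihom R N' K') (a + b + s + d))"
    by (rule ihom_curry_closed[OF _ _ _ T]) simp_all
  have R: "?R \<in> PHom R M' (shift (ihom R N' K') (a + b + s + d))"
    by (rule hom_comp_PHom[OF _ hom_comp_PHom[OF _ f C refl] hom_ihom_map_PHom[OF _ _ _ _ g h refl]])
      (simp_all add: ac_simps)
  show ?thesis
  proof (rule ihom_PHom_eqI[OF L R])
    fix x m y n assume m: "m \<in> carrier (pobj M' x)" and n: "n \<in> carrier (pobj N' y)"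
    have fm: "f x m \<in> carrier (pobj M (x + a))" by (rule PHom_shift_closed[OF f m refl])
    have C': "ihom_curry R M N K s \<phi> (x + a) (f x m) \<in> PHom R N (shift K (x + (a + s)))"
      by (rule ihom_PHom_closed(1)[OF C fm]) (simp add: add.assoc)
    have "?R x m y n = h (y + b + (x + a + s)) (ihom_curry R M N K s \<phi> (x + a) (f x m) (y + b) (g y n))"
      using C' m n by (simp add: add.assoc del: ihom_curry_apply)
    moreover have "?L x m y n = h (x + y + (a + b) + s) (\<phi> (x + y + (a + b)) (hom_tensor_map R M' N' M N a b f g (x + y) (gr_elt R M' N' (x + y) x y m n)))"
      using T m n by (simp add: add.assoc)
    ultimately show "?L x m y n = ?R x m y n"
      using ihom_curry_natural[OF assms(1-9) \<phi> m n] by simp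
  qed
qed


section \<open>Extension of pairings to direct sums\<close>

text \<open>Common frame for composition, tensor product and internal hom of graded morphisms.
  Biadditivity carries the extension, because the direct sums are generated additively by
  homogeneous elements.\<close>

locale graded_pairing =
  fixes R :: "('r, 'm) ring_scheme" and A :: "'p::preordered_ab_group_add \<Rightarrow> ('r, 'x) module"
    and B :: "'p \<Rightarrow> ('r, 'y) module" and C :: "'p \<Rightarrow> ('r, 'z) module"
    and op :: "'p \<Rightarrow> 'p \<Rightarrow> 'x \<Rightarrow> 'y \<Rightarrow> 'z"
  assumes A: "\<And>s. module R (A s)" and B: "\<And>s. module R (B s)" and C: "\<And>s. module R (C s)"
    and closed: "\<And>s t x y. x \<in> carrier (A s) \<Longrightarrow> y \<in> carrier (B t) \<Longrightarrow> op s t x y \<in> carrier (C (s + t))"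
    and add_left: "\<And>s t x x' y. x \<in> carrier (A s) \<Longrightarrow> x' \<in> carrier (A s) \<Longrightarrow> y \<in> carrier (B t) \<Longrightarrow>
      op s t (x \<oplus>\<^bsub>A s\<^esub> x') y = op s t x y \<oplus>\<^bsub>C (s + t)\<^esub> op s t x' y"
    and add_right: "\<And>s t x y y'. x \<in> carrier (A s) \<Longrightarrow> y \<in> carrier (B t) \<Longrightarrow> y' \<in> carrier (B t) \<Longrightarrow>
      op s t x (y \<oplus>\<^bsub>B t\<^esub> y') = op s t x y \<oplus>\<^bsub>C (s + t)\<^esub> op s t x y'"
begin

lemma families: "module_family R UNIV A" "module_family R UNIV B" "module_family R UNIV C"
  by (intro module_family.intro module.axioms(1)[OF A] A B C)+

text \<open>Writing zero as zero plus zero, the value equals its own double and therefore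
  vanishes.\<close>

lemma zero_left: assumes "y \<in> carrier (B t)" shows "op s t \<zero>\<^bsub>A s\<^esub> y = \<zero>\<^bsub>C (s + t)\<^esub>"
proof -
  interpret A: module R "A s" by (rule A)
  interpret C: module R "C (s + t)" by (rule C)
  show ?thesis
    using add_left[of "\<zero>\<^bsub>A s\<^esub>" s "\<zero>\<^bsub>A s\<^esub>" y t] closed[of "\<zero>\<^bsub>A s\<^esub>" s y t] assms
    by simp
qed

lemma zero_right: assumes "x \<in> carrier (A s)" shows "op s t x \<zero>\<^bsub>B t\<^esub> = \<zero>\<^bsub>C (s + t)\<^esub>"
proof -
  interpret B: module R "B t" by (rule B)
  interpret C: module R "C (s + t)" by (rule C)
  show ?thesis
    using add_right[of x s "\<zero>\<^bsub>B t\<^esub>" t "\<zero>\<^bsub>B t\<^esub>"] closed[of x s "\<zero>\<^bsub>B t\<^esub>" t] assms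
    by simp
qed

lemmas C_add_closed = abelian_monoid.a_closed[OF abelian_group.axioms(1)[OF module.axioms(2)[OF C]]]

abbreviation "ext \<equiv> bilinear_ext A B C op"

lemma memD:
  "f \<in> carrier (dsum UNIV A) \<Longrightarrow> f s \<in> carrier (A s)" "g \<in> carrier (dsum UNIV B) \<Longrightarrow> g t \<in> carrier (B t)"
  "f \<in> carrier (dsum UNIV A) \<Longrightarrow> finite {s. f s \<noteq> \<zero>\<^bsub>A s\<^esub>}" "g \<in> carrier (dsum UNIV B) \<Longrightarrow> finite {t. g t \<noteq> \<zero>\<^bsub>B t\<^esub>}"
  by (simp_all add: module_family.dsum_mem[OF families(1)] module_family.dsum_mem[OF families(2)])

text \<open>The definition sums over the exact supports, which change when arguments are added.
  Pairs outside the supports contribute zero, so any finite supersets serve equally well.\<close>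

lemma ext_eq_finsum:
  assumes f: "f \<in> carrier (dsum UNIV A)" and g: "g \<in> carrier (dsum UNIV B)"
    and S: "finite S" "{s. f s \<noteq> \<zero>\<^bsub>A s\<^esub>} \<subseteq> S" and T: "finite T" "{t. g t \<noteq> \<zero>\<^bsub>B t\<^esub>} \<subseteq> T"
  shows "ext f g r = finsum (C r) (\<lambda>(s, t). op s t (f s) (g t)) {(s, t). s \<in> S \<and> t \<in> T \<and> s + t = r}"
proof -
  interpret C: module R "C r" by (rule C)
  have fin: "finite {(s, t). s \<in> S \<and> t \<in> T \<and> s + t = r}"
    by (rule finite_subset[of _ "S \<times> T"]) (use S T in auto)
  show ?thesis
    unfolding bilinear_ext_def
    by (rule C.add.finprod_mono_neutral_cong_left[OF fin])
      (use S T closed memD(1)[OF f] memD(2)[OF g] zero_left zero_right in auto)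
qed

text \<open>A degree \<open>r\<close> can be in the support only if it is a sum of two degrees from
  the finite supports of \<open>f\<close> and \<open>g\<close>.\<close>

lemma ext_closed:
  assumes f: "f \<in> carrier (dsum UNIV A)" and g: "g \<in> carrier (dsum UNIV B)"
  shows "ext f g \<in> carrier (dsum UNIV C)"
proof -
  let ?S = "{s. f s \<noteq> \<zero>\<^bsub>A s\<^esub>}" and ?T = "{t. g t \<noteq> \<zero>\<^bsub>B t\<^esub>}"
  note eq = ext_eq_finsum[OF f g memD(3)[OF f] order_refl memD(4)[OF g] order_refl]
  have "ext f g r \<in> carrier (C r)" for r
  proof -
    interpret C: module R "C r" by (rule C)
    show ?thesis unfolding eq
      by (rule C.finsum_closed) (use closed memD(1)[OF f] memD(2)[OF g] in auto)
  qed
  moreover have "{r. ext f g r \<noteq> \<zero>\<^bsub>C r\<^esub>} \<subseteq> (\<lambda>(s, t). s + t) ` (?S \<times> ?T)"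
  proof
    fix r assume "r \<in> {r. ext f g r \<noteq> \<zero>\<^bsub>C r\<^esub>}"
    interpret C: module R "C r" by (rule C)
    have "{(s, t). s \<in> ?S \<and> t \<in> ?T \<and> s + t = r} \<noteq> {}"
    proof
      assume *: "{(s, t). s \<in> ?S \<and> t \<in> ?T \<and> s + t = r} = {}"
      have "ext f g r = \<zero>\<^bsub>C r\<^esub>" unfolding eq * by simp
      with \<open>r \<in> {r. ext f g r \<noteq> \<zero>\<^bsub>C r\<^esub>}\<close> show False by simp
    qed
    then show "r \<in> (\<lambda>(s, t). s + t) ` (?S \<times> ?T)" by auto
  qed
  then have "finite {r. ext f g r \<noteq> \<zero>\<^bsub>C r\<^esub>}"
    by (rule finite_subset) (use memD(3)[OF f] memD(4)[OF g] in simp)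
  ultimately show ?thesis
    by (simp add: module_family.dsum_mem[OF families(3)])
qed

lemma ext_add_left:
  assumes f: "f \<in> carrier (dsum UNIV A)" and f': "f' \<in> carrier (dsum UNIV A)" and g: "g \<in> carrier (dsum UNIV B)"
  shows "ext (f \<oplus>\<^bsub>dsum UNIV A\<^esub> f') g = ext f g \<oplus>\<^bsub>dsum UNIV C\<^esub> ext f' g"
proof
  fix r
  interpret C: module R "C r" by (rule C)
  note a = module_family.dsum_add[OF families(1)]
  note ff' = module_family.dsum_add_closed[OF families(1) f f']
  \<comment> \<open>One index set containing all three supports, so that the three sums run over the
    same pairs.\<close>
  let ?S = "{s. f s \<noteq> \<zero>\<^bsub>A s\<^esub>} \<union> {s. f' s \<noteq> \<zero>\<^bsub>A s\<^esub>} \<union> {s. (f \<oplus>\<^bsub>dsum UNIV A\<^esub> f') s \<noteq> \<zero>\<^bsub>A s\<^esub>}"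
  have S: "finite ?S" using memD(3)[OF f] memD(3)[OF f'] memD(3)[OF ff'] by simp
  let ?I = "{(s, t). s \<in> ?S \<and> t \<in> {t. g t \<noteq> \<zero>\<^bsub>B t\<^esub>} \<and> s + t = r}"
  note eq = ext_eq_finsum[OF _ g S _ memD(4)[OF g] order_refl]
  have "ext (f \<oplus>\<^bsub>dsum UNIV A\<^esub> f') g r = finsum (C r) (\<lambda>(s, t). op s t ((f \<oplus>\<^bsub>dsum UNIV A\<^esub> f') s) (g t)) ?I"
    by (rule eq[OF ff']) blast
  also have "\<dots> = (\<Oplus>\<^bsub>C r\<^esub>p\<in>?I. (case p of (s, t) \<Rightarrow> op s t (f s) (g t)) \<oplus>\<^bsub>C r\<^esub> (case p of (s, t) \<Rightarrow> op s t (f' s) (g t)))"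
    using closed memD(1)[OF f] memD(1)[OF f'] memD(2)[OF g]
    by (intro C.finsum_cong') (auto simp: a add_left intro: C_add_closed)
  also have "\<dots> = finsum (C r) (\<lambda>(s, t). op s t (f s) (g t)) ?I \<oplus>\<^bsub>C r\<^esub> finsum (C r) (\<lambda>(s, t). op s t (f' s) (g t)) ?I"
    by (rule C.finsum_addf) (use closed memD(1)[OF f] memD(1)[OF f'] memD(2)[OF g] in auto)
  also have "finsum (C r) (\<lambda>(s, t). op s t (f s) (g t)) ?I = ext f g r" by (rule eq[OF f, symmetric]) blast
  also have "finsum (C r) (\<lambda>(s, t). op s t (f' s) (g t)) ?I = ext f' g r" by (rule eq[OF f', symmetric]) blast
  finally show "ext (f \<oplus>\<^bsub>dsum UNIV A\<^esub> f') g r = (ext f g \<oplus>\<^bsub>dsum UNIV C\<^esub> ext f' g) r"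
    by (simp add: module_family.dsum_add[OF families(3)])
qed

lemma ext_add_right:
  assumes f: "f \<in> carrier (dsum UNIV A)" and g: "g \<in> carrier (dsum UNIV B)" and g': "g' \<in> carrier (dsum UNIV B)"
  shows "ext f (g \<oplus>\<^bsub>dsum UNIV B\<^esub> g') = ext f g \<oplus>\<^bsub>dsum UNIV C\<^esub> ext f g'"
proof
  fix r
  interpret C: module R "C r" by (rule C)
  note a = module_family.dsum_add[OF families(2)]
  note gg' = module_family.dsum_add_closed[OF families(2) g g']
  let ?T = "{s. g s \<noteq> \<zero>\<^bsub>B s\<^esub>} \<union> {s. g' s \<noteq> \<zero>\<^bsub>B s\<^esub>} \<union> {s. (g \<oplus>\<^bsub>dsum UNIV B\<^esub> g') s \<noteq> \<zero>\<^bsub>B s\<^esub>}"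
  have T: "finite ?T" using memD(4)[OF g] memD(4)[OF g'] memD(4)[OF gg'] by simp
  let ?I = "{(s, t). s \<in> {s. f s \<noteq> \<zero>\<^bsub>A s\<^esub>} \<and> t \<in> ?T \<and> s + t = r}"
  note eq = ext_eq_finsum[OF f _ memD(3)[OF f] order_refl T]
  have "ext f (g \<oplus>\<^bsub>dsum UNIV B\<^esub> g') r = finsum (C r) (\<lambda>(s, t). op s t (f s) ((g \<oplus>\<^bsub>dsum UNIV B\<^esub> g') t)) ?I"
    by (rule eq[OF gg']) blast
  also have "\<dots> = (\<Oplus>\<^bsub>C r\<^esub>p\<in>?I. (case p of (s, t) \<Rightarrow> op s t (f s) (g t)) \<oplus>\<^bsub>C r\<^esub> (case p of (s, t) \<Rightarrow> op s t (f s) (g' t)))"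
    using closed memD(2)[OF g] memD(2)[OF g'] memD(1)[OF f]
    by (intro C.finsum_cong') (auto simp: a add_right intro: C_add_closed)
  also have "\<dots> = finsum (C r) (\<lambda>(s, t). op s t (f s) (g t)) ?I \<oplus>\<^bsub>C r\<^esub> finsum (C r) (\<lambda>(s, t). op s t (f s) (g' t)) ?I"
    by (rule C.finsum_addf) (use closed memD(2)[OF g] memD(2)[OF g'] memD(1)[OF f] in auto)
  also have "finsum (C r) (\<lambda>(s, t). op s t (f s) (g t)) ?I = ext f g r" by (rule eq[OF g, symmetric]) blast
  also have "finsum (C r) (\<lambda>(s, t). op s t (f s) (g' t)) ?I = ext f g' r" by (rule eq[OF g', symmetric]) blast
  finally show "ext f (g \<oplus>\<^bsub>dsum UNIV B\<^esub> g') r = (ext f g \<oplus>\<^bsub>dsum UNIV C\<^esub> ext f g') r"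
    by (simp add: module_family.dsum_add[OF families(3)])
qed

text \<open>The sum is taken over the singletons \<open>{s}\<close> and \<open>{t}\<close> instead
  of the supports, which are empty when \<open>x\<close> or \<open>y\<close> is zero; this covers
  both cases uniformly.\<close>

lemma ext_incl:
  assumes x: "x \<in> carrier (A s)" and y: "y \<in> carrier (B t)"
  shows "ext (dsum_in UNIV A s x) (dsum_in UNIV B t y) = dsum_in UNIV C (s + t) (op s t x y)"
proof
  fix r
  interpret C: module R "C r" by (rule C)
  have sing: "{(s', t'). s' \<in> {s} \<and> t' \<in> {t} \<and> s' + t' = r} = (if s + t = r then {(s, t)} else {})" by auto
  have "ext (dsum_in UNIV A s x) (dsum_in UNIV B t y) r =
    finsum (C r) (\<lambda>(s', t'). op s' t' (dsum_in UNIV A s x s') (dsum_in UNIV B t y t'))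
      {(s', t'). s' \<in> {s} \<and> t' \<in> {t} \<and> s' + t' = r}"
    by (rule ext_eq_finsum)
      (auto simp: dsum_in_def intro!: module_family.dsum_in_closed[OF families(1), unfolded dsum_in_def, simplified]
        module_family.dsum_in_closed[OF families(2), unfolded dsum_in_def, simplified] x y split: if_splits)
  also have "\<dots> = dsum_in UNIV C (s + t) (op s t x y) r"
  proof (cases "s + t = r")
    case True
    have "op s t x y \<in> carrier (C r)" using closed[OF x y] by (simp add: True)
    then show ?thesis unfolding sing by (simp add: dsum_in_def True)
  next
    case False
    then show ?thesis unfolding sing by (simp add: dsum_in_def)
  qed
  finally show "ext (dsum_in UNIV A s x) (dsum_in UNIV B t y) r = dsum_in UNIV C (s + t) (op s t x y) r" .
qed

end


section \<open>Graded morphisms\<close>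

abbreviation gr_homog ::
  "('r, 'm) ring_scheme \<Rightarrow> ('p::preordered_ab_group_add, 'r, 'a) pers \<Rightarrow> ('p, 'r, 'b) pers
    \<Rightarrow> 'p \<Rightarrow> ('p \<Rightarrow> 'a \<Rightarrow> 'b) \<Rightarrow> 'p \<Rightarrow> 'p \<Rightarrow> 'a \<Rightarrow> 'b"
  where "gr_homog R M N \<equiv> dsum_in UNIV (\<lambda>s. nat_hom R M (shift N s))"

text \<open>Writes degree-zero morphisms as summand inclusions, the form on which the rules for
  homogeneous morphisms act.\<close>

lemma gr_of_eq: "gr_of R M N \<phi> = gr_homog R M N 0 \<phi>"
  by (simp add: gr_of_def dsum_in_def fun_eq_iff)

lemma gr_hom_family:
  "persistence_module R M \<Longrightarrow> persistence_module R N \<Longrightarrow> module_family R UNIV (\<lambda>s. nat_hom R M (shift N s))"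
  by (rule module_family.intro) (simp_all add: pers_cring)

lemma gr_homog_GHom [simp]:
  "persistence_module R M \<Longrightarrow> persistence_module R N \<Longrightarrow> \<phi> \<in> PHom R M (shift N s) \<Longrightarrow> gr_homog R M N s \<phi> \<in> GHom R M N"
  unfolding gr_hom_def by (rule module_family.dsum_in_closed[OF gr_hom_family]) simp_all

lemma gr_of_GHom [simp]:
  "persistence_module R M \<Longrightarrow> persistence_module R N \<Longrightarrow> \<phi> \<in> PHom R M N \<Longrightarrow> gr_of R M N \<phi> \<in> GHom R M N"
  by (simp add: gr_of_eq)

lemma GHom_add_closed [simp]:
  "persistence_module R M \<Longrightarrow> persistence_module R N \<Longrightarrow> f \<in> GHom R M N \<Longrightarrow> g \<in> GHom R M N \<Longrightarrow>
    f \<oplus>\<^bsub>gr_hom R M N\<^esub> g \<in> GHom R M N"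
  unfolding gr_hom_def by (rule module_family.dsum_add_closed[OF gr_hom_family])

text \<open>No separate case for zero appears, since zero is homogeneous. An identity whose two
  sides are additive in each graded argument follows from its homogeneous instances.\<close>

lemma GHom_induct [consumes 3, case_names homog add]:
  assumes "persistence_module R M" "persistence_module R N" "f \<in> GHom R M N"
    and homog: "\<And>s \<phi>. \<phi> \<in> PHom R M (shift N s) \<Longrightarrow> P (gr_homog R M N s \<phi>)"
    and add: "\<And>f g. f \<in> GHom R M N \<Longrightarrow> g \<in> GHom R M N \<Longrightarrow> P f \<Longrightarrow> P g \<Longrightarrow> P (f \<oplus>\<^bsub>gr_hom R M N\<^esub> g)"
  shows "P f"
  using assms(3) unfolding gr_hom_def
proof (induction rule: module_family.dsum_induct[OF gr_hom_family[OF assms(1,2)], consumes 1, case_names zero incl add])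
  case zero
  \<comment> \<open>Zero is presented as the homogeneous morphism zero of degree 0; any other degree
    would do as well.\<close>
  have "P (gr_homog R M N 0 \<zero>\<^bsub>nat_hom R M (shift N 0)\<^esub>)"
    using assms(1,2) by (intro homog) simp
  then show ?case
    by (simp add: module_family.dsum_in_zero[OF gr_hom_family[OF assms(1,2)], of 0, simplified])
next
  case (incl i x)
  then show ?case by (intro homog)
next
  case (add v w)
  then show ?case using assms(5) unfolding gr_hom_def by blast
qed

text \<open>The pairing takes the inner morphism first, whereas \<open>gr_comp\<close> takes the
  outer one first. Additivity of the pairing on the left is thus additivity of
  \<open>gr_comp\<close> on the right.\<close>

lemma gr_comp_pairing:
  assumes "persistence_module R M" "persistence_module R N" "persistence_module R K"
  shows "graded_pairing R (\<lambda>s. nat_hom R M (shift N s)) (\<lambda>t. nat_hom R N (shift K t))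
    (\<lambda>r. nat_hom R M (shift K r)) (\<lambda>s t \<alpha> \<beta>. hom_comp M s \<beta> \<alpha>)"
  using assms
  by (intro graded_pairing.intro hom_comp_add[OF assms]) (auto intro: hom_comp_PHom)

lemma gr_tensor_map_pairing:
  assumes "persistence_module R M" "persistence_module R M'" "persistence_module R N" "persistence_module R N'"
  shows "graded_pairing R (\<lambda>s. nat_hom R M (shift M' s)) (\<lambda>t. nat_hom R N (shift N' t))
    (\<lambda>r. nat_hom R (M \<boxtimes>\<^bsub>R\<^esub> N) (shift (M' \<boxtimes>\<^bsub>R\<^esub> N') r)) (hom_tensor_map R M N M' N')"
  using assms
  by (intro graded_pairing.intro hom_tensor_map_add[OF assms]) (auto intro: hom_tensor_map_PHom)

lemma gr_ihom_map_pairing: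
  assumes "persistence_module R N" "persistence_module R N'" "persistence_module R K" "persistence_module R K'"
  shows "graded_pairing R (\<lambda>e. nat_hom R N' (shift N e)) (\<lambda>d. nat_hom R K (shift K' d))
    (\<lambda>r. nat_hom R (ihom R N K) (shift (ihom R N' K') r)) (\<lambda>e d \<psi> \<chi>. hom_ihom_map R N N' K e \<psi> \<chi>)"
  using assms
  by (intro graded_pairing.intro hom_ihom_map_add[OF assms]) (auto intro: hom_ihom_map_PHom)

lemma
  assumes "persistence_module R M" "persistence_module R N" "persistence_module R K"
  shows gr_comp_closed [simp]:
      "f \<in> GHom R M N \<Longrightarrow> g \<in> GHom R N K \<Longrightarrow> gr_comp R M N K g f \<in> GHom R M K"
    and gr_comp_add_right [simp]:
      "f \<in> GHom R M N \<Longrightarrow> f' \<in> GHom R M N \<Longrightarrow> g \<in> GHom R N K \<Longrightarrow>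
        gr_comp R M N K g (f \<oplus>\<^bsub>gr_hom R M N\<^esub> f') = gr_comp R M N K g f \<oplus>\<^bsub>gr_hom R M K\<^esub> gr_comp R M N K g f'"
    and gr_comp_add_left [simp]:
      "f \<in> GHom R M N \<Longrightarrow> g \<in> GHom R N K \<Longrightarrow> g' \<in> GHom R N K \<Longrightarrow>
        gr_comp R M N K (g \<oplus>\<^bsub>gr_hom R N K\<^esub> g') f = gr_comp R M N K g f \<oplus>\<^bsub>gr_hom R M K\<^esub> gr_comp R M N K g' f"
    and gr_comp_homog:
      "\<alpha> \<in> PHom R M (shift N s) \<Longrightarrow> \<beta> \<in> PHom R N (shift K t) \<Longrightarrow>
        gr_comp R M N K (gr_homog R N K t \<beta>) (gr_homog R M N s \<alpha>) = gr_homog R M K (s + t) (hom_comp M s \<beta> \<alpha>)"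
  unfolding gr_comp_def gr_hom_def
  by (fact graded_pairing.ext_closed[OF gr_comp_pairing[OF assms]]
      graded_pairing.ext_add_left[OF gr_comp_pairing[OF assms]]
      graded_pairing.ext_add_right[OF gr_comp_pairing[OF assms]]
      graded_pairing.ext_incl[OF gr_comp_pairing[OF assms]])+

lemma
  assumes "persistence_module R M" "persistence_module R M'" "persistence_module R N" "persistence_module R N'"
  shows gr_tensor_map_closed [simp]:
      "f \<in> GHom R M M' \<Longrightarrow> g \<in> GHom R N N' \<Longrightarrow> gr_tensor_map R M N M' N' f g \<in> GHom R (M \<boxtimes>\<^bsub>R\<^esub> N) (M' \<boxtimes>\<^bsub>R\<^esub> N')"
    and gr_tensor_map_add_left [simp]:
      "f \<in> GHom R M M' \<Longrightarrow> f' \<in> GHom R M M' \<Longrightarrow> g \<in> GHom R N N' \<Longrightarrow>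
        gr_tensor_map R M N M' N' (f \<oplus>\<^bsub>gr_hom R M M'\<^esub> f') g =
        gr_tensor_map R M N M' N' f g \<oplus>\<^bsub>gr_hom R (M \<boxtimes>\<^bsub>R\<^esub> N) (M' \<boxtimes>\<^bsub>R\<^esub> N')\<^esub> gr_tensor_map R M N M' N' f' g"
    and gr_tensor_map_add_right [simp]:
      "f \<in> GHom R M M' \<Longrightarrow> g \<in> GHom R N N' \<Longrightarrow> g' \<in> GHom R N N' \<Longrightarrow>
        gr_tensor_map R M N M' N' f (g \<oplus>\<^bsub>gr_hom R N N'\<^esub> g') =
        gr_tensor_map R M N M' N' f g \<oplus>\<^bsub>gr_hom R (M \<boxtimes>\<^bsub>R\<^esub> N) (M' \<boxtimes>\<^bsub>R\<^esub> N')\<^esub> gr_tensor_map R M N M' N' f g'"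
    and gr_tensor_map_homog:
      "\<phi> \<in> PHom R M (shift M' a) \<Longrightarrow> \<psi> \<in> PHom R N (shift N' b) \<Longrightarrow>
        gr_tensor_map R M N M' N' (gr_homog R M M' a \<phi>) (gr_homog R N N' b \<psi>) =
        gr_homog R (M \<boxtimes>\<^bsub>R\<^esub> N) (M' \<boxtimes>\<^bsub>R\<^esub> N') (a + b) (hom_tensor_map R M N M' N' a b \<phi> \<psi>)"
  unfolding gr_tensor_map_def gr_hom_def
  by (fact graded_pairing.ext_closed[OF gr_tensor_map_pairing[OF assms]]
      graded_pairing.ext_add_left[OF gr_tensor_map_pairing[OF assms]]
      graded_pairing.ext_add_right[OF gr_tensor_map_pairing[OF assms]]
      graded_pairing.ext_incl[OF gr_tensor_map_pairing[OF assms]])+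

lemma
  assumes "persistence_module R N" "persistence_module R N'" "persistence_module R K" "persistence_module R K'"
  shows gr_ihom_map_closed [simp]:
      "g \<in> GHom R N' N \<Longrightarrow> h \<in> GHom R K K' \<Longrightarrow> gr_ihom_map R N N' K K' g h \<in> GHom R (ihom R N K) (ihom R N' K')"
    and gr_ihom_map_add_left [simp]:
      "g \<in> GHom R N' N \<Longrightarrow> g' \<in> GHom R N' N \<Longrightarrow> h \<in> GHom R K K' \<Longrightarrow>
        gr_ihom_map R N N' K K' (g \<oplus>\<^bsub>gr_hom R N' N\<^esub> g') h =
        gr_ihom_map R N N' K K' g h \<oplus>\<^bsub>gr_hom R (ihom R N K) (ihom R N' K')\<^esub> gr_ihom_map R N N' K K' g' h"
    and gr_ihom_map_add_right [simp]:
      "g \<in> GHom R N' N \<Longrightarrow> h \<in> GHom R K K' \<Longrightarrow> h' \<in> GHom R K K' \<Longrightarrow>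
        gr_ihom_map R N N' K K' g (h \<oplus>\<^bsub>gr_hom R K K'\<^esub> h') =
        gr_ihom_map R N N' K K' g h \<oplus>\<^bsub>gr_hom R (ihom R N K) (ihom R N' K')\<^esub> gr_ihom_map R N N' K K' g h'"
    and gr_ihom_map_homog:
      "\<psi> \<in> PHom R N' (shift N e) \<Longrightarrow> \<chi> \<in> PHom R K (shift K' d) \<Longrightarrow>
        gr_ihom_map R N N' K K' (gr_homog R N' N e \<psi>) (gr_homog R K K' d \<chi>) =
        gr_homog R (ihom R N K) (ihom R N' K') (e + d) (hom_ihom_map R N N' K e \<psi> \<chi>)"
  unfolding gr_ihom_map_def gr_hom_def
  by (fact graded_pairing.ext_closed[OF gr_ihom_map_pairing[OF assms]]
      graded_pairing.ext_add_left[OF gr_ihom_map_pairing[OF assms]]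
      graded_pairing.ext_add_right[OF gr_ihom_map_pairing[OF assms]]
      graded_pairing.ext_incl[OF gr_ihom_map_pairing[OF assms]])+

lemmas homog_simps = gr_comp_homog gr_tensor_map_homog gr_ihom_map_homog

text \<open>With its counterpart for tensor products, this transfers coherence identities from
  natural transformations to graded morphisms with no induction.\<close>

lemma gr_comp_of:
  assumes "persistence_module R M" "persistence_module R N" "persistence_module R K"
    and "\<phi> \<in> PHom R M N" "\<psi> \<in> PHom R N K"
  shows "gr_comp R M N K (gr_of R N K \<psi>) (gr_of R M N \<phi>) = gr_of R M K (pm_comp M \<psi> \<phi>)"
  using assms by (simp add: gr_of_eq pm_comp_eq homog_simps)

lemma gr_tensor_map_of:
  assumes "persistence_module R M" "persistence_module R M'" "persistence_module R N" "persistence_module R N'"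
    and "\<phi> \<in> PHom R M M'" "\<psi> \<in> PHom R N N'"
  shows "gr_tensor_map R M N M' N' (gr_of R M M' \<phi>) (gr_of R N N' \<psi>) =
    gr_of R (M \<boxtimes>\<^bsub>R\<^esub> N) (M' \<boxtimes>\<^bsub>R\<^esub> N') (pm_tensor_map R M N M' N' \<phi> \<psi>)"
  using assms by (simp add: gr_of_eq pm_tensor_map_eq homog_simps)

lemma gr_iso_of:
  assumes "persistence_module R M" "persistence_module R N" "pm_iso R M N \<phi>"
  shows "gr_iso R M N (gr_of R M N \<phi>)"
proof -
  obtain \<psi> where "\<phi> \<in> PHom R M N" "\<psi> \<in> PHom R N M" "pm_comp M \<psi> \<phi> = pm_id M" "pm_comp N \<phi> \<psi> = pm_id N"
    using assms(3) by (auto simp: pm_iso_def)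
  then show ?thesis
    unfolding gr_iso_def gr_id_def using assms
    by (intro conjI bexI[of _ "gr_of R N M \<psi>"]) (simp_all add: gr_comp_of)
qed

section \<open>Currying of graded morphisms\<close>

lemma gr_adj_add:
  assumes "persistence_module R M" "persistence_module R N" "persistence_module R K"
    and f: "f \<in> GHom R (M \<boxtimes>\<^bsub>R\<^esub> N) K" and g: "g \<in> GHom R (M \<boxtimes>\<^bsub>R\<^esub> N) K"
  shows "gr_adj R M N K (f \<oplus>\<^bsub>gr_hom R (M \<boxtimes>\<^bsub>R\<^esub> N) K\<^esub> g) =
    gr_adj R M N K f \<oplus>\<^bsub>gr_hom R M (ihom R N K)\<^esub> gr_adj R M N K g"
proof
  fix s
  have "f s \<in> PHom R (M \<boxtimes>\<^bsub>R\<^esub> N) (shift K s)" "g s \<in> PHom R (M \<boxtimes>\<^bsub>R\<^esub> N) (shift K s)"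
    using f g by (simp_all add: gr_hom_def module_family.dsum_mem[OF gr_hom_family] assms)
  then show "gr_adj R M N K (f \<oplus>\<^bsub>gr_hom R (M \<boxtimes>\<^bsub>R\<^esub> N) K\<^esub> g) s =
      (gr_adj R M N K f \<oplus>\<^bsub>gr_hom R M (ihom R N K)\<^esub> gr_adj R M N K g) s"
    by (simp add: gr_adj_def gr_hom_def module_family.dsum_add[OF gr_hom_family] assms ihom_curry_add)
qed

lemma ihom_curry_zero:
  assumes "persistence_module R M" "persistence_module R N" "persistence_module R K"
  shows "ihom_curry R M N K s \<zero>\<^bsub>nat_hom R (M \<boxtimes>\<^bsub>R\<^esub> N) (shift K s)\<^esub> = \<zero>\<^bsub>nat_hom R M (shift (ihom R N K) s)\<^esub>"
  using lin_hom_zero[OF _ _ PHom_lin_hom[OF ihom_curry_PHom[OF assms], of s]] assms by simp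

lemma gr_adj_homog:
  assumes "persistence_module R M" "persistence_module R N" "persistence_module R K"
  shows "gr_adj R M N K (gr_homog R (M \<boxtimes>\<^bsub>R\<^esub> N) K s \<phi>) = gr_homog R M (ihom R N K) s (ihom_curry R M N K s \<phi>)"
  using assms by (auto simp: gr_adj_def dsum_in_def ihom_curry_zero)

text \<open>A bijection in each degree extends to families; it restricts to finitely supported ones
  because currying and its inverse both preserve zero.\<close>

lemma gr_adj_bij:
  assumes M: "persistence_module R M" and N: "persistence_module R N" and K: "persistence_module R K"
  shows "bij_betw (gr_adj R M N K) (GHom R (M \<boxtimes>\<^bsub>R\<^esub> N) K) (GHom R M (ihom R N K))"
proof (rule bij_betw_imageI)
  let ?A = "\<lambda>s. nat_hom R (M \<boxtimes>\<^bsub>R\<^esub> N) (shift K s)" and ?B = "\<lambda>s. nat_hom R M (shift (ihom R N K) s)"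
  have mem: "f \<in> GHom R (M \<boxtimes>\<^bsub>R\<^esub> N) K \<longleftrightarrow> (\<forall>s. f s \<in> carrier (?A s)) \<and> finite {s. f s \<noteq> \<zero>\<^bsub>?A s\<^esub>}" for f
    by (simp add: gr_hom_def module_family.dsum_mem[OF gr_hom_family] M N K)
  have mem': "f \<in> GHom R M (ihom R N K) \<longleftrightarrow> (\<forall>s. f s \<in> carrier (?B s)) \<and> finite {s. f s \<noteq> \<zero>\<^bsub>?B s\<^esub>}" for f
    by (simp add: gr_hom_def module_family.dsum_mem[OF gr_hom_family] M N K)
  let ?c = "ihom_curry R M N K"
  have bij: "bij_betw (?c s) (carrier (?A s)) (carrier (?B s))" for s by (rule ihom_curry_bij[OF M N K])
  have z: "?c s \<zero>\<^bsub>?A s\<^esub> = \<zero>\<^bsub>?B s\<^esub>" for s by (rule ihom_curry_zero[OF M N K])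
  show "inj_on (gr_adj R M N K) (GHom R (M \<boxtimes>\<^bsub>R\<^esub> N) K)"
  proof (rule inj_onI, rule ext)
    fix f g s assume "f \<in> GHom R (M \<boxtimes>\<^bsub>R\<^esub> N) K" "g \<in> GHom R (M \<boxtimes>\<^bsub>R\<^esub> N) K" "gr_adj R M N K f = gr_adj R M N K g"
    then show "f s = g s"
      using ihom_curry_inj[OF M N K, of s] by (auto simp: mem gr_adj_def inj_on_def dest: fun_cong[of _ _ s])
  qed
  show "gr_adj R M N K ` GHom R (M \<boxtimes>\<^bsub>R\<^esub> N) K = GHom R M (ihom R N K)"
  proof (intro equalityI subsetI)
    fix h assume "h \<in> gr_adj R M N K ` GHom R (M \<boxtimes>\<^bsub>R\<^esub> N) K"
    then obtain f where f: "f \<in> GHom R (M \<boxtimes>\<^bsub>R\<^esub> N) K" "h = (\<lambda>s. ?c s (f s))" by (auto simp: gr_adj_def)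
    have "finite {s. h s \<noteq> \<zero>\<^bsub>?B s\<^esub>}"
      by (rule finite_subset[of _ "{s. f s \<noteq> \<zero>\<^bsub>?A s\<^esub>}"]) (use f z mem in auto)
    then show "h \<in> GHom R M (ihom R N K)"
      using f mem by (simp add: mem' ihom_curry_closed[OF M N K])
  next
    fix h assume h: "h \<in> GHom R M (ihom R N K)"
    let ?f = "\<lambda>s. inv_into (carrier (?A s)) (?c s) (h s)"
    have hc: "h s \<in> carrier (?B s)" for s using h mem' by simp
    have f: "?f s \<in> carrier (?A s)" "?c s (?f s) = h s" for s
      using bij[of s] hc[of s] by (auto simp: bij_betw_inv_into_right bij_betw_def inv_into_into)
    \<comment> \<open>Injectivity at zero: outside the support of \<open>h\<close> the preimage
      vanishes, so the support does not grow.\<close>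
    have fz: "?f s = \<zero>\<^bsub>?A s\<^esub>" if "h s = \<zero>\<^bsub>?B s\<^esub>" for s
      using bij_betw_inv_into_left[OF bij[of s], of "\<zero>\<^bsub>?A s\<^esub>"] that z M N K by simp
    have "{s. ?f s \<noteq> \<zero>\<^bsub>?A s\<^esub>} \<subseteq> {s. h s \<noteq> \<zero>\<^bsub>?B s\<^esub>}" using fz by blast
    moreover have "finite {s. h s \<noteq> \<zero>\<^bsub>?B s\<^esub>}" using h mem' by simp
    ultimately have "finite {s. ?f s \<noteq> \<zero>\<^bsub>?A s\<^esub>}" by (rule finite_subset)
    then have "?f \<in> GHom R (M \<boxtimes>\<^bsub>R\<^esub> N) K" using f(1) by (simp add: mem)
    moreover have "h = gr_adj R M N K ?f" using f(2) by (simp add: gr_adj_def)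
    ultimately show "h \<in> gr_adj R M N K ` GHom R (M \<boxtimes>\<^bsub>R\<^esub> N) K" by (rule rev_image_eqI[where f = "gr_adj R M N K"])
  qed
qed


section \<open>The axioms for graded morphisms\<close>

lemma gr_id_eq: "gr_id R M = gr_homog R M M 0 (pm_id M)"
  by (simp add: gr_id_def gr_of_eq)

lemma gr_id_GHom [simp]: "persistence_module R M \<Longrightarrow> gr_id R M \<in> GHom R M M"
  by (simp add: gr_id_def)

text \<open>Associativity is additive in each of the three morphisms, so nested inductions lead to
  homogeneous ones.\<close>

lemma gr_category:
  assumes [simp]: "persistence_module R M" "persistence_module R N" "persistence_module R K" "persistence_module R L"
  shows "gr_category R M N K L"
proof -
  have id: "gr_comp R M M N f (gr_id R M) = f" "gr_comp R M N N (gr_id R N) f = f" if "f \<in> GHom R M N" for f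
    using assms(1,2) that
    by (induction f rule: GHom_induct) (simp_all add: gr_id_eq homog_simps hom_comp_id[OF assms(1,2)])
  have "gr_comp R M K L h (gr_comp R M N K g f) = gr_comp R M N L (gr_comp R N K L h g) f"
    if f: "f \<in> GHom R M N" and g: "g \<in> GHom R N K" and h: "h \<in> GHom R K L" for f g h
    using assms(1,2) f
  proof (induction f rule: GHom_induct)
    case (homog s \<alpha>)
    note \<alpha> = this
    show ?case using assms(2,3) g
    proof (induction g rule: GHom_induct)
      case (homog t \<beta>)
      note \<beta> = this
      note [simp] = \<alpha> \<beta> hom_comp_PHom[OF assms(1) \<alpha> \<beta> refl]
      show ?case using assms(3,4) h
      proof (induction h rule: GHom_induct)
        case (homog v \<gamma>)
        note [simp] = homog hom_comp_PHom[OF assms(2) \<beta> homog refl]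
        \<comment> \<open>After the homogeneous law, the remaining difference is
          \<open>s + t + v\<close> against \<open>s + (t + v)\<close>.\<close>
        show ?case by (simp add: homog_simps hom_comp_assoc[OF assms \<alpha> \<beta> homog]) (simp add: add.assoc)
      qed simp_all
    qed (use \<alpha> h in simp_all)
  qed (use g h in simp_all)
  with id show ?thesis by (simp add: gr_category_def)
qed

text \<open>Both sides of the interchange law are additive in all four morphisms, and
  \<open>hom_tensor_map_comp\<close> is the homogeneous case.\<close>

lemma gr_tensor_functor:
  assumes [simp]: "persistence_module R M" "persistence_module R M'" "persistence_module R M''"
      "persistence_module R N" "persistence_module R N'" "persistence_module R N''"
  shows "gr_tensor_functor R M M' M'' N N' N''"
proof -
  have "gr_tensor_map R M N M'' N'' (gr_comp R M M' M'' f' f) (gr_comp R N N' N'' g' g) =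
      gr_comp R (M \<boxtimes>\<^bsub>R\<^esub> N) (M' \<boxtimes>\<^bsub>R\<^esub> N') (M'' \<boxtimes>\<^bsub>R\<^esub> N'')
        (gr_tensor_map R M' N' M'' N'' f' g') (gr_tensor_map R M N M' N' f g)"
    if f: "f \<in> GHom R M M'" and f': "f' \<in> GHom R M' M''" and g: "g \<in> GHom R N N'" and g': "g' \<in> GHom R N' N''"
    for f f' g g'
    using assms(1,2) f
  proof (induction f rule: GHom_induct)
    case (homog a \<alpha>)
    note \<alpha> = this
    show ?case using assms(2,3) f'
    proof (induction f' rule: GHom_induct)
      case (homog c \<alpha>')
      note \<alpha>' = this
      show ?case using assms(4,5) g
      proof (induction g rule: GHom_induct)
        case (homog b \<beta>)
        note \<beta> = this
        show ?case using assms(5,6) g'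
        proof (induction g' rule: GHom_induct)
          case (homog d \<beta>')
          note [simp] = \<alpha> \<alpha>' \<beta> homog hom_comp_PHom[OF assms(1) \<alpha> \<alpha>' refl] hom_comp_PHom[OF assms(4) \<beta> homog refl]
            hom_tensor_map_PHom[OF _ _ _ _ \<alpha> \<beta> refl] hom_tensor_map_PHom[OF _ _ _ _ \<alpha>' homog refl]
          show ?case
            by (simp add: homog_simps hom_tensor_map_comp[OF assms \<alpha> \<alpha>' \<beta> homog]) (simp add: ac_simps)
        qed (use \<alpha> \<alpha>' \<beta> in simp_all)
      qed (use \<alpha> \<alpha>' g' in simp_all)
    qed (use \<alpha> g g' in simp_all)
  qed (use f' g g' in simp_all)
  moreover have "gr_tensor_map R M N M N (gr_id R M) (gr_id R N) = gr_id R (M \<boxtimes>\<^bsub>R\<^esub> N)"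
    by (simp add: gr_id_eq homog_simps hom_tensor_map_id)
  ultimately show ?thesis by (simp add: gr_tensor_functor_def)
qed

lemma gr_assoc_eq: "gr_assoc R M N K = gr_homog R ((M \<boxtimes>\<^bsub>R\<^esub> N) \<boxtimes>\<^bsub>R\<^esub> K) (M \<boxtimes>\<^bsub>R\<^esub> (N \<boxtimes>\<^bsub>R\<^esub> K)) 0 (pm_assoc R M N K)"
  and gr_lunit_eq: "gr_lunit R M = gr_homog R (pm_unit R \<boxtimes>\<^bsub>R\<^esub> M) M 0 (pm_lunit R M)"
  and gr_runit_eq: "gr_runit R M = gr_homog R (M \<boxtimes>\<^bsub>R\<^esub> pm_unit R) M 0 (pm_runit R M)"
  and gr_braid_eq: "gr_braid R M N = gr_homog R (M \<boxtimes>\<^bsub>R\<^esub> N) (N \<boxtimes>\<^bsub>R\<^esub> M) 0 (pm_braid R M N)"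
  and gr_ihom_curry_eq: "gr_ihom_curry R M N K =
    gr_homog R (ihom R (M \<boxtimes>\<^bsub>R\<^esub> N) K) (ihom R M (ihom R N K)) 0 (ihom_curry R M N K)"
  by (simp_all add: gr_assoc_def gr_lunit_def gr_runit_def gr_braid_def gr_ihom_curry_def gr_of_eq)

lemma gr_lunit_GHom [simp]:
  "persistence_module R M \<Longrightarrow> gr_lunit R M \<in> GHom R (pm_unit R \<boxtimes>\<^bsub>R\<^esub> M) M"
  using pers_cring[of R M] by (simp add: gr_lunit_def pm_lunit_PHom)

lemma gr_runit_GHom [simp]:
  "persistence_module R M \<Longrightarrow> gr_runit R M \<in> GHom R (M \<boxtimes>\<^bsub>R\<^esub> pm_unit R) M"
  using pers_cring[of R M] by (simp add: gr_runit_def pm_runit_PHom)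

lemma gr_braid_GHom [simp]:
  "persistence_module R M \<Longrightarrow> persistence_module R N \<Longrightarrow> gr_braid R M N \<in> GHom R (M \<boxtimes>\<^bsub>R\<^esub> N) (N \<boxtimes>\<^bsub>R\<^esub> M)"
  by (simp add: gr_braid_def pm_braid_PHom)

lemma gr_assoc_GHom [simp]:
  "persistence_module R M \<Longrightarrow> persistence_module R N \<Longrightarrow> persistence_module R K \<Longrightarrow>
    gr_assoc R M N K \<in> GHom R ((M \<boxtimes>\<^bsub>R\<^esub> N) \<boxtimes>\<^bsub>R\<^esub> K) (M \<boxtimes>\<^bsub>R\<^esub> (N \<boxtimes>\<^bsub>R\<^esub> K))"
  by (simp add: gr_assoc_def pm_assoc_PHom)

lemma gr_ihom_curry_GHom [simp]:
  "persistence_module R M \<Longrightarrow> persistence_module R N \<Longrightarrow> persistence_module R K \<Longrightarrow>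
    gr_ihom_curry R M N K \<in> GHom R (ihom R (M \<boxtimes>\<^bsub>R\<^esub> N) K) (ihom R M (ihom R N K))"
  by (simp add: gr_ihom_curry_def ihom_curry_PHom)

text \<open>Naturality against graded morphisms is reduced to homogeneous ones by induction; the
  isomorphism claims concern degree zero and carry over through \<open>gr_of\<close>.\<close>

lemma gr_monoidal_isos:
  fixes M :: "('p::preordered_ab_group_add, 'r, 'a) pers"
  assumes [simp]: "persistence_module R M" "persistence_module R M'" "persistence_module R N"
      "persistence_module R N'" "persistence_module R K" "persistence_module R K'"
  shows "gr_monoidal_isos R M M' N N' K K'"
proof -
  have [simp]: "cring R" by (rule pers_cring) fact
  let ?U = "pm_unit R :: ('p, 'r, 'r) pers"
  have assoc: "gr_comp R ((M \<boxtimes>\<^bsub>R\<^esub> N) \<boxtimes>\<^bsub>R\<^esub> K) ((M' \<boxtimes>\<^bsub>R\<^esub> N') \<boxtimes>\<^bsub>R\<^esub> K') (M' \<boxtimes>\<^bsub>R\<^esub> (N' \<boxtimes>\<^bsub>R\<^esub> K'))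
        (gr_assoc R M' N' K')
        (gr_tensor_map R (M \<boxtimes>\<^bsub>R\<^esub> N) K (M' \<boxtimes>\<^bsub>R\<^esub> N') K' (gr_tensor_map R M N M' N' f g) h) =
      gr_comp R ((M \<boxtimes>\<^bsub>R\<^esub> N) \<boxtimes>\<^bsub>R\<^esub> K) (M \<boxtimes>\<^bsub>R\<^esub> (N \<boxtimes>\<^bsub>R\<^esub> K)) (M' \<boxtimes>\<^bsub>R\<^esub> (N' \<boxtimes>\<^bsub>R\<^esub> K'))
        (gr_tensor_map R M (N \<boxtimes>\<^bsub>R\<^esub> K) M' (N' \<boxtimes>\<^bsub>R\<^esub> K') f (gr_tensor_map R N K N' K' g h))
        (gr_assoc R M N K)"
    if f: "f \<in> GHom R M M'" and g: "g \<in> GHom R N N'" and h: "h \<in> GHom R K K'" for f g h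
    using assms(1,2) f
  proof (induction f rule: GHom_induct)
    case (homog a \<alpha>)
    note \<alpha> = this
    show ?case using assms(3,4) g
    proof (induction g rule: GHom_induct)
      case (homog b \<beta>)
      note \<beta> = this
      show ?case using assms(5,6) h
      proof (induction h rule: GHom_induct)
        case (homog c \<gamma>)
        note ab = hom_tensor_map_PHom[OF assms(1,3,2,4) \<alpha> \<beta> refl]
        note bc = hom_tensor_map_PHom[OF assms(3,5,4,6) \<beta> homog refl]
        note [simp] = \<alpha> \<beta> homog ab bc hom_tensor_map_PHom[OF _ _ _ _ ab homog refl]
          hom_tensor_map_PHom[OF _ _ _ _ \<alpha> bc refl]
        show ?case
          by (simp add: gr_assoc_eq homog_simps pm_assoc_PHom pm_assoc_natural[OF assms(1,3,5,2,4,6) \<alpha> \<beta> homog])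
            (simp add: add.assoc)
      qed (use \<alpha> \<beta> in simp_all)
    qed (use \<alpha> h in simp_all)
  qed (use g h in simp_all)
  have id: "pm_id ?U \<in> PHom R ?U (shift ?U 0)" by simp
  have lunit: "gr_comp R (?U \<boxtimes>\<^bsub>R\<^esub> M) (?U \<boxtimes>\<^bsub>R\<^esub> M') M' (gr_lunit R M')
        (gr_tensor_map R ?U M ?U M' (gr_id R ?U) f) = gr_comp R (?U \<boxtimes>\<^bsub>R\<^esub> M) M M' f (gr_lunit R M)"
    if "f \<in> GHom R M M'" for f
    using assms(1,2) that
  proof (induction f rule: GHom_induct)
    case (homog a \<alpha>)
    note [simp] = homog hom_tensor_map_PHom[OF _ _ _ _ id homog refl, simplified]
    show ?case
      by (simp add: gr_id_eq gr_lunit_eq homog_simps pm_lunit_PHom pm_lunit_natural[OF assms(1,2) homog])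
  qed simp_all
  have runit: "gr_comp R (M \<boxtimes>\<^bsub>R\<^esub> ?U) (M' \<boxtimes>\<^bsub>R\<^esub> ?U) M' (gr_runit R M')
        (gr_tensor_map R M ?U M' ?U f (gr_id R ?U)) = gr_comp R (M \<boxtimes>\<^bsub>R\<^esub> ?U) M M' f (gr_runit R M)"
    if "f \<in> GHom R M M'" for f
    using assms(1,2) that
  proof (induction f rule: GHom_induct)
    case (homog a \<alpha>)
    note [simp] = homog hom_tensor_map_PHom[OF _ _ _ _ homog id refl, simplified]
    show ?case
      by (simp add: gr_id_eq gr_runit_eq homog_simps pm_runit_PHom pm_runit_natural[OF assms(1,2) homog])
  qed simp_all
  have "gr_iso R ((M \<boxtimes>\<^bsub>R\<^esub> N) \<boxtimes>\<^bsub>R\<^esub> K) (M \<boxtimes>\<^bsub>R\<^esub> (N \<boxtimes>\<^bsub>R\<^esub> K)) (gr_assoc R M N K)"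
    "gr_iso R (?U \<boxtimes>\<^bsub>R\<^esub> M) M (gr_lunit R M)" "gr_iso R (M \<boxtimes>\<^bsub>R\<^esub> ?U) M (gr_runit R M)"
    unfolding gr_assoc_def gr_lunit_def gr_runit_def
    by (rule gr_iso_of; simp add: pm_assoc_iso pm_lunit_iso pm_runit_iso)+
  with assoc lunit runit show ?thesis by (simp add: gr_monoidal_isos_def)
qed

text \<open>Every arrow has degree zero, so this is the image under \<open>gr_of\<close> of the
  pentagon of natural transformations.\<close>

lemma gr_pentagon:
  assumes [simp]: "persistence_module R M" "persistence_module R N" "persistence_module R K" "persistence_module R L"
  shows "gr_pentagon R M N K L"
  using pm_pentagon[OF assms]
  by (simp add: gr_pentagon_def pm_pentagon_def gr_assoc_def gr_id_def gr_comp_of gr_tensor_map_of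
      pm_assoc_PHom pm_tensor_map_PHom pm_comp_PHom[OF _ pm_tensor_map_PHom pm_assoc_PHom])

lemma gr_triangle:
  assumes [simp]: "persistence_module R M" "persistence_module R N"
  shows "gr_triangle R M N"
  using pm_triangle[OF assms] pers_cring[OF assms(1)]
  by (simp add: gr_triangle_def pm_triangle_def gr_assoc_def gr_lunit_def gr_runit_def gr_id_def gr_comp_of gr_tensor_map_of
      pm_assoc_PHom pm_tensor_map_PHom pm_lunit_PHom pm_runit_PHom)

lemma gr_symmetry:
  assumes [simp]: "persistence_module R M" "persistence_module R M'" "persistence_module R N"
      "persistence_module R N'" "persistence_module R K"
  shows "gr_symmetry R M M' N N' K"
proof -
  have nat: "gr_comp R (M \<boxtimes>\<^bsub>R\<^esub> N) (M' \<boxtimes>\<^bsub>R\<^esub> N') (N' \<boxtimes>\<^bsub>R\<^esub> M') (gr_braid R M' N') (gr_tensor_map R M N M' N' f g) =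
      gr_comp R (M \<boxtimes>\<^bsub>R\<^esub> N) (N \<boxtimes>\<^bsub>R\<^esub> M) (N' \<boxtimes>\<^bsub>R\<^esub> M') (gr_tensor_map R N M N' M' g f) (gr_braid R M N)"
    if f: "f \<in> GHom R M M'" and g: "g \<in> GHom R N N'" for f g
    using assms(1,2) f
  proof (induction f rule: GHom_induct)
    case (homog a \<alpha>)
    note \<alpha> = this
    show ?case using assms(3,4) g
    proof (induction g rule: GHom_induct)
      case (homog b \<beta>)
      note [simp] = \<alpha> homog hom_tensor_map_PHom[OF _ _ _ _ \<alpha> homog refl] hom_tensor_map_PHom[OF _ _ _ _ homog \<alpha> refl]
      show ?case
        by (simp add: gr_braid_eq homog_simps pm_braid_PHom pm_braid_natural[OF assms(1,3,2,4) \<alpha> homog])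
          (simp add: add.commute)
    qed (use \<alpha> in simp_all)
  qed (use g in simp_all)
  have iso: "gr_iso R (M \<boxtimes>\<^bsub>R\<^esub> N) (N \<boxtimes>\<^bsub>R\<^esub> M) (gr_braid R M N)"
    unfolding gr_braid_def by (rule gr_iso_of) (simp_all add: pm_braid_iso)
  have inv: "gr_comp R (M \<boxtimes>\<^bsub>R\<^esub> N) (N \<boxtimes>\<^bsub>R\<^esub> M) (M \<boxtimes>\<^bsub>R\<^esub> N) (gr_braid R N M) (gr_braid R M N) = gr_id R (M \<boxtimes>\<^bsub>R\<^esub> N)"
    by (simp add: gr_braid_def gr_comp_of pm_braid_PHom pm_braid_braid gr_id_def)
  show ?thesis
    using pm_hexagon[OF assms(1,3,5)] nat iso inv
    by (simp add: gr_symmetry_def gr_assoc_def gr_braid_def gr_id_def gr_comp_of gr_tensor_map_of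
        pm_assoc_PHom pm_braid_PHom pm_tensor_map_PHom pm_comp_PHom[OF _ pm_assoc_PHom pm_braid_PHom]
        pm_comp_PHom[OF _ pm_tensor_map_PHom pm_assoc_PHom])
qed

lemma gr_ihom_functor:
  assumes [simp]: "persistence_module R N" "persistence_module R N'" "persistence_module R N''"
      "persistence_module R K" "persistence_module R K'" "persistence_module R K''"
  shows "gr_ihom_functor R N N' N'' K K' K''"
proof -
  have "gr_ihom_map R N N'' K K'' (gr_comp R N'' N' N g g') (gr_comp R K K' K'' h' h) =
      gr_comp R (ihom R N K) (ihom R N' K') (ihom R N'' K'')
        (gr_ihom_map R N' N'' K' K'' g' h') (gr_ihom_map R N N' K K' g h)"
    if g: "g \<in> GHom R N' N" and g': "g' \<in> GHom R N'' N'" and h: "h \<in> GHom R K K'" and h': "h' \<in> GHom R K' K''"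
    for g g' h h'
    \<comment> \<open>\<open>g\<close> runs from \<open>N'\<close> to \<open>N\<close>, whence the
      reversed order of the two hypotheses.\<close>
    using assms(2,1) g
  proof (induction g rule: GHom_induct)
    case (homog e \<alpha>)
    note \<alpha> = this
    show ?case using assms(3,2) g'
    proof (induction g' rule: GHom_induct)
      case (homog e' \<alpha>')
      note \<alpha>' = this
      show ?case using assms(4,5) h
      proof (induction h rule: GHom_induct)
        case (homog d \<beta>)
        note \<beta> = this
        show ?case using assms(5,6) h'
        proof (induction h' rule: GHom_induct)
          case (homog d' \<beta>')
          note [simp] = \<alpha> \<alpha>' \<beta> homog hom_comp_PHom[OF assms(3) \<alpha>' \<alpha> refl] hom_comp_PHom[OF assms(4) \<beta> homog refl]
            hom_ihom_map_PHom[OF _ _ _ _ \<alpha> \<beta> refl] hom_ihom_map_PHom[OF _ _ _ _ \<alpha>' homog refl]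
          show ?case
            by (simp add: homog_simps hom_ihom_map_comp[OF assms \<alpha> \<alpha>' \<beta> homog]) (simp add: ac_simps)
        qed (use \<alpha> \<alpha>' \<beta> in simp_all)
      qed (use \<alpha> \<alpha>' h' in simp_all)
    qed (use \<alpha> h h' in simp_all)
  qed (use g' h h' in simp_all)
  moreover have "gr_ihom_map R N N K K (gr_id R N) (gr_id R K) = gr_id R (ihom R N K)"
    by (simp add: gr_id_eq homog_simps hom_ihom_map_id)
  ultimately show ?thesis by (simp add: gr_ihom_functor_def)
qed

lemma gr_adj_closed [simp]:
  "persistence_module R M \<Longrightarrow> persistence_module R N \<Longrightarrow> persistence_module R K \<Longrightarrow>
    f \<in> GHom R (M \<boxtimes>\<^bsub>R\<^esub> N) K \<Longrightarrow> gr_adj R M N K f \<in> GHom R M (ihom R N K)"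
  using bij_betwE[OF gr_adj_bij] by blast

text \<open>The transposed morphism \<open>\<phi>\<close> is decomposed as well: additivity of
  \<open>gr_adj\<close> makes both sides additive in all four variables, and
  \<open>ihom_curry_adj_natural\<close> is the homogeneous case.\<close>

lemma gr_adjunction:
  assumes [simp]: "persistence_module R M" "persistence_module R M'" "persistence_module R N"
      "persistence_module R N'" "persistence_module R K" "persistence_module R K'"
  shows "gr_adjunction R M M' N N' K K'"
proof -
  have "gr_adj R M' N' K'
        (gr_comp R (M' \<boxtimes>\<^bsub>R\<^esub> N') K K' h
          (gr_comp R (M' \<boxtimes>\<^bsub>R\<^esub> N') (M \<boxtimes>\<^bsub>R\<^esub> N) K \<phi> (gr_tensor_map R M' N' M N f g))) =
      gr_comp R M' (ihom R N K) (ihom R N' K') (gr_ihom_map R N N' K K' g h)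
        (gr_comp R M' M (ihom R N K) (gr_adj R M N K \<phi>) f)"
    if \<phi>: "\<phi> \<in> GHom R (M \<boxtimes>\<^bsub>R\<^esub> N) K" and f: "f \<in> GHom R M' M" and g: "g \<in> GHom R N' N" and h: "h \<in> GHom R K K'"
    for \<phi> f g h
    using gr_tensor_pers[OF assms(1,3)] assms(5) \<phi>
  proof (induction \<phi> rule: GHom_induct)
    case (homog s \<phi>)
    note \<phi> = this
    show ?case using assms(2,1) f
    proof (induction f rule: GHom_induct)
      case (homog a \<alpha>)
      note \<alpha> = this
      show ?case using assms(4,3) g
      proof (induction g rule: GHom_induct)
        case (homog b \<beta>)
        note \<beta> = this
        show ?case using assms(5,6) h
        proof (induction h rule: GHom_induct)
          case (homog d \<gamma>)
          note T = hom_tensor_map_PHom[OF assms(2,4,1,3) \<alpha> \<beta> refl]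
          note \<phi>T = hom_comp_PHom[OF gr_tensor_pers[OF assms(2,4)] T \<phi> refl]
          note C = ihom_curry_closed[OF assms(1,3,5) \<phi>]
          note [simp] = \<phi> \<alpha> \<beta> homog T \<phi>T hom_comp_PHom[OF gr_tensor_pers[OF assms(2,4)] \<phi>T homog refl]
            C hom_comp_PHom[OF assms(2) \<alpha> C refl] hom_ihom_map_PHom[OF assms(3,4,5,6) \<beta> homog refl]
          show ?case
            by (simp add: gr_adj_homog homog_simps ihom_curry_adj_natural[OF assms(1,3,5,2,4,6) \<alpha> \<beta> homog \<phi>])
              (simp add: ac_simps)
        qed (use \<phi> \<alpha> \<beta> in \<open>simp_all add: gr_adj_add\<close>)
      qed (use \<phi> \<alpha> h in \<open>simp_all add: gr_adj_add\<close>)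
    qed (use \<phi> g h in \<open>simp_all add: gr_adj_add\<close>)
  qed (use f g h in \<open>simp_all add: gr_adj_add\<close>)
  then show ?thesis by (simp add: gr_adjunction_def gr_adj_bij)
qed

lemma gr_ihom_natural_iso:
  assumes [simp]: "persistence_module R M" "persistence_module R M'" "persistence_module R N"
      "persistence_module R N'" "persistence_module R K" "persistence_module R K'"
  shows "gr_ihom_natural_iso R M M' N N' K K'"
proof -
  have "gr_comp R (ihom R (M \<boxtimes>\<^bsub>R\<^esub> N) K) (ihom R M (ihom R N K)) (ihom R M' (ihom R N' K'))
        (gr_ihom_map R M M' (ihom R N K) (ihom R N' K') f (gr_ihom_map R N N' K K' g h))
        (gr_ihom_curry R M N K) =
      gr_comp R (ihom R (M \<boxtimes>\<^bsub>R\<^esub> N) K) (ihom R (M' \<boxtimes>\<^bsub>R\<^esub> N') K') (ihom R M' (ihom R N' K'))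
        (gr_ihom_curry R M' N' K')
        (gr_ihom_map R (M \<boxtimes>\<^bsub>R\<^esub> N) (M' \<boxtimes>\<^bsub>R\<^esub> N') K K' (gr_tensor_map R M' N' M N f g) h)"
    if f: "f \<in> GHom R M' M" and g: "g \<in> GHom R N' N" and h: "h \<in> GHom R K K'" for f g h
    using assms(2,1) f
  proof (induction f rule: GHom_induct)
    case (homog a \<alpha>)
    note \<alpha> = this
    show ?case using assms(4,3) g
    proof (induction g rule: GHom_induct)
      case (homog b \<beta>)
      note \<beta> = this
      show ?case using assms(5,6) h
      proof (induction h rule: GHom_induct)
        case (homog d \<gamma>)
        note ab = hom_tensor_map_PHom[OF assms(2,4,1,3) \<alpha> \<beta> refl]
        note bd = hom_ihom_map_PHom[OF assms(3,4,5,6) \<beta> homog refl]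
        note [simp] = \<alpha> \<beta> homog ab bd hom_ihom_map_PHom[OF _ _ _ _ \<alpha> bd refl] hom_ihom_map_PHom[OF _ _ _ _ ab homog refl]
        show ?case
          by (simp add: gr_ihom_curry_eq homog_simps ihom_curry_PHom
              ihom_curry_ihom_natural[OF assms(1,3,5,2,4,6) \<alpha> \<beta> homog]) (simp add: add.assoc)
      qed (use \<alpha> \<beta> in simp_all)
    qed (use \<alpha> h in simp_all)
  qed (use g h in simp_all)
  moreover have "gr_iso R (ihom R (M \<boxtimes>\<^bsub>R\<^esub> N) K) (ihom R M (ihom R N K)) (gr_ihom_curry R M N K)"
    unfolding gr_ihom_curry_def by (rule gr_iso_of) (simp_all add: ihom_curry_iso)
  ultimately show ?thesis by (simp add: gr_ihom_natural_iso_def)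
qed


section \<open>The axioms for natural transformations\<close>

text \<open>The homogeneous laws with all degrees zero, where \<open>shift\<close> by 0 is the
  identity.\<close>

lemma pm_category:
  assumes "persistence_module R M" "persistence_module R N" "persistence_module R K" "persistence_module R L"
  shows "pm_category R M N K L"
  using assms hom_comp_id[of R M N _ 0] hom_comp_assoc[of R M N K L _ 0 _ 0 _ 0]
  by (auto simp: pm_category_def pm_comp_eq intro: pm_comp_PHom[unfolded pm_comp_eq])

lemma pm_tensor_functor:
  assumes "persistence_module R M" "persistence_module R M'" "persistence_module R M''"
      "persistence_module R N" "persistence_module R N'" "persistence_module R N''"
  shows "pm_tensor_functor R M M' M'' N N' N''"
  using assms hom_tensor_map_comp[OF assms, of _ 0 _ 0 _ 0 _ 0]
  by (simp add: pm_tensor_functor_def pm_tensor_map_PHom hom_tensor_map_id[folded pm_tensor_map_eq])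
    (simp add: pm_tensor_map_eq pm_comp_eq)

lemma pm_monoidal_isos:
  assumes "persistence_module R M" "persistence_module R M'" "persistence_module R N"
      "persistence_module R N'" "persistence_module R K" "persistence_module R K'"
  shows "pm_monoidal_isos R M M' N N' K K'"
  using assms pm_assoc_natural[OF assms(1,3,5,2,4,6), of _ 0 _ 0 _ 0]
    pm_lunit_natural[OF assms(1,2), of _ 0] pm_runit_natural[OF assms(1,2), of _ 0]
  by (simp add: pm_monoidal_isos_def pm_assoc_iso pm_lunit_iso pm_runit_iso pm_tensor_map_eq pm_comp_eq)

lemma pm_symmetry:
  assumes "persistence_module R M" "persistence_module R M'" "persistence_module R N"
      "persistence_module R N'" "persistence_module R K"
  shows "pm_symmetry R M M' N N' K"
  using assms pm_braid_natural[OF assms(1,3,2,4), of _ 0 _ 0]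
  by (simp add: pm_symmetry_def pm_braid_iso pm_braid_braid pm_hexagon)
    (simp add: pm_tensor_map_eq pm_comp_eq)

lemma pm_ihom_map_eq: "pm_ihom_map R N N' K \<psi> \<chi> = hom_ihom_map R N N' K 0 \<psi> \<chi>"
  by (simp add: pm_ihom_map_def hom_ihom_map_def)

lemma pm_ihom_functor:
  assumes "persistence_module R N" "persistence_module R N'" "persistence_module R N''"
      "persistence_module R K" "persistence_module R K'" "persistence_module R K''"
  shows "pm_ihom_functor R N N' N'' K K' K''"
  using assms hom_ihom_map_comp[OF assms, of _ 0 _ 0 _ 0 _ 0] hom_ihom_map_PHom[OF assms(1,2,4,5), of _ 0 _ 0 0]
  by (simp add: pm_ihom_functor_def pm_ihom_map_eq pm_comp_eq hom_ihom_map_id)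

lemma pm_adjunction:
  assumes "persistence_module R M" "persistence_module R M'" "persistence_module R N"
      "persistence_module R N'" "persistence_module R K" "persistence_module R K'"
  shows "pm_adjunction R M M' N N' K K'"
  using ihom_curry_bij[OF assms(1,3,5), of 0] ihom_curry_adj_natural[OF assms(1,3,5,2,4,6), of _ 0 _ 0 _ 0 _ 0]
  by (simp add: pm_adjunction_def pm_adj_def[abs_def] pm_ihom_map_eq pm_comp_eq pm_tensor_map_eq)

text \<open>The assertion that the isomorphism has degree zero is the conjunct on
  \<open>ihom_curry\<close>: the graded isomorphism \<open>gr_ihom_curry\<close> is its image under
  \<open>gr_of\<close>.\<close>

theorem theorem10p7:
  fixes R :: "('r, 'm) ring_scheme"
    and M :: "('p::preordered_ab_group_add, 'r, 'a) pers"
    and M' :: "('p, 'r, 'a') pers" and M'' :: "('p, 'r, 'a'') pers"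
    and N :: "('p, 'r, 'b) pers" and N' :: "('p, 'r, 'b') pers" and N'' :: "('p, 'r, 'b'') pers"
    and K :: "('p, 'r, 'c) pers" and K' :: "('p, 'r, 'c') pers" and K'' :: "('p, 'r, 'c'') pers"
    and L :: "('p, 'r, 'd) pers"
  assumes "cring R"
    and "persistence_module R M" "persistence_module R M'" "persistence_module R M''"
    and "persistence_module R N" "persistence_module R N'" "persistence_module R N''"
    and "persistence_module R K" "persistence_module R K'" "persistence_module R K''"
    and "persistence_module R L"
  shows
    "persistence_module R (pm_unit R :: ('p, 'r, 'r) pers) \<and>
     gr_closed_symmetric_monoidal R M M' M'' N N' N'' K K' K'' L \<and>
     gr_ihom_natural_iso R M M' N N' K K' \<and>
     pm_iso R (ihom R (M \<boxtimes>\<^bsub>R\<^esub> N) K) (ihom R M (ihom R N K)) (ihom_curry R M N K) \<and>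
     pm_closed_symmetric_monoidal R M M' M'' N N' N'' K K' K'' L"
  using assms
  by (simp add: gr_closed_symmetric_monoidal_def pm_closed_symmetric_monoidal_def
      gr_category gr_tensor_functor gr_monoidal_isos gr_pentagon gr_triangle gr_symmetry
      gr_ihom_functor gr_adjunction gr_ihom_natural_iso ihom_curry_iso
      pm_category pm_tensor_functor pm_monoidal_isos pm_pentagon pm_triangle pm_symmetry
      pm_ihom_functor pm_adjunction)

end
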